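(* Let $(M,g)$ be a globally hyperbolic stationary Lorentzian manifold with a complete timelike Killing vector field $\mathcal Y$ and a compact Cauchy surface. Let $\gamma$ be a (non constant) closed geodesic in $M$ and let $\gamma^{(N)}$ denote its $N$-th iterate, $N\ge1$. Then $\mathrm O(2)\big[\gamma^{(N)}\big]$ is a nondegenerate critical orbit of $f$ in $\widetilde{\mathcal N}$ if and only if both of the following hold: (a) $\mathrm O(2)[\gamma]$ is a nondegenerate critical orbit of $f$ in $\widetilde{\mathcal N}$; (b) $\mathfrak s(\mathfrak P_\gamma)\setminus\{1\}$ does not contain any $N$-th root of unity. Moreover, there exist positive integers $m_1,\ldots,m_s$, with $s\le 2^{\dim(M)}$, and, for each $j\in\{1,\ldots,s\}$, a strictly increasing sequence $q_{j1}<q_{j2}<\cdots<q_{jm}<\cdots$ of positive integers, such that the sets $N_j=\{m_jq_{ji}: i=1,2,\ldots\}$, $j=1,\dots,s$, form a partition of $\mathbb N\setminus\{0\}$, and such that $$\mathrm n\big(\gamma^{(m_jq_{ji})}\big)=\mathrm n\big(\gamma^{(m_j)}\big)\qquad\text{for all } i\ge1 \text{ and all } j\in\{1,\dots,s\}.$$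
   Context: A closed geodesic is a geodesic $\gamma:[0,1]\to M$ with $\gamma(0)=\gamma(1)$, $\dot\gamma(0)=\dot\gamma(1)$; its $N$-th iterate is $\gamma^{(N)}(t)=\widetilde\gamma(Nt)$, $t\in[0,1]$, with $\widetilde\gamma$ the periodic extension. $\Lambda M$ is the Hilbert manifold of $H^1$ loops in $M$, $f(\gamma)=\frac12\int_0^1 g(\dot\gamma,\dot\gamma)\,dt$, and $\mathcal N=\{\gamma\in\Lambda M: g(\dot\gamma,\mathcal Y)\text{ is constant a.e.}\}$, a smooth submanifold whose tangent space $T_\gamma\mathcal N$ consists of periodic $H^1$ fields $V$ along $\gamma$ with $g(\frac{\mathrm D}{\mathrm dt}V,\mathcal Y)-g(V,\frac{\mathrm D}{\mathrm dt}\mathcal Y)$ constant a.e. The flow $\mathcal F_t$ of $\mathcal Y$ gives a free $\mathbb R$-action $\gamma\mapsto\mathcal F_t\circ\gamma$ on $\mathcal N$; $\widetilde{\mathcal N}=\mathcal N/\mathbb R$ is a smooth Hilbert manifold, $[\gamma]$ is the class of $\gamma$, and $f$ descends to $\widetilde{\mathcal N}$. $\mathrm O(2)$ acts on $\widetilde{\mathcal N}$ through its action on the parameter circle $\mathbb S^1=[0,1]/\{0,1\}$. Critical points of $f$ in $\widetilde{\mathcal N}$ are the classes of closed geodesics. The nullity $\mathrm n(\gamma)$ of a closed geodesic is the dimension of the kernel of the index form $I_\gamma(V,W)=\int_0^1 g(\frac{\mathrm D}{\mathrm dt}V,\frac{\mathrm D}{\mathrm dt}W)+g(R(\dot\gamma,V)\dot\gamma,W)\,dt$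 (with $R(X,Y)=\nabla_X\nabla_Y-\nabla_Y\nabla_X-\nabla_{[X,Y]}$) on $T_\gamma\mathcal N$; it equals the dimension of the space of Jacobi fields $J$ along $\gamma$ with $J(0)=J(1)$, $\frac{\mathrm D}{\mathrm dt}J(0)=\frac{\mathrm D}{\mathrm dt}J(1)$, and is at least $2$ (it contains $\dot\gamma$ and $\mathcal Y|_\gamma$). The critical orbit $\mathrm O(2)[\gamma]$ is nondegenerate if the kernel of the Hessian of $f$ at $[\gamma]$ in $\widetilde{\mathcal N}$ is the tangent space of the orbit, i.e., if $\mathrm n(\gamma)=2$. The linearized Poincaré map $\mathfrak P_\gamma$ is the linear map of $T_{\gamma(0)}M\oplus T_{\gamma(0)}M^*$ given by $\mathfrak P_\gamma\big(J(0),g(\frac{\mathrm D}{\mathrm dt}J(0),\cdot)\big)=\big(J(1),g(\frac{\mathrm D}{\mathrm dt}J(1),\cdot)\big)$ for $J$ a Jacobi field along $\gamma$, and $\mathfrak s(\mathfrak P_\gamma)\subset\mathbb C$ is its spectrum. *)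

theory Defs
  imports "HOL-Analysis.Analysis" "HOL-Library.Function_Algebras"
begin

section \<open>Smooth manifolds\<close>

text \<open>
  The manifold is the whole type \<open>'m\<close>, which is required to be Hausdorff and second countable,
  and its dimension is \<open>CARD('n)\<close>. A chart is a pair consisting of its open domain and its
  coordinate map. The predicates \<open>Ck_on\<close> and \<open>smooth_on\<close> are meant for open sets.
\<close>

primrec Ck_on :: "nat \<Rightarrow> 'a::euclidean_space set \<Rightarrow> ('a \<Rightarrow> 'b::real_normed_vector) \<Rightarrow> bool" where
  "Ck_on 0 = (\<lambda>S f. continuous_on S f)"
| "Ck_on (Suc k) = (\<lambda>S f. (\<forall>x\<in>S. f differentiable (at x)) \<and>
      (\<forall>v. Ck_on k S (\<lambda>x. frechet_derivative f (at x) v)))"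

definition smooth_on :: "'a::euclidean_space set \<Rightarrow> ('a \<Rightarrow> 'b::real_normed_vector) \<Rightarrow> bool" where
  "smooth_on S f \<longleftrightarrow> (\<forall>k. Ck_on k S f)"

type_synonym ('m, 'n) chart = "'m set \<times> ('m \<Rightarrow> real ^ 'n)"

definition chart_inv :: "('m, 'n) chart \<Rightarrow> real ^ 'n \<Rightarrow> 'm" where
  "chart_inv c = inv_into (fst c) (snd c)"

definition is_chart :: "('m::topological_space, 'n::finite) chart \<Rightarrow> bool" where
  "is_chart c \<longleftrightarrow> open (fst c) \<and> open (snd c ` fst c) \<and>
     homeomorphism (fst c) (snd c ` fst c) (snd c) (chart_inv c)"

definition smooth_atlas ::
  "('m::{t2_space, second_countable_topology}, 'n::finite) chart set \<Rightarrow> bool" where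
  "smooth_atlas A \<longleftrightarrow> (\<forall>c\<in>A. is_chart c) \<and> (\<Union>c\<in>A. fst c) = UNIV \<and>
     (\<forall>c\<in>A. \<forall>d\<in>A. smooth_on (snd c ` (fst c \<inter> fst d)) (snd d \<circ> chart_inv c))"

text \<open>
  Every point \<open>p\<close> has a preferred chart \<open>chart_at A p\<close>, and \<open>T\<^sub>pM\<close> is identified with
  \<open>\<real>\<^sup>n\<close> by means of this chart. Thus all tangent vectors below are coordinate vectors with respect
  to the preferred chart at their base point. The vector with components \<open>v\<close> in a chart \<open>c\<close>
  around \<open>p\<close> has components \<open>change c d p v\<close> in a chart \<open>d\<close>.
\<close>

definition chart_at :: "('m, 'n) chart set \<Rightarrow> 'm \<Rightarrow> ('m, 'n) chart" where
  "chart_at A p = (SOME c. c \<in> A \<and> p \<in> fst c)"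

definition change ::
  "('m, 'n::finite) chart \<Rightarrow> ('m, 'n) chart \<Rightarrow> 'm \<Rightarrow> real ^ 'n \<Rightarrow> real ^ 'n" where
  "change c d p v = frechet_derivative (snd d \<circ> chart_inv c) (at (snd c p)) v"

definition comps ::
  "('m, 'n::finite) chart set \<Rightarrow> ('m, 'n) chart \<Rightarrow> 'm \<Rightarrow> real ^ 'n \<Rightarrow> real ^ 'n" where
  "comps A c p v = change (chart_at A p) c p v"

definition coord_field :: "('m, 'n::finite) chart set \<Rightarrow> ('m, 'n) chart \<Rightarrow> 'm \<Rightarrow> 'n \<Rightarrow> real ^ 'n" where
  "coord_field A c p i = change c (chart_at A p) p (axis i 1)"


section \<open>Lorentzian metrics\<close>

type_synonym ('m, 'n) metric = "'m \<Rightarrow> real ^ 'n \<Rightarrow> real ^ 'n \<Rightarrow> real"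

definition gram ::
  "('m, 'n::finite) chart set \<Rightarrow> ('m, 'n) metric \<Rightarrow> ('m, 'n) chart \<Rightarrow> real ^ 'n \<Rightarrow> real ^ 'n ^ 'n" where
  "gram A g c x = (let p = chart_inv c x in
     \<chi> i j. g p (coord_field A c p i) (coord_field A c p j))"

definition lorentzian_form :: "(real ^ 'n \<Rightarrow> real ^ 'n::finite \<Rightarrow> real) \<Rightarrow> bool" where
  "lorentzian_form b \<longleftrightarrow> bilinear b \<and> (\<forall>v w. b v w = b w v) \<and>
     (\<exists>(e :: 'n \<Rightarrow> real ^ 'n) k.
        \<forall>i j. b (e i) (e j) = (if i \<noteq> j then 0 else if i = k then - 1 else 1))"

definition lorentzian_manifold ::
  "('m::{t2_space, second_countable_topology}, 'n::finite) chart set \<Rightarrow> ('m, 'n) metric \<Rightarrow> bool" where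
  "lorentzian_manifold A g \<longleftrightarrow> smooth_atlas A \<and> (\<forall>p. lorentzian_form (g p)) \<and>
     (\<forall>c\<in>A. smooth_on (snd c ` fst c) (gram A g c))"

definition pderiv :: "(real ^ 'n::finite \<Rightarrow> 'b::real_normed_vector) \<Rightarrow> real ^ 'n \<Rightarrow> 'n \<Rightarrow> 'b" where
  "pderiv f x i = frechet_derivative f (at x) (axis i 1)"

text \<open>
  \<open>christoffel A g c x u v\<close> is the vector with components \<open>\<Gamma>\<^sup>k\<^sub>i\<^sub>j u\<^sup>i v\<^sup>j\<close> in the chart \<open>c\<close>, where
  \<open>\<Gamma>\<^sup>k\<^sub>i\<^sub>j = 1/2 g\<^sup>k\<^sup>l (\<partial>\<^sub>i g\<^sub>j\<^sub>l + \<partial>\<^sub>j g\<^sub>i\<^sub>l - \<partial>\<^sub>l g\<^sub>i\<^sub>j)\<close>.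
\<close>

definition christoffel ::
  "('m, 'n::finite) chart set \<Rightarrow> ('m, 'n) metric \<Rightarrow> ('m, 'n) chart \<Rightarrow> real ^ 'n
     \<Rightarrow> real ^ 'n \<Rightarrow> real ^ 'n \<Rightarrow> real ^ 'n" where
  "christoffel A g c x u v = (\<chi> k. \<Sum>i\<in>UNIV. \<Sum>j\<in>UNIV. \<Sum>l\<in>UNIV.
     1 / 2 * matrix_inv (gram A g c x) $ k $ l *
       (pderiv (\<lambda>y. gram A g c y $ j $ l) x i + pderiv (\<lambda>y. gram A g c y $ i $ l) x j
         - pderiv (\<lambda>y. gram A g c y $ i $ j) x l) * u $ i * v $ j)"

text \<open>
  The curvature tensor with the sign convention
  \<open>R(X,Y) = \<nabla>\<^sub>X\<nabla>\<^sub>Y - \<nabla>\<^sub>Y\<nabla>\<^sub>X - \<nabla>\<^sub>[\<^sub>X\<^sub>,\<^sub>Y\<^sub>]\<close>, evaluated on vector fields with constant components;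
  \<open>curvature A g p u v w\<close> is \<open>R(u,v)w\<close>.
\<close>

definition curvature ::
  "('m, 'n::finite) chart set \<Rightarrow> ('m, 'n) metric \<Rightarrow> 'm \<Rightarrow> real ^ 'n \<Rightarrow> real ^ 'n \<Rightarrow> real ^ 'n
     \<Rightarrow> real ^ 'n" where
  "curvature A g p u v w = (let x = snd (chart_at A p) p; \<Gamma> = christoffel A g (chart_at A p) in
     frechet_derivative (\<lambda>y. \<Gamma> y v w) (at x) u - frechet_derivative (\<lambda>y. \<Gamma> y u w) (at x) v
       + \<Gamma> x u (\<Gamma> x v w) - \<Gamma> x v (\<Gamma> x u w))"


section \<open>Curves, Cauchy surfaces and Killing fields\<close>

text \<open>
  Derivatives are taken within the parameter set \<open>T\<close>, hence one-sidedly at the end points if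
  \<open>T\<close> is a compact interval.
\<close>

definition velocity ::
  "('m, 'n::finite) chart set \<Rightarrow> real set \<Rightarrow> (real \<Rightarrow> 'm) \<Rightarrow> real \<Rightarrow> real ^ 'n" where
  "velocity A T \<gamma> t = vector_derivative (\<lambda>s. snd (chart_at A (\<gamma> t)) (\<gamma> s)) (at t within T)"

definition smooth_curve ::
  "('m::topological_space, 'n::finite) chart set \<Rightarrow> (real \<Rightarrow> 'm) \<Rightarrow> bool" where
  "smooth_curve A \<sigma> \<longleftrightarrow> continuous_on UNIV \<sigma> \<and>
     (\<forall>c\<in>A. smooth_on (\<sigma> -` fst c) (\<lambda>t. snd c (\<sigma> t)))"

text \<open>
  An inextendible curve is necessarily defined on an open interval, which may be reparametrized
  to be the whole real line.
\<close>

definition inextendible_timelike_curve ::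
  "('m::topological_space, 'n::finite) chart set \<Rightarrow> ('m, 'n) metric \<Rightarrow> (real \<Rightarrow> 'm) \<Rightarrow> bool" where
  "inextendible_timelike_curve A g \<sigma> \<longleftrightarrow> smooth_curve A \<sigma> \<and>
     (\<forall>t. g (\<sigma> t) (velocity A UNIV \<sigma> t) (velocity A UNIV \<sigma> t) < 0) \<and>
     \<not> (\<exists>p. (\<sigma> \<longlongrightarrow> p) at_top) \<and> \<not> (\<exists>p. (\<sigma> \<longlongrightarrow> p) at_bot)"

definition cauchy_surface ::
  "('m::topological_space, 'n::finite) chart set \<Rightarrow> ('m, 'n) metric \<Rightarrow> 'm set \<Rightarrow> bool" where
  "cauchy_surface A g S \<longleftrightarrow> (\<forall>\<sigma>. inextendible_timelike_curve A g \<sigma> \<longrightarrow> (\<exists>!t. \<sigma> t \<in> S))"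

definition globally_hyperbolic ::
  "('m::topological_space, 'n::finite) chart set \<Rightarrow> ('m, 'n) metric \<Rightarrow> bool" where
  "globally_hyperbolic A g \<longleftrightarrow> (\<exists>S. cauchy_surface A g S)"

definition field_comps ::
  "('m, 'n::finite) chart set \<Rightarrow> ('m \<Rightarrow> real ^ 'n) \<Rightarrow> ('m, 'n) chart \<Rightarrow> real ^ 'n \<Rightarrow> real ^ 'n" where
  "field_comps A Y c x = comps A c (chart_inv c x) (Y (chart_inv c x))"

definition smooth_vector_field ::
  "('m, 'n::finite) chart set \<Rightarrow> ('m \<Rightarrow> real ^ 'n) \<Rightarrow> bool" where
  "smooth_vector_field A Y \<longleftrightarrow> (\<forall>c\<in>A. smooth_on (snd c ` fst c) (field_comps A Y c))"

text \<open>The Killing equation expresses that the Lie derivative of \<open>g\<close> in the direction \<open>Y\<close> vanishes.\<close>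

definition killing_field ::
  "('m, 'n::finite) chart set \<Rightarrow> ('m, 'n) metric \<Rightarrow> ('m \<Rightarrow> real ^ 'n) \<Rightarrow> bool" where
  "killing_field A g Y \<longleftrightarrow> smooth_vector_field A Y \<and>
     (\<forall>c\<in>A. \<forall>x\<in>snd c ` fst c. \<forall>i j. (\<Sum>k\<in>UNIV.
        field_comps A Y c x $ k * pderiv (\<lambda>y. gram A g c y $ i $ j) x k
        + gram A g c x $ k $ j * pderiv (\<lambda>y. field_comps A Y c y $ k) x i
        + gram A g c x $ i $ k * pderiv (\<lambda>y. field_comps A Y c y $ k) x j) = 0)"

definition complete_field ::
  "('m::topological_space, 'n::finite) chart set \<Rightarrow> ('m \<Rightarrow> real ^ 'n) \<Rightarrow> bool" where
  "complete_field A Y \<longleftrightarrow> (\<forall>p. \<exists>\<sigma>. \<sigma> 0 = p \<and> continuous_on UNIV \<sigma> \<and>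
     (\<forall>t. \<forall>c\<in>A. \<sigma> t \<in> fst c \<longrightarrow>
        ((\<lambda>s. snd c (\<sigma> s)) has_vector_derivative comps A c (\<sigma> t) (Y (\<sigma> t))) (at t)))"

definition timelike_field :: "('m, 'n) metric \<Rightarrow> ('m \<Rightarrow> real ^ 'n) \<Rightarrow> bool" where
  "timelike_field g Y \<longleftrightarrow> (\<forall>p. g p (Y p) (Y p) < 0)"


section \<open>Closed geodesics and Jacobi fields\<close>

text \<open>
  Curves and fields along curves are parametrized by \<open>[0,1]\<close>; their values outside this interval
  are irrelevant, and spaces of fields are made extensional by the value zero there.
\<close>

definition vel :: "('m, 'n::finite) chart set \<Rightarrow> (real \<Rightarrow> 'm) \<Rightarrow> real \<Rightarrow> real ^ 'n" where
  "vel A \<gamma> = velocity A {0..1} \<gamma>"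

definition cov_deriv ::
  "('m, 'n::finite) chart set \<Rightarrow> ('m, 'n) metric \<Rightarrow> (real \<Rightarrow> 'm) \<Rightarrow> (real \<Rightarrow> real ^ 'n)
     \<Rightarrow> real \<Rightarrow> real ^ 'n" where
  "cov_deriv A g \<gamma> V t = (let c = chart_at A (\<gamma> t) in
     vector_derivative (\<lambda>s. comps A c (\<gamma> s) (V s)) (at t within {0..1})
       + christoffel A g c (snd c (\<gamma> t)) (vel A \<gamma> t) (V t))"

definition differentiable_curve ::
  "('m::topological_space, 'n::finite) chart set \<Rightarrow> (real \<Rightarrow> 'm) \<Rightarrow> bool" where
  "differentiable_curve A \<gamma> \<longleftrightarrow> continuous_on {0..1} \<gamma> \<and>
     (\<forall>c\<in>A. \<forall>t\<in>{0..1}. \<gamma> t \<in> fst c \<longrightarrow> (\<lambda>s. snd c (\<gamma> s)) differentiable (at t within {0..1}))"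

definition differentiable_along ::
  "('m, 'n::finite) chart set \<Rightarrow> (real \<Rightarrow> 'm) \<Rightarrow> (real \<Rightarrow> real ^ 'n) \<Rightarrow> bool" where
  "differentiable_along A \<gamma> V \<longleftrightarrow> (\<forall>c\<in>A. \<forall>t\<in>{0..1}. \<gamma> t \<in> fst c \<longrightarrow>
     (\<lambda>s. comps A c (\<gamma> s) (V s)) differentiable (at t within {0..1}))"

definition geodesic ::
  "('m::topological_space, 'n::finite) chart set \<Rightarrow> ('m, 'n) metric \<Rightarrow> (real \<Rightarrow> 'm) \<Rightarrow> bool" where
  "geodesic A g \<gamma> \<longleftrightarrow> differentiable_curve A \<gamma> \<and> differentiable_along A \<gamma> (vel A \<gamma>) \<and>
     (\<forall>t\<in>{0..1}. cov_deriv A g \<gamma> (vel A \<gamma>) t = 0)"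

definition closed_geodesic ::
  "('m::topological_space, 'n::finite) chart set \<Rightarrow> ('m, 'n) metric \<Rightarrow> (real \<Rightarrow> 'm) \<Rightarrow> bool" where
  "closed_geodesic A g \<gamma> \<longleftrightarrow> geodesic A g \<gamma> \<and> \<gamma> 0 = \<gamma> 1 \<and> vel A \<gamma> 0 = vel A \<gamma> 1"

definition periodic_ext :: "(real \<Rightarrow> 'm) \<Rightarrow> real \<Rightarrow> 'm" where
  "periodic_ext \<gamma> t = \<gamma> (frac t)"

definition iterate :: "nat \<Rightarrow> (real \<Rightarrow> 'm) \<Rightarrow> real \<Rightarrow> 'm" where
  "iterate N \<gamma> t = periodic_ext \<gamma> (real N * t)"

definition jacobi_field ::
  "('m, 'n::finite) chart set \<Rightarrow> ('m, 'n) metric \<Rightarrow> (real \<Rightarrow> 'm) \<Rightarrow> (real \<Rightarrow> real ^ 'n) \<Rightarrow> bool" where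
  "jacobi_field A g \<gamma> J \<longleftrightarrow>
     differentiable_along A \<gamma> J \<and> differentiable_along A \<gamma> (cov_deriv A g \<gamma> J) \<and>
     (\<forall>t\<in>{0..1}. cov_deriv A g \<gamma> (cov_deriv A g \<gamma> J) t
        = curvature A g (\<gamma> t) (vel A \<gamma> t) (J t) (vel A \<gamma> t))"

definition flat :: "('m, 'n::finite) metric \<Rightarrow> 'm \<Rightarrow> real ^ 'n \<Rightarrow> (real ^ 'n) \<Rightarrow>\<^sub>L real" where
  "flat g p w = Blinfun (\<lambda>v. g p w v)"

definition poincare_map ::
  "('m, 'n::finite) chart set \<Rightarrow> ('m, 'n) metric \<Rightarrow> (real \<Rightarrow> 'm)
     \<Rightarrow> (real ^ 'n) \<times> ((real ^ 'n) \<Rightarrow>\<^sub>L real) \<Rightarrow> (real ^ 'n) \<times> ((real ^ 'n) \<Rightarrow>\<^sub>L real)" where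
  "poincare_map A g \<gamma> x = (THE y. \<exists>J. jacobi_field A g \<gamma> J \<and>
     x = (J 0, flat g (\<gamma> 0) (cov_deriv A g \<gamma> J 0)) \<and>
     y = (J 1, flat g (\<gamma> 1) (cov_deriv A g \<gamma> J 1)))"

text \<open>
  The complex spectrum of an endomorphism of a finite-dimensional real vector space, i.e. the set
  of eigenvalues \<open>z\<close> of its complexification, with eigenvectors \<open>u + \<i> v\<close>.
\<close>

definition spectrum :: "('v::real_vector \<Rightarrow> 'v) \<Rightarrow> complex set" where
  "spectrum P = {z. \<exists>u v. (u, v) \<noteq> (0, 0) \<and>
     P u = Re z *\<^sub>R u - Im z *\<^sub>R v \<and> P v = Im z *\<^sub>R u + Re z *\<^sub>R v}"


section \<open>The constrained loop space\<close>

text \<open>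
  The Sobolev class \<open>H\<^sup>1\<close> on \<open>[a,b]\<close>: absolutely continuous functions (those that are almost
  everywhere differentiable and are recovered by integrating the derivative) with
  square integrable derivative.
\<close>

definition H1_on :: "real \<Rightarrow> real \<Rightarrow> (real \<Rightarrow> real ^ 'n::finite) \<Rightarrow> bool" where
  "H1_on a b f \<longleftrightarrow> (let f' = (\<lambda>t. vector_derivative f (at t within {a..b})) in
     (AE t in lebesgue_on {a..b}. f differentiable (at t within {a..b})) \<and>
     (\<lambda>t. (norm (f' t))\<^sup>2) integrable_on {a..b} \<and>
     (\<forall>t\<in>{a..b}. (f' has_integral (f t - f a)) {a..t}))"

definition H1_loop ::
  "('m::topological_space, 'n::finite) chart set \<Rightarrow> (real \<Rightarrow> 'm) \<Rightarrow> bool" where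
  "H1_loop A \<gamma> \<longleftrightarrow> continuous_on {0..1} \<gamma> \<and> \<gamma> 0 = \<gamma> 1 \<and>
     (\<forall>c\<in>A. \<forall>a b. 0 \<le> a \<and> a < b \<and> b \<le> 1 \<and> \<gamma> ` {a..b} \<subseteq> fst c \<longrightarrow>
        H1_on a b (\<lambda>t. snd c (\<gamma> t)))"

definition H1_field ::
  "('m, 'n::finite) chart set \<Rightarrow> (real \<Rightarrow> 'm) \<Rightarrow> (real \<Rightarrow> real ^ 'n) \<Rightarrow> bool" where
  "H1_field A \<gamma> V \<longleftrightarrow> (\<forall>t. t \<notin> {0..1} \<longrightarrow> V t = 0) \<and> V 0 = V 1 \<and>
     (\<forall>c\<in>A. \<forall>a b. 0 \<le> a \<and> a < b \<and> b \<le> 1 \<and> \<gamma> ` {a..b} \<subseteq> fst c \<longrightarrow>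
        H1_on a b (\<lambda>t. comps A c (\<gamma> t) (V t)))"

definition ae_const :: "(real \<Rightarrow> real) \<Rightarrow> bool" where
  "ae_const h \<longleftrightarrow> (\<exists>k. AE t in lebesgue_on {0..1}. h t = k)"

text \<open>The manifold \<open>\<N>\<close> and its tangent space at \<open>\<gamma>\<close>.\<close>

definition loops_N ::
  "('m::topological_space, 'n::finite) chart set \<Rightarrow> ('m, 'n) metric \<Rightarrow> ('m \<Rightarrow> real ^ 'n)
     \<Rightarrow> (real \<Rightarrow> 'm) set" where
  "loops_N A g Y = {\<gamma>. H1_loop A \<gamma> \<and> ae_const (\<lambda>t. g (\<gamma> t) (vel A \<gamma> t) (Y (\<gamma> t)))}"

definition tangent_N ::
  "('m, 'n::finite) chart set \<Rightarrow> ('m, 'n) metric \<Rightarrow> ('m \<Rightarrow> real ^ 'n) \<Rightarrow> (real \<Rightarrow> 'm)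
     \<Rightarrow> (real \<Rightarrow> real ^ 'n) set" where
  "tangent_N A g Y \<gamma> = {V. H1_field A \<gamma> V \<and> ae_const (\<lambda>t.
     g (\<gamma> t) (cov_deriv A g \<gamma> V t) (Y (\<gamma> t))
       - g (\<gamma> t) (V t) (cov_deriv A g \<gamma> (\<lambda>s. Y (\<gamma> s)) t))}"

text \<open>The differential at \<open>\<gamma>\<close> of the functional \<open>f(\<gamma>) = 1/2 \<integral> g(\<gamma>',\<gamma>') dt\<close>.\<close>

definition energy_differential ::
  "('m, 'n::finite) chart set \<Rightarrow> ('m, 'n) metric \<Rightarrow> (real \<Rightarrow> 'm) \<Rightarrow> (real \<Rightarrow> real ^ 'n) \<Rightarrow> real" where
  "energy_differential A g \<gamma> V =
     integral {0..1} (\<lambda>t. g (\<gamma> t) (vel A \<gamma> t) (cov_deriv A g \<gamma> V t))"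

definition critical_point ::
  "('m::topological_space, 'n::finite) chart set \<Rightarrow> ('m, 'n) metric \<Rightarrow> ('m \<Rightarrow> real ^ 'n)
     \<Rightarrow> (real \<Rightarrow> 'm) \<Rightarrow> bool" where
  "critical_point A g Y \<gamma> \<longleftrightarrow> \<gamma> \<in> loops_N A g Y \<and>
     (\<forall>V\<in>tangent_N A g Y \<gamma>. energy_differential A g \<gamma> V = 0)"

definition index_form ::
  "('m, 'n::finite) chart set \<Rightarrow> ('m, 'n) metric \<Rightarrow> (real \<Rightarrow> 'm) \<Rightarrow> (real \<Rightarrow> real ^ 'n)
     \<Rightarrow> (real \<Rightarrow> real ^ 'n) \<Rightarrow> real" where
  "index_form A g \<gamma> V W = integral {0..1} (\<lambda>t.
     g (\<gamma> t) (cov_deriv A g \<gamma> V t) (cov_deriv A g \<gamma> W t)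
       + g (\<gamma> t) (curvature A g (\<gamma> t) (vel A \<gamma> t) (V t) (vel A \<gamma> t)) (W t))"

definition nullity ::
  "('m, 'n::finite) chart set \<Rightarrow> ('m, 'n) metric \<Rightarrow> ('m \<Rightarrow> real ^ 'n) \<Rightarrow> (real \<Rightarrow> 'm) \<Rightarrow> nat" where
  "nullity A g Y \<gamma> = vector_space.dim (\<lambda>a V t. a *\<^sub>R V t)
     {V \<in> tangent_N A g Y \<gamma>. \<forall>W\<in>tangent_N A g Y \<gamma>. index_form A g \<gamma> V W = 0}"


section \<open>Nondegenerate critical orbits in the quotient by the flow\<close>

text \<open>
  The tangent space at \<open>[\<gamma>]\<close> of the quotient of \<open>\<N>\<close> by the flow of \<open>Y\<close> is the quotient of
  \<open>T\<^sub>\<gamma>\<N>\<close> by the line spanned by \<open>Y\<close> along \<open>\<gamma>\<close>; its elements are represented as cosets.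
\<close>

definition coset_Y ::
  "('m \<Rightarrow> real ^ 'n::finite) \<Rightarrow> (real \<Rightarrow> 'm) \<Rightarrow> (real \<Rightarrow> real ^ 'n) \<Rightarrow> (real \<Rightarrow> real ^ 'n) set" where
  "coset_Y Y \<gamma> V = range (\<lambda>a t. V t + a *\<^sub>R (if t \<in> {0..1} then Y (\<gamma> t) else 0))"

definition tangent_quot ::
  "('m, 'n::finite) chart set \<Rightarrow> ('m, 'n) metric \<Rightarrow> ('m \<Rightarrow> real ^ 'n) \<Rightarrow> (real \<Rightarrow> 'm)
     \<Rightarrow> (real \<Rightarrow> real ^ 'n) set set" where
  "tangent_quot A g Y \<gamma> = coset_Y Y \<gamma> ` tangent_N A g Y \<gamma>"

text \<open>
  The Hessian at the critical point \<open>[\<gamma>]\<close> is induced by the index form, whose value does not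
  depend on the representatives.
\<close>

definition hessian_kernel ::
  "('m, 'n::finite) chart set \<Rightarrow> ('m, 'n) metric \<Rightarrow> ('m \<Rightarrow> real ^ 'n) \<Rightarrow> (real \<Rightarrow> 'm)
     \<Rightarrow> (real \<Rightarrow> real ^ 'n) set set" where
  "hessian_kernel A g Y \<gamma> = {X \<in> tangent_quot A g Y \<gamma>. \<forall>Z\<in>tangent_quot A g Y \<gamma>.
     \<forall>V\<in>X. \<forall>W\<in>Z. index_form A g \<gamma> V W = 0}"

text \<open>
  The tangent space at \<open>[\<gamma>]\<close> of the orbit \<open>O(2)[\<gamma>]\<close>: rotations of the parameter circle move
  \<open>\<gamma>\<close> in the direction of its velocity.
\<close>

definition orbit_tangent ::
  "('m, 'n::finite) chart set \<Rightarrow> ('m \<Rightarrow> real ^ 'n) \<Rightarrow> (real \<Rightarrow> 'm)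
     \<Rightarrow> (real \<Rightarrow> real ^ 'n) set set" where
  "orbit_tangent A Y \<gamma> =
     range (\<lambda>b. coset_Y Y \<gamma> (\<lambda>t. b *\<^sub>R (if t \<in> {0..1} then vel A \<gamma> t else 0)))"

definition nondegenerate_critical_orbit ::
  "('m::topological_space, 'n::finite) chart set \<Rightarrow> ('m, 'n) metric \<Rightarrow> ('m \<Rightarrow> real ^ 'n)
     \<Rightarrow> (real \<Rightarrow> 'm) \<Rightarrow> bool" where
  "nondegenerate_critical_orbit A g Y \<gamma> \<longleftrightarrow>
     critical_point A g Y \<gamma> \<and> hessian_kernel A g Y \<gamma> = orbit_tangent A Y \<gamma>"

end

theory Submission
  imports Defs
begin

text \<open>
  A parallel frame along \<open>\<gamma>\<close> turns the Jacobi equation into a linear system \<open>x'' = R x\<close>, whose flow over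
  one period, corrected by the holonomy of the frame, is the Poincare map \<open>P\<close>. The kernel of the
  index form on the constrained fields consists of the periodic Jacobi fields: an arbitrary periodic
  test field becomes admissible after adding a multiple \<open>\<phi> Y\<close> of the Killing field, which does not
  change the value of the index form, and the lemma of du Bois-Reymond applies. Hence the nullity of
  the \<open>N\<close>-th iterate is the dimension of the space of fixed points of \<open>P\<^sup>N\<close>. The fixed points of
  \<open>P\<^sup>N\<close> are spanned by eigenvectors for the \<open>N\<close>-th roots of unity, which gives the criterion for
  nondegeneracy. They depend only on the set of those \<open>d\<close> dividing \<open>N\<close> that are orders of eigenvalues
  of \<open>P\<close>. At most \<open>dim M\<close> orders \<open>d > 1\<close> occur, and each class \<open>N\<^sub>j\<close> consists of the numbers with a
  given set of such divisors, whose least common multiple is \<open>m\<^sub>j\<close>.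
\<close>

section \<open>Linear differential equations\<close>

text \<open>Tangent vectors are coordinate vectors in a chart chosen point by point, so a field
  along \<gamma> need not be continuous as a function of t. Derivatives are therefore taken in one
  fixed chart near a given time and shown not to depend on it; the parallel frame then replaces the
  varying tangent spaces by a single one. The frame is in general not periodic: its value H at time
  1 is the holonomy, and a periodic field becomes a function with x(0) = H(x(1)). The constraint on
  tangent fields restricts derivatives almost everywhere, so a bump function times a vector is
  usually not an admissible test field. The Killing field can absorb the constraint because it is
  timelike, hence g(Y,Y) can be divided by, and because it is itself a Jacobi field. The bound by
  dim M, although P acts on a space of twice that dimension, comes from complex conjugation: P is
  real, so an eigenvalue of order d > 2 occurs together with its conjugate, and order 2 belongs to
  -1 alone. An iterate runs N times as fast as \<gamma>, so its flow is P^N only after the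
  derivative component has been rescaled by N.\<close>

lemma linear_family_expand:
  fixes F :: "'a::euclidean_space \<Rightarrow> 'b::real_vector"
  assumes "linear F"
  shows "F x = (\<Sum>e\<in>Basis. (x \<bullet> e) *\<^sub>R F e)"
proof -
  have "F x = F (\<Sum>e\<in>Basis. (x \<bullet> e) *\<^sub>R e)" by (simp add: euclidean_representation)
  also have "\<dots> = (\<Sum>e\<in>Basis. (x \<bullet> e) *\<^sub>R F e)"
    using assms by (simp add: linear_sum linear_scale)
  finally show ?thesis .
qed

text \<open>In finite dimension the images of a basis control the whole operator. Hence continuity
  is only asked for each fixed vector, the form in which it is available for Christoffel symbols and
  curvature.\<close>

lemma linear_family_bound:
  fixes A :: "'t::topological_space \<Rightarrow> 'a::euclidean_space \<Rightarrow> 'b::real_normed_vector"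
  assumes "compact T" and lin: "\<And>t. t \<in> T \<Longrightarrow> linear (A t)"
    and cont: "\<And>v. continuous_on T (\<lambda>t. A t v)"
  shows "\<exists>K\<ge>0. \<forall>t\<in>T. \<forall>v. norm (A t v) \<le> K * norm v"
proof -
  have "\<exists>B. \<forall>t\<in>T. norm (A t e) \<le> B" for e
    using compact_imp_bounded[OF compact_continuous_image[OF cont[of e] \<open>compact T\<close>]]
    by (auto simp: bounded_iff)
  then obtain B where B: "\<And>e t. t \<in> T \<Longrightarrow> norm (A t e) \<le> B e" by metis
  have "norm (A t v) \<le> (\<Sum>e\<in>Basis. \<bar>B e\<bar>) * norm v" if t: "t \<in> T" for t v
  proof -
    have "norm (A t v) = norm (\<Sum>e\<in>Basis. (v \<bullet> e) *\<^sub>R A t e)"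
      using linear_family_expand[OF lin[OF t], of v] by simp
    also have "\<dots> \<le> (\<Sum>e\<in>Basis. norm v * \<bar>B e\<bar>)"
    proof (rule sum_norm_le)
      fix e :: 'a assume e: "e \<in> Basis"
      have "norm (A t e) \<le> \<bar>B e\<bar>" using B[OF t, of e] by linarith
      then show "norm ((v \<bullet> e) *\<^sub>R A t e) \<le> norm v * \<bar>B e\<bar>"
        using Basis_le_norm[OF e, of v] by (auto intro: mult_mono)
    qed
    finally show ?thesis by (simp add: sum_distrib_left mult.commute[of _ "norm v"])
  qed
  then show ?thesis by (intro exI[of _ "\<Sum>e\<in>Basis. \<bar>B e\<bar>"]) (auto simp: sum_nonneg)
qed

lemma linear_family_continuous:
  fixes A :: "'t::topological_space \<Rightarrow> 'a::euclidean_space \<Rightarrow> 'b::real_normed_vector"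
  assumes lin: "\<And>t. t \<in> T \<Longrightarrow> linear (A t)"
    and cont: "\<And>v. continuous_on T (\<lambda>t. A t v)" and y: "continuous_on T y"
  shows "continuous_on T (\<lambda>t. A t (y t))"
proof -
  have "continuous_on T (\<lambda>t. \<Sum>e\<in>Basis. (y t \<bullet> e) *\<^sub>R A t e)"
    by (intro continuous_intros cont y)
  then show ?thesis
    by (rule continuous_on_eq) (use linear_family_expand[OF lin] in simp)
qed

lemma has_vector_derivative_linear_family:
  fixes F :: "real \<Rightarrow> 'a::euclidean_space \<Rightarrow> 'b::real_normed_vector"
  assumes lin: "\<And>s. s \<in> S \<Longrightarrow> linear (F s)" and "linear F'" and "t \<in> S"
    and F: "\<And>e. ((\<lambda>s. F s e) has_vector_derivative F' e) (at t within S)"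
    and x: "(x has_vector_derivative x') (at t within S)"
  shows "((\<lambda>s. F s (x s)) has_vector_derivative F' (x t) + F t x') (at t within S)"
proof -
  have "((\<lambda>s. \<Sum>e\<in>Basis. (x s \<bullet> e) *\<^sub>R F s e) has_vector_derivative
      (\<Sum>e\<in>Basis. (x t \<bullet> e) *\<^sub>R F' e + (x' \<bullet> e) *\<^sub>R F t e)) (at t within S)"
  proof (intro has_vector_derivative_sum has_vector_derivative_scaleR F)
    fix e :: 'a
    show "((\<lambda>s. x s \<bullet> e) has_field_derivative x' \<bullet> e) (at t within S)"
      unfolding has_real_derivative_iff_has_vector_derivative
      using bounded_linear.has_vector_derivative[OF bounded_linear_inner_left x] .
  qed
  moreover have "(\<Sum>e\<in>Basis. (x t \<bullet> e) *\<^sub>R F' e + (x' \<bullet> e) *\<^sub>R F t e) = F' (x t) + F t x'"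
    using linear_family_expand[OF \<open>linear F'\<close>, of "x t"] linear_family_expand[OF lin[OF \<open>t \<in> S\<close>], of x']
    by (simp add: sum.distrib)
  ultimately have "((\<lambda>s. \<Sum>e\<in>Basis. (x s \<bullet> e) *\<^sub>R F s e) has_vector_derivative F' (x t) + F t x') (at t within S)"
    by simp
  then show ?thesis
    by (rule has_vector_derivative_transform[OF \<open>t \<in> S\<close>, rotated])
       (use linear_family_expand[OF lin] in blast)
qed

text \<open>Gronwall's argument: if K bounds the operators, |x|^2 changes at relative rate at most
  2K, so exp(-2Kt)|x|^2 does not increase and exp(2Kt)|x|^2 does not decrease. The first settles
  times after \<open>t0\<close>, the second times before it.\<close>

lemma linear_ode_unique:
  fixes A :: "real \<Rightarrow> 'a::euclidean_space \<Rightarrow> 'a"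
  assumes lin: "\<And>t. t \<in> {a..b} \<Longrightarrow> linear (A t)"
    and cont: "\<And>v. continuous_on {a..b} (\<lambda>t. A t v)"
    and der: "\<And>t. t \<in> {a..b} \<Longrightarrow> (x has_vector_derivative A t (x t)) (at t within {a..b})"
    and t0: "t0 \<in> {a..b}" "x t0 = 0" and t: "t \<in> {a..b}"
  shows "x t = 0"
proof -
  have "\<exists>K\<ge>0. \<forall>t\<in>{a..b}. \<forall>v. norm (A t v) \<le> K * norm v"
    by (rule linear_family_bound[OF compact_Icc lin cont])
  then obtain K where K: "K \<ge> 0" "\<And>t v. t \<in> {a..b} \<Longrightarrow> norm (A t v) \<le> K * norm v"
    by blast
  have AK: "\<bar>x s \<bullet> A s (x s)\<bar> \<le> K * (x s \<bullet> x s)" if "s \<in> {a..b}" for s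
  proof -
    have "\<bar>x s \<bullet> A s (x s)\<bar> \<le> norm (x s) * norm (A s (x s))" by (rule Cauchy_Schwarz_ineq2)
    also have "\<dots> \<le> norm (x s) * (K * norm (x s))" by (intro mult_left_mono K that) auto
    finally show ?thesis by (simp add: dot_square_norm power2_eq_square algebra_simps)
  qed
  have D: "((\<lambda>s. exp (c * s) * (x s \<bullet> x s)) has_real_derivative
      exp (c * s) * (c * (x s \<bullet> x s) + 2 * (x s \<bullet> A s (x s)))) (at s within {a..b})"
    if "s \<in> {a..b}" for c s
  proof -
    have "((\<lambda>s. x s \<bullet> x s) has_real_derivative (x s \<bullet> A s (x s) + A s (x s) \<bullet> x s)) (at s within {a..b})"
      unfolding has_real_derivative_iff_has_vector_derivative
      by (rule bounded_bilinear.has_vector_derivative[OF bounded_bilinear_inner der[OF that] der[OF that]])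
    moreover have "((\<lambda>s. exp (c * s)) has_real_derivative c * exp (c * s)) (at s within {a..b})"
      by (auto intro!: derivative_eq_intros)
    ultimately have "((\<lambda>s. exp (c * s) * (x s \<bullet> x s)) has_real_derivative
        c * exp (c * s) * (x s \<bullet> x s) + (x s \<bullet> A s (x s) + A s (x s) \<bullet> x s) * exp (c * s)) (at s within {a..b})"
      by (intro DERIV_mult)
    then show ?thesis by (simp add: algebra_simps inner_commute)
  qed
  have mvt: "\<exists>s\<in>{p<..<q}. exp (c * q) * (x q \<bullet> x q) - exp (c * p) * (x p \<bullet> x p)
      = (q - p) * (exp (c * s) * (c * (x s \<bullet> x s) + 2 * (x s \<bullet> A s (x s))))"
    if "a \<le> p" "p < q" "q \<le> b" for p q c
  proof -
    have "\<exists>s\<in>{p<..<q}. exp (c * q) * (x q \<bullet> x q) - exp (c * p) * (x p \<bullet> x p)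
      = (exp (c * s) * (c * (x s \<bullet> x s) + 2 * (x s \<bullet> A s (x s)))) * (q - p)"
    proof (rule mvt_simple[OF \<open>p < q\<close>])
      fix s assume "p \<le> s" "s \<le> q"
      then have "s \<in> {a..b}" "{p..q} \<subseteq> {a..b}" using that by auto
      then show "((\<lambda>s. exp (c * s) * (x s \<bullet> x s)) has_derivative
          (*) (exp (c * s) * (c * (x s \<bullet> x s) + 2 * (x s \<bullet> A s (x s))))) (at s within {p..q})"
        using D[of s c] has_field_derivative_def has_derivative_subset by blast
    qed
    then show ?thesis by (simp add: mult.commute)
  qed
  consider "t = t0" | "t0 < t" | "t < t0" by linarith
  then have "x t \<bullet> x t \<le> 0"
  proof cases
    case 2
    then obtain s where s: "s \<in> {t0<..<t}" and e: "exp (-2 * K * t) * (x t \<bullet> x t) =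
        (t - t0) * (exp (-2 * K * s) * (-2 * K * (x s \<bullet> x s) + 2 * (x s \<bullet> A s (x s))))"
      using mvt[of t0 t "-2 * K"] t0 t by auto
    have "-2 * K * (x s \<bullet> x s) + 2 * (x s \<bullet> A s (x s)) \<le> 0"
      using AK[of s] s t0 t by auto
    then have "exp (-2 * K * t) * (x t \<bullet> x t) \<le> 0"
      unfolding e using 2 by (intro mult_nonneg_nonpos) auto
    then show ?thesis by (simp add: mult_le_0_iff)
  next
    case 3
    then obtain s where s: "s \<in> {t<..<t0}" and e: "- (exp (2 * K * t) * (x t \<bullet> x t)) =
        (t0 - t) * (exp (2 * K * s) * (2 * K * (x s \<bullet> x s) + 2 * (x s \<bullet> A s (x s))))"
      using mvt[of t t0 "2 * K"] t0 t by auto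
    have "0 \<le> 2 * K * (x s \<bullet> x s) + 2 * (x s \<bullet> A s (x s))"
      using AK[of s] s t0 t by auto
    then have "0 \<le> - (exp (2 * K * t) * (x t \<bullet> x t))"
      unfolding e using 3 by (intro mult_nonneg_nonneg) auto
    then show ?thesis by (simp add: mult_le_0_iff)
  qed (use t0 in simp)
  then show ?thesis using inner_ge_zero[of "x t"] inner_eq_zero_iff[of "x t"] by linarith
qed

text \<open>Picard iteration, written as the series of its increments \<open>d k\<close> so that it
  can be differentiated term by term.\<close>

lemma linear_ode_exists:
  fixes A :: "real \<Rightarrow> 'a::euclidean_space \<Rightarrow> 'a"
  assumes ab: "a \<le> b" and lin: "\<And>t. t \<in> {a..b} \<Longrightarrow> linear (A t)"
    and cont: "\<And>v. continuous_on {a..b} (\<lambda>t. A t v)"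
  obtains x where "x a = v0"
    "\<And>t. t \<in> {a..b} \<Longrightarrow> (x has_vector_derivative A t (x t)) (at t within {a..b})"
proof -
  have "\<exists>K\<ge>0. \<forall>t\<in>{a..b}. \<forall>v. norm (A t v) \<le> K * norm v"
    by (rule linear_family_bound[OF compact_Icc lin cont])
  then obtain K where K: "K \<ge> 0" "\<And>t v. t \<in> {a..b} \<Longrightarrow> norm (A t v) \<le> K * norm v"
    by blast
  define d where "d = rec_nat (\<lambda>t. v0) (\<lambda>k dk t. integral {a..t} (\<lambda>s. A s (dk s)))"
  have d0: "d 0 = (\<lambda>t. v0)" and dS: "d (Suc k) = (\<lambda>t. integral {a..t} (\<lambda>s. A s (d k s)))" for k
    by (auto simp: d_def)
  have dder: "(d (Suc k) has_vector_derivative A t (d k t)) (at t within {a..b})"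
    if "continuous_on {a..b} (d k)" "t \<in> {a..b}" for k t
    unfolding dS using integral_has_vector_derivative[OF linear_family_continuous[OF lin cont that(1)] that(2)] .
  have dcont: "continuous_on {a..b} (d k)" for k
  proof (induction k)
    case (Suc k)
    then show ?case using dder[OF Suc] has_vector_derivative_continuous continuous_on_eq_continuous_within by blast
  qed (simp add: d0)
  \<comment> \<open>Each integration contributes one more factor K (t - a) and the next denominator,
    as in the exponential series.\<close>
  have bd: "norm (d k t) \<le> norm v0 * ((K * (t - a)) ^ k / fact k)" if "t \<in> {a..b}" for k t
    using that
  proof (induction k arbitrary: t)
    case (Suc k)
    have sub: "{a..t} \<subseteq> {a..b}" using Suc.prems by auto
    have i1: "(\<lambda>s. A s (d k s)) integrable_on {a..t}"
      by (rule integrable_continuous_interval, rule continuous_on_subset[OF linear_family_continuous[OF lin cont dcont] sub])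
    have i2: "((\<lambda>s. K * (norm v0 * ((K * (s - a)) ^ k / fact k))) has_integral
      (norm v0 * ((K * (t - a)) ^ Suc k / fact (Suc k)) - norm v0 * ((K * (a - a)) ^ Suc k / fact (Suc k)))) {a..t}"
    proof (rule fundamental_theorem_of_calculus)
      show "a \<le> t" using Suc.prems by simp
      fix s assume "s \<in> {a..t}"
      have "((\<lambda>s. norm v0 * ((K * (s - a)) ^ Suc k / fact (Suc k))) has_real_derivative
         norm v0 * ((real (Suc k) * (K * (s - a)) ^ k * K) / fact (Suc k))) (at s within {a..t})"
        by (auto intro!: derivative_eq_intros simp del: power_Suc fact_Suc)
      moreover have "norm v0 * ((real (Suc k) * (K * (s - a)) ^ k * K) / fact (Suc k)) =
         K * (norm v0 * ((K * (s - a)) ^ k / fact k))"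
        by (simp add: field_simps del: of_nat_Suc)
      ultimately show "((\<lambda>s. norm v0 * ((K * (s - a)) ^ Suc k / fact (Suc k))) has_vector_derivative
         K * (norm v0 * ((K * (s - a)) ^ k / fact k))) (at s within {a..t})"
        by (simp only: has_real_derivative_iff_has_vector_derivative)
    qed
    have "norm (d (Suc k) t) \<le> integral {a..t} (\<lambda>s. K * (norm v0 * ((K * (s - a)) ^ k / fact k)))"
      unfolding dS
    proof (rule integral_norm_bound_integral[OF i1])
      show "(\<lambda>s. K * (norm v0 * ((K * (s - a)) ^ k / fact k))) integrable_on {a..t}" using i2 by blast
      fix s assume "s \<in> {a..t}"
      then have s: "s \<in> {a..b}" using sub by auto
      show "norm (A s (d k s)) \<le> K * (norm v0 * ((K * (s - a)) ^ k / fact k))"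
        using K(2)[OF s, of "d k s"] mult_left_mono[OF Suc.IH[OF s] K(1)] by linarith
    qed
    also have "\<dots> = norm v0 * ((K * (t - a)) ^ Suc k / fact (Suc k))"
      using integral_unique[OF i2] by simp
    finally show ?case .
  qed (simp add: d0)
  define M where "M k = norm v0 * ((K * (b - a)) ^ k / fact k)" for k
  have dM: "norm (d k t) \<le> M k" if "t \<in> {a..b}" for k t
  proof -
    have "(K * (t - a)) ^ k \<le> (K * (b - a)) ^ k"
      using that K(1) by (intro power_mono mult_left_mono) auto
    then have "norm v0 * ((K * (t - a)) ^ k / fact k) \<le> M k"
      unfolding M_def by (intro mult_left_mono divide_right_mono) auto
    then show ?thesis using bd[OF that, of k] by linarith
  qed
  have "summable (\<lambda>k. inverse (fact k) * (K * (b - a)) ^ k)" by (rule summable_exp)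
  then have sM: "summable M" unfolding M_def
    by (intro summable_mult) (simp add: divide_inverse mult.commute)
  have ul: "uniform_limit {a..b} (\<lambda>n t. \<Sum>i<n. d i t) (\<lambda>t. \<Sum>i. d i t) sequentially"
    by (rule Weierstrass_m_test[OF _ sM]) (rule dM)
  \<comment> \<open>\<open>d 0\<close> is constant and \<open>d (Suc k)\<close> has derivative
    \<open>A t (d k t)\<close>. Because of this shift, the first n + 1 derivatives add up to the
    operator applied to the sum of the first n terms.\<close>
  define D where "D = (\<lambda>n t (h::real). case n of 0 \<Rightarrow> 0 | Suc k \<Rightarrow> h *\<^sub>R A t (d k t))"
  have Dsum: "(\<Sum>i<Suc n. D i t h) = h *\<^sub>R A t (\<Sum>i<n. d i t)" if "t \<in> {a..b}" for n t h
    unfolding sum.lessThan_Suc_shift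
    by (simp add: D_def scaleR_sum_right linear_sum[OF lin[OF that]] linear_scale[OF lin[OF that]])
  have "\<exists>g. \<forall>t\<in>{a..b}. (\<lambda>n. d n t) sums (g t) \<and>
      (g has_derivative (\<lambda>h. h *\<^sub>R A t (\<Sum>i. d i t))) (at t within {a..b})"
  proof (rule has_derivative_series[where f'=D and x=a])
    show "a \<in> {a..b}" using ab by simp
    then show "(\<lambda>n. d n a) sums (\<Sum>n. d n a)"
      by (intro summable_sums summable_comparison_test'[OF sM, of 0]) (use dM in auto)
    show "(d n has_derivative D n t) (at t within {a..b})" if "t \<in> {a..b}" for n t
    proof (cases n)
      case 0
      then show ?thesis by (simp add: D_def d0)
    next
      case (Suc k)
      then show ?thesis using dder[OF dcont that] by (simp add: D_def has_vector_derivative_def)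
    qed
    \<comment> \<open>The partial sums are compared up to e / (K + 1); the added 1 covers the case K
      = 0.\<close>
    fix e :: real assume "e > 0"
    have "\<forall>\<^sub>F n in sequentially. \<forall>t\<in>{a..b}. dist (\<Sum>i<n. d i t) (\<Sum>i. d i t) < e / (K + 1)"
      using ul \<open>e > 0\<close> K(1) unfolding uniform_limit_iff by (auto simp: divide_pos_pos)
    then have "\<forall>\<^sub>F n in sequentially. \<forall>t\<in>{a..b}. \<forall>h. norm ((\<Sum>i<Suc n. D i t h) - h *\<^sub>R A t (\<Sum>i. d i t)) \<le> e * norm h"
    proof eventually_elim
      case (elim n)
      show ?case
      proof (intro ballI allI)
        fix t h assume t: "t \<in> {a..b}"
        have "(\<Sum>i<Suc n. D i t h) - h *\<^sub>R A t (\<Sum>i. d i t) = h *\<^sub>R A t ((\<Sum>i<n. d i t) - (\<Sum>i. d i t))"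
          unfolding Dsum[OF t] by (simp add: linear_diff[OF lin[OF t]] scaleR_diff_right)
        moreover have "norm (A t ((\<Sum>i<n. d i t) - (\<Sum>i. d i t))) \<le> K * (e / (K + 1))"
          by (rule order_trans[OF K(2)[OF t]])
             (rule mult_left_mono[OF less_imp_le K(1)], use elim t in \<open>simp add: dist_norm\<close>)
        moreover have "K * (e / (K + 1)) \<le> e" using K(1) \<open>e > 0\<close> by (simp add: field_simps)
        ultimately have "norm (A t ((\<Sum>i<n. d i t) - (\<Sum>i. d i t))) \<le> e"
          and *: "(\<Sum>i<Suc n. D i t h) - h *\<^sub>R A t (\<Sum>i. d i t) = h *\<^sub>R A t ((\<Sum>i<n. d i t) - (\<Sum>i. d i t))"
          by linarith+
        then show "norm ((\<Sum>i<Suc n. D i t h) - h *\<^sub>R A t (\<Sum>i. d i t)) \<le> e * norm h"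
          unfolding * using mult_left_mono[of _ e "\<bar>h\<bar>"] by (simp add: mult.commute[of e])
      qed
    qed
    then show "\<forall>\<^sub>F n in sequentially. \<forall>t\<in>{a..b}. \<forall>h. norm ((\<Sum>i<n. D i t h) - h *\<^sub>R A t (\<Sum>i. d i t)) \<le> e * norm h"
      by (rule eventually_sequentially_Suc[THEN iffD1])
  qed simp
  then obtain g where g: "\<And>t. t \<in> {a..b} \<Longrightarrow> (\<lambda>n. d n t) sums (g t)"
      "\<And>t. t \<in> {a..b} \<Longrightarrow> (g has_derivative (\<lambda>h. h *\<^sub>R A t (\<Sum>i. d i t))) (at t within {a..b})"
    by blast
  have "g a = v0"
  proof -
    have "d n a = (if n = 0 then v0 else 0)" for n
      by (cases n) (auto simp: d0 dS)
    then have "(\<lambda>n. d n a) = (\<lambda>n. if n = 0 then v0 else 0)" by auto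
    then have "(\<lambda>n. d n a) sums v0" using sums_single[of 0 "\<lambda>_. v0"] by simp
    then show ?thesis using g(1)[of a] ab sums_unique2 by auto
  qed
  moreover have "(g has_vector_derivative A t (g t)) (at t within {a..b})" if "t \<in> {a..b}" for t
    using g(2)[OF that] sums_unique[OF g(1)[OF that]] by (simp add: has_vector_derivative_def)
  ultimately show thesis by (rule that)
qed

section \<open>Iterated directional derivatives\<close>

text \<open>The direction precedes the point, so that \<open>dd f v\<close> is again a function of
  the point and can be differentiated further, following the recursion of
  \<open>Ck_on\<close>.\<close>

definition dd :: "('a::real_normed_vector \<Rightarrow> 'b::real_normed_vector) \<Rightarrow> 'a \<Rightarrow> 'a \<Rightarrow> 'b" where
  "dd f v x = frechet_derivative f (at x) v"

lemma dd_has_derivative: "f differentiable (at x) \<Longrightarrow> (f has_derivative (\<lambda>v. dd f v x)) (at x)"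
  unfolding dd_def by (simp add: frechet_derivative_works)

lemma dd_eqI: "(f has_derivative D) (at x) \<Longrightarrow> dd f v x = D v"
  unfolding dd_def by (metis frechet_derivative_at)

lemma dd_linear: "f differentiable (at x) \<Longrightarrow> linear (\<lambda>v. dd f v x)"
  using dd_has_derivative has_derivative_linear by blast

lemma dd_cong_open:
  assumes "open U" "x \<in> U" "\<And>y. y \<in> U \<Longrightarrow> f y = g y"
  shows "dd f v x = dd g v x"
proof -
  have "(f has_derivative D) (at x) \<longleftrightarrow> (g has_derivative D) (at x)" for D
    using assms has_derivative_transform_within_open[of f D x UNIV U g]
      has_derivative_transform_within_open[of g D x UNIV U f] by auto
  then show ?thesis unfolding dd_def frechet_derivative_def by simp
qed

lemma smooth_on_differentiable: "smooth_on U f \<Longrightarrow> x \<in> U \<Longrightarrow> f differentiable (at x)"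
  unfolding smooth_on_def by (metis Ck_on.simps(2))

lemma smooth_on_dd: "smooth_on U f \<Longrightarrow> smooth_on U (dd f v)"
  unfolding smooth_on_def dd_def by (metis Ck_on.simps(2))

lemma smooth_on_continuous: "smooth_on U f \<Longrightarrow> continuous_on U f"
  unfolding smooth_on_def by (metis Ck_on.simps(1))

text \<open>The mean value theorem twice: in direction u for the difference of f and its translate
  by h v, then in direction v for \<open>dd f u\<close>.\<close>

lemma dd_second_difference:
  fixes f :: "'a::euclidean_space \<Rightarrow> real"
  assumes "h > 0" and seg: "\<And>s r. 0 \<le> s \<Longrightarrow> s \<le> h \<Longrightarrow> 0 \<le> r \<Longrightarrow> r \<le> h \<Longrightarrow> x + s *\<^sub>R u + r *\<^sub>R v \<in> U"
    and f: "\<And>y. y \<in> U \<Longrightarrow> f differentiable (at y)" "\<And>y. y \<in> U \<Longrightarrow> dd f u differentiable (at y)"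
  obtains s r where "0 < s" "s < h" "0 < r" "r < h"
    "f (x + h *\<^sub>R u + h *\<^sub>R v) - f (x + h *\<^sub>R u) - f (x + h *\<^sub>R v) + f x
       = h * h * dd (dd f u) v (x + s *\<^sub>R u + r *\<^sub>R v)"
proof -
  have chain: "((\<lambda>s. k (p + s *\<^sub>R w)) has_real_derivative dd k w (p + s *\<^sub>R w)) (at s)"
    if "k differentiable (at (p + s *\<^sub>R w))" for k :: "'a \<Rightarrow> real" and p w s
  proof -
    have "((\<lambda>s. k (p + s *\<^sub>R w)) has_derivative (\<lambda>h. dd k (h *\<^sub>R w) (p + s *\<^sub>R w))) (at s)"
      by (rule has_derivative_compose[of "\<lambda>s. p + s *\<^sub>R w" "\<lambda>h. h *\<^sub>R w", OF _ dd_has_derivative[OF that]])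
         (auto intro!: derivative_eq_intros)
    then show ?thesis
      using linear_scale[OF dd_linear[OF that]]
      by (simp add: has_field_derivative_def mult_commute_abs)
  qed
  have "\<exists>s. 0 < s \<and> s < h \<and> (f (x + h *\<^sub>R v + h *\<^sub>R u) - f (x + h *\<^sub>R u)) - (f (x + h *\<^sub>R v + 0 *\<^sub>R u) - f (x + 0 *\<^sub>R u))
      = (h - 0) * (dd f u (x + h *\<^sub>R v + s *\<^sub>R u) - dd f u (x + s *\<^sub>R u))"
  proof (rule MVT2[OF \<open>h > 0\<close>], rule DERIV_diff; rule chain; rule f(1))
    fix s assume "0 \<le> s" "s \<le> h"
    then show "x + h *\<^sub>R v + s *\<^sub>R u \<in> U" "x + s *\<^sub>R u \<in> U"
      using seg[of s h] seg[of s 0] \<open>h > 0\<close> by (auto simp: algebra_simps)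
  qed
  then obtain s where s: "0 < s" "s < h" "f (x + h *\<^sub>R v + h *\<^sub>R u) - f (x + h *\<^sub>R u) - (f (x + h *\<^sub>R v) - f x)
      = h * (dd f u (x + h *\<^sub>R v + s *\<^sub>R u) - dd f u (x + s *\<^sub>R u))" by auto
  have "\<exists>r. 0 < r \<and> r < h \<and> dd f u (x + s *\<^sub>R u + h *\<^sub>R v) - dd f u (x + s *\<^sub>R u + 0 *\<^sub>R v)
      = (h - 0) * dd (dd f u) v (x + s *\<^sub>R u + r *\<^sub>R v)"
  proof (rule MVT2[OF \<open>h > 0\<close>], rule chain, rule f(2))
    fix r assume "0 \<le> r" "r \<le> h"
    then show "x + s *\<^sub>R u + r *\<^sub>R v \<in> U" using seg[of s r] s by auto
  qed
  then obtain r where r: "0 < r" "r < h" "dd f u (x + s *\<^sub>R u + h *\<^sub>R v) - dd f u (x + s *\<^sub>R u)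
      = h * dd (dd f u) v (x + s *\<^sub>R u + r *\<^sub>R v)" by auto
  show thesis
    by (rule that[OF s(1,2) r(1,2)]) (use s(3) r(3) in \<open>simp add: algebra_simps\<close>)
qed

text \<open>Schwarz's theorem. The second difference is symmetric in u and v, so the two mixed
  derivatives agree at two points arbitrarily close to x, and continuity carries this to x.\<close>

lemma dd_commute_real:
  fixes f :: "'a::euclidean_space \<Rightarrow> real"
  assumes "open U" "x \<in> U"
    and f: "\<And>y. y \<in> U \<Longrightarrow> f differentiable (at y)" "\<And>y w. y \<in> U \<Longrightarrow> dd f w differentiable (at y)"
    and c: "\<And>v w. continuous_on U (dd (dd f v) w)"
  shows "dd (dd f u) v x = dd (dd f v) u x"
proof (rule ccontr)
  define e where "e = \<bar>dd (dd f u) v x - dd (dd f v) u x\<bar> / 2"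
  assume "dd (dd f u) v x \<noteq> dd (dd f v) u x"
  then have "e > 0" by (simp add: e_def)
  have "isCont (dd (dd f v) w) x" for v w
    using c[of v w] assms(2) unfolding continuous_on_eq_continuous_at[OF assms(1)] by simp
  then have "\<exists>\<delta>>0. \<forall>y. dist y x < \<delta> \<longrightarrow> dist (dd (dd f v) w y) (dd (dd f v) w x) < e" for v w
    using \<open>e > 0\<close> unfolding continuous_at_eps_delta by (simp add: dist_norm)
  then obtain \<delta> where \<delta>: "\<And>v w. \<delta> v w > 0"
      "\<And>v w y. dist y x < \<delta> v w \<Longrightarrow> dist (dd (dd f v) w y) (dd (dd f v) w x) < e" by metis
  obtain \<rho> where \<rho>: "\<rho> > 0" "ball x \<rho> \<subseteq> U" using assms(1,2) openE by blast
  define m where "m = min \<rho> (min (\<delta> u v) (\<delta> v u))"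
  have "m > 0" using \<rho> \<delta> by (simp add: m_def)
  \<comment> \<open>Small enough for the parallelogram with sides h u and h v to stay within
    distance m of x; the added 1 covers u = v = 0.\<close>
  define h where "h = m / (norm u + norm v + 1)"
  have "norm u + norm v + 1 > 0" by (smt (verit) norm_ge_zero)
  then have h: "h > 0" "h * (norm u + norm v) < m"
    using \<open>m > 0\<close> by (auto simp: h_def field_simps)
  have near: "dist (x + s *\<^sub>R u + r *\<^sub>R v) x < m" if "0 \<le> s" "s \<le> h" "0 \<le> r" "r \<le> h" for s r
  proof -
    have "dist (x + s *\<^sub>R u + r *\<^sub>R v) x = norm (s *\<^sub>R u + r *\<^sub>R v)" by (simp add: dist_norm algebra_simps)
    also have "\<dots> \<le> s * norm u + r * norm v" using that by (intro norm_triangle_le) auto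
    also have "\<dots> \<le> h * norm u + h * norm v" using that by (intro add_mono mult_right_mono) auto
    finally show ?thesis using h(2) by (simp add: algebra_simps)
  qed
  have inU: "x + s *\<^sub>R u + r *\<^sub>R v \<in> U" if "0 \<le> s" "s \<le> h" "0 \<le> r" "r \<le> h" for s r
    using near[OF that] \<rho> by (auto simp: m_def dist_commute)
  obtain s r where 1: "0 < s" "s < h" "0 < r" "r < h"
    "f (x + h *\<^sub>R u + h *\<^sub>R v) - f (x + h *\<^sub>R u) - f (x + h *\<^sub>R v) + f x
       = h * h * dd (dd f u) v (x + s *\<^sub>R u + r *\<^sub>R v)"
    by (rule dd_second_difference[OF h(1) inU f(1) f(2)])
  have "x + s *\<^sub>R v + r *\<^sub>R u \<in> U" if "0 \<le> s" "s \<le> h" "0 \<le> r" "r \<le> h" for s r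
    using inU[of r s] that by (simp add: algebra_simps)
  then obtain s' r' where 2: "0 < s'" "s' < h" "0 < r'" "r' < h"
    "f (x + h *\<^sub>R v + h *\<^sub>R u) - f (x + h *\<^sub>R v) - f (x + h *\<^sub>R u) + f x
       = h * h * dd (dd f v) u (x + s' *\<^sub>R v + r' *\<^sub>R u)"
    using dd_second_difference[OF h(1) _ f(1) f(2), where x=x and u=v and v=u] by metis
  have "h * h * dd (dd f u) v (x + s *\<^sub>R u + r *\<^sub>R v) = h * h * dd (dd f v) u (x + s' *\<^sub>R v + r' *\<^sub>R u)"
    using 1(5) 2(5) by (simp add: algebra_simps)
  then have eq: "dd (dd f u) v (x + s *\<^sub>R u + r *\<^sub>R v) = dd (dd f v) u (x + s' *\<^sub>R v + r' *\<^sub>R u)"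
    using h(1) by simp
  have "dist (dd (dd f u) v (x + s *\<^sub>R u + r *\<^sub>R v)) (dd (dd f u) v x) < e"
    using near[of s r] 1 by (intro \<delta>(2)) (auto simp: m_def)
  moreover have "dist (dd (dd f v) u (x + s' *\<^sub>R v + r' *\<^sub>R u)) (dd (dd f v) u x) < e"
    using near[of r' s'] 2 by (intro \<delta>(2)) (auto simp: m_def algebra_simps)
  ultimately show False unfolding eq e_def dist_real_def by argo
qed

lemma dd_bounded_linear:
  assumes "bounded_linear L" "f differentiable (at x)"
  shows "dd (\<lambda>y. L (f y)) v x = L (dd f v x)" "(\<lambda>y. L (f y)) differentiable (at x)"
proof -
  have "((\<lambda>y. L (f y)) has_derivative (\<lambda>v. L (dd f v x))) (at x)"
    by (rule bounded_linear.has_derivative[OF assms(1) dd_has_derivative[OF assms(2)]])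
  then show "dd (\<lambda>y. L (f y)) v x = L (dd f v x)" "(\<lambda>y. L (f y)) differentiable (at x)"
    by (auto simp: dd_eqI differentiable_def)
qed

lemma dd_commute:
  fixes f :: "'a::euclidean_space \<Rightarrow> 'b::euclidean_space"
  assumes "open U" "x \<in> U" "smooth_on U f"
  shows "dd (dd f u) v x = dd (dd f v) u x"
proof (rule euclidean_eqI)
  fix b :: 'b assume "b \<in> Basis"
  let ?L = "\<lambda>z::'b. z \<bullet> b"
  have d: "f differentiable (at y)" "dd f w differentiable (at y)" if "y \<in> U" for y w
    using smooth_on_differentiable[OF assms(3) that] smooth_on_differentiable[OF smooth_on_dd[OF assms(3)] that] by auto
  have 1: "dd (\<lambda>y. ?L (f y)) w y = ?L (dd f w y)" if "y \<in> U" for y w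
    by (rule dd_bounded_linear(1)[OF bounded_linear_inner_left d(1)[OF that]])
  have 2: "dd (dd (\<lambda>y. ?L (f y)) w) w' y = ?L (dd (dd f w) w' y)" if "y \<in> U" for y w w'
    using dd_cong_open[OF assms(1) that 1] dd_bounded_linear(1)[OF bounded_linear_inner_left d(2)[OF that]]
    by simp
  have "dd (dd (\<lambda>y. ?L (f y)) u) v x = dd (dd (\<lambda>y. ?L (f y)) v) u x"
  proof (rule dd_commute_real[OF assms(1,2)])
    fix y w assume y: "y \<in> U"
    show "(\<lambda>y. ?L (f y)) differentiable (at y)"
      by (rule dd_bounded_linear(2)[OF bounded_linear_inner_left d(1)[OF y]])
    have "(\<lambda>y. ?L (dd f w y)) differentiable (at y)"
      by (rule dd_bounded_linear(2)[OF bounded_linear_inner_left d(2)[OF y]])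
    then show "dd (\<lambda>y. ?L (f y)) w differentiable (at y)"
      unfolding differentiable_def using 1 y assms(1)
        has_derivative_transform_within_open[of "\<lambda>y. ?L (dd f w y)" _ y UNIV U "dd (\<lambda>y. ?L (f y)) w"]
      by auto
  next
    fix v w
    have "continuous_on U (\<lambda>y. ?L (dd (dd f v) w y))"
      by (intro continuous_intros smooth_on_continuous smooth_on_dd assms)
    then show "continuous_on U (dd (dd (\<lambda>y. ?L (f y)) v) w)"
      by (rule continuous_on_eq) (simp add: 2)
  qed
  then show "dd (dd f u) v x \<bullet> b = dd (dd f v) u x \<bullet> b" using 2 assms(2) by simp
qed

section \<open>The Levi-Civita connection in a coordinate domain\<close>

lemma bounded_bilinear_matrix_vector_mult:
  "bounded_bilinear ((*v) :: real^'n^'m \<Rightarrow> real^'n \<Rightarrow> real^'m)"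
  unfolding bilinear_conv_bounded_bilinear[symmetric] bilinear_def
  by (auto intro!: linearI simp: matrix_vector_mult_add_rdistrib matrix_vector_right_distrib
      scaleR_matrix_vector_assoc matrix_vector_mult_scaleR)

lemma matrix_inv_invertible:
  assumes "invertible A"
  shows "A ** matrix_inv A = mat 1" "matrix_inv A ** A = mat 1"
  using someI_ex[OF assms[unfolded invertible_def]] by (auto simp: matrix_inv_def)

lemma differentiable_det:
  fixes M :: "'a::real_normed_vector \<Rightarrow> real^'n^'n"
  assumes "\<And>i j. (\<lambda>x. M x $ i $ j) differentiable (at x)"
  shows "(\<lambda>x. det (M x)) differentiable (at x)"
proof -
  from assms obtain D where D: "\<And>i j. ((\<lambda>x. M x $ i $ j) has_derivative D i j) (at x)"
    unfolding differentiable_def by metis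
  show ?thesis
    unfolding det_def
    by (rule differentiableI[OF has_derivative_sum], rule has_derivative_mult_right,
        rule has_derivative_prod, rule D)
qed

text \<open>By Cramer's rule each entry of the inverse is a quotient of two determinants: column l
  of the inverse solves the system with right-hand side the l-th unit vector.\<close>

lemma differentiable_matrix_inv:
  fixes G :: "'a::real_normed_vector \<Rightarrow> real^'n^'n"
  assumes G: "G differentiable (at x)" and "open U" "x \<in> U" and det: "\<And>y. y \<in> U \<Longrightarrow> det (G y) \<noteq> 0"
  shows "(\<lambda>x. matrix_inv (G x)) differentiable (at x)"
proof -
  have Gc: "(\<lambda>x. G x $ i $ j) differentiable (at x)" for i j
  proof -
    have "bounded_linear (\<lambda>M::real^'n^'n. M $ i $ j)"
      by (intro bounded_linear_compose[OF bounded_linear_vec_nth] bounded_linear_vec_nth)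
    from dd_bounded_linear(2)[OF this G] show ?thesis .
  qed
  have comp: "(\<lambda>x. matrix_inv (G x) $ k $ l) differentiable (at x)" for k l
  proof -
    let ?N = "\<lambda>y. det (\<chi> i j. if j = k then axis l 1 $ i else G y $ i $ j) / det (G y)"
    have d: "?N differentiable (at x)"
    proof (rule differentiable_divide)
      show "(\<lambda>y. det (\<chi> i j. if j = k then axis l 1 $ i else G y $ i $ j)) differentiable (at x)"
      proof (rule differentiable_det)
        fix i j
        show "(\<lambda>y. (\<chi> i j. if j = k then axis l 1 $ i else G y $ i $ j) $ i $ j) differentiable (at x)"
          using Gc[of i j] by (cases "j = k") auto
      qed
    qed (use differentiable_det[OF Gc] det[OF \<open>x \<in> U\<close>] in auto)
    have eq: "?N y = matrix_inv (G y) $ k $ l" if "y \<in> U" for y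
    proof -
      have inv: "G y ** matrix_inv (G y) = mat 1"
        using matrix_inv_invertible(1)[of "G y"] det[OF that] by (simp add: invertible_det_nz)
      then have "G y *v (matrix_inv (G y) *v axis l 1) = axis l 1"
        by (simp add: matrix_vector_mul_assoc)
      then have "matrix_inv (G y) *v axis l 1 = (\<chi> k. det (\<chi> i j. if j = k then axis l 1 $ i else G y $ i $ j) / det (G y))"
        by (rule cramer[OF det[OF that], THEN iffD1])
      then have "(matrix_inv (G y) *v axis l 1) $ k = ?N y" by (simp only: vec_lambda_beta)
      then show ?thesis by (simp only: matrix_vector_mul_component inner_axis inner_real_def mult_1_right)
    qed
    from d obtain D where "(?N has_derivative D) (at x)" unfolding differentiable_def by blast
    then have "((\<lambda>x. matrix_inv (G x) $ k $ l) has_derivative D) (at x)"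
      by (rule has_derivative_transform_within_open[OF _ \<open>open U\<close> \<open>x \<in> U\<close>]) (rule eq)
    then show ?thesis by (rule differentiableI)
  qed
  show ?thesis
  proof (rule differentiable_componentwise_within[THEN iffD2], rule ballI)
    fix b :: "real^'n^'n" assume "b \<in> Basis"
    then obtain i j where "b = axis i (axis j 1)" by (auto simp: Basis_vec_def)
    then show "(\<lambda>x. matrix_inv (G x) \<bullet> b) differentiable (at x)"
      using comp[of i j] by (simp add: inner_axis)
  qed
qed

section \<open>Metric, Christoffel symbols and curvature on an open subset of euclidean
  space\<close>

definition gm :: "('a \<Rightarrow> real^'n^'n) \<Rightarrow> 'a \<Rightarrow> real^'n \<Rightarrow> real^'n \<Rightarrow> real" where
  "gm G x v w = v \<bullet> (G x *v w)"

text \<open>The formula of \<open>christoffel\<close> for a bare matrix field, so that the local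
  theory can be developed without an atlas; \<open>Rm\<close> is the counterpart of
  \<open>curvature\<close>.\<close>

definition Gam :: "(real^'n::finite \<Rightarrow> real^'n^'n) \<Rightarrow> real^'n \<Rightarrow> real^'n \<Rightarrow> real^'n \<Rightarrow> real^'n" where
  "Gam G x u v = (\<chi> k. \<Sum>i\<in>UNIV. \<Sum>j\<in>UNIV. \<Sum>l\<in>UNIV.
     1 / 2 * matrix_inv (G x) $ k $ l *
       (pderiv (\<lambda>y. G y $ j $ l) x i + pderiv (\<lambda>y. G y $ i $ l) x j
         - pderiv (\<lambda>y. G y $ i $ j) x l) * u $ i * v $ j)"

definition Rm :: "(real^'n::finite \<Rightarrow> real^'n^'n) \<Rightarrow> real^'n \<Rightarrow> real^'n \<Rightarrow> real^'n \<Rightarrow> real^'n \<Rightarrow> real^'n" where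
  "Rm G x u v w = dd (\<lambda>y. Gam G y v w) u x - dd (\<lambda>y. Gam G y u w) v x
     + Gam G x u (Gam G x v w) - Gam G x v (Gam G x u w)"

lemma gm_bilinear: "bilinear (gm G x)"
  unfolding bilinear_def gm_def
  by (auto intro!: linearI simp: inner_add_left inner_add_right matrix_vector_right_distrib
      matrix_vector_mult_scaleR)

lemma gm_simps:
  "gm G x (v + v') w = gm G x v w + gm G x v' w" "gm G x (v - v') w = gm G x v w - gm G x v' w"
  "gm G x v (w + w') = gm G x v w + gm G x v w'" "gm G x v (w - w') = gm G x v w - gm G x v w'"
  "gm G x (- v) w = - gm G x v w" "gm G x v (- w) = - gm G x v w"
  "gm G x (a *\<^sub>R v) w = a * gm G x v w" "gm G x v (a *\<^sub>R w) = a * gm G x v w"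
  "gm G x 0 w = 0" "gm G x v 0 = 0"
  using gm_bilinear[of G x] by (auto simp: bilinear_ladd bilinear_radd bilinear_lsub bilinear_rsub
      bilinear_lneg bilinear_rneg bilinear_lmul bilinear_rmul bilinear_lzero bilinear_rzero)

lemma gm_has_derivative:
  assumes "(H has_derivative H') F" "(v has_derivative v') F" "(w has_derivative w') F"
    and "F = at x within S"
  shows "((\<lambda>y. gm H y (v y) (w y)) has_derivative
    (\<lambda>u. v x \<bullet> (H' u *v w x) + gm H x (v' u) (w x) + gm H x (v x) (w' u))) F"
  using bounded_bilinear.FDERIV[OF bounded_bilinear_inner assms(2)[unfolded assms(4)]
      bounded_bilinear.FDERIV[OF bounded_bilinear_matrix_vector_mult assms(1,3)[unfolded assms(4)]]]
  unfolding gm_def assms(4) by (simp add: inner_add_right algebra_simps)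

text \<open>The first term is again of the form \<open>gm\<close>, with \<open>dd H u\<close> in
  place of \<open>H\<close>. To make this possible \<open>gm\<close> takes the matrix field and the
  point as separate arguments.\<close>

lemma gm_dd:
  assumes "H differentiable (at x)" "v differentiable (at x)" "w differentiable (at x)"
  shows "(\<lambda>y. gm H y (v y) (w y)) differentiable (at x)"
    "dd (\<lambda>y. gm H y (v y) (w y)) u x = gm (dd H u) x (v x) (w x) + gm H x (dd v u x) (w x) + gm H x (v x) (dd w u x)"
  using gm_has_derivative[OF dd_has_derivative[OF assms(1)] dd_has_derivative[OF assms(2)]
      dd_has_derivative[OF assms(3)] refl]
  by (auto simp: differentiable_def gm_def[of "dd H u"] dd_eqI)

lemma dd_const [simp]: "dd (\<lambda>y. c) u x = 0"
  by (rule dd_eqI) (rule has_derivative_const)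

lemma gm_dd_const:
  assumes "H differentiable (at x)"
  shows "(\<lambda>y. gm H y v w) differentiable (at x)" "dd (\<lambda>y. gm H y v w) u x = gm (dd H u) x v w"
  using gm_dd[OF assms differentiable_const differentiable_const] by (auto simp: gm_simps)

lemma dd_add: "f differentiable (at x) \<Longrightarrow> h differentiable (at x) \<Longrightarrow> dd (\<lambda>y. f y + h y) u x = dd f u x + dd h u x"
  by (rule dd_eqI[OF has_derivative_add[OF dd_has_derivative dd_has_derivative]])

lemma dd_diff: "f differentiable (at x) \<Longrightarrow> h differentiable (at x) \<Longrightarrow> dd (\<lambda>y. f y - h y) u x = dd f u x - dd h u x"
  by (rule dd_eqI[OF has_derivative_diff[OF dd_has_derivative dd_has_derivative]])

lemma dd_cmult: "f differentiable (at x) \<Longrightarrow> dd (\<lambda>y. c * f y) u x = c * dd f u x" for f :: "_ \<Rightarrow> real"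
  by (rule dd_eqI[OF has_derivative_mult_right[OF dd_has_derivative]])

text \<open>The Christoffel symbols of the first kind.\<close>

definition lower_Gam :: "(real^'n::finite \<Rightarrow> real^'n^'n) \<Rightarrow> real^'n \<Rightarrow> real^'n \<Rightarrow> real^'n \<Rightarrow> real^'n" where
  "lower_Gam G x u v = (\<Sum>l\<in>UNIV. (1 / 2 * (gm (dd G u) x v (axis l 1) + gm (dd G v) x u (axis l 1)
      - gm (dd G (axis l 1)) x u v)) *\<^sub>R axis l 1)"

lemma sum_axis_nth: "(\<Sum>l\<in>UNIV. f l *\<^sub>R axis l (1::real)) $ k = f k"
  by (simp add: axis_def if_distrib[of "\<lambda>x. _ * x"] cong: if_cong)

lemma vec_expand: "(v::real^'n) = (\<Sum>i\<in>UNIV. v $ i *\<^sub>R axis i 1)"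
  by (simp add: vec_eq_iff sum_axis_nth del: sum_component)

locale local_metric =
  fixes U :: "(real^'n::finite) set" and G :: "real^'n \<Rightarrow> real^'n^'n"
  assumes open_U: "open U" and smooth_G: "smooth_on U G"
    and sym_G: "x \<in> U \<Longrightarrow> transpose (G x) = G x" and det_G: "x \<in> U \<Longrightarrow> det (G x) \<noteq> 0"
begin

lemma diff_G: "x \<in> U \<Longrightarrow> G differentiable (at x)"
  "x \<in> U \<Longrightarrow> dd G u differentiable (at x)" "x \<in> U \<Longrightarrow> dd (dd G u) v differentiable (at x)"
  using smooth_on_differentiable[OF smooth_G] smooth_on_differentiable[OF smooth_on_dd[OF smooth_G]]
    smooth_on_differentiable[OF smooth_on_dd[OF smooth_on_dd[OF smooth_G]]] by blast+

lemma gm_sym: "x \<in> U \<Longrightarrow> gm G x v w = gm G x w v"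
  unfolding gm_def by (metis dot_lmul_matrix inner_commute sym_G vector_transpose_matrix)

lemma gm_dd_sym: "x \<in> U \<Longrightarrow> gm (dd G u) x v w = gm (dd G u) x w v"
  using dd_cong_open[OF open_U, of x "\<lambda>y. gm G y v w" "\<lambda>y. gm G y w v" u] gm_sym gm_dd_const[OF diff_G(1)] by simp

lemma gm_dd2_sym: "x \<in> U \<Longrightarrow> gm (dd (dd G z) u) x v w = gm (dd (dd G z) u) x w v"
  using dd_cong_open[OF open_U, of x "\<lambda>y. gm (dd G z) y v w" "\<lambda>y. gm (dd G z) y w v" u] gm_dd_sym gm_dd_const[OF diff_G(2)] by simp

lemma gm_dd2_commute: "x \<in> U \<Longrightarrow> gm (dd (dd G z) u) x v w = gm (dd (dd G u) z) x v w"
  unfolding gm_def using dd_commute[OF open_U _ smooth_G] by simp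

lemma G_inv: "x \<in> U \<Longrightarrow> G x *v (matrix_inv (G x) *v v) = v" "x \<in> U \<Longrightarrow> matrix_inv (G x) *v (G x *v v) = v"
  using det_G[of x] invertible_det_nz[of "G x"] matrix_inv_invertible[of "G x"]
  by (auto simp: matrix_vector_mul_assoc)

text \<open>Nondegeneracy. Vector identities are proved after lowering an index by means of this
  rule, since the inverse matrix then drops out.\<close>

lemma gm_eqI: "x \<in> U \<Longrightarrow> (\<And>w. gm G x u w = gm G x v w) \<Longrightarrow> u = v"
proof -
  assume x: "x \<in> U" and eq: "\<And>w. gm G x u w = gm G x v w"
  have "u \<bullet> z = v \<bullet> z" for z
    using eq[of "matrix_inv (G x) *v z"] by (simp add: gm_def G_inv[OF x])
  then show "u = v" using vector_eq_rdot[of u v] by blast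
qed

lemma diff_inv: "x \<in> U \<Longrightarrow> (\<lambda>x. matrix_inv (G x)) differentiable (at x)"
  by (rule differentiable_matrix_inv[OF diff_G(1) open_U]) (auto simp: det_G)

lemma gm_dd_expand:
  assumes "x \<in> U"
  shows "gm (dd G u) x v w = (\<Sum>i\<in>UNIV. \<Sum>j\<in>UNIV. u $ i * v $ j * (dd G (axis i 1) x *v w) $ j)"
proof -
  have "dd G u x = (\<Sum>i\<in>UNIV. u $ i *\<^sub>R dd G (axis i 1) x)"
    by (subst vec_expand[of u])
       (simp add: linear_sum[OF dd_linear[OF diff_G(1)[OF assms]]] linear_scale[OF dd_linear[OF diff_G(1)[OF assms]]])
  then have "dd G u x *v w = (\<Sum>i\<in>UNIV. u $ i *\<^sub>R (dd G (axis i 1) x *v w))"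
    by (simp add: bounded_bilinear.sum_left[OF bounded_bilinear_matrix_vector_mult]
        bounded_bilinear.scaleR_left[OF bounded_bilinear_matrix_vector_mult])
  then have "gm (dd G u) x v w = (\<Sum>i\<in>UNIV. u $ i * (\<Sum>j\<in>UNIV. v $ j * (dd G (axis i 1) x *v w) $ j))"
    by (simp add: gm_def inner_sum_right inner_vec_def[of v] del: sum_component)
  then show ?thesis by (simp add: sum_distrib_left mult.assoc)
qed

lemma pderiv_G: "x \<in> U \<Longrightarrow> pderiv (\<lambda>y. G y $ j $ l) x i = (dd G (axis i 1) x *v axis l 1) $ j"
proof -
  assume "x \<in> U"
  have "bounded_linear (\<lambda>M::real^'n^'n. M $ j $ l)"
    by (intro bounded_linear_compose[OF bounded_linear_vec_nth] bounded_linear_vec_nth)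
  from dd_bounded_linear(1)[OF this diff_G(1)[OF \<open>x \<in> U\<close>], of "axis i 1"]
  show ?thesis by (simp add: pderiv_def dd_def matrix_vector_mul_component inner_axis row_def)
qed

lemma Gam_eq: 
  assumes "x \<in> U"
  shows "Gam G x u v = matrix_inv (G x) *v lower_Gam G x u v"
proof -
  have low: "lower_Gam G x u v $ l = (\<Sum>i\<in>UNIV. \<Sum>j\<in>UNIV. 1 / 2 * 
       (pderiv (\<lambda>y. G y $ j $ l) x i + pderiv (\<lambda>y. G y $ i $ l) x j
         - pderiv (\<lambda>y. G y $ i $ j) x l) * u $ i * v $ j)" for l
  proof -
    have a: "gm (dd G u) x v (axis l 1) = (\<Sum>i\<in>UNIV. \<Sum>j\<in>UNIV. u $ i * v $ j * pderiv (\<lambda>y. G y $ j $ l) x i)"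
      using gm_dd_expand[OF assms] pderiv_G[OF assms] by simp
    have b: "gm (dd G v) x u (axis l 1) = (\<Sum>i\<in>UNIV. \<Sum>j\<in>UNIV. u $ i * v $ j * pderiv (\<lambda>y. G y $ i $ l) x j)"
      using gm_dd_expand[OF assms, of v u] pderiv_G[OF assms] by (subst sum.swap) (simp add: mult.commute)
    have "gm (dd G (axis l 1)) x u v = (\<Sum>i\<in>UNIV. u $ i * (\<Sum>j\<in>UNIV. dd G (axis l 1) x $ i $ j * v $ j))"
      by (simp add: gm_def inner_vec_def matrix_vector_mult_def)
    also have "\<dots> = (\<Sum>i\<in>UNIV. \<Sum>j\<in>UNIV. u $ i * v $ j * pderiv (\<lambda>y. G y $ i $ j) x l)"
      unfolding pderiv_G[OF assms] matrix_vector_mul_component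
      by (simp add: inner_axis row_def sum_distrib_left mult_ac)
    finally have c: "gm (dd G (axis l 1)) x u v = \<dots>" .
    show ?thesis unfolding lower_Gam_def sum_axis_nth a b c
      by (simp add: sum.distrib[symmetric] sum_subtractf[symmetric] sum_distrib_left algebra_simps add_divide_distrib diff_divide_distrib)
  qed
  have "(matrix_inv (G x) *v lower_Gam G x u v) $ k = Gam G x u v $ k" for k
  proof -
    have "(matrix_inv (G x) *v lower_Gam G x u v) $ k = (\<Sum>l\<in>UNIV. matrix_inv (G x) $ k $ l * lower_Gam G x u v $ l)"
      by (simp add: matrix_vector_mult_def)
    also have "\<dots> = (\<Sum>l\<in>UNIV. \<Sum>i\<in>UNIV. \<Sum>j\<in>UNIV. 1 / 2 * matrix_inv (G x) $ k $ l *
       (pderiv (\<lambda>y. G y $ j $ l) x i + pderiv (\<lambda>y. G y $ i $ l) x j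
         - pderiv (\<lambda>y. G y $ i $ j) x l) * u $ i * v $ j)"
      unfolding low sum_distrib_left by (simp add: mult_ac)
    also have "\<dots> = (\<Sum>i\<in>UNIV. \<Sum>l\<in>UNIV. \<Sum>j\<in>UNIV. 1 / 2 * matrix_inv (G x) $ k $ l *
       (pderiv (\<lambda>y. G y $ j $ l) x i + pderiv (\<lambda>y. G y $ i $ l) x j
         - pderiv (\<lambda>y. G y $ i $ j) x l) * u $ i * v $ j)" by (rule sum.swap)
    also have "\<dots> = Gam G x u v $ k" 
      unfolding Gam_def vec_lambda_beta by (rule sum.cong[OF refl], rule sum.swap)
    finally show ?thesis .
  qed
  then show ?thesis by (simp add: vec_eq_iff)
qed

text \<open>The Koszul formula for constant fields, whose brackets vanish.\<close>

lemma Gam_lower: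
  assumes x: "x \<in> U"
  shows "gm G x (Gam G x u v) w = 1 / 2 * (gm (dd G u) x v w + gm (dd G v) x u w - gm (dd G w) x u v)"
proof -
  have "gm G x (Gam G x u v) w = gm G x w (Gam G x u v)" by (rule gm_sym[OF x])
  also have "\<dots> = w \<bullet> lower_Gam G x u v" by (simp add: gm_def Gam_eq[OF x] G_inv[OF x])
  also have "\<dots> = (\<Sum>l\<in>UNIV. w $ l * (1 / 2 * (gm (dd G u) x v (axis l 1) + gm (dd G v) x u (axis l 1)
      - gm (dd G (axis l 1)) x u v)))"
    by (simp add: inner_vec_def lower_Gam_def sum_axis_nth del: sum_component)
  also have "\<dots> = 1 / 2 * ((\<Sum>l\<in>UNIV. w $ l * gm (dd G u) x v (axis l 1)) + (\<Sum>l\<in>UNIV. w $ l * gm (dd G v) x u (axis l 1))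
      - (\<Sum>l\<in>UNIV. w $ l * gm (dd G (axis l 1)) x u v))"
    by (simp add: sum.distrib[symmetric] sum_subtractf[symmetric] sum_distrib_left algebra_simps add_divide_distrib diff_divide_distrib)
  finally have eq: "gm G x (Gam G x u v) w = \<dots>" .
  have 1: "(\<Sum>l\<in>UNIV. w $ l * gm (dd G u) x v (axis l 1)) = gm (dd G u) x v w" for u v
    by (subst (2) vec_expand[of w]) (simp add: linear_sum linear_scale gm_bilinear[unfolded bilinear_def])
  have 2: "(\<Sum>l\<in>UNIV. w $ l * gm (dd G (axis l 1)) x u v) = gm (dd G w) x u v"
  proof -
    have "linear (\<lambda>w. gm (dd G w) x u v)"
      using dd_linear[OF gm_dd_const(1)[OF diff_G(1)[OF x]], of u v] by (simp add: gm_dd_const(2)[OF diff_G(1)[OF x]])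
    from linear_sum[OF this, of "\<lambda>l. w $ l *\<^sub>R axis l 1" UNIV] show ?thesis
      by (simp add: vec_expand[of w, symmetric] linear_scale[OF \<open>linear (\<lambda>w. gm (dd G w) x u v)\<close>])
  qed
  show ?thesis unfolding eq 1 2 ..
qed

lemma Gam_sym: "x \<in> U \<Longrightarrow> Gam G x u v = Gam G x v u"
  by (rule gm_eqI) (use gm_dd_sym in \<open>auto simp: Gam_lower\<close>)

text \<open>Metric compatibility. In the sum of the two Koszul formulas only the derivative in
  direction u survives.\<close>

lemma Gam_compat:
  assumes "x \<in> U"
  shows "gm (dd G u) x v w = gm G x (Gam G x u v) w + gm G x v (Gam G x u w)"
proof -
  have "gm G x v (Gam G x u w) = gm G x (Gam G x u w) v" by (rule gm_sym[OF assms])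
  then show ?thesis using gm_dd_sym[OF assms, of u w v] by (simp add: Gam_lower[OF assms] field_simps)
qed

lemma Gam_linear:
  assumes x: "x \<in> U"
  shows "linear (Gam G x u)" "linear (\<lambda>u. Gam G x u v)"
proof -
  show l: "linear (Gam G x u)" for u
  proof (rule linearI; rule gm_eqI[OF x])
    have ld: "gm (dd G (a + b)) x v w = gm (dd G a) x v w + gm (dd G b) x v w"
      "gm (dd G (c *\<^sub>R a)) x v w = c * gm (dd G a) x v w" for a b c v w
      using linear_add[OF dd_linear[OF gm_dd_const(1)[OF diff_G(1)[OF x]], of v w], of a b]
        linear_scale[OF dd_linear[OF gm_dd_const(1)[OF diff_G(1)[OF x]], of v w], of c a]
      by (simp_all add: gm_dd_const(2)[OF diff_G(1)[OF x]])
    fix v v' w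
    show "gm G x (Gam G x u (v + v')) w = gm G x (Gam G x u v + Gam G x u v') w"
      by (simp add: Gam_lower[OF x] gm_simps ld algebra_simps)
    fix c
    show "gm G x (Gam G x u (c *\<^sub>R v)) w = gm G x (c *\<^sub>R Gam G x u v) w"
      by (simp add: Gam_lower[OF x] gm_simps ld algebra_simps)
  qed
  show "linear (\<lambda>u. Gam G x u v)" unfolding Gam_sym[OF x, of _ v] by (rule l)
qed

lemma lower_Gam_diff:
  assumes x: "x \<in> U"
  shows "(\<lambda>y. lower_Gam G y u v) differentiable (at x)"
    "dd (\<lambda>y. lower_Gam G y u v) z x = (\<Sum>l\<in>UNIV. (1 / 2 * (gm (dd (dd G u) z) x v (axis l 1)
       + gm (dd (dd G v) z) x u (axis l 1) - gm (dd (dd G (axis l 1)) z) x u v)) *\<^sub>R axis l 1)"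
proof -
  have h: "((\<lambda>y. gm (dd G u) y v w) has_derivative (\<lambda>z. gm (dd (dd G u) z) x v w)) (at x)" for u v w
    using dd_has_derivative[OF gm_dd_const(1)[OF diff_G(2)[OF x]]] by (simp add: gm_dd_const(2)[OF diff_G(2)[OF x]])
  have "((\<lambda>y. lower_Gam G y u v) has_derivative (\<lambda>z. \<Sum>l\<in>UNIV. (1 / 2 * (gm (dd (dd G u) z) x v (axis l 1)
       + gm (dd (dd G v) z) x u (axis l 1) - gm (dd (dd G (axis l 1)) z) x u v)) *\<^sub>R axis l 1)) (at x)"
    unfolding lower_Gam_def
    by (intro has_derivative_sum has_derivative_scaleR_left has_derivative_mult_right has_derivative_add has_derivative_diff h)
  then show "(\<lambda>y. lower_Gam G y u v) differentiable (at x)"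
    "dd (\<lambda>y. lower_Gam G y u v) z x = (\<Sum>l\<in>UNIV. (1 / 2 * (gm (dd (dd G u) z) x v (axis l 1)
       + gm (dd (dd G v) z) x u (axis l 1) - gm (dd (dd G (axis l 1)) z) x u v)) *\<^sub>R axis l 1)"
    by (auto simp: differentiable_def dd_eqI)
qed

lemma Gam_diff: 
  assumes x: "x \<in> U"
  shows "(\<lambda>y. Gam G y u v) differentiable (at x)"
proof -
  have "((\<lambda>y. matrix_inv (G y) *v lower_Gam G y u v) has_derivative
    (\<lambda>h. matrix_inv (G x) *v dd (\<lambda>y. lower_Gam G y u v) h x + dd (\<lambda>y. matrix_inv (G y)) h x *v lower_Gam G x u v)) (at x)"
    by (rule bounded_bilinear.FDERIV[OF bounded_bilinear_matrix_vector_mult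
        dd_has_derivative[OF diff_inv[OF x]] dd_has_derivative[OF lower_Gam_diff(1)[OF x]]])
  then have "((\<lambda>y. Gam G y u v) has_derivative
    (\<lambda>h. matrix_inv (G x) *v dd (\<lambda>y. lower_Gam G y u v) h x + dd (\<lambda>y. matrix_inv (G y)) h x *v lower_Gam G x u v)) (at x)"
    by (rule has_derivative_transform_within_open[OF _ open_U x]) (simp add: Gam_eq)
  then show ?thesis by (rule differentiableI)
qed

lemma Gam_diff_lower:
  assumes x: "x \<in> U"
  shows "gm G x (dd (\<lambda>y. Gam G y u v) z x) w + gm (dd G z) x (Gam G x u v) w =
    1 / 2 * (gm (dd (dd G u) z) x v w + gm (dd (dd G v) z) x u w - gm (dd (dd G w) z) x u v)"
proof -
  have "dd (\<lambda>y. gm G y (Gam G y u v) w) z x = gm (dd G z) x (Gam G x u v) w + gm G x (dd (\<lambda>y. Gam G y u v) z x) w"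
    using gm_dd(2)[OF diff_G(1)[OF x] Gam_diff[OF x] differentiable_const] by (simp add: gm_simps)
  moreover have "dd (\<lambda>y. gm G y (Gam G y u v) w) z x =
      dd (\<lambda>y. 1 / 2 * (gm (dd G u) y v w + gm (dd G v) y u w - gm (dd G w) y u v)) z x"
    by (rule dd_cong_open[OF open_U x Gam_lower])
  moreover have "\<dots> = 1 / 2 * (gm (dd (dd G u) z) x v w + gm (dd (dd G v) z) x u w - gm (dd (dd G w) z) x u v)"
  proof -
    note d = gm_dd_const(1)[OF diff_G(2)[OF x]]
    show ?thesis
      by (simp only: dd_cmult[OF differentiable_diff[OF differentiable_add[OF d d] d]]
          dd_diff[OF differentiable_add[OF d d] d] dd_add[OF d d] gm_dd_const(2)[OF diff_G(2)[OF x]])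
  qed
  ultimately show ?thesis by simp
qed

lemma Gam_continuous: "continuous_on U (\<lambda>x. Gam G x u v)"
  using Gam_diff differentiable_imp_continuous_within continuous_at_imp_continuous_on by blast

text \<open>Only existence is known for the derivative of the inverse matrix. Differentiating the
  product of \<open>G\<close> with \<open>Gam\<close>, which is \<open>lower_Gam\<close>, and
  solving for the derivative of \<open>Gam\<close> involves just the inverse matrix itself.\<close>

lemma Gam_diff_continuous: "continuous_on U (\<lambda>x. dd (\<lambda>y. Gam G y u v) z x)"
proof -
  have eq: "dd (\<lambda>y. Gam G y u v) z x = matrix_inv (G x) *v (dd (\<lambda>y. lower_Gam G y u v) z x - dd G z x *v Gam G x u v)"
    if x: "x \<in> U" for x
  proof -
    have "dd (\<lambda>y. G y *v Gam G y u v) z x = G x *v dd (\<lambda>y. Gam G y u v) z x + dd G z x *v Gam G x u v"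
      by (rule dd_eqI[OF bounded_bilinear.FDERIV[OF bounded_bilinear_matrix_vector_mult
        dd_has_derivative[OF diff_G(1)[OF x]] dd_has_derivative[OF Gam_diff[OF x]]]])
    moreover have "dd (\<lambda>y. G y *v Gam G y u v) z x = dd (\<lambda>y. lower_Gam G y u v) z x"
      by (rule dd_cong_open[OF open_U x]) (simp add: Gam_eq G_inv)
    ultimately have "G x *v dd (\<lambda>y. Gam G y u v) z x = dd (\<lambda>y. lower_Gam G y u v) z x - dd G z x *v Gam G x u v"
      by simp
    then show ?thesis using G_inv(2)[OF x] by metis
  qed
  have c1: "continuous_on U (\<lambda>x. matrix_inv (G x))"
    using diff_inv differentiable_imp_continuous_within continuous_at_imp_continuous_on by blast
  have c2: "continuous_on U (dd G z)" "continuous_on U (dd (dd G z) w)" for z w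
    by (intro smooth_on_continuous smooth_on_dd smooth_G)+
  note mv = bounded_bilinear.continuous_on[OF bounded_bilinear_matrix_vector_mult]
  have c3: "continuous_on U (\<lambda>x. gm (dd (dd G u) z) x v w)" for u z v w
    unfolding gm_def by (intro continuous_intros mv c2)
  have "continuous_on U (\<lambda>x. \<Sum>l\<in>UNIV. (1 / 2 * (gm (dd (dd G u) z) x v (axis l 1)
       + gm (dd (dd G v) z) x u (axis l 1) - gm (dd (dd G (axis l 1)) z) x u v)) *\<^sub>R axis l (1::real))"
    by (intro continuous_on_sum continuous_on_scaleR continuous_on_mult continuous_on_diff continuous_on_add continuous_on_const c3)
  then have "continuous_on U (\<lambda>x. dd (\<lambda>y. lower_Gam G y u v) z x)"
    by (rule continuous_on_eq) (simp only: lower_Gam_diff(2))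
  then have "continuous_on U (\<lambda>x. matrix_inv (G x) *v (dd (\<lambda>y. lower_Gam G y u v) z x - dd G z x *v Gam G x u v))"
    by (intro mv c1 c2 Gam_continuous continuous_intros)
  then show ?thesis by (rule continuous_on_eq) (simp add: eq)
qed

lemma Gam_simps:
  assumes "x \<in> U"
  shows "Gam G x (u + u') v = Gam G x u v + Gam G x u' v" "Gam G x (c *\<^sub>R u) v = c *\<^sub>R Gam G x u v"
    "Gam G x u (v + v') = Gam G x u v + Gam G x u v'" "Gam G x u (c *\<^sub>R v) = c *\<^sub>R Gam G x u v"
    "Gam G x (u - u') v = Gam G x u v - Gam G x u' v" "Gam G x u (v - v') = Gam G x u v - Gam G x u v'"
  using Gam_linear[OF assms]
  by (auto simp: linear_add linear_scale linear_diff linear_add[OF Gam_linear(2)[OF assms]]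
      linear_scale[OF Gam_linear(2)[OF assms]] linear_diff[OF Gam_linear(2)[OF assms]])

text \<open>
  The fully covariant curvature tensor in terms of second derivatives of the metric, from which
  all its symmetries can be read off.
\<close>

lemma Rm_lower:
  assumes x: "x \<in> U"
  shows "gm G x (Rm G x u v w) z = 1 / 2 * (gm (dd (dd G w) u) x v z + gm (dd (dd G z) v) x u w
      - gm (dd (dd G z) u) x v w - gm (dd (dd G w) v) x u z)
    + gm G x (Gam G x u w) (Gam G x v z) - gm G x (Gam G x v w) (Gam G x u z)"
proof -
  have 1: "gm G x (dd (\<lambda>y. Gam G y v w) u x) z =
    1 / 2 * (gm (dd (dd G v) u) x w z + gm (dd (dd G w) u) x v z - gm (dd (dd G z) u) x v w)
      - gm G x (Gam G x u (Gam G x v w)) z - gm G x (Gam G x v w) (Gam G x u z)" for u v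
    using Gam_diff_lower[OF x, of v w u z] Gam_compat[OF x, of u "Gam G x v w" z] by linarith
  show ?thesis
    unfolding Rm_def gm_simps 1 using gm_dd2_commute[OF x, of u v w z] by (simp add: algebra_simps)
qed

text \<open>Self-adjointness of the Jacobi operator, which maps v to R(u,v)u.\<close>

lemma Rm_pair_sym:
  assumes x: "x \<in> U"
  shows "gm G x (Rm G x u v u) w = gm G x (Rm G x u w u) v"
  unfolding Rm_lower[OF x] Gam_sym[OF x, of v u] Gam_sym[OF x, of w u] Gam_sym[OF x, of w v]
  using gm_dd2_sym[OF x, of u u v w] gm_dd2_commute[OF x, of w v u u]
    gm_dd2_commute[OF x, of w u v u] gm_dd2_sym[OF x, of u w v u]
    gm_dd2_commute[OF x, of u v u w] gm_dd2_sym[OF x, of v u u w]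
    gm_sym[OF x, of "Gam G x u v" "Gam G x u w"] gm_sym[OF x, of "Gam G x u u" "Gam G x v w"]
  by argo

text \<open>Pair symmetry combined with skewness in the first two arguments, in the form needed for
  Killing fields.\<close>

lemma Rm_skew:
  assumes x: "x \<in> U"
  shows "gm G x (Rm G x u w v) u = - gm G x (Rm G x u v u) w"
  unfolding Rm_lower[OF x] Gam_sym[OF x, of v u] Gam_sym[OF x, of w u] Gam_sym[OF x, of w v]
  using gm_dd2_sym[OF x, of u u v w] gm_dd2_commute[OF x, of w v u u]
    gm_dd2_commute[OF x, of w u v u] gm_dd2_sym[OF x, of u w v u]
    gm_dd2_commute[OF x, of u v u w] gm_dd2_sym[OF x, of v u u w]
    gm_sym[OF x, of "Gam G x u v" "Gam G x u w"] gm_sym[OF x, of "Gam G x u u" "Gam G x v w"]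
  by argo

lemma Rm_self: "Rm G x u u w = 0"
  by (simp add: Rm_def)

end

section \<open>Leibniz and chain rules for families of linear maps\<close>

lemma dd_linear_family:
  fixes F :: "'p::euclidean_space \<Rightarrow> 'a::euclidean_space \<Rightarrow> 'b::real_normed_vector"
  assumes "open W" "x \<in> W" and lin: "\<And>y. y \<in> W \<Longrightarrow> linear (F y)"
    and F: "\<And>c. (\<lambda>y. F y c) differentiable (at x)" and w: "w differentiable (at x)"
  shows "(\<lambda>y. F y (w y)) differentiable (at x)"
    "dd (\<lambda>y. F y (w y)) u x = dd (\<lambda>y. F y (w x)) u x + F x (dd w u x)"
proof -
  have main: "((\<lambda>y. F y (w y)) has_derivative
      (\<lambda>h. (\<Sum>e\<in>Basis. (w x \<bullet> e) *\<^sub>R dd (\<lambda>y. F y e) h x + (dd w h x \<bullet> e) *\<^sub>R F x e))) (at x)"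
    if "w differentiable (at x)" for w
  proof -
    have "((\<lambda>y. \<Sum>e\<in>Basis. (w y \<bullet> e) *\<^sub>R F y e) has_derivative
      (\<lambda>h. (\<Sum>e\<in>Basis. (w x \<bullet> e) *\<^sub>R dd (\<lambda>y. F y e) h x + (dd w h x \<bullet> e) *\<^sub>R F x e))) (at x)"
      by (intro has_derivative_sum has_derivative_scaleR dd_has_derivative F has_derivative_inner_left that)
    then show ?thesis
      by (rule has_derivative_transform_within_open[OF _ assms(1,2)]) (simp add: linear_family_expand[OF lin, symmetric])
  qed
  have 1: "dd (\<lambda>y. F y (w x)) u x = (\<Sum>e\<in>Basis. (w x \<bullet> e) *\<^sub>R dd (\<lambda>y. F y e) u x)"
    using dd_eqI[OF main[OF differentiable_const[of "w x"]], of u] by simp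
  show "(\<lambda>y. F y (w y)) differentiable (at x)" using main[OF w] by (rule differentiableI)
  show "dd (\<lambda>y. F y (w y)) u x = dd (\<lambda>y. F y (w x)) u x + F x (dd w u x)"
    unfolding dd_eqI[OF main[OF w]] 1 sum.distrib
    using linear_family_expand[OF lin[OF assms(2)], of "dd w u x"] by simp
qed

lemma dd_linear_in_param:
  fixes F :: "'p::euclidean_space \<Rightarrow> 'a::euclidean_space \<Rightarrow> 'b::real_normed_vector"
  assumes "open W" "x \<in> W" and lin: "\<And>y. y \<in> W \<Longrightarrow> linear (F y)"
    and F: "\<And>c. (\<lambda>y. F y c) differentiable (at x)"
  shows "linear (\<lambda>c. dd (\<lambda>y. F y c) u x)"
proof (rule linearI)
  fix a b c
  have "dd (\<lambda>y. F y (a + b)) u x = dd (\<lambda>y. F y a + F y b) u x"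
    by (rule dd_cong_open[OF assms(1,2)]) (simp add: linear_add[OF lin])
  then show "dd (\<lambda>y. F y (a + b)) u x = dd (\<lambda>y. F y a) u x + dd (\<lambda>y. F y b) u x"
    by (simp add: dd_add[OF F F])
  have "dd (\<lambda>y. F y (c *\<^sub>R a)) u x = dd (\<lambda>y. c *\<^sub>R F y a) u x"
    by (rule dd_cong_open[OF assms(1,2)]) (simp add: linear_scale[OF lin])
  then show "dd (\<lambda>y. F y (c *\<^sub>R a)) u x = c *\<^sub>R dd (\<lambda>y. F y a) u x"
    by (simp add: dd_bounded_linear(1)[OF bounded_linear_scaleR_right F])
qed

lemma dd_compose:
  assumes "f differentiable (at (p x))" "p differentiable (at x)"
  shows "(\<lambda>y. f (p y)) differentiable (at x)" "dd (\<lambda>y. f (p y)) u x = dd f (dd p u x) (p x)"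
  using has_derivative_compose[OF dd_has_derivative[OF assms(2)] dd_has_derivative[OF assms(1)]]
  by (auto simp: differentiable_def dd_eqI)

lemma dd_compose_curve:
  assumes "f differentiable (at (p t))" "(p has_vector_derivative p') (at t within S)"
  shows "((\<lambda>s. f (p s)) has_vector_derivative dd f p' (p t)) (at t within S)"
  using has_derivative_compose[OF assms(2)[unfolded has_vector_derivative_def] dd_has_derivative[OF assms(1)]]
  unfolding has_vector_derivative_def by (simp add: linear_scale[OF dd_linear[OF assms(1)]])

context local_metric
begin

lemma Gam_param_linear:
  assumes "x \<in> U"
  shows "linear (\<lambda>c. dd (\<lambda>y. Gam G y v c) z x)" "linear (\<lambda>c. dd (\<lambda>y. Gam G y c v) z x)"
  by (rule dd_linear_in_param[OF open_U assms Gam_linear(1) Gam_diff[OF assms]]; assumption)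
     (rule dd_linear_in_param[OF open_U assms Gam_linear(2) Gam_diff[OF assms]]; assumption)

lemma Rm_linear:
  assumes "x \<in> U"
  shows "linear (\<lambda>u. Rm G x u v w)" "linear (\<lambda>v. Rm G x u v w)" "linear (Rm G x u v)"
proof -
  note [simp] = Gam_simps[OF assms] linear_add[OF Gam_param_linear(1)[OF assms]]
    linear_add[OF Gam_param_linear(2)[OF assms]] linear_scale[OF Gam_param_linear(1)[OF assms]]
    linear_scale[OF Gam_param_linear(2)[OF assms]] linear_add[OF dd_linear[OF Gam_diff[OF assms]]]
    linear_scale[OF dd_linear[OF Gam_diff[OF assms]]]
  show "linear (\<lambda>u. Rm G x u v w)" "linear (\<lambda>v. Rm G x u v w)" "linear (Rm G x u v)"
    by (rule linearI; simp add: Rm_def algebra_simps)+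
qed

lemma Rm_continuous: "continuous_on U (\<lambda>x. Rm G x u v w)"
proof -
  have g: "continuous_on U (\<lambda>x. Gam G x u (Gam G x v w))" for u v
    by (rule linear_family_continuous[OF Gam_linear(1) Gam_continuous Gam_continuous])
  show ?thesis unfolding Rm_def by (intro continuous_on_diff continuous_on_add Gam_diff_continuous g)
qed

end

section \<open>Killing fields in coordinates\<close>

locale local_killing = local_metric +
  fixes Y :: "real^'n \<Rightarrow> real^'n"
  assumes smooth_Y: "smooth_on U Y"
    and killing: "x \<in> U \<Longrightarrow> gm (dd G (Y x)) x v w + gm G x (dd Y v x) w + gm G x v (dd Y w x) = 0"
begin

text \<open>The covariant derivative of \<open>Y\<close> in direction \<open>v\<close>.\<close>

definition nab :: "real^'n \<Rightarrow> real^'n \<Rightarrow> real^'n" where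
  "nab x v = dd Y v x + Gam G x v (Y x)"

lemma diff_Y: "x \<in> U \<Longrightarrow> Y differentiable (at x)" "x \<in> U \<Longrightarrow> dd Y v differentiable (at x)"
  using smooth_on_differentiable[OF smooth_Y] smooth_on_differentiable[OF smooth_on_dd[OF smooth_Y]] by auto

lemma nab_linear: "x \<in> U \<Longrightarrow> linear (nab x)"
  unfolding nab_def using dd_linear[OF diff_Y(1)] Gam_linear(2) linear_compose_add by blast

text \<open>The covariant form of the Killing equation: compatibility turns the derivative of the
  metric along \<open>Y\<close> into Christoffel terms, and by symmetry these complete the
  derivatives of \<open>Y\<close> to covariant ones.\<close>

lemma nab_skew:
  assumes x: "x \<in> U"
  shows "gm G x (nab x v) w + gm G x v (nab x w) = 0"
  using killing[OF x, of v w] Gam_compat[OF x, of "Y x" v w]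
  by (simp add: nab_def gm_simps Gam_sym[OF x, of _ "Y x"])

lemma Gam_Y_dd:
  assumes x: "x \<in> U"
  shows "(\<lambda>y. Gam G y v (Y y)) differentiable (at x)"
    "dd (\<lambda>y. Gam G y v (Y y)) u x = dd (\<lambda>y. Gam G y v (Y x)) u x + Gam G x v (dd Y u x)"
  using dd_linear_family[OF open_U x Gam_linear(1) Gam_diff[OF x] diff_Y(1)[OF x]] by auto

lemma nab_dd:
  assumes x: "x \<in> U"
  shows "(\<lambda>y. nab y v) differentiable (at x)"
    "dd (\<lambda>y. nab y v) u x = dd (dd Y v) u x + dd (\<lambda>y. Gam G y v (Y x)) u x + Gam G x v (dd Y u x)"
  unfolding nab_def
  by (rule differentiable_add[OF diff_Y(2)[OF x] Gam_Y_dd(1)[OF x]])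
     (simp add: dd_add[OF diff_Y(2)[OF x] Gam_Y_dd(1)[OF x]] Gam_Y_dd(2)[OF x])

text \<open>The second covariant derivative of \<open>Y\<close>. The last term removes the covariant
  derivative of the constant field \<open>v\<close>, which makes the expression tensorial.\<close>

definition nab2 :: "real^'n \<Rightarrow> real^'n \<Rightarrow> real^'n \<Rightarrow> real^'n" where
  "nab2 x u v = dd (\<lambda>y. nab y v) u x + Gam G x u (nab x v) - nab x (Gam G x u v)"

lemma nab2_skew:
  assumes x: "x \<in> U"
  shows "gm G x (nab2 x u v) w + gm G x v (nab2 x u w) = 0"
proof -
  have d: "(\<lambda>y. gm G y (nab y v) w) differentiable (at x)"
    "(\<lambda>y. gm G y v (nab y w)) differentiable (at x)"
    using gm_dd(1)[OF diff_G(1)[OF x] nab_dd(1)[OF x] differentiable_const]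
      gm_dd(1)[OF diff_G(1)[OF x] differentiable_const nab_dd(1)[OF x]] by auto
  have "dd (\<lambda>y. gm G y (nab y v) w + gm G y v (nab y w)) u x = dd (\<lambda>y. 0) u x"
    by (rule dd_cong_open[OF open_U x]) (rule nab_skew)
  then have "gm (dd G u) x (nab x v) w + gm G x (dd (\<lambda>y. nab y v) u x) w
      + gm (dd G u) x v (nab x w) + gm G x v (dd (\<lambda>y. nab y w) u x) = 0"
    unfolding dd_add[OF d] using gm_dd(2)[OF diff_G(1)[OF x] nab_dd(1)[OF x] differentiable_const]
      gm_dd(2)[OF diff_G(1)[OF x] differentiable_const nab_dd(1)[OF x]] by (simp add: gm_simps)
  then show ?thesis
    using nab_skew[OF x, of v "Gam G x u w"] nab_skew[OF x, of "Gam G x u v" w]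
    unfolding Gam_compat[OF x] nab2_def gm_simps by linarith
qed

text \<open>The Ricci identity. Second derivatives of \<open>Y\<close> cancel by Schwarz's theorem
  and the correction terms by symmetry of the Christoffel symbols.\<close>

lemma nab2_commute:
  assumes x: "x \<in> U"
  shows "nab2 x u v - nab2 x v u = Rm G x u v (Y x)"
  unfolding nab2_def nab_dd(2)[OF x] Rm_def
  unfolding nab_def Gam_simps[OF x]
    dd_commute[OF open_U x smooth_Y, of v u] Gam_sym[OF x, of v u]
  by (simp add: algebra_simps)

text \<open>Skewness makes g(nab2 w u, u) vanish and turns g(nab2 u u, w) into -g(nab2 u w, u); the
  Ricci identity relates the two. Along a geodesic the result is the Jacobi equation for
  \<open>Y\<close>.\<close>

lemma nab2_Rm:
  assumes x: "x \<in> U"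
  shows "nab2 x u u = Rm G x u (Y x) u"
proof (rule gm_eqI[OF x])
  fix w
  have "gm G x (nab2 x w u) u = 0"
    using nab2_skew[OF x, of w u u] gm_sym[OF x, of u "nab2 x w u"] by simp
  moreover have "gm G x (nab2 x u w) u - gm G x (nab2 x w u) u = gm G x (Rm G x u w (Y x)) u"
    using nab2_commute[OF x, of u w] by (simp add: gm_simps(2)[symmetric])
  moreover have "gm G x (nab2 x u u) w + gm G x (nab2 x u w) u = 0"
    using nab2_skew[OF x, of u u w] gm_sym[OF x, of u "nab2 x u w"] by simp
  ultimately show "gm G x (nab2 x u u) w = gm G x (Rm G x u (Y x) u) w"
    using Rm_skew[OF x, of u w "Y x"] by linarith
qed

end

section \<open>Change of coordinates\<close>

locale metric_transition = M1: local_metric U G + M2: local_metric V H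
  for U :: "(real^'n::finite) set" and G and V :: "(real^'n::finite) set" and H +
  fixes W :: "(real^'n) set" and \<phi> :: "real^'n \<Rightarrow> real^'n"
  assumes open_W: "open W" and W_sub: "W \<subseteq> U" and img: "\<phi> ` W \<subseteq> V" and smooth_\<phi>: "smooth_on W \<phi>"
    and pull: "x \<in> W \<Longrightarrow> gm G x v w = gm H (\<phi> x) (dd \<phi> v x) (dd \<phi> w x)"
begin

lemma diff_\<phi>: "x \<in> W \<Longrightarrow> \<phi> differentiable (at x)" "x \<in> W \<Longrightarrow> dd \<phi> v differentiable (at x)"
  "x \<in> W \<Longrightarrow> dd (dd \<phi> v) w differentiable (at x)"
  using smooth_on_differentiable[OF smooth_\<phi>] smooth_on_differentiable[OF smooth_on_dd[OF smooth_\<phi>]]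
    smooth_on_differentiable[OF smooth_on_dd[OF smooth_on_dd[OF smooth_\<phi>]]] by auto

lemma in_U: "x \<in> W \<Longrightarrow> x \<in> U" and in_V: "x \<in> W \<Longrightarrow> \<phi> x \<in> V"
  using W_sub img by auto

lemma D\<phi>_linear: "x \<in> W \<Longrightarrow> linear (\<lambda>v. dd \<phi> v x)"
  by (rule dd_linear[OF diff_\<phi>(1)])

text \<open>A vector in the kernel would be orthogonal to all vectors. Bijectivity of the
  differential thus follows from the isometry property, without the inverse transition map.\<close>

lemma D\<phi>_surj:
  assumes x: "x \<in> W"
  shows "surj (\<lambda>v. dd \<phi> v x)"
proof -
  have "inj (\<lambda>v. dd \<phi> v x)"
    unfolding linear_injective_0[OF D\<phi>_linear[OF x]]
  proof (intro allI impI)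
    fix v assume "dd \<phi> v x = 0"
    then have "gm G x v w = gm G x 0 w" for w by (simp add: pull[OF x] gm_simps)
    then show "v = 0" by (rule M1.gm_eqI[OF in_U[OF x]])
  qed
  then show ?thesis by (rule eucl.linear_inj_imp_surj[OF D\<phi>_linear[OF x]])
qed

lemma D\<phi>_eqI:
  assumes x: "x \<in> W" and "\<And>w. gm H (\<phi> x) u (dd \<phi> w x) = gm H (\<phi> x) v (dd \<phi> w x)"
  shows "u = v"
proof (rule M2.gm_eqI[OF in_V[OF x]])
  fix w
  obtain w' where "w = dd \<phi> w' x" using surjD[OF D\<phi>_surj[OF x]] by blast
  then show "gm H (\<phi> x) u w = gm H (\<phi> x) v w" using assms(2) by simp
qed

lemma D\<phi>2_sym: "x \<in> W \<Longrightarrow> dd (dd \<phi> v) u x = dd (dd \<phi> u) v x"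
  by (rule dd_commute[OF open_W _ smooth_\<phi>])

lemma dd_pull:
  assumes x: "x \<in> W"
  shows "gm (dd G u) x v w = gm (dd H (dd \<phi> u x)) (\<phi> x) (dd \<phi> v x) (dd \<phi> w x)
     + gm H (\<phi> x) (dd (dd \<phi> v) u x) (dd \<phi> w x) + gm H (\<phi> x) (dd \<phi> v x) (dd (dd \<phi> w) u x)"
proof -
  have H: "H differentiable at (\<phi> x)" by (rule M2.diff_G(1)[OF in_V[OF x]])
  have "gm (dd G u) x v w = dd (\<lambda>y. gm G y v w) u x"
    by (rule gm_dd_const(2)[OF M1.diff_G(1)[OF in_U[OF x]], symmetric])
  also have "\<dots> = dd (\<lambda>y. gm (\<lambda>y. H (\<phi> y)) y (dd \<phi> v y) (dd \<phi> w y)) u x"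
    by (rule dd_cong_open[OF open_W x]) (simp add: pull gm_def[of H] gm_def[of "\<lambda>y. H (\<phi> y)"])
  also have "\<dots> = gm (dd (\<lambda>y. H (\<phi> y)) u) x (dd \<phi> v x) (dd \<phi> w x)
     + gm (\<lambda>y. H (\<phi> y)) x (dd (dd \<phi> v) u x) (dd \<phi> w x) + gm (\<lambda>y. H (\<phi> y)) x (dd \<phi> v x) (dd (dd \<phi> w) u x)"
    by (rule gm_dd(2)[OF dd_compose(1)[OF H diff_\<phi>(1)[OF x]] diff_\<phi>(2)[OF x] diff_\<phi>(2)[OF x]])
  finally show ?thesis
    unfolding gm_def dd_compose(2)[OF H diff_\<phi>(1)[OF x]] .
qed

text \<open>Koszul's formula in both charts. Of the six terms with second derivatives of the
  transition map four cancel in pairs, and the remaining two combine to the inhomogeneous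
  term.\<close>

lemma Gam_trans:
  assumes x: "x \<in> W"
  shows "dd \<phi> (Gam G x u v) x = Gam H (\<phi> x) (dd \<phi> u x) (dd \<phi> v x) + dd (dd \<phi> v) u x"
proof (rule D\<phi>_eqI[OF x])
  fix w
  have "gm H (\<phi> x) (dd \<phi> (Gam G x u v) x) (dd \<phi> w x) = gm G x (Gam G x u v) w"
    by (rule pull[OF x, symmetric])
  also have "\<dots> = gm H (\<phi> x) (Gam H (\<phi> x) (dd \<phi> u x) (dd \<phi> v x) + dd (dd \<phi> v) u x) (dd \<phi> w x)"
    unfolding M1.Gam_lower[OF in_U[OF x]] dd_pull[OF x] gm_simps M2.Gam_lower[OF in_V[OF x]]
    using D\<phi>2_sym[OF x, of v u] D\<phi>2_sym[OF x, of w u] D\<phi>2_sym[OF x, of w v]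
      M2.gm_sym[OF in_V[OF x], of "dd \<phi> v x" "dd (dd \<phi> w) u x"]
      M2.gm_sym[OF in_V[OF x], of "dd \<phi> u x" "dd (dd \<phi> w) v x"]
      M2.gm_sym[OF in_V[OF x], of "dd \<phi> u x" "dd (dd \<phi> v) w x"]
    by (simp add: field_simps)
  finally show "gm H (\<phi> x) (dd \<phi> (Gam G x u v) x) (dd \<phi> w x) =
    gm H (\<phi> x) (Gam H (\<phi> x) (dd \<phi> u x) (dd \<phi> v x) + dd (dd \<phi> v) u x) (dd \<phi> w x)" .
qed

lemma Gam_trans_dd:
  assumes x: "x \<in> W"
  shows "dd (dd \<phi> (Gam G x v w)) u x + dd \<phi> (dd (\<lambda>y. Gam G y v w) u x) x =
    dd (\<lambda>y. Gam H y (dd \<phi> v x) (dd \<phi> w x)) (dd \<phi> u x) (\<phi> x) + Gam H (\<phi> x) (dd (dd \<phi> v) u x) (dd \<phi> w x)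
     + Gam H (\<phi> x) (dd \<phi> v x) (dd (dd \<phi> w) u x) + dd (dd (dd \<phi> w) v) u x"
proof -
  let ?K = "\<lambda>y a b. Gam H (\<phi> y) a b"
  have K: "(\<lambda>y. ?K y a b) differentiable (at x)"
    "dd (\<lambda>y. ?K y a b) u x = dd (\<lambda>y. Gam H y a b) (dd \<phi> u x) (\<phi> x)" for a b
    using dd_compose[where p=\<phi> and f="\<lambda>y. Gam H y a b", OF M2.Gam_diff[OF in_V[OF x]] diff_\<phi>(1)[OF x]] by auto
  have K1: "(\<lambda>y. ?K y a (dd \<phi> w y)) differentiable (at x)"
    "dd (\<lambda>y. ?K y a (dd \<phi> w y)) u x = dd (\<lambda>y. ?K y a (dd \<phi> w x)) u x + ?K x a (dd (dd \<phi> w) u x)" for a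
    using dd_linear_family[OF open_W x, where F="\<lambda>y b. ?K y a b" and w="dd \<phi> w", OF M2.Gam_linear(1)[OF in_V] K(1) diff_\<phi>(2)[OF x]]
    by auto
  have K2: "(\<lambda>y. ?K y (dd \<phi> v y) (dd \<phi> w y)) differentiable (at x)"
    "dd (\<lambda>y. ?K y (dd \<phi> v y) (dd \<phi> w y)) u x = dd (\<lambda>y. ?K y (dd \<phi> v x) (dd \<phi> w y)) u x + ?K x (dd (dd \<phi> v) u x) (dd \<phi> w x)"
    using dd_linear_family[OF open_W x, where F="\<lambda>y a. ?K y a (dd \<phi> w y)" and w="dd \<phi> v", OF M2.Gam_linear(2)[OF in_V] K1(1) diff_\<phi>(2)[OF x]]
    by auto
  have "dd (\<lambda>y. dd \<phi> (Gam G y v w) y) u x = dd (\<lambda>y. ?K y (dd \<phi> v y) (dd \<phi> w y) + dd (dd \<phi> w) v y) u x"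
    by (rule dd_cong_open[OF open_W x]) (rule Gam_trans)
  moreover have "dd (\<lambda>y. dd \<phi> (Gam G y v w) y) u x = dd (dd \<phi> (Gam G x v w)) u x + dd \<phi> (dd (\<lambda>y. Gam G y v w) u x) x"
    by (rule dd_linear_family(2)[OF open_W x, where F="\<lambda>y c. dd \<phi> c y", OF D\<phi>_linear _ M1.Gam_diff[OF in_U[OF x]]])
       (auto intro: diff_\<phi>(2)[OF x])
  ultimately show ?thesis
    unfolding dd_add[OF K2(1) diff_\<phi>(3)[OF x]] K2(2) K1(2) K(2) by (simp add: algebra_simps)
qed

text \<open>Antisymmetrizing the differentiated transformation law cancels the third derivatives of
  the transition map; the terms with second derivatives cancel against those coming from the
  quadratic part of the curvature.\<close>

lemma Rm_trans:
  assumes x: "x \<in> W"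
  shows "dd \<phi> (Rm G x u v w) x = Rm H (\<phi> x) (dd \<phi> u x) (dd \<phi> v x) (dd \<phi> w x)"
proof -
  have c: "dd (dd (dd \<phi> w) v) u x = dd (dd (dd \<phi> w) u) v x"
    by (rule dd_commute[OF open_W x smooth_on_dd[OF smooth_\<phi>]])
  have B: "dd \<phi> (dd (\<lambda>y. Gam G y v w) u x) x =
    dd (\<lambda>y. Gam H y (dd \<phi> v x) (dd \<phi> w x)) (dd \<phi> u x) (\<phi> x) + Gam H (\<phi> x) (dd (dd \<phi> v) u x) (dd \<phi> w x)
     + Gam H (\<phi> x) (dd \<phi> v x) (dd (dd \<phi> w) u x) + dd (dd (dd \<phi> w) v) u x - dd (dd \<phi> (Gam G x v w)) u x" for u v
    unfolding Gam_trans_dd[OF x, symmetric] by simp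
  show ?thesis
    unfolding Rm_def linear_add[OF D\<phi>_linear[OF x]] linear_diff[OF D\<phi>_linear[OF x]] Gam_trans[OF x]
      M2.Gam_simps[OF in_V[OF x]] B c D\<phi>2_sym[OF x, of v u]
    by (simp add: algebra_simps)
qed

end

section \<open>Charts of a Lorentzian manifold\<close>

lemma has_vector_derivative_Un:
  assumes "(f has_vector_derivative f') (at t within S)" "(f has_vector_derivative f') (at t within T)"
  shows "(f has_vector_derivative f') (at t within (S \<union> T))"
  using assms unfolding has_vector_derivative_def has_derivative_within
  unfolding at_within_union
  by (auto intro: filterlim_sup)

lemma has_vector_derivative_eventually:
  assumes "(f has_vector_derivative f') (at t within S)"
    and "eventually (\<lambda>s. f s = h s) (at t within S)" "f t = h t"
  shows "(h has_vector_derivative f') (at t within S)"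
proof -
  have "eventually (\<lambda>s. s \<in> S \<longrightarrow> f s = h s) (nhds t)"
    using assms(2,3) unfolding eventually_at_filter by (auto elim!: eventually_mono)
  then show ?thesis using has_vector_derivative_cong_ev[of S f h t f'] assms(1,3) by simp
qed

text \<open>A coordinate change along a curve is linear only while the curve stays in both chart
  domains, that is, near t. Elsewhere the family is replaced by zero, which does not affect the
  derivative at t.\<close>

lemma has_vector_derivative_linear_family_ev:
  fixes F :: "real \<Rightarrow> 'a::euclidean_space \<Rightarrow> 'b::real_normed_vector"
  assumes lin: "eventually (\<lambda>s. linear (F s)) (at t within S)" "linear (F t)" and "linear F'" and "t \<in> S"
    and F: "\<And>e. ((\<lambda>s. F s e) has_vector_derivative F' e) (at t within S)"
    and x: "(x has_vector_derivative x') (at t within S)"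
  shows "((\<lambda>s. F s (x s)) has_vector_derivative F' (x t) + F t x') (at t within S)"
proof -
  define F2 where "F2 s = (if linear (F s) then F s else (\<lambda>_. 0))" for s
  have ev: "eventually (\<lambda>s. F s = F2 s) (at t within S)"
    using lin(1) by eventually_elim (simp add: F2_def)
  have t: "F2 t = F t" using lin(2) by (simp add: F2_def)
  have "((\<lambda>s. F2 s (x s)) has_vector_derivative F' (x t) + F2 t x') (at t within S)"
  proof (rule has_vector_derivative_linear_family[OF _ \<open>linear F'\<close> \<open>t \<in> S\<close> _ x])
    show "linear (F2 s)" for s by (simp add: F2_def linear_zero)
    show "((\<lambda>s. F2 s e) has_vector_derivative F' e) (at t within S)" for e
      by (rule has_vector_derivative_eventually[OF F[of e]]) (use ev t in \<open>auto elim!: eventually_mono\<close>)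
  qed
  then have "((\<lambda>s. F s (x s)) has_vector_derivative F' (x t) + F2 t x') (at t within S)"
    by (rule has_vector_derivative_eventually) (use ev t in \<open>auto elim!: eventually_mono\<close>)
  then show ?thesis unfolding t .
qed

text \<open>Pairing with the orthonormal vectors recovers coefficients up to sign. So these vectors
  are independent, hence a basis by dimension, and a vector orthogonal to all of them has zero
  coefficients.\<close>

lemma lorentzian_form_nondegenerate:
  fixes b :: "real^'n \<Rightarrow> real^'n::finite \<Rightarrow> real"
  assumes "lorentzian_form b" and 0: "\<And>w. b v w = 0"
  shows "v = 0"
proof -
  obtain e :: "'n \<Rightarrow> real^'n" and k where b: "bilinear b" 
    and e: "\<And>i j. b (e i) (e j) = (if i \<noteq> j then 0 else if i = k then - 1 else 1)"
    using assms unfolding lorentzian_form_def by blast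
  let ?T = "\<lambda>a::real^'n. \<Sum>i\<in>UNIV. a $ i *\<^sub>R e i"
  have be: "b (?T a) (e j) = a $ j * (if j = k then - 1 else 1)" for a j
  proof -
    have "b (?T a) (e j) = (\<Sum>i\<in>UNIV. a $ i * b (e i) (e j))"
      using b unfolding bilinear_def by (simp add: linear_sum[of "\<lambda>x. b x (e j)"] linear_scale[of "\<lambda>x. b x (e j)"])
    also have "\<dots> = (\<Sum>i\<in>UNIV. if i = j then a $ j * (if j = k then - 1 else 1) else 0)"
      by (rule sum.cong) (auto simp: e)
    finally show ?thesis by simp
  qed
  have lin: "linear ?T"
    by (rule linearI) (simp_all add: scaleR_add_left sum.distrib scaleR_sum_right)
  have "inj ?T"
    unfolding linear_injective_0[OF lin]
  proof (intro allI impI)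
    fix a assume "?T a = 0"
    then have "a $ j * (if j = k then - 1 else 1) = 0" for j
      using be[of a j] bilinear_lzero[OF b] by simp
    then have "a $ j = 0" for j by (cases "j = k") fastforce+
    then show "a = 0" by (simp add: vec_eq_iff)
  qed
  then obtain a where a: "v = ?T a" using eucl.linear_inj_imp_surj[OF lin] by (meson surjD)
  have "a $ j * (if j = k then - 1 else 1) = 0" for j using be[of a j] 0[of "e j"] a by simp
  then have "a $ j = 0" for j by (cases "j = k") fastforce+
  then show ?thesis by (simp add: a)
qed

locale lorentz =
  fixes A :: "('m::{t2_space, second_countable_topology}, 'n::finite) chart set" and g :: "('m, 'n) metric"
  assumes lorentzian: "lorentzian_manifold A g"
begin

lemma atlas: "smooth_atlas A" and g_form: "lorentzian_form (g p)"
  and gram_smooth: "c \<in> A \<Longrightarrow> smooth_on (snd c ` fst c) (gram A g c)"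
  using lorentzian unfolding lorentzian_manifold_def by auto

lemma g_bilinear: "bilinear (g p)" and g_sym: "g p v w = g p w v"
  using g_form[of p] unfolding lorentzian_form_def by auto

lemma g_simps:
  "g p (v + v') w = g p v w + g p v' w" "g p (v - v') w = g p v w - g p v' w"
  "g p v (w + w') = g p v w + g p v w'" "g p v (w - w') = g p v w - g p v w'"
  "g p (- v) w = - g p v w" "g p v (- w) = - g p v w"
  "g p (a *\<^sub>R v) w = a * g p v w" "g p v (a *\<^sub>R w) = a * g p v w"
  "g p 0 w = 0" "g p v 0 = 0"
  using g_bilinear[of p] by (auto simp: bilinear_ladd bilinear_radd bilinear_lsub bilinear_rsub
      bilinear_lneg bilinear_rneg bilinear_lmul bilinear_rmul bilinear_lzero bilinear_rzero)

lemma g_eqI: "(\<And>w. g p u w = g p v w) \<Longrightarrow> u = v"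
  using lorentzian_form_nondegenerate[OF g_form, of p "u - v"] by (simp add: g_simps)

lemma chart: 
  assumes "c \<in> A"
  shows "open (fst c)" "open (snd c ` fst c)" "homeomorphism (fst c) (snd c ` fst c) (snd c) (chart_inv c)"
  using atlas assms unfolding smooth_atlas_def is_chart_def by auto

lemma chart_inv [simp]: "c \<in> A \<Longrightarrow> p \<in> fst c \<Longrightarrow> chart_inv c (snd c p) = p"
  using chart(3) homeomorphism_apply1 by fastforce

lemma chart_at: "chart_at A p \<in> A" "p \<in> fst (chart_at A p)"
proof -
  have "\<exists>c. c \<in> A \<and> p \<in> fst c" using atlas unfolding smooth_atlas_def by blast
  from someI_ex[OF this] show "chart_at A p \<in> A" "p \<in> fst (chart_at A p)" unfolding chart_at_def by auto
qed

section \<open>Coordinate changes and components of tangent vectors\<close>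

definition trans_dom where "trans_dom c d = snd c ` (fst c \<inter> fst d)"
definition trans where "trans c d = snd d \<circ> chart_inv c"

lemma trans_dom_open: "c \<in> A \<Longrightarrow> d \<in> A \<Longrightarrow> open (trans_dom c d)"
proof -
  assume cd: "c \<in> A" "d \<in> A"
  have "trans_dom c d = snd c ` fst c \<inter> chart_inv c -` fst d"
    unfolding trans_dom_def using cd by (auto simp: image_iff) 
  moreover have "open (snd c ` fst c \<inter> chart_inv c -` fst d)"
    using continuous_open_preimage[OF homeomorphism_cont2[OF chart(3)[OF cd(1)]] chart(2)[OF cd(1)] chart(1)[OF cd(2)]] .
  ultimately show ?thesis by simp
qed

lemma trans_smooth: "c \<in> A \<Longrightarrow> d \<in> A \<Longrightarrow> smooth_on (trans_dom c d) (trans c d)"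
  using atlas unfolding smooth_atlas_def trans_dom_def trans_def by auto

lemma trans_apply: "c \<in> A \<Longrightarrow> p \<in> fst c \<Longrightarrow> trans c d (snd c p) = snd d p"
  by (simp add: trans_def)

lemma trans_diff: "c \<in> A \<Longrightarrow> d \<in> A \<Longrightarrow> p \<in> fst c \<Longrightarrow> p \<in> fst d \<Longrightarrow> trans c d differentiable (at (snd c p))"
  using smooth_on_differentiable[OF trans_smooth] unfolding trans_dom_def by blast

lemma change_dd: "change c d p v = dd (trans c d) v (snd c p)"
  by (simp add: change_def dd_def trans_def)

lemma change_linear: "c \<in> A \<Longrightarrow> d \<in> A \<Longrightarrow> p \<in> fst c \<Longrightarrow> p \<in> fst d \<Longrightarrow> linear (change c d p)"
  using dd_linear[OF trans_diff] unfolding change_dd[abs_def] .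

lemma change_change:
  assumes "c \<in> A" "d \<in> A" "e \<in> A" "p \<in> fst c" "p \<in> fst d" "p \<in> fst e"
  shows "change d e p (change c d p v) = change c e p v"
proof -
  have o: "open (trans_dom c d)" "snd c p \<in> trans_dom c d"
    using trans_dom_open assms by (auto simp: trans_dom_def)
  have "dd (\<lambda>y. trans d e (trans c d y)) v (snd c p) = dd (trans c e) v (snd c p)"
    by (rule dd_cong_open[OF o]) (use assms in \<open>auto simp: trans_dom_def trans_apply\<close>)
  moreover have "dd (\<lambda>y. trans d e (trans c d y)) v (snd c p) = dd (trans d e) (dd (trans c d) v (snd c p)) (trans c d (snd c p))"
    by (rule dd_compose(2)) (use trans_diff assms in \<open>auto simp: trans_apply\<close>)
  ultimately show ?thesis unfolding change_dd using assms by (simp add: trans_apply)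
qed

lemma change_self: "c \<in> A \<Longrightarrow> p \<in> fst c \<Longrightarrow> change c c p v = v"
proof -
  assume c: "c \<in> A" "p \<in> fst c"
  have o: "open (trans_dom c c)" "snd c p \<in> trans_dom c c"
    using trans_dom_open[OF c(1) c(1)] c by (auto simp: trans_dom_def)
  have "dd (trans c c) v (snd c p) = dd (\<lambda>y. y) v (snd c p)"
    by (rule dd_cong_open[OF o]) (use c in \<open>auto simp: trans_dom_def trans_apply\<close>)
  also have "\<dots> = v" by (rule dd_eqI[OF has_derivative_ident])
  finally show ?thesis by (simp add: change_dd)
qed

text \<open>The inverse of \<open>comps A c p\<close>.\<close>

definition uncomp where "uncomp c p = change c (chart_at A p) p"

lemma comps_back: "c \<in> A \<Longrightarrow> p \<in> fst c \<Longrightarrow> comps A c p (uncomp c p v) = v"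
  "c \<in> A \<Longrightarrow> p \<in> fst c \<Longrightarrow> uncomp c p (comps A c p v) = v"
  unfolding comps_def uncomp_def using change_change change_self chart_at by auto

lemma comps_linear: "c \<in> A \<Longrightarrow> p \<in> fst c \<Longrightarrow> linear (comps A c p)"
  and back_linear: "c \<in> A \<Longrightarrow> p \<in> fst c \<Longrightarrow> linear (uncomp c p)"
  unfolding comps_def[abs_def] uncomp_def using change_linear chart_at by auto

lemma comps_chart_at: "comps A (chart_at A p) p v = v"
  unfolding comps_def using change_self chart_at by auto

lemma comps_change: "c \<in> A \<Longrightarrow> p \<in> fst c \<Longrightarrow> d \<in> A \<Longrightarrow> p \<in> fst d \<Longrightarrow> change c d p (comps A c p v) = comps A d p v"
  unfolding comps_def using change_change chart_at by auto

lemma gram_back: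
  assumes "c \<in> A" "p \<in> fst c"
  shows "gm (gram A g c) (snd c p) v w = g p (uncomp c p v) (uncomp c p w)"
proof -
  have b: "bilinear (\<lambda>v w. g p (uncomp c p v) (uncomp c p w))"
    using g_bilinear[of p] back_linear[OF assms] unfolding bilinear_def
    by (auto intro: linear_compose[unfolded o_def])
  have "g p (uncomp c p v) (uncomp c p w) = (\<lambda>v w. g p (uncomp c p v) (uncomp c p w)) (\<Sum>i\<in>UNIV. v $ i *\<^sub>R axis i 1) (\<Sum>i\<in>UNIV. w $ i *\<^sub>R axis i 1)"
    using vec_expand[of v] vec_expand[of w] by simp
  also have "\<dots> = (\<Sum>i\<in>UNIV. \<Sum>j\<in>UNIV. v $ i * w $ j * g p (uncomp c p (axis i 1)) (uncomp c p (axis j 1)))"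
    unfolding bilinear_sum[OF b] by (simp add: bilinear_lmul[OF b] bilinear_rmul[OF b] sum.cartesian_product mult_ac)
  also have "\<dots> = gm (gram A g c) (snd c p) v w"
    using assms by (simp add: gm_def gram_def Let_def coord_field_def uncomp_def inner_vec_def matrix_vector_mult_def
        sum_distrib_left mult_ac)
  finally show ?thesis by simp
qed

lemma g_gram: "c \<in> A \<Longrightarrow> p \<in> fst c \<Longrightarrow> g p v w = gm (gram A g c) (snd c p) (comps A c p v) (comps A c p w)"
  by (simp add: gram_back comps_back)

lemma local_metric: 
  assumes c: "c \<in> A"
  shows "local_metric (snd c ` fst c) (gram A g c)"
proof
  show "open (snd c ` fst c)" "smooth_on (snd c ` fst c) (gram A g c)" using chart gram_smooth c by auto
  fix x assume "x \<in> snd c ` fst c"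
  then obtain p where p: "p \<in> fst c" "x = snd c p" by auto
  show "transpose (gram A g c x) = gram A g c x"
    unfolding gram_def transpose_def Let_def vec_eq_iff by (simp, intro allI, rule g_sym)
  have "v = 0" if "gram A g c x *v v = 0" for v
  proof -
    have "g p (uncomp c p v) w = 0" for w
    proof -
      have "g p w (uncomp c p v) = gm (gram A g c) (snd c p) (comps A c p w) v"
        using gram_back[OF c p(1), of "comps A c p w" v] comps_back[OF c p(1)] by simp
      then show ?thesis using that p g_sym[of p w] by (simp add: gm_def)
    qed
    then have "uncomp c p v = 0" using lorentzian_form_nondegenerate[OF g_form] by blast
    then show "v = 0" using comps_back(1)[OF c p(1), of v] linear_0[OF comps_linear[OF c p(1)]] by simp
  qed
  then have "invertible (gram A g c x)"
    unfolding invertible_left_inverse matrix_left_invertible_ker by blast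
  then show "det (gram A g c x) \<noteq> 0" by (simp add: invertible_det_nz)
qed

lemma metric_transition:
  assumes c: "c \<in> A" and d: "d \<in> A"
  shows "metric_transition (snd c ` fst c) (gram A g c) (snd d ` fst d) (gram A g d) (trans_dom c d) (trans c d)"
proof -
  interpret M1: local_metric "snd c ` fst c" "gram A g c" by (rule local_metric[OF c])
  interpret M2: local_metric "snd d ` fst d" "gram A g d" by (rule local_metric[OF d])
  show ?thesis
  proof
    show "open (trans_dom c d)" "trans_dom c d \<subseteq> snd c ` fst c" "trans c d ` trans_dom c d \<subseteq> snd d ` fst d"
      "smooth_on (trans_dom c d) (trans c d)"
      using trans_dom_open c d trans_smooth by (auto simp: trans_dom_def trans_apply)
    fix x v w assume "x \<in> trans_dom c d"
    then obtain p where p: "p \<in> fst c" "p \<in> fst d" "x = snd c p" by (auto simp: trans_dom_def)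
    have "uncomp d p (change c d p v) = uncomp c p v" for v
      unfolding uncomp_def using change_change c d p chart_at by auto
    then show "gm (gram A g c) x v w = gm (gram A g d) (trans c d x) (dd (trans c d) v x) (dd (trans c d) w x)"
      unfolding p(3) trans_apply[OF c p(1)] change_dd[symmetric] gram_back[OF c p(1)] gram_back[OF d p(2)] by simp
  qed
qed

lemma christoffel_Gam: "christoffel A g c = Gam (gram A g c)"
  by (intro ext) (simp add: christoffel_def Gam_def)

lemma curvature_Rm: "curvature A g p u v w = Rm (gram A g (chart_at A p)) (snd (chart_at A p) p) u v w"
  by (simp add: curvature_def Rm_def Let_def dd_def christoffel_Gam)

text \<open>\<open>curvature\<close> is defined through the preferred chart at p. By the tensor law
  it may be computed in any chart, in particular in one that stays fixed along a piece of a
  curve.\<close>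

lemma comps_curvature:
  assumes "c \<in> A" "p \<in> fst c"
  shows "comps A c p (curvature A g p u v w) = Rm (gram A g c) (snd c p) (comps A c p u) (comps A c p v) (comps A c p w)"
proof -
  interpret T: metric_transition "snd (chart_at A p) ` fst (chart_at A p)" "gram A g (chart_at A p)" "snd c ` fst c"
    "gram A g c" "trans_dom (chart_at A p) c" "trans (chart_at A p) c"
    by (rule metric_transition[OF chart_at(1) assms(1)])
  have "snd (chart_at A p) p \<in> trans_dom (chart_at A p) c" using assms chart_at by (auto simp: trans_dom_def)
  from T.Rm_trans[OF this] show ?thesis
    unfolding curvature_Rm comps_def change_dd trans_apply[OF chart_at] .
qed

lemma curvature_linear:
  "linear (\<lambda>u. curvature A g p u v w)" "linear (\<lambda>v. curvature A g p u v w)" "linear (curvature A g p u v)"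
proof -
  interpret M: local_metric "snd (chart_at A p) ` fst (chart_at A p)" "gram A g (chart_at A p)"
    by (rule local_metric[OF chart_at(1)])
  have "snd (chart_at A p) p \<in> snd (chart_at A p) ` fst (chart_at A p)" using chart_at by auto
  from M.Rm_linear[OF this] show "linear (\<lambda>u. curvature A g p u v w)" "linear (\<lambda>v. curvature A g p u v w)"
    "linear (curvature A g p u v)"
    unfolding curvature_Rm[abs_def] by auto
qed

lemma curvature_pair_sym: "g p (curvature A g p u v u) w = g p (curvature A g p u w u) v" (is ?sym)
  and curvature_self: "curvature A g p u u w = 0" (is ?self)
proof -
  interpret M: local_metric "snd (chart_at A p) ` fst (chart_at A p)" "gram A g (chart_at A p)"
    by (rule local_metric[OF chart_at(1)])
  have "snd (chart_at A p) p \<in> snd (chart_at A p) ` fst (chart_at A p)" using chart_at by auto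
  have e: "g p a b = gm (gram A g (chart_at A p)) (snd (chart_at A p) p) a b" for a b
    using g_gram[OF chart_at, of p a b] by (simp only: comps_chart_at)
  show ?sym
    unfolding e curvature_Rm by (rule M.Rm_pair_sym) fact
  show ?self unfolding curvature_Rm by (rule M.Rm_self)
qed

text \<open>The equation in \<open>killing_field\<close> is the case of unit vectors; both sides are
  bilinear in the two vectors.\<close>

lemma local_killing:
  assumes K: "killing_field A g Y" and c: "c \<in> A"
  shows "local_killing (snd c ` fst c) (gram A g c) (field_comps A Y c)"
proof -
  interpret M: local_metric "snd c ` fst c" "gram A g c" by (rule local_metric[OF c])
  let ?Y = "field_comps A Y c"
  have sm: "smooth_on (snd c ` fst c) ?Y"
    using K c unfolding killing_field_def smooth_vector_field_def by blast
  show ?thesis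
  proof
    show "smooth_on (snd c ` fst c) ?Y" by (rule sm)
    fix x v w assume x: "x \<in> snd c ` fst c"
    let ?B = "\<lambda>v w. gm (dd (gram A g c) (?Y x)) x v w + gm (gram A g c) x (dd ?Y v x) w + gm (gram A g c) x v (dd ?Y w x)"
    note dY = dd_linear[OF smooth_on_differentiable[OF sm x]]
    have bil: "bilinear ?B"
      unfolding bilinear_def
      by (auto intro!: linearI simp: gm_simps linear_add[OF dY] linear_scale[OF dY] algebra_simps)
    have ax: "?B (axis i 1) (axis j 1) = 0" for i j
    proof -
      have p: "pderiv (\<lambda>y. ?Y y $ k) x i = dd ?Y (axis i 1) x $ k" for k i
        using dd_bounded_linear(1)[OF bounded_linear_vec_nth smooth_on_differentiable[OF sm x], of k "axis i 1"]
        by (simp add: pderiv_def dd_def)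
      have e: "(\<Sum>k\<in>UNIV. ?Y x $ k * pderiv (\<lambda>y. gram A g c y $ i $ j) x k
        + gram A g c x $ k $ j * pderiv (\<lambda>y. ?Y y $ k) x i
        + gram A g c x $ i $ k * pderiv (\<lambda>y. ?Y y $ k) x j) = 0"
        using K c x unfolding killing_field_def by blast
      have "gm (dd (gram A g c) (?Y x)) x (axis i 1) (axis j 1) = (\<Sum>k\<in>UNIV. ?Y x $ k * (\<Sum>l\<in>UNIV. axis i 1 $ l * pderiv (\<lambda>y. gram A g c y $ l $ j) x k))"
        unfolding M.gm_dd_expand[OF x] M.pderiv_G[OF x] by (simp add: sum_distrib_left mult.assoc)
      also have "\<dots> = (\<Sum>k\<in>UNIV. ?Y x $ k * pderiv (\<lambda>y. gram A g c y $ i $ j) x k)"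
        by (simp add: axis_def if_distrib[of "\<lambda>x. x * _"] cong: if_cong)
      finally have 1: "gm (dd (gram A g c) (?Y x)) x (axis i 1) (axis j 1) = \<dots>" .
      have gx: "gm (gram A g c) x z (axis j 1) = (\<Sum>k\<in>UNIV. gram A g c x $ k $ j * z $ k)" for z j
        unfolding gm_def inner_vec_def matrix_vector_mult_basis column_def by (simp add: mult.commute)
      have gs: "gram A g c x $ k $ i = gram A g c x $ i $ k" for k i
        using arg_cong[OF M.sym_G[OF x], of "\<lambda>M. M $ i $ k"] by (simp add: transpose_def)
      have 3: "gm (gram A g c) x (axis i 1) (dd ?Y (axis j 1) x) = (\<Sum>k\<in>UNIV. gram A g c x $ i $ k * dd ?Y (axis j 1) x $ k)"
        unfolding M.gm_sym[OF x, of "axis i 1"] gx by (rule sum.cong[OF refl]) (rule arg_cong2[OF gs refl])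
      show ?thesis using e unfolding 1 3 gx p sum.distrib .
    qed
    have "?B v w = ?B (\<Sum>i\<in>UNIV. v $ i *\<^sub>R axis i 1) (\<Sum>i\<in>UNIV. w $ i *\<^sub>R axis i 1)"
      using vec_expand[of v] vec_expand[of w] by simp
    also have "\<dots> = (\<Sum>(i,j)\<in>UNIV \<times> UNIV. ?B (v $ i *\<^sub>R axis i 1) (w $ j *\<^sub>R axis j 1))"
      by (rule bilinear_sum[OF bil])
    also have "\<dots> = 0"
      by (rule sum.neutral) (use ax in \<open>auto simp only: bilinear_lmul[OF bil] bilinear_rmul[OF bil] split_conv scaleR_zero_right\<close>)
    finally show "?B v w = 0" .
  qed
qed

end

section \<open>Covariant derivatives along curves\<close>

lemma has_vector_derivative_Icc_join:
  fixes f :: "real \<Rightarrow> 'a::real_normed_vector"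
  assumes "a \<le> b" "b \<le> c" "t \<in> {a..c}"
    and "t \<le> b \<Longrightarrow> (f has_vector_derivative f') (at t within {a..b})"
    and "b \<le> t \<Longrightarrow> (f has_vector_derivative f') (at t within {b..c})"
  shows "(f has_vector_derivative f') (at t within {a..c})"
proof -
  consider "t < b" | "t = b" | "b < t" by linarith
  then show ?thesis
  proof cases
    case 1
    have "at t within {a..c} = at t within {a..b}"
      by (rule at_within_nhd[of t "{..<b}"]) (use 1 assms in auto)
    then show ?thesis using assms(4) 1 by simp
  next
    case 2
    have "{a..c} = {a..b} \<union> {b..c}" using assms(1,2) by auto
    then show ?thesis using has_vector_derivative_Un[of f f' t "{a..b}" "{b..c}"] assms(4,5) 2 by simp
  next
    case 3
    have "at t within {a..c} = at t within {b..c}"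
      by (rule at_within_nhd[of t "{b<..}"]) (use 3 assms in auto)
    then show ?thesis using assms(5) 3 by simp
  qed
qed

lemma gm_has_vector_derivative:
  assumes "(H has_vector_derivative H') (at t within S)" "(v has_vector_derivative v') (at t within S)"
    "(w has_vector_derivative w') (at t within S)"
  shows "((\<lambda>s. gm H s (v s) (w s)) has_vector_derivative
    (v t \<bullet> (H' *v w t) + gm H t v' (w t) + gm H t (v t) w')) (at t within S)"
  using bounded_bilinear.has_vector_derivative[OF bounded_bilinear_inner assms(2)
      bounded_bilinear.has_vector_derivative[OF bounded_bilinear_matrix_vector_mult assms(1,3)]]
  unfolding gm_def by (simp add: inner_add_right algebra_simps)

context lorentz
begin

text \<open>Covariant differentiability as a relation: w is the covariant derivative of V at t
  within S. In contrast to \<open>cov_deriv\<close> it asserts that the derivative exists, refers to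
  every chart around the point, and makes sense on subintervals.\<close>

definition covd :: "(real \<Rightarrow> 'm) \<Rightarrow> real set \<Rightarrow> (real \<Rightarrow> real^'n) \<Rightarrow> real \<Rightarrow> real^'n \<Rightarrow> bool" where
  "covd \<gamma> S V t w \<longleftrightarrow> (\<forall>c\<in>A. \<gamma> t \<in> fst c \<longrightarrow> ((\<lambda>s. comps A c (\<gamma> s) (V s)) has_vector_derivative
     (comps A c (\<gamma> t) w - Gam (gram A g c) (snd c (\<gamma> t)) (comps A c (\<gamma> t) (vel A \<gamma> t)) (comps A c (\<gamma> t) (V t))))
     (at t within S))"

end

locale lorentz_curve = lorentz +
  fixes \<gamma> :: "real \<Rightarrow> 'a"
  assumes diff_curve: "differentiable_curve A \<gamma>"
begin

lemma cont_\<gamma>: "continuous_on {0..1} \<gamma>"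
  using diff_curve unfolding differentiable_curve_def by blast

lemma eventually_chart:
  assumes "S \<subseteq> {0..1}" "t \<in> S" "open X" "\<gamma> t \<in> X"
  shows "eventually (\<lambda>s. \<gamma> s \<in> X) (at t within S)"
proof -
  have "(\<gamma> \<longlongrightarrow> \<gamma> t) (at t within S)"
    using continuous_on_subset[OF cont_\<gamma> assms(1)] assms(2) unfolding continuous_on_def by blast
  then show ?thesis using assms(3,4) by (rule topological_tendstoD)
qed

lemma eventually_charts:
  assumes "S \<subseteq> {0..1}" "t \<in> S" "c \<in> A" "\<gamma> t \<in> fst c" "d \<in> A" "\<gamma> t \<in> fst d"
  shows "eventually (\<lambda>s. \<gamma> s \<in> fst c \<and> \<gamma> s \<in> fst d) (at t within S)"
  using eventually_chart[OF assms(1,2) chart(1)[OF assms(3)] assms(4)]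
    eventually_chart[OF assms(1,2) chart(1)[OF assms(5)] assms(6)] by eventually_elim auto

lemma vel_chart:
  assumes t: "t \<in> {0..1}" and c: "c \<in> A" "\<gamma> t \<in> fst c"
  shows "((\<lambda>s. snd c (\<gamma> s)) has_vector_derivative comps A c (\<gamma> t) (vel A \<gamma> t)) (at t within {0..1})"
proof -
  let ?d = "chart_at A (\<gamma> t)"
  have "(\<lambda>s. snd ?d (\<gamma> s)) differentiable (at t within {0..1})"
    using diff_curve t chart_at unfolding differentiable_curve_def by blast
  then have d: "((\<lambda>s. snd ?d (\<gamma> s)) has_vector_derivative vel A \<gamma> t) (at t within {0..1})"
    by (simp add: vel_def velocity_def vector_derivative_works)
  have "((\<lambda>s. trans ?d c (snd ?d (\<gamma> s))) has_vector_derivative dd (trans ?d c) (vel A \<gamma> t) (snd ?d (\<gamma> t))) (at t within {0..1})"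
    by (rule dd_compose_curve[OF trans_diff d]) (use chart_at c in auto)
  then have "((\<lambda>s. trans ?d c (snd ?d (\<gamma> s))) has_vector_derivative comps A c (\<gamma> t) (vel A \<gamma> t)) (at t within {0..1})"
    by (simp add: comps_def change_dd)
  moreover have "eventually (\<lambda>s. trans ?d c (snd ?d (\<gamma> s)) = snd c (\<gamma> s)) (at t within {0..1})"
    using eventually_charts[OF subset_refl t chart_at c] by eventually_elim (simp add: trans_apply chart_at)
  ultimately show ?thesis
    by (rule has_vector_derivative_eventually) (simp add: trans_apply chart_at)
qed

lemma vel_eqI:
  assumes t: "t \<in> {0..1}" and c: "c \<in> A" "\<gamma> t \<in> fst c"
    and v: "((\<lambda>s. snd c (\<gamma> s)) has_vector_derivative v) (at t within {0..1})"
  shows "comps A c (\<gamma> t) (vel A \<gamma> t) = v"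
  using vector_derivative_unique_within_closed_interval[of 0 1 t "\<lambda>s. snd c (\<gamma> s)"] vel_chart[OF t c] v t by simp

lemma vel_chart_subset:
  assumes "S \<subseteq> {0..1}" "t \<in> S" "c \<in> A" "\<gamma> t \<in> fst c"
  shows "((\<lambda>s. snd c (\<gamma> s)) has_vector_derivative comps A c (\<gamma> t) (vel A \<gamma> t)) (at t within S)"
  using has_vector_derivative_within_subset[OF vel_chart[of t c] assms(1)] assms by auto

text \<open>One chart suffices. Differentiating the coordinate change along the curve produces a
  second derivative of the transition map, and exactly this term is the inhomogeneous part in the
  transformation law of the Christoffel symbols.\<close>

lemma covdI:
  assumes S: "S \<subseteq> {0..1}" "t \<in> S" and c: "c \<in> A" "\<gamma> t \<in> fst c"
    and D: "((\<lambda>s. comps A c (\<gamma> s) (V s)) has_vector_derivative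
     (comps A c (\<gamma> t) w - Gam (gram A g c) (snd c (\<gamma> t)) (comps A c (\<gamma> t) (vel A \<gamma> t)) (comps A c (\<gamma> t) (V t))))
     (at t within S)"
  shows "covd \<gamma> S V t w"
  unfolding covd_def
proof (intro ballI impI)
  fix d assume d: "d \<in> A" "\<gamma> t \<in> fst d"
  interpret T: metric_transition "snd c ` fst c" "gram A g c" "snd d ` fst d" "gram A g d" "trans_dom c d" "trans c d"
    by (rule metric_transition[OF c(1) d(1)])
  let ?u = "comps A c (\<gamma> t) (vel A \<gamma> t)" and ?x = "snd c (\<gamma> t)" and ?v = "comps A c (\<gamma> t) (V t)"
  let ?F' = "\<lambda>e. dd (dd (trans c d) e) ?u ?x"
  have x: "?x \<in> trans_dom c d" using c d by (auto simp: trans_dom_def)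
  have ev: "eventually (\<lambda>s. \<gamma> s \<in> fst c \<and> \<gamma> s \<in> fst d) (at t within S)"
    by (rule eventually_charts[OF S c d])
  have "((\<lambda>s. change c d (\<gamma> s) (comps A c (\<gamma> s) (V s))) has_vector_derivative ?F' ?v + change c d (\<gamma> t)
      (comps A c (\<gamma> t) w - Gam (gram A g c) ?x ?u ?v)) (at t within S)"
  proof (rule has_vector_derivative_linear_family_ev[OF _ _ _ S(2) _ D])
    show "eventually (\<lambda>s. linear (change c d (\<gamma> s))) (at t within S)"
      using ev by eventually_elim (use change_linear c d in auto)
    show "linear (change c d (\<gamma> t))" using change_linear c d by auto
    have "?F' = (\<lambda>e. dd (dd (trans c d) ?u) e ?x)" by (rule ext) (rule T.D\<phi>2_sym[OF x])
    then show "linear ?F'" by (simp only: dd_linear[OF T.diff_\<phi>(2)[OF x]])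
    show "((\<lambda>s. change c d (\<gamma> s) e) has_vector_derivative ?F' e) (at t within S)" for e
      unfolding change_dd by (rule dd_compose_curve[OF T.diff_\<phi>(2)[OF x] vel_chart_subset[OF S c]])
  qed
  moreover have "?F' ?v + change c d (\<gamma> t) (comps A c (\<gamma> t) w - Gam (gram A g c) ?x ?u ?v) =
     comps A d (\<gamma> t) w - Gam (gram A g d) (snd d (\<gamma> t)) (comps A d (\<gamma> t) (vel A \<gamma> t)) (comps A d (\<gamma> t) (V t))"
    unfolding linear_diff[OF change_linear[OF c(1) d(1) c(2) d(2)]] comps_change[OF c d]
    unfolding change_dd T.Gam_trans[OF x] trans_apply[OF c]
    unfolding change_dd[symmetric] comps_change[OF c d] by simp
  moreover have "eventually (\<lambda>s. change c d (\<gamma> s) (comps A c (\<gamma> s) (V s)) = comps A d (\<gamma> s) (V s)) (at t within S)"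
    using ev by eventually_elim (use comps_change c d in auto)
  ultimately show "((\<lambda>s. comps A d (\<gamma> s) (V s)) has_vector_derivative
     comps A d (\<gamma> t) w - Gam (gram A g d) (snd d (\<gamma> t)) (comps A d (\<gamma> t) (vel A \<gamma> t)) (comps A d (\<gamma> t) (V t))) (at t within S)"
    using has_vector_derivative_eventually comps_change[OF c d] by fastforce
qed

lemma covdD:
  assumes "covd \<gamma> S V t w" "c \<in> A" "\<gamma> t \<in> fst c"
  shows "((\<lambda>s. comps A c (\<gamma> s) (V s)) has_vector_derivative
     (comps A c (\<gamma> t) w - Gam (gram A g c) (snd c (\<gamma> t)) (comps A c (\<gamma> t) (vel A \<gamma> t)) (comps A c (\<gamma> t) (V t))))
     (at t within S)"
  using assms unfolding covd_def by blast

lemma covd_subset: "covd \<gamma> S V t w \<Longrightarrow> T \<subseteq> S \<Longrightarrow> covd \<gamma> T V t w"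
  unfolding covd_def using has_vector_derivative_within_subset by blast

lemma covd_cong: "covd \<gamma> S V t w \<Longrightarrow> t \<in> S \<Longrightarrow> (\<And>s. s \<in> S \<Longrightarrow> V s = W s) \<Longrightarrow> covd \<gamma> S W t w"
  unfolding covd_def
proof (intro ballI impI)
  fix c
  assume V: "\<forall>c\<in>A. \<gamma> t \<in> fst c \<longrightarrow> ((\<lambda>s. comps A c (\<gamma> s) (V s)) has_vector_derivative
     (comps A c (\<gamma> t) w - Gam (gram A g c) (snd c (\<gamma> t)) (comps A c (\<gamma> t) (vel A \<gamma> t)) (comps A c (\<gamma> t) (V t))))
     (at t within S)" and t: "t \<in> S" and eq: "\<And>s. s \<in> S \<Longrightarrow> V s = W s" and c: "c \<in> A" "\<gamma> t \<in> fst c"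
  show "((\<lambda>s. comps A c (\<gamma> s) (W s)) has_vector_derivative
     (comps A c (\<gamma> t) w - Gam (gram A g c) (snd c (\<gamma> t)) (comps A c (\<gamma> t) (vel A \<gamma> t)) (comps A c (\<gamma> t) (W t))))
     (at t within S)"
    unfolding eq[OF t, symmetric]
    by (rule has_vector_derivative_transform[OF t _ V[rule_format, OF c]]) (simp add: eq)
qed

lemma covd_join:
  assumes "a \<le> b" "b \<le> c" "t \<in> {a..c}"
    and "t \<le> b \<Longrightarrow> covd \<gamma> {a..b} V t w" and "b \<le> t \<Longrightarrow> covd \<gamma> {b..c} V t w"
  shows "covd \<gamma> {a..c} V t w"
  unfolding covd_def
  by (intro ballI impI has_vector_derivative_Icc_join[OF assms(1-3)]) (use assms(4,5) covdD in blast)+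

lemma covd_scaleR:
  assumes S: "S \<subseteq> {0..1}" "t \<in> S" and V: "covd \<gamma> S V t w"
    and f: "(f has_vector_derivative f') (at t within S)"
  shows "covd \<gamma> S (\<lambda>s. f s *\<^sub>R V s) t (f' *\<^sub>R V t + f t *\<^sub>R w)"
proof (rule covdI[OF S chart_at])
  let ?c = "chart_at A (\<gamma> t)"
  interpret M: local_metric "snd ?c ` fst ?c" "gram A g ?c" by (rule local_metric[OF chart_at(1)])
  have x: "snd ?c (\<gamma> t) \<in> snd ?c ` fst ?c" using chart_at by auto
  note l = comps_linear[OF chart_at]
  have ev: "eventually (\<lambda>s. f s *\<^sub>R comps A ?c (\<gamma> s) (V s) = comps A ?c (\<gamma> s) (f s *\<^sub>R V s)) (at t within S)"
    using eventually_chart[OF S chart(1)[OF chart_at(1)] chart_at(2)]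
    by eventually_elim (use linear_scale[OF comps_linear] chart_at in auto)
  have f: "(f has_field_derivative f') (at t within S)"
    using f by (simp add: has_real_derivative_iff_has_vector_derivative)
  show "((\<lambda>s. comps A ?c (\<gamma> s) (f s *\<^sub>R V s)) has_vector_derivative
     comps A ?c (\<gamma> t) (f' *\<^sub>R V t + f t *\<^sub>R w) -
     Gam (gram A g ?c) (snd ?c (\<gamma> t)) (comps A ?c (\<gamma> t) (vel A \<gamma> t)) (comps A ?c (\<gamma> t) (f t *\<^sub>R V t))) (at t within S)"
    by (rule has_vector_derivative_eq_rhs[OF has_vector_derivative_eventually[OF
          has_vector_derivative_scaleR[OF f covdD[OF V chart_at]] ev]])
       (simp_all add: linear_add[OF l] linear_scale[OF l] M.Gam_simps[OF x] algebra_simps)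
qed

lemma covd_add:
  assumes S: "S \<subseteq> {0..1}" "t \<in> S" and V: "covd \<gamma> S V t v" and W: "covd \<gamma> S W t w"
  shows "covd \<gamma> S (\<lambda>s. V s + W s) t (v + w)"
proof (rule covdI[OF S chart_at])
  let ?c = "chart_at A (\<gamma> t)"
  interpret M: local_metric "snd ?c ` fst ?c" "gram A g ?c" by (rule local_metric[OF chart_at(1)])
  have x: "snd ?c (\<gamma> t) \<in> snd ?c ` fst ?c" using chart_at by auto
  note l = comps_linear[OF chart_at]
  have ev: "eventually (\<lambda>s. comps A ?c (\<gamma> s) (V s) + comps A ?c (\<gamma> s) (W s) = comps A ?c (\<gamma> s) (V s + W s)) (at t within S)"
    using eventually_chart[OF S chart(1)[OF chart_at(1)] chart_at(2)]
    by eventually_elim (use linear_add[OF comps_linear] chart_at in auto)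
  show "((\<lambda>s. comps A ?c (\<gamma> s) (V s + W s)) has_vector_derivative comps A ?c (\<gamma> t) (v + w) -
     Gam (gram A g ?c) (snd ?c (\<gamma> t)) (comps A ?c (\<gamma> t) (vel A \<gamma> t)) (comps A ?c (\<gamma> t) (V t + W t))) (at t within S)"
    by (rule has_vector_derivative_eq_rhs[OF has_vector_derivative_eventually[OF
          has_vector_derivative_add[OF covdD[OF V chart_at] covdD[OF W chart_at]] ev]])
       (simp_all add: linear_add[OF l] M.Gam_simps[OF x] algebra_simps)
qed

lemma covd_zero: "S \<subseteq> {0..1} \<Longrightarrow> t \<in> S \<Longrightarrow> covd \<gamma> S (\<lambda>s. 0) t 0"
proof -
  assume S: "S \<subseteq> {0..1}" "t \<in> S"
  let ?c = "chart_at A (\<gamma> t)"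
  interpret M: local_metric "snd ?c ` fst ?c" "gram A g ?c" by (rule local_metric[OF chart_at(1)])
  have x: "snd ?c (\<gamma> t) \<in> snd ?c ` fst ?c" using chart_at by auto
  show ?thesis
  proof (rule covdI[OF S chart_at])
    have ev: "eventually (\<lambda>s. 0 = comps A ?c (\<gamma> s) 0) (at t within S)"
      using eventually_chart[OF S chart(1)[OF chart_at(1)] chart_at(2)]
      by eventually_elim (use linear_0[OF comps_linear] chart_at in auto)
    show "((\<lambda>s. comps A ?c (\<gamma> s) 0) has_vector_derivative comps A ?c (\<gamma> t) 0 -
     Gam (gram A g ?c) (snd ?c (\<gamma> t)) (comps A ?c (\<gamma> t) (vel A \<gamma> t)) (comps A ?c (\<gamma> t) 0)) (at t within S)"
      by (rule has_vector_derivative_eq_rhs[OF has_vector_derivative_eventually[OF has_vector_derivative_const[of 0] ev]])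
         (simp_all add: linear_0[OF comps_linear[OF chart_at]] linear_0[OF M.Gam_linear(1)[OF x]])
  qed
qed

lemma covd_sum:
  assumes S: "S \<subseteq> {0..1}" "t \<in> S" and V: "\<And>i. i \<in> I \<Longrightarrow> covd \<gamma> S (V i) t (w i)"
  shows "covd \<gamma> S (\<lambda>s. \<Sum>i\<in>I. V i s) t (\<Sum>i\<in>I. w i)"
  using V
proof (induction I rule: infinite_finite_induct)
  case (insert i I)
  then show ?case using covd_add[OF S, of "V i" "w i" "\<lambda>s. \<Sum>i\<in>I. V i s"] by simp
qed (use covd_zero[OF S] in simp_all)

text \<open>By metric compatibility the derivative of the Gram matrix along the curve equals the two
  Christoffel terms by which ordinary and covariant derivatives of V and W differ.\<close>

lemma covd_metric:
  assumes S: "S \<subseteq> {0..1}" "t \<in> S" and V: "covd \<gamma> S V t v" and W: "covd \<gamma> S W t w"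
  shows "((\<lambda>s. g (\<gamma> s) (V s) (W s)) has_vector_derivative g (\<gamma> t) v (W t) + g (\<gamma> t) (V t) w) (at t within S)"
proof -
  let ?c = "chart_at A (\<gamma> t)"
  let ?G = "gram A g ?c" and ?x = "\<lambda>s. snd ?c (\<gamma> s)"
  interpret M: local_metric "snd ?c ` fst ?c" ?G by (rule local_metric[OF chart_at(1)])
  have x: "?x t \<in> snd ?c ` fst ?c" using chart_at by auto
  have ev: "eventually (\<lambda>s. gm (\<lambda>s. ?G (?x s)) s (comps A ?c (\<gamma> s) (V s)) (comps A ?c (\<gamma> s) (W s)) = g (\<gamma> s) (V s) (W s)) (at t within S)"
    using eventually_chart[OF S chart(1)[OF chart_at(1)] chart_at(2)]
    by eventually_elim (use g_gram[OF chart_at(1)] in \<open>simp add: gm_def\<close>)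
  have gg: "g (\<gamma> t) a b = gm ?G (?x t) a b" for a b
    using g_gram[OF chart_at, of "\<gamma> t" a b] by (simp add: comps_chart_at)
  have gm': "gm (\<lambda>s. ?G (?x s)) t a b = gm ?G (?x t) a b" for a b by (simp add: gm_def)
  show ?thesis
    by (rule has_vector_derivative_eq_rhs[OF has_vector_derivative_eventually[OF
          gm_has_vector_derivative[OF dd_compose_curve[OF M.diff_G(1)[OF x] vel_chart_subset[OF S chart_at]]
          covdD[OF V chart_at] covdD[OF W chart_at]] ev]])
       (use M.Gam_compat[OF x, of "vel A \<gamma> t" "V t" "W t"] in \<open>simp_all add: gg gm' comps_chart_at gm_simps gm_def[of "dd ?G _", symmetric]\<close>)
qed

lemma covd_cov_deriv:
  assumes t: "t \<in> {0..1}" and "covd \<gamma> {0..1} V t w"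
  shows "cov_deriv A g \<gamma> V t = w"
proof -
  have "((\<lambda>s. comps A (chart_at A (\<gamma> t)) (\<gamma> s) (V s)) has_vector_derivative
    (w - Gam (gram A g (chart_at A (\<gamma> t))) (snd (chart_at A (\<gamma> t)) (\<gamma> t)) (vel A \<gamma> t) (V t))) (at t within {0..1})"
    using covdD[OF assms(2) chart_at] by (simp add: comps_chart_at)
  from vector_derivative_within_cbox[of 0 1 t, OF _ _ this[folded box_real(2)]] t show ?thesis
    unfolding cov_deriv_def Let_def christoffel_Gam by simp
qed

lemma differentiable_along_covd:
  assumes "differentiable_along A \<gamma> V" and t: "t \<in> {0..1}"
  shows "covd \<gamma> {0..1} V t (cov_deriv A g \<gamma> V t)"
proof (rule covdI[OF subset_refl t chart_at])
  have "(\<lambda>s. comps A (chart_at A (\<gamma> t)) (\<gamma> s) (V s)) differentiable (at t within {0..1})"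
    using assms chart_at unfolding differentiable_along_def by blast
  then show "((\<lambda>s. comps A (chart_at A (\<gamma> t)) (\<gamma> s) (V s)) has_vector_derivative
     comps A (chart_at A (\<gamma> t)) (\<gamma> t) (cov_deriv A g \<gamma> V t) -
     Gam (gram A g (chart_at A (\<gamma> t))) (snd (chart_at A (\<gamma> t)) (\<gamma> t))
      (comps A (chart_at A (\<gamma> t)) (\<gamma> t) (vel A \<gamma> t)) (comps A (chart_at A (\<gamma> t)) (\<gamma> t) (V t))) (at t within {0..1})"
    unfolding comps_chart_at cov_deriv_def Let_def christoffel_Gam by (simp add: vector_derivative_works)
qed

lemma differentiable_alongI:
  assumes "\<And>t. t \<in> {0..1} \<Longrightarrow> covd \<gamma> {0..1} V t (W t)"
  shows "differentiable_along A \<gamma> V"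
  unfolding differentiable_along_def using covdD[OF assms] differentiableI_vector by blast

lemma covd_continuous:
  assumes "\<And>t. t \<in> S \<Longrightarrow> covd \<gamma> S V t (w t)" "c \<in> A" "\<gamma> ` S \<subseteq> fst c"
  shows "continuous_on S (\<lambda>s. comps A c (\<gamma> s) (V s))"
  unfolding continuous_on_eq_continuous_within
proof
  fix t assume t: "t \<in> S"
  then have "\<gamma> t \<in> fst c" using assms(3) by auto
  from covdD[OF assms(1)[OF t] assms(2) this] show "continuous (at t within S) (\<lambda>s. comps A c (\<gamma> s) (V s))"
    by (rule has_vector_derivative_continuous)
qed

lemma chart_continuous: "c \<in> A \<Longrightarrow> S \<subseteq> {0..1} \<Longrightarrow> \<gamma> ` S \<subseteq> fst c \<Longrightarrow> continuous_on S (\<lambda>s. snd c (\<gamma> s))"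
  by (rule continuous_on_compose2[OF homeomorphism_cont1[OF chart(3)] continuous_on_subset[OF cont_\<gamma>]])

end

section \<open>Geodesics and parallel frames\<close>

locale lorentz_geodesic = lorentz_curve +
  assumes geod: "geodesic A g \<gamma>"
begin

lemma covd_vel: "t \<in> {0..1} \<Longrightarrow> covd \<gamma> {0..1} (vel A \<gamma>) t 0"
  using geod differentiable_along_covd[of "vel A \<gamma>" t] unfolding geodesic_def by simp

lemma vel_continuous: "c \<in> A \<Longrightarrow> S \<subseteq> {0..1} \<Longrightarrow> \<gamma> ` S \<subseteq> fst c \<Longrightarrow> continuous_on S (\<lambda>s. comps A c (\<gamma> s) (vel A \<gamma> s))"
  by (rule covd_continuous[where w="\<lambda>_. 0"]) (rule covd_subset[OF covd_vel], auto)

lemma Gam_along_continuous: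
  assumes c: "c \<in> A" and S: "S \<subseteq> {0..1}" "\<gamma> ` S \<subseteq> fst c" and v: "continuous_on S v"
  shows "continuous_on S (\<lambda>t. Gam (gram A g c) (snd c (\<gamma> t)) (comps A c (\<gamma> t) (vel A \<gamma> t)) (v t))"
proof -
  interpret M: local_metric "snd c ` fst c" "gram A g c" by (rule local_metric[OF c])
  have x: "snd c (\<gamma> t) \<in> snd c ` fst c" if "t \<in> S" for t using S that by auto
  have 0: "continuous_on S (\<lambda>t. Gam (gram A g c) (snd c (\<gamma> t)) a b)" for a b
    by (rule continuous_on_compose2[OF M.Gam_continuous chart_continuous[OF c S]]) (use x in auto)
  have 1: "continuous_on S (\<lambda>t. Gam (gram A g c) (snd c (\<gamma> t)) a (v t))" for a
    by (rule linear_family_continuous[OF M.Gam_linear(1)[OF x] 0 v])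
  show ?thesis
    by (rule linear_family_continuous[where A="\<lambda>t a. Gam (gram A g c) (snd c (\<gamma> t)) a (v t)",
          OF M.Gam_linear(2)[OF x] 1 vel_continuous[OF c S]])
qed

lemma parallel_exists_local:
  assumes c: "c \<in> A" and S: "{a..b} \<subseteq> {0..1}" "\<gamma> ` {a..b} \<subseteq> fst c" and "a \<le> b"
  shows "\<exists>V. V a = v \<and> (\<forall>t\<in>{a..b}. covd \<gamma> {a..b} V t 0)"
proof -
  interpret M: local_metric "snd c ` fst c" "gram A g c" by (rule local_metric[OF c])
  have x: "snd c (\<gamma> t) \<in> snd c ` fst c" "\<gamma> t \<in> fst c" if "t \<in> {a..b}" for t
    using S(2) that by blast+
  let ?A = "\<lambda>t v. - Gam (gram A g c) (snd c (\<gamma> t)) (comps A c (\<gamma> t) (vel A \<gamma> t)) v"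
  have l: "linear (?A t)" if "t \<in> {a..b}" for t
    using linear_compose_neg[OF M.Gam_linear(1)[OF x(1)[OF that]]] .
  have cont: "continuous_on {a..b} (\<lambda>t. ?A t v)" for v
    by (intro continuous_on_minus Gam_along_continuous c S continuous_on_const)
  obtain z where z: "z a = comps A c (\<gamma> a) v" "\<And>t. t \<in> {a..b} \<Longrightarrow> (z has_vector_derivative ?A t (z t)) (at t within {a..b})"
    using linear_ode_exists[OF \<open>a \<le> b\<close> l cont, of "comps A c (\<gamma> a) v"] by metis
  have V: "comps A c (\<gamma> s) (uncomp c (\<gamma> s) (z s)) = z s" if "s \<in> {a..b}" for s
    using comps_back(1)[OF c x(2)[OF that]] .
  show ?thesis
  proof (intro exI conjI ballI)
    show "uncomp c (\<gamma> a) (z a) = v" using comps_back(2)[OF c, of "\<gamma> a"] x \<open>a \<le> b\<close> z(1) by auto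
    fix t assume t: "t \<in> {a..b}"
    show "covd \<gamma> {a..b} (\<lambda>t. uncomp c (\<gamma> t) (z t)) t 0"
    proof (rule covdI[OF S(1) t c x(2)[OF t]])
      show "((\<lambda>s. comps A c (\<gamma> s) (uncomp c (\<gamma> s) (z s))) has_vector_derivative comps A c (\<gamma> t) 0 -
         Gam (gram A g c) (snd c (\<gamma> t)) (comps A c (\<gamma> t) (vel A \<gamma> t)) (comps A c (\<gamma> t) (uncomp c (\<gamma> t) (z t)))) (at t within {a..b})"
        unfolding V[OF t] linear_0[OF comps_linear[OF c x(2)[OF t]]] diff_0
        by (rule has_vector_derivative_transform[OF t V z(2)[OF t]])
    qed
  qed
qed

text \<open>The curve need not lie in one chart, so local solutions are glued by bisection of [0,1].
  The property of an interval allows an arbitrary initial vector, since the second piece has to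
  start where the first one ends.\<close>

lemma parallel_exists: "\<exists>V. V 0 = v \<and> (\<forall>t\<in>{0..1}. covd \<gamma> {0..1} V t 0)"
proof -
  have "0 \<le> (0::real) \<and> 1 \<le> (1::real) \<longrightarrow> (\<forall>v. \<exists>V. V 0 = v \<and> (\<forall>t\<in>{0..1}. covd \<gamma> {0..1} V t 0))"
  proof (rule Bolzano[where P="\<lambda>a b. 0 \<le> a \<and> a \<le> b \<and> b \<le> 1 \<longrightarrow> (\<forall>v. \<exists>V. V a = v \<and> (\<forall>t\<in>{a..b}. covd \<gamma> {a..b} V t 0))", THEN impE])
    fix a b c :: real
    assume P: "0 \<le> a \<and> a \<le> b \<and> b \<le> 1 \<longrightarrow> (\<forall>v. \<exists>V. V a = v \<and> (\<forall>t\<in>{a..b}. covd \<gamma> {a..b} V t 0))"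
      "0 \<le> b \<and> b \<le> c \<and> c \<le> 1 \<longrightarrow> (\<forall>v. \<exists>V. V b = v \<and> (\<forall>t\<in>{b..c}. covd \<gamma> {b..c} V t 0))" and abc: "a \<le> b" "b \<le> c"
    show "0 \<le> a \<and> a \<le> c \<and> c \<le> 1 \<longrightarrow> (\<forall>v. \<exists>V. V a = v \<and> (\<forall>t\<in>{a..c}. covd \<gamma> {a..c} V t 0))"
    proof (intro impI allI)
      fix v assume ac: "0 \<le> a \<and> a \<le> c \<and> c \<le> 1"
      obtain V1 where V1: "V1 a = v" "\<forall>t\<in>{a..b}. covd \<gamma> {a..b} V1 t 0" using P(1) ac abc by force
      obtain V2 where V2: "V2 b = V1 b" "\<forall>t\<in>{b..c}. covd \<gamma> {b..c} V2 t 0" using P(2) ac abc by force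
      let ?V = "\<lambda>t. if t \<le> b then V1 t else V2 t"
      show "\<exists>V. V a = v \<and> (\<forall>t\<in>{a..c}. covd \<gamma> {a..c} V t 0)"
      proof (intro exI[of _ ?V] conjI ballI)
        show "?V a = v" using V1 abc by simp
        fix t assume t: "t \<in> {a..c}"
        show "covd \<gamma> {a..c} ?V t 0"
        proof (rule covd_join[OF abc t])
          assume "t \<le> b"
          then show "covd \<gamma> {a..b} ?V t 0" using covd_cong[of "{a..b}" V1 t 0 ?V] V1 t by auto
        next
          assume "b \<le> t"
          moreover have "V2 s = ?V s" if "s \<in> {b..c}" for s using that V2(1) by (cases "s = b") auto
          ultimately show "covd \<gamma> {b..c} ?V t 0" using covd_cong[of "{b..c}" V2 t 0 ?V] V2(2) t by auto
        qed
      qed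
    qed
  next
    fix x :: real assume x: "0 \<le> x" "x \<le> 1"
    let ?c = "chart_at A (\<gamma> x)"
    have "eventually (\<lambda>s. \<gamma> s \<in> fst ?c) (at x within {0..1})"
      using eventually_chart[OF subset_refl _ chart(1)[OF chart_at(1)] chart_at(2)] x by auto
    then obtain d where d: "d > 0" "\<And>s. s \<in> {0..1} \<Longrightarrow> s \<noteq> x \<Longrightarrow> dist s x < d \<Longrightarrow> \<gamma> s \<in> fst ?c"
      unfolding eventually_at by blast
    have d2: "\<gamma> s \<in> fst ?c" if "s \<in> {0..1}" "dist s x < d" for s
      using d(2)[of s] that chart_at(2) by (cases "s = x") auto
    show "\<exists>d>0. \<forall>a b. a \<le> x \<and> x \<le> b \<and> b - a < d \<longrightarrow>
       (0 \<le> a \<and> a \<le> b \<and> b \<le> 1 \<longrightarrow> (\<forall>v. \<exists>V. V a = v \<and> (\<forall>t\<in>{a..b}. covd \<gamma> {a..b} V t 0)))"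
    proof (intro exI[of _ d] conjI allI impI d(1))
      fix a b v assume ab: "a \<le> x \<and> x \<le> b \<and> b - a < d" "0 \<le> a \<and> a \<le> b \<and> b \<le> 1"
      show "\<exists>V. V a = v \<and> (\<forall>t\<in>{a..b}. covd \<gamma> {a..b} V t 0)"
        by (rule parallel_exists_local[OF chart_at(1)[of "\<gamma> x"]]) (use ab d2 in \<open>auto simp: dist_real_def\<close>)
    qed
  qed auto
  then show ?thesis by simp
qed

text \<open>Parallel transport from time 0. Linearity is demanded at every real time, also outside
  [0,1], so that it can be used without a side condition.\<close>

definition frame :: "real \<Rightarrow> real^'b \<Rightarrow> real^'b" where
  "frame = (SOME E. (\<forall>t. linear (E t)) \<and> (\<forall>x. E 0 x = x) \<and>
     (\<forall>x. \<forall>t\<in>{0..1}. covd \<gamma> {0..1} (\<lambda>s. E s x) t 0))"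

lemma frame: "linear (frame t)" "frame 0 x = x" "t \<in> {0..1} \<Longrightarrow> covd \<gamma> {0..1} (\<lambda>s. frame s x) t 0"
proof -
  have "\<forall>i. \<exists>V. V 0 = axis i 1 \<and> (\<forall>t\<in>{0..1}. covd \<gamma> {0..1} V t 0)" using parallel_exists by blast
  then obtain V where V: "\<And>i. V i 0 = axis i 1" "\<And>i t. t \<in> {0..1} \<Longrightarrow> covd \<gamma> {0..1} (V i) t 0" by metis
  let ?E = "\<lambda>t x. \<Sum>i\<in>UNIV. x $ i *\<^sub>R V i t"
  have "(\<forall>t. linear (?E t)) \<and> (\<forall>x. ?E 0 x = x) \<and> (\<forall>x. \<forall>t\<in>{0..1}. covd \<gamma> {0..1} (\<lambda>s. ?E s x) t 0)"
  proof (intro conjI allI ballI)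
    show "linear (?E t)" for t by (rule linearI) (simp_all add: scaleR_add_left sum.distrib scaleR_sum_right)
    show "?E 0 x = x" for x unfolding V(1) by (rule vec_expand[symmetric])
    fix x t assume t: "t \<in> {0..1::real}"
    have "covd \<gamma> {0..1} (\<lambda>s. x $ i *\<^sub>R V i s) t (0 *\<^sub>R V i t + x $ i *\<^sub>R 0)" for i
      by (rule covd_scaleR[OF subset_refl t V(2)[OF t] has_vector_derivative_const])
    then show "covd \<gamma> {0..1} (\<lambda>s. ?E s x) t 0"
      using covd_sum[OF subset_refl t, of UNIV "\<lambda>i s. x $ i *\<^sub>R V i s" "\<lambda>_. 0"] by simp
  qed
  from someI[of "\<lambda>E. (\<forall>t. linear (E t)) \<and> (\<forall>x. E 0 x = x) \<and> (\<forall>x. \<forall>t\<in>{0..1}. covd \<gamma> {0..1} (\<lambda>s. E s x) t 0)", OF this]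
  show "linear (frame t)" "frame 0 x = x" "t \<in> {0..1} \<Longrightarrow> covd \<gamma> {0..1} (\<lambda>s. frame s x) t 0"
    unfolding frame_def by blast+
qed

lemma frame_isometry: "t \<in> {0..1} \<Longrightarrow> g (\<gamma> t) (frame t x) (frame t y) = g (\<gamma> 0) x y"
proof -
  assume t: "t \<in> {0..1}"
  have "((\<lambda>s. g (\<gamma> s) (frame s x) (frame s y)) has_vector_derivative 0) (at t within {0..1})" if "t \<in> {0..1}" for t
    using covd_metric[OF subset_refl that frame(3)[OF that] frame(3)[OF that]] by (simp add: g_simps)
  then obtain c where "\<And>t. t \<in> {0..1} \<Longrightarrow> g (\<gamma> t) (frame t x) (frame t y) = c"
    using has_vector_derivative_zero_constant[OF convex_real_interval(5)] by blast
  then have "g (\<gamma> t) (frame t x) (frame t y) = g (\<gamma> 0) (frame 0 x) (frame 0 y)" using t by force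
  then show ?thesis by (simp add: frame(2))
qed

lemma frame_bij: "t \<in> {0..1} \<Longrightarrow> bij (frame t)"
proof -
  assume t: "t \<in> {0..1}"
  have "inj (frame t)"
    unfolding linear_injective_0[OF frame(1)]
  proof (intro allI impI)
    fix x assume "frame t x = 0"
    then have "g (\<gamma> 0) x y = g (\<gamma> 0) 0 y" for y using frame_isometry[OF t, of x y] by (simp add: g_simps)
    then show "x = 0" by (rule g_eqI)
  qed
  then show ?thesis using eucl.linear_inj_imp_surj[OF frame(1)] by (auto simp: bij_def)
qed

definition unframe :: "real \<Rightarrow> real^'b \<Rightarrow> real^'b" where "unframe t = inv (frame t)"

lemma unframe: "t \<in> {0..1} \<Longrightarrow> frame t (unframe t v) = v" "t \<in> {0..1} \<Longrightarrow> unframe t (frame t v) = v"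
  unfolding unframe_def using frame_bij[of t] by (auto simp: bij_def surj_f_inv_f)

lemma unframe_linear: "t \<in> {0..1} \<Longrightarrow> linear (unframe t)"
proof (rule linearI)
  assume t: "t \<in> {0..1}"
  fix v w c
  have "frame t (unframe t v + unframe t w) = v + w"
    using linear_add[OF frame(1), of t "unframe t v" "unframe t w"] by (simp add: unframe(1)[OF t])
  then show "unframe t (v + w) = unframe t v + unframe t w"
    using unframe(2)[OF t, of "unframe t v + unframe t w"] by simp
  have "frame t (c *\<^sub>R unframe t v) = c *\<^sub>R v"
    using linear_scale[OF frame(1), of t c "unframe t v"] by (simp add: unframe(1)[OF t])
  then show "unframe t (c *\<^sub>R v) = c *\<^sub>R unframe t v"
    using unframe(2)[OF t, of "c *\<^sub>R unframe t v"] by simp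
qed

lemma unframe_isometry: "t \<in> {0..1} \<Longrightarrow> g (\<gamma> 0) (unframe t v) y = g (\<gamma> t) v (frame t y)"
  using frame_isometry[of t "unframe t v" y] by (simp add: unframe)

end

context lorentz
begin

text \<open>The map from vectors to functionals given by the indefinite form is injective, hence
  surjective by dimension. Limits can therefore be tested by pairing with fixed vectors through
  \<open>g\<close>.\<close>

lemma g_represents: "\<exists>y. \<forall>x. g p x y = x \<bullet> z"
proof -
  let ?T = "\<lambda>y. \<Sum>i\<in>UNIV. g p (axis i 1) y *\<^sub>R axis i (1::real)"
  have T: "x \<bullet> ?T y = g p x y" for x y
  proof -
    have "g p x y = g p (\<Sum>i\<in>UNIV. x $ i *\<^sub>R axis i 1) y" using vec_expand[of x] by simp
    also have "\<dots> = (\<Sum>i\<in>UNIV. x $ i * g p (axis i 1) y)"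
      using g_bilinear[of p] unfolding bilinear_def by (simp add: linear_sum[of "\<lambda>x. g p x y"] linear_scale[of "\<lambda>x. g p x y"])
    finally show ?thesis by (simp add: inner_vec_def sum_axis_nth del: sum_component)
  qed
  have lin: "linear ?T" by (rule linearI) (simp_all add: g_simps scaleR_add_left sum.distrib scaleR_sum_right)
  have "inj ?T" unfolding linear_injective_0[OF lin]
  proof (intro allI impI)
    fix y assume "?T y = 0"
    then have "g p y x = g p 0 x" for x using T[of x y] by (simp add: g_simps g_sym[of p y])
    then show "y = 0" by (rule g_eqI)
  qed
  then obtain y where "z = ?T y" using eucl.linear_inj_imp_surj[OF lin] by (meson surjD)
  then have "\<forall>x. g p x y = x \<bullet> z" using T by simp
  then show ?thesis by blast
qed

lemma g_has_vector_derivativeI: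
  assumes "\<And>y. ((\<lambda>s. g p (x s) y) has_vector_derivative g p x' y) (at t within S)"
  shows "(x has_vector_derivative x') (at t within S)"
  unfolding has_vector_derivative_def
proof (subst has_derivative_componentwise_within, intro ballI)
  fix i :: "real^'n" assume "i \<in> Basis"
  obtain y where "\<And>x. g p x y = x \<bullet> i" using g_represents by blast
  then show "((\<lambda>x'. x x' \<bullet> i) has_derivative (\<lambda>x. (x *\<^sub>R x') \<bullet> i)) (at t within S)"
    using assms[of y] by (simp add: has_vector_derivative_def)
qed

lemma g_continuous_onI:
  assumes "\<And>y. continuous_on S (\<lambda>s. g p (x s) y)"
  shows "continuous_on S x"
proof -
  have "continuous_on S (\<lambda>s. x s \<bullet> i)" for i
  proof -
    obtain y where "\<And>x. g p x y = x \<bullet> i" using g_represents by blast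
    then show ?thesis using assms[of y] by simp
  qed
  then have "continuous_on S (\<lambda>s. \<Sum>i\<in>Basis. (x s \<bullet> i) *\<^sub>R i)"
    by (intro continuous_on_sum continuous_on_scaleR continuous_on_const)
  then show ?thesis by (simp only: euclidean_representation)
qed

end

context lorentz_geodesic
begin

text \<open>The frame vectors are parallel, so only the coefficients are differentiated.\<close>

lemma covd_frame:
  assumes S: "S \<subseteq> {0..1}" "t \<in> S" and x: "(x has_vector_derivative x') (at t within S)"
  shows "covd \<gamma> S (\<lambda>s. frame s (x s)) t (frame t x')"
proof -
  have e: "frame s y = (\<Sum>i\<in>UNIV. y $ i *\<^sub>R frame s (axis i 1))" for s y
  proof -
    have "frame s y = frame s (\<Sum>i\<in>UNIV. y $ i *\<^sub>R axis i 1)" using vec_expand[of y] by simp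
    then show ?thesis by (simp add: linear_sum[OF frame(1)] linear_scale[OF frame(1)])
  qed
  have t: "t \<in> {0..1}" using S by auto
  have "covd \<gamma> S (\<lambda>s. x s $ i *\<^sub>R frame s (axis i 1)) t (x' $ i *\<^sub>R frame t (axis i 1) + x t $ i *\<^sub>R 0)" for i
    by (rule covd_scaleR[OF S covd_subset[OF frame(3)[OF t] S(1)]])
       (rule bounded_linear.has_vector_derivative[OF bounded_linear_vec_nth x])
  then have "covd \<gamma> S (\<lambda>s. \<Sum>i\<in>UNIV. x s $ i *\<^sub>R frame s (axis i 1)) t (\<Sum>i\<in>UNIV. x' $ i *\<^sub>R frame t (axis i 1))"
    using covd_sum[OF S, of UNIV "\<lambda>i s. x s $ i *\<^sub>R frame s (axis i 1)" "\<lambda>i. x' $ i *\<^sub>R frame t (axis i 1)"] by simp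
  then show ?thesis unfolding e[symmetric] .
qed

text \<open>Pairing with parallel vectors reduces the claim to the product rule for the metric; the
  inverse of the frame is never differentiated.\<close>

lemma covd_unframe:
  assumes S: "S \<subseteq> {0..1}" "t \<in> S" and V: "covd \<gamma> S V t w"
  shows "((\<lambda>s. unframe s (V s)) has_vector_derivative unframe t w) (at t within S)"
proof (rule g_has_vector_derivativeI[of "\<gamma> 0"])
  fix y
  have t: "t \<in> {0..1}" using S by auto
  have "((\<lambda>s. g (\<gamma> s) (V s) (frame s y)) has_vector_derivative g (\<gamma> t) w (frame t y)) (at t within S)"
    using covd_metric[OF S V covd_subset[OF frame(3)[OF t, of y] S(1)]] by (simp add: g_simps)
  then have "((\<lambda>s. g (\<gamma> s) (V s) (frame s y)) has_vector_derivative g (\<gamma> 0) (unframe t w) y) (at t within S)"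
    by (simp add: unframe_isometry[OF t])
  then show "((\<lambda>s. g (\<gamma> 0) (unframe s (V s)) y) has_vector_derivative g (\<gamma> 0) (unframe t w) y) (at t within S)"
    by (rule has_vector_derivative_transform[OF S(2), rotated]) (use S unframe_isometry in auto)
qed

text \<open>The Jacobi operator in the frame. With the sign convention of \<open>curvature\<close>
  the Jacobi equation reads x'' = \<open>Rf t x\<close>.\<close>

definition Rf :: "real \<Rightarrow> real^'b \<Rightarrow> real^'b" where
  "Rf t x = unframe t (curvature A g (\<gamma> t) (vel A \<gamma> t) (frame t x) (vel A \<gamma> t))"

lemma Rf_linear: "t \<in> {0..1} \<Longrightarrow> linear (Rf t)"
  unfolding Rf_def[abs_def]
  using linear_compose[OF linear_compose[OF frame(1) curvature_linear(2)] unframe_linear] by (simp add: o_def)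

lemma Rf_sym: "t \<in> {0..1} \<Longrightarrow> g (\<gamma> 0) (Rf t x) y = g (\<gamma> 0) x (Rf t y)"
  unfolding Rf_def g_sym[of _ x] unframe_isometry by (rule curvature_pair_sym)

lemma frame_Rf: "t \<in> {0..1} \<Longrightarrow> frame t (Rf t x) = curvature A g (\<gamma> t) (vel A \<gamma> t) (frame t x) (vel A \<gamma> t)"
  unfolding Rf_def by (rule unframe)

text \<open>Coordinate vectors jump with the preferred chart. Continuity is therefore tested on the
  scalars g(R x, y), which near each time can be computed in a single chart, one argument of the
  curvature after the other.\<close>

lemma Rf_continuous: "continuous_on {0..1} (\<lambda>t. Rf t x)"
proof (rule g_continuous_onI[where p="\<gamma> 0"])
  fix y
  let ?h = "\<lambda>t. g (\<gamma> t) (curvature A g (\<gamma> t) (vel A \<gamma> t) (frame t x) (vel A \<gamma> t)) (frame t y)"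
  have "continuous_on {0..1} ?h"
    unfolding continuous_on_eq_continuous_within
  proof
    fix t0 :: real assume t0: "t0 \<in> {0..1}"
    let ?c = "chart_at A (\<gamma> t0)"
    interpret M: local_metric "snd ?c ` fst ?c" "gram A g ?c" by (rule local_metric[OF chart_at(1)])
    let ?G = "gram A g ?c" and ?x = "\<lambda>t. snd ?c (\<gamma> t)"
    \<comment> \<open>A relative neighbourhood of \<open>t0\<close> in [0,1], so that continuity on
      T gives continuity at \<open>t0\<close>.\<close>
    define T where "T = {t\<in>{0..1}. \<gamma> t \<in> fst ?c}"
    have T: "T \<subseteq> {0..1}" "\<gamma> ` T \<subseteq> fst ?c" "t0 \<in> T" using t0 chart_at by (auto simp: T_def)
    have inx: "?x t \<in> snd ?c ` fst ?c" if "t \<in> T" for t using T that by auto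
    note cx = chart_continuous[OF chart_at(1) T(1,2)]
    note cu = vel_continuous[OF chart_at(1) T(1,2)]
    have cE: "continuous_on T (\<lambda>t. comps A ?c (\<gamma> t) (frame t z))" for z
      by (rule covd_continuous[where w="\<lambda>_. 0", OF _ chart_at(1) T(2)]) (rule covd_subset[OF frame(3)], use T in auto)
    have 0: "continuous_on T (\<lambda>t. Rm ?G (?x t) a b d)" for a b d
      by (rule continuous_on_compose2[OF M.Rm_continuous cx]) (use inx in auto)
    have 1: "continuous_on T (\<lambda>t. Rm ?G (?x t) a b (comps A ?c (\<gamma> t) (vel A \<gamma> t)))" for a b
      by (rule linear_family_continuous[OF M.Rm_linear(3)[OF inx] 0 cu])
    have 2: "continuous_on T (\<lambda>t. Rm ?G (?x t) a (comps A ?c (\<gamma> t) (frame t x)) (comps A ?c (\<gamma> t) (vel A \<gamma> t)))" for a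
      by (rule linear_family_continuous[where A="\<lambda>t b. Rm ?G (?x t) a b (comps A ?c (\<gamma> t) (vel A \<gamma> t))", OF M.Rm_linear(2)[OF inx] 1 cE])
    have 3: "continuous_on T (\<lambda>t. Rm ?G (?x t) (comps A ?c (\<gamma> t) (vel A \<gamma> t)) (comps A ?c (\<gamma> t) (frame t x)) (comps A ?c (\<gamma> t) (vel A \<gamma> t)))"
      by (rule linear_family_continuous[where A="\<lambda>t a. Rm ?G (?x t) a (comps A ?c (\<gamma> t) (frame t x)) (comps A ?c (\<gamma> t) (vel A \<gamma> t))", OF M.Rm_linear(1)[OF inx] 2 cu])
    have cG: "continuous_on T (\<lambda>t. ?G (?x t))"
      by (rule continuous_on_compose2[OF smooth_on_continuous[OF M.smooth_G] cx]) (use inx in auto)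
    have "continuous_on T (\<lambda>t. gm ?G (?x t) (Rm ?G (?x t) (comps A ?c (\<gamma> t) (vel A \<gamma> t)) (comps A ?c (\<gamma> t) (frame t x)) (comps A ?c (\<gamma> t) (vel A \<gamma> t)))
        (comps A ?c (\<gamma> t) (frame t y)))"
      unfolding gm_def by (intro continuous_on_inner 3 bounded_bilinear.continuous_on[OF bounded_bilinear_matrix_vector_mult cG cE])
    then have "continuous_on T ?h"
      by (rule continuous_on_eq) (use T in \<open>simp add: g_gram[OF chart_at(1)[of "\<gamma> t0"]] comps_curvature[OF chart_at(1)] subset_iff image_subset_iff\<close>)
    then have "(?h \<longlongrightarrow> ?h t0) (at t0 within T)" using T(3) unfolding continuous_on_def by blast
    moreover have "at t0 within T = at t0 within {0..1}"
    proof -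
      have "eventually (\<lambda>s. s \<in> {0..1} \<longrightarrow> s \<in> T) (nhds t0)"
        using eventually_chart[OF subset_refl t0 chart(1)[OF chart_at(1)] chart_at(2)] t0 chart_at
        unfolding eventually_at_filter T_def by (auto elim!: eventually_mono)
      then obtain O' where "open O'" "t0 \<in> O'" "\<And>s. s \<in> O' \<Longrightarrow> s \<in> {0..1} \<Longrightarrow> s \<in> T"
        unfolding eventually_nhds by blast
      then show ?thesis using T(1) by (intro at_within_nhd[of t0 O']) auto
    qed
    ultimately show "continuous (at t0 within {0..1}) ?h" by (simp add: continuous_within)
  qed
  then show "continuous_on {0..1} (\<lambda>t. g (\<gamma> 0) (Rf t x) y)"
    by (rule continuous_on_eq) (simp add: Rf_def unframe_isometry)
qed

lemma vel_frame: "t \<in> {0..1} \<Longrightarrow> vel A \<gamma> t = frame t (vel A \<gamma> 0)"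
proof -
  assume t: "t \<in> {0..1}"
  have "((\<lambda>s. unframe s (vel A \<gamma> s)) has_vector_derivative 0) (at t within {0..1})" if t: "t \<in> {0..1}" for t
    using covd_unframe[OF subset_refl t covd_vel[OF t]] linear_0[OF unframe_linear[OF t]] by simp
  then obtain c where "\<And>t. t \<in> {0..1} \<Longrightarrow> unframe t (vel A \<gamma> t) = c"
    using has_vector_derivative_zero_constant[OF convex_real_interval(5)] by blast
  then have "unframe t (vel A \<gamma> t) = unframe 0 (vel A \<gamma> 0)" using t by force
  also have "\<dots> = vel A \<gamma> 0" using unframe(1)[of 0 "vel A \<gamma> 0"] by (simp add: frame(2))
  finally show ?thesis using unframe(1)[OF t] by metis
qed

end

section \<open>The Killing field along a geodesic\<close>

locale lorentz_killing_geodesic = lorentz_geodesic A g \<gamma>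
  for A :: "('m::{t2_space, second_countable_topology}, 'n::finite) chart set" and g and \<gamma> +
  fixes Y :: "'m \<Rightarrow> real^'n"
  assumes kill: "killing_field A g Y"
begin

lemma field_comps_chart: "c \<in> A \<Longrightarrow> p \<in> fst c \<Longrightarrow> field_comps A Y c (snd c p) = comps A c p (Y p)"
  by (simp add: field_comps_def)

definition DY :: "real \<Rightarrow> real^'n" where "DY t = cov_deriv A g \<gamma> (\<lambda>s. Y (\<gamma> s)) t"

lemma covd_Y_nab:
  assumes t: "t \<in> {0..1}" and c: "c \<in> A" "\<gamma> t \<in> fst c"
  shows "covd \<gamma> {0..1} (\<lambda>s. Y (\<gamma> s)) t (uncomp c (\<gamma> t) (local_killing.nab (gram A g c) (field_comps A Y c) (snd c (\<gamma> t)) (comps A c (\<gamma> t) (vel A \<gamma> t))))"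
proof -
  interpret K: local_killing "snd c ` fst c" "gram A g c" "field_comps A Y c" by (rule local_killing[OF kill c(1)])
  have x: "snd c (\<gamma> t) \<in> snd c ` fst c" using c by auto
  show ?thesis
  proof (rule covdI[OF subset_refl t c])
    have ev: "eventually (\<lambda>s. field_comps A Y c (snd c (\<gamma> s)) = comps A c (\<gamma> s) (Y (\<gamma> s))) (at t within {0..1})"
      using eventually_chart[OF subset_refl t chart(1)[OF c(1)] c(2)] by eventually_elim (rule field_comps_chart[OF c(1)])
    show "((\<lambda>s. comps A c (\<gamma> s) (Y (\<gamma> s))) has_vector_derivative
     comps A c (\<gamma> t) (uncomp c (\<gamma> t) (K.nab (snd c (\<gamma> t)) (comps A c (\<gamma> t) (vel A \<gamma> t)))) -
     Gam (gram A g c) (snd c (\<gamma> t)) (comps A c (\<gamma> t) (vel A \<gamma> t)) (comps A c (\<gamma> t) (Y (\<gamma> t)))) (at t within {0..1})"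
      by (rule has_vector_derivative_eq_rhs[OF has_vector_derivative_eventually[OF dd_compose_curve[OF K.diff_Y(1)[OF x] vel_chart[OF t c]] ev]])
         (simp_all add: field_comps_chart[OF c] comps_back[OF c] K.nab_def)
  qed
qed

lemma DY_nab:
  assumes t: "t \<in> {0..1}" and c: "c \<in> A" "\<gamma> t \<in> fst c"
  shows "comps A c (\<gamma> t) (DY t) = local_killing.nab (gram A g c) (field_comps A Y c) (snd c (\<gamma> t)) (comps A c (\<gamma> t) (vel A \<gamma> t))"
  unfolding DY_def covd_cov_deriv[OF t covd_Y_nab[OF t c]] by (rule comps_back(1)[OF c])

lemma covd_Y: "t \<in> {0..1} \<Longrightarrow> covd \<gamma> {0..1} (\<lambda>s. Y (\<gamma> s)) t (DY t)"
  using covd_Y_nab[OF _ chart_at] covd_cov_deriv[OF _ covd_Y_nab[OF _ chart_at]] unfolding DY_def by metis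

text \<open>Skewness of the covariant derivative of \<open>Y\<close>, with the velocity in both
  slots. It makes g(\<gamma>', Y) constant, so that a geodesic satisfies the constraint of the loop
  space.\<close>

lemma g_vel_DY: "t \<in> {0..1} \<Longrightarrow> g (\<gamma> t) (vel A \<gamma> t) (DY t) = 0"
proof -
  assume t: "t \<in> {0..1}"
  let ?c = "chart_at A (\<gamma> t)"
  interpret K: local_killing "snd ?c ` fst ?c" "gram A g ?c" "field_comps A Y ?c" by (rule local_killing[OF kill chart_at(1)])
  have x: "snd ?c (\<gamma> t) \<in> snd ?c ` fst ?c" using chart_at by auto
  let ?u = "comps A ?c (\<gamma> t) (vel A \<gamma> t)"
  have "gm (gram A g ?c) (snd ?c (\<gamma> t)) ?u (K.nab (snd ?c (\<gamma> t)) ?u) = 0"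
    using K.nab_skew[OF x, of ?u ?u] K.gm_sym[OF x, of ?u] by simp
  then show ?thesis unfolding g_gram[OF chart_at, of "\<gamma> t" "vel A \<gamma> t" "DY t"] DY_nab[OF t chart_at] .
qed

text \<open>The Killing field is a Jacobi field: since the velocity is parallel, differentiating the
  covariant derivative of \<open>Y\<close> along \<gamma> leaves the second covariant derivative in
  the velocity direction, which is a curvature term.\<close>

lemma covd_DY:
  assumes t: "t \<in> {0..1}"
  shows "covd \<gamma> {0..1} DY t (curvature A g (\<gamma> t) (vel A \<gamma> t) (Y (\<gamma> t)) (vel A \<gamma> t))"
proof -
  let ?c = "chart_at A (\<gamma> t)"
  interpret K: local_killing "snd ?c ` fst ?c" "gram A g ?c" "field_comps A Y ?c" by (rule local_killing[OF kill chart_at(1)])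
  let ?x = "\<lambda>s. snd ?c (\<gamma> s)" and ?u = "\<lambda>s. comps A ?c (\<gamma> s) (vel A \<gamma> s)"
  have x: "?x t \<in> snd ?c ` fst ?c" using chart_at by auto
  have ev: "eventually (\<lambda>s. \<gamma> s \<in> fst ?c \<and> s \<in> {0..1}) (at t within {0..1})"
    using eventually_chart[OF subset_refl t chart(1)[OF chart_at(1)] chart_at(2)]
    by (rule eventually_elim2[OF _ eventually_at_topological[THEN iffD2]]) (auto intro!: exI[of _ UNIV])
  have "((\<lambda>s. K.nab (?x s) (?u s)) has_vector_derivative
     dd (\<lambda>y. K.nab y (?u t)) (?u t) (?x t) + K.nab (?x t) (comps A ?c (\<gamma> t) 0 - Gam (gram A g ?c) (?x t) (?u t) (?u t))) (at t within {0..1})"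
  proof (rule has_vector_derivative_linear_family_ev[where F="\<lambda>s. K.nab (?x s)" and F'="\<lambda>e. dd (\<lambda>y. K.nab y e) (?u t) (?x t)",
        OF _ _ _ t _ covdD[OF covd_vel[OF t] chart_at]])
    show "eventually (\<lambda>s. linear (K.nab (?x s))) (at t within {0..1})"
      using ev by eventually_elim (auto intro: K.nab_linear)
    show "linear (K.nab (?x t))" by (rule K.nab_linear[OF x])
    show "linear (\<lambda>e. dd (\<lambda>y. K.nab y e) (?u t) (?x t))"
      by (rule dd_linear_in_param[OF K.open_U x K.nab_linear K.nab_dd(1)[OF x]])
    show "((\<lambda>s. K.nab (?x s) e) has_vector_derivative dd (\<lambda>y. K.nab y e) (?u t) (?x t)) (at t within {0..1})" for e
      by (rule dd_compose_curve[OF K.nab_dd(1)[OF x] vel_chart[OF t chart_at]])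
  qed
  moreover have "eventually (\<lambda>s. K.nab (?x s) (?u s) = comps A ?c (\<gamma> s) (DY s)) (at t within {0..1})"
    using ev by eventually_elim (use DY_nab chart_at(1) in simp)
  ultimately have D: "((\<lambda>s. comps A ?c (\<gamma> s) (DY s)) has_vector_derivative
     dd (\<lambda>y. K.nab y (?u t)) (?u t) (?x t) + K.nab (?x t) (comps A ?c (\<gamma> t) 0 - Gam (gram A g ?c) (?x t) (?u t) (?u t))) (at t within {0..1})"
    by (rule has_vector_derivative_eventually) (use DY_nab[OF t chart_at] in simp)
  have "dd (\<lambda>y. K.nab y (?u t)) (?u t) (?x t) + K.nab (?x t) (comps A ?c (\<gamma> t) 0 - Gam (gram A g ?c) (?x t) (?u t) (?u t))
    = K.nab2 (?x t) (?u t) (?u t) - Gam (gram A g ?c) (?x t) (?u t) (comps A ?c (\<gamma> t) (DY t))"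
    unfolding K.nab2_def DY_nab[OF t chart_at] linear_0[OF comps_linear[OF chart_at]] diff_0
    by (simp add: linear_neg[OF K.nab_linear[OF x]])
  also have "K.nab2 (?x t) (?u t) (?u t) = comps A ?c (\<gamma> t) (curvature A g (\<gamma> t) (vel A \<gamma> t) (Y (\<gamma> t)) (vel A \<gamma> t))"
    unfolding K.nab2_Rm[OF x] comps_curvature[OF chart_at] field_comps_chart[OF chart_at] ..
  finally show ?thesis using covdI[OF subset_refl t chart_at] D by simp
qed

end

section \<open>The Sobolev class in terms of weak derivatives\<close>

lemma AE_lebesgue_on_iff:
  fixes S :: "'a::euclidean_space set"
  assumes S: "S \<in> sets lebesgue"
  shows "(AE t in lebesgue_on S. P t) \<longleftrightarrow> (\<exists>N. negligible N \<and> (\<forall>t\<in>S - N. P t))"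
proof
  assume "AE t in lebesgue_on S. P t"
  then obtain N where "N \<in> null_sets (lebesgue_on S)" "{t\<in>space (lebesgue_on S). \<not> P t} \<subseteq> N"
    unfolding eventually_ae_filter by blast
  then show "\<exists>N. negligible N \<and> (\<forall>t\<in>S - N. P t)"
    using S by (intro exI[of _ N]) (auto simp: null_sets_restrict_space negligible_iff_null_sets)
next
  assume "\<exists>N. negligible N \<and> (\<forall>t\<in>S - N. P t)"
  then obtain N where N: "negligible N" "\<forall>t\<in>S - N. P t" by blast
  have "negligible (S \<inter> N)" using N(1) negligible_subset by blast
  then have "S \<inter> N \<in> null_sets (lebesgue_on S)"
    using S by (simp add: null_sets_restrict_space negligible_iff_null_sets)
  moreover have "{t\<in>space (lebesgue_on S). \<not> P t} \<subseteq> S \<inter> N" using N(2) by auto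
  ultimately show "AE t in lebesgue_on S. P t" unfolding eventually_ae_filter by blast
qed

text \<open>The class \<open>H1_on\<close> with a named derivative, fixed only up to null sets and
  two-sided at interior points. Restricting and gluing intervals then keeps the same derivative,
  whereas the derivative in \<open>H1_on\<close> is tied to the interval.\<close>

definition H1w :: "real \<Rightarrow> real \<Rightarrow> (real \<Rightarrow> 'a::euclidean_space) \<Rightarrow> (real \<Rightarrow> 'a) \<Rightarrow> bool" where
  "H1w a b f f' \<longleftrightarrow>
     (\<exists>N. negligible N \<and> (\<forall>t\<in>{a<..<b} - N. (f has_vector_derivative f' t) (at t))) \<and>
     (\<lambda>t. (norm (f' t))\<^sup>2) integrable_on {a..b} \<and>
     (\<forall>t\<in>{a..b}. (f' has_integral (f t - f a)) {a..t})"

lemma H1wD: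
  assumes "H1w a b f f'"
  shows "\<exists>N. negligible N \<and> (\<forall>t\<in>{a<..<b} - N. (f has_vector_derivative f' t) (at t))"
    "(\<lambda>t. (norm (f' t))\<^sup>2) integrable_on {a..b}"
    "\<And>t. t \<in> {a..b} \<Longrightarrow> (f' has_integral (f t - f a)) {a..t}"
  using assms unfolding H1w_def by auto

lemma H1_on_imp_H1w:
  assumes "H1_on a b f"
  shows "H1w a b f (\<lambda>t. vector_derivative f (at t within {a..b}))"
proof -
  have f: "AE t in lebesgue_on {a..b}. f differentiable (at t within {a..b})"
    "(\<lambda>t. (norm (vector_derivative f (at t within {a..b})))\<^sup>2) integrable_on {a..b}"
    "\<forall>t\<in>{a..b}. ((\<lambda>t. vector_derivative f (at t within {a..b})) has_integral (f t - f a)) {a..t}"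
    using assms unfolding H1_on_def Let_def by auto
  obtain N where N: "negligible N" "\<forall>t\<in>{a..b} - N. f differentiable (at t within {a..b})"
    using f(1) AE_lebesgue_on_iff[of "{a..b}"] by auto
  have "\<forall>t\<in>{a<..<b} - N. (f has_vector_derivative vector_derivative f (at t within {a..b})) (at t)"
  proof
    fix t assume t: "t \<in> {a<..<b} - N"
    then have "(f has_vector_derivative vector_derivative f (at t within {a..b})) (at t within {a..b})"
      using N(2) by (auto simp: vector_derivative_works)
    moreover have "at t within {a..b} = at t" using t at_within_Icc_at by auto
    ultimately show "(f has_vector_derivative vector_derivative f (at t within {a..b})) (at t)" by metis
  qed
  then show ?thesis unfolding H1w_def using N(1) f(2,3) by blast
qed

lemma H1w_imp_H1_on:
  assumes f: "H1w a b f f'" and "a < b"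
  shows "H1_on a b f"
proof -
  obtain N where N: "negligible N" "\<forall>t\<in>{a<..<b} - N. (f has_vector_derivative f' t) (at t)"
    using H1wD(1)[OF f] by blast
  \<comment> \<open>At the end points \<open>H1w\<close> gives no derivative, so they join the
    exceptional null set.\<close>
  define M where "M = N \<union> {a, b}"
  have M: "negligible M" unfolding M_def using N(1) by (simp add: negligible_Un)
  have d: "(f has_vector_derivative f' t) (at t within {a..b})" if "t \<in> {a..b} - M" for t
    using N(2) that by (auto simp: M_def intro: has_vector_derivative_at_within)
  have e: "vector_derivative f (at t within {a..b}) = f' t" if "t \<in> {a..b} - M" for t
    using vector_derivative_within_cbox[of a b t f "f' t"] d[OF that] that \<open>a < b\<close> by simp
  show ?thesis
    unfolding H1_on_def Let_def
  proof (intro conjI ballI)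
    have "\<forall>t\<in>{a..b} - M. f differentiable (at t within {a..b})"
      using d differentiableI_vector by blast
    then show "AE t in lebesgue_on {a..b}. f differentiable (at t within {a..b})"
      using AE_lebesgue_on_iff[of "{a..b}"] M by auto
    show "(\<lambda>t. (norm (vector_derivative f (at t within {a..b})))\<^sup>2) integrable_on {a..b}"
      by (rule integrable_spike[OF H1wD(2)[OF f] M]) (simp add: e)
    fix t assume t: "t \<in> {a..b}"
    show "((\<lambda>t. vector_derivative f (at t within {a..b})) has_integral (f t - f a)) {a..t}"
      by (rule has_integral_spike[OF M _ H1wD(3)[OF f t]]) (use e t in auto)
  qed
qed

lemma H1w_integrable: "H1w a b f f' \<Longrightarrow> f' integrable_on {a..b}"
proof (cases "a \<le> b")
  case True
  assume "H1w a b f f'"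
  from H1wD(3)[OF this, of b] True show ?thesis by (auto simp: integrable_on_def)
qed (simp add: integrable_on_empty)

lemma H1w_measurable: "H1w a b f f' \<Longrightarrow> f' \<in> borel_measurable (lebesgue_on {a..b})"
  by (rule integrable_imp_measurable[OF H1w_integrable])

text \<open>Existence of the gauge integral alone does not make the norm integrable; here the norm
  is dominated by 1 + |f'|^2.\<close>

lemma H1w_absolutely_integrable:
  assumes "H1w a b f f'"
  shows "f' absolutely_integrable_on {a..b}"
proof (rule absolutely_integrable_integrable_bound[OF _ H1w_integrable[OF assms]])
  show "(\<lambda>t. 1 + (norm (f' t))\<^sup>2) integrable_on {a..b}"
    using H1wD(2)[OF assms] by (intro integrable_add integrable_const_ivl)
  fix t
  have "0 \<le> (norm (f' t) - 1)\<^sup>2" by simp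
  then have "2 * norm (f' t) \<le> 1 + (norm (f' t))\<^sup>2" by (simp add: power2_eq_square algebra_simps)
  then show "norm (f' t) \<le> 1 + (norm (f' t))\<^sup>2" using norm_ge_zero[of "f' t"] by linarith
qed

lemma H1w_continuous:
  assumes "H1w a b f f'"
  shows "continuous_on {a..b} f"
proof -
  have "continuous_on {a..b} (\<lambda>t. f a + integral {a..t} f')"
    by (intro continuous_intros indefinite_integral_continuous_1 H1w_integrable[OF assms])
  then show ?thesis
    by (rule continuous_on_eq) (use integral_unique[OF H1wD(3)[OF assms]] in simp)
qed

lemma H1w_has_integral:
  assumes f: "H1w a b f f'" and st: "a \<le> s" "s \<le> t" "t \<le> b"
  shows "(f' has_integral (f t - f s)) {s..t}"
proof -
  have i: "f' integrable_on {s..t}"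
    using integrable_on_subinterval[OF H1w_integrable[OF f]] st by simp
  have "(f' has_integral (f s - f a) + integral {s..t} f') {a..t}"
    by (rule has_integral_combine[OF st(1,2) H1wD(3)[OF f] integrable_integral[OF i]]) (use st in auto)
  moreover have "(f' has_integral (f t - f a)) {a..t}" using H1wD(3)[OF f, of t] st by simp
  ultimately have "(f s - f a) + integral {s..t} f' = f t - f a" by (rule has_integral_unique)
  then have "integral {s..t} f' = f t - f s" by (simp add: algebra_simps)
  then show ?thesis using integrable_integral[OF i] by simp
qed

lemma H1w_subset:
  assumes f: "H1w a b f f'" and "a \<le> c" "d \<le> b"
  shows "H1w c d f f'"
  unfolding H1w_def
proof (intro conjI ballI)
  obtain N where "negligible N" "\<forall>t\<in>{a<..<b} - N. (f has_vector_derivative f' t) (at t)"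
    using H1wD(1)[OF f] by blast
  then show "\<exists>N. negligible N \<and> (\<forall>t\<in>{c<..<d} - N. (f has_vector_derivative f' t) (at t))"
    using assms(2,3) by (intro exI[of _ N]) auto
  show "(\<lambda>t. (norm (f' t))\<^sup>2) integrable_on {c..d}"
    by (rule integrable_on_subinterval[OF H1wD(2)[OF f]]) (use assms in auto)
  show "(f' has_integral (f t - f c)) {c..t}" if "t \<in> {c..d}" for t
    by (rule H1w_has_integral[OF f]) (use assms that in auto)
qed

lemma H1w_join:
  assumes f: "H1w a b f f'" and f2: "H1w b c f f'" and ab: "a \<le> b" "b \<le> c"
  shows "H1w a c f f'"
  unfolding H1w_def
proof (intro conjI ballI)
  obtain N where N: "negligible N" "\<forall>t\<in>{a<..<b} - N. (f has_vector_derivative f' t) (at t)"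
    using H1wD(1)[OF f] by blast
  obtain M where M: "negligible M" "\<forall>t\<in>{b<..<c} - M. (f has_vector_derivative f' t) (at t)"
    using H1wD(1)[OF f2] by blast
  have "(f has_vector_derivative f' t) (at t)" if "t \<in> {a<..<c} - (N \<union> M \<union> {b})" for t
  proof (cases "t < b")
    case True then show ?thesis using N(2) that by auto
  next
    case False then show ?thesis using M(2) that by auto
  qed
  then show "\<exists>N. negligible N \<and> (\<forall>t\<in>{a<..<c} - N. (f has_vector_derivative f' t) (at t))"
    using N(1) M(1) by (intro exI[of _ "N \<union> M \<union> {b}"]) (auto simp: negligible_Un)
  show "(\<lambda>t. (norm (f' t))\<^sup>2) integrable_on {a..c}"
    by (rule Henstock_Kurzweil_Integration.integrable_combine[OF ab H1wD(2)[OF f] H1wD(2)[OF f2]])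
  fix t assume t: "t \<in> {a..c}"
  show "(f' has_integral f t - f a) {a..t}"
  proof (cases "t \<le> b")
    case True then show ?thesis using H1wD(3)[OF f] t by auto
  next
    case False
    have "(f' has_integral (f b - f a) + (f t - f b)) {a..t}"
      by (rule has_integral_combine[of a b t]) (use False ab t H1wD(3)[OF f] H1wD(3)[OF f2] in auto)
    then show ?thesis by simp
  qed
qed

lemma H1w_cong:
  assumes f: "H1w a b f f'" and eq: "\<And>t. t \<in> {a..b} \<Longrightarrow> f t = h t"
  shows "H1w a b h f'"
  unfolding H1w_def
proof (intro conjI ballI)
  obtain N where N: "negligible N" "\<forall>t\<in>{a<..<b} - N. (f has_vector_derivative f' t) (at t)"
    using H1wD(1)[OF f] by blast
  have "(h has_vector_derivative f' t) (at t)" if t: "t \<in> {a<..<b} - N" for t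
    by (rule has_vector_derivative_transform_within_open[of f _ _ "{a<..<b}"]) (use N(2) t eq in auto)
  then show "\<exists>N. negligible N \<and> (\<forall>t\<in>{a<..<b} - N. (h has_vector_derivative f' t) (at t))"
    using N(1) by blast
  show "(\<lambda>t. (norm (f' t))\<^sup>2) integrable_on {a..b}" by (rule H1wD(2)[OF f])
  show "(f' has_integral h t - h a) {a..t}" if "t \<in> {a..b}" for t
    using H1wD(3)[OF f that] eq[OF that] eq[of a] that by auto
qed

lemma H1w_spike:
  assumes f: "H1w a b f f'" and "negligible N" and eq: "\<And>t. t \<in> {a..b} - N \<Longrightarrow> f' t = h' t"
  shows "H1w a b f h'"
  unfolding H1w_def
proof (intro conjI ballI)
  obtain M where M: "negligible M" "\<forall>t\<in>{a<..<b} - M. (f has_vector_derivative f' t) (at t)"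
    using H1wD(1)[OF f] by blast
  have "(f has_vector_derivative h' t) (at t)" if "t \<in> {a<..<b} - (N \<union> M)" for t
  proof -
    have "(f has_vector_derivative f' t) (at t)" using M(2) that by auto
    moreover have "f' t = h' t" using eq[of t] that by auto
    ultimately show ?thesis by simp
  qed
  then show "\<exists>N. negligible N \<and> (\<forall>t\<in>{a<..<b} - N. (f has_vector_derivative h' t) (at t))"
    using M(1) assms(2) by (intro exI[of _ "N \<union> M"]) (auto simp: negligible_Un)
  show "(\<lambda>t. (norm (h' t))\<^sup>2) integrable_on {a..b}"
    by (rule integrable_spike[OF H1wD(2)[OF f] assms(2)]) (simp add: eq)
  show "(h' has_integral f t - f a) {a..t}" if "t \<in> {a..b}" for t
    by (rule has_integral_spike[OF assms(2) _ H1wD(3)[OF f that]]) (use eq that in auto)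
qed

lemma H1w_C1:
  assumes f: "\<And>t. t \<in> {a..b} \<Longrightarrow> (f has_vector_derivative f' t) (at t within {a..b})"
    and c: "continuous_on {a..b} f'"
  shows "H1w a b f f'"
  unfolding H1w_def
proof (intro conjI ballI)
  have "(f has_vector_derivative f' t) (at t)" if "t \<in> {a<..<b}" for t
    using f[of t] that at_within_Icc_at[of a t b] by auto
  then show "\<exists>N. negligible N \<and> (\<forall>t\<in>{a<..<b} - N. (f has_vector_derivative f' t) (at t))"
    by (intro exI[of _ "{}"]) auto
  show "(\<lambda>t. (norm (f' t))\<^sup>2) integrable_on {a..b}"
    by (intro integrable_continuous_interval continuous_intros c)
  fix t assume t: "t \<in> {a..b}"
  show "(f' has_integral f t - f a) {a..t}"
    by (rule fundamental_theorem_of_calculus) (use t has_vector_derivative_within_subset[OF f] in auto)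
qed

lemma square_integrable_bound:
  fixes h :: "real \<Rightarrow> 'a::euclidean_space"
  assumes "h \<in> borel_measurable (lebesgue_on {a..b})" "\<And>t. t \<in> {a..b} \<Longrightarrow> (norm (h t))\<^sup>2 \<le> k t" "k integrable_on {a..b}"
  shows "(\<lambda>t. (norm (h t))\<^sup>2) integrable_on {a..b}"
  by (rule measurable_bounded_by_integrable_imp_integrable[OF _ assms(3)])
     (use assms(1,2) in \<open>auto intro: borel_measurable_power measurable_compose[OF _ borel_measurable_norm]\<close>)

section \<open>Products of functions of class H^1\<close>

lemma square_sum_le: "(x + y)\<^sup>2 \<le> 2 * x\<^sup>2 + 2 * (y::real)\<^sup>2"
proof -
  have "0 \<le> (x - y)\<^sup>2" by simp
  then show ?thesis by (simp add: power2_eq_square algebra_simps)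
qed

lemma borel_measurable_bounded_bilinear:
  fixes B :: "'a::euclidean_space \<Rightarrow> 'b::euclidean_space \<Rightarrow> 'c::euclidean_space"
  assumes "bounded_bilinear B" "f \<in> borel_measurable M" "h \<in> borel_measurable M"
  shows "(\<lambda>t. B (f t) (h t)) \<in> borel_measurable M"
  by (rule borel_measurable_continuous_Pair[OF assms(2,3)])
     (intro bounded_bilinear.continuous_on[OF assms(1)] continuous_intros)

lemma H1w_prod_integrable:
  fixes B :: "'a::euclidean_space \<Rightarrow> 'b::euclidean_space \<Rightarrow> 'c::euclidean_space"
  assumes B: "bounded_bilinear B" and f: "H1w a b f f'" and h: "H1w a b h h'"
  shows "(\<lambda>t. B (f' t) (h' t)) absolutely_integrable_on {a..b}"
proof -
  obtain K where K: "K > 0" "\<And>x y. norm (B x y) \<le> norm x * norm y * K"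
    using bounded_bilinear.pos_bounded[OF B] by blast
  show ?thesis
  proof (rule measurable_bounded_by_integrable_imp_absolutely_integrable)
    show "(\<lambda>t. B (f' t) (h' t)) \<in> borel_measurable (lebesgue_on {a..b})"
      by (rule borel_measurable_bounded_bilinear[OF B H1w_measurable[OF f] H1w_measurable[OF h]])
    show "(\<lambda>t. K * ((norm (f' t))\<^sup>2 + (norm (h' t))\<^sup>2)) integrable_on {a..b}"
      by (intro integrable_on_mult_right integrable_add H1wD(2)[OF f] H1wD(2)[OF h])
    fix t
    have "norm (f' t) * norm (h' t) \<le> (norm (f' t))\<^sup>2 + (norm (h' t))\<^sup>2"
    proof -
      have "0 \<le> (norm (f' t) - norm (h' t))\<^sup>2" by simp
      then have "2 * (norm (f' t) * norm (h' t)) \<le> (norm (f' t))\<^sup>2 + (norm (h' t))\<^sup>2"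
        by (simp add: power2_eq_square algebra_simps)
      moreover have "0 \<le> norm (f' t) * norm (h' t)" by simp
      ultimately show ?thesis by linarith
    qed
    then have "norm (f' t) * norm (h' t) * K \<le> ((norm (f' t))\<^sup>2 + (norm (h' t))\<^sup>2) * K"
      using K(1) by (intro mult_right_mono) auto
    then show "norm (B (f' t) (h' t)) \<le> K * ((norm (f' t))\<^sup>2 + (norm (h' t))\<^sup>2)"
      using K(2)[of "f' t" "h' t"] by (simp add: mult.commute)
  qed auto
qed

lemma continuous_on_Icc_bounded:
  fixes h :: "real \<Rightarrow> 'a::real_normed_vector"
  assumes "continuous_on {a..b} h"
  shows "\<exists>C. \<forall>t\<in>{a..b}. norm (h t) \<le> C"
  using compact_imp_bounded[OF compact_continuous_image[OF assms compact_Icc]]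
  by (auto simp: bounded_iff)

lemma absolutely_integrable_bilinear_continuous:
  fixes B :: "'a::euclidean_space \<Rightarrow> 'b::euclidean_space \<Rightarrow> 'c::euclidean_space"
    and f' :: "real \<Rightarrow> 'a"
  assumes B: "bounded_bilinear B" and f: "f' absolutely_integrable_on {a..b}" and h: "continuous_on {a..b} h"
  shows "(\<lambda>t. B (f' t) (h t)) absolutely_integrable_on {a..b}"
proof -
  obtain K where K: "K > 0" "\<And>x y. norm (B x y) \<le> norm x * norm y * K"
    using bounded_bilinear.pos_bounded[OF B] by blast
  obtain C where C: "\<And>t. t \<in> {a..b} \<Longrightarrow> norm (h t) \<le> C"
    using continuous_on_Icc_bounded[OF h] by blast
  show ?thesis
  proof (rule measurable_bounded_by_integrable_imp_absolutely_integrable)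
    have "f' integrable_on {a..b}" using f by (simp add: absolutely_integrable_on_def)
    then show "(\<lambda>t. B (f' t) (h t)) \<in> borel_measurable (lebesgue_on {a..b})"
      by (intro borel_measurable_bounded_bilinear[OF B] integrable_imp_measurable
          continuous_imp_measurable_on_sets_lebesgue h) auto
    show "(\<lambda>t. (C * K) * norm (f' t)) integrable_on {a..b}"
      using f by (intro integrable_on_mult_right) (simp add: absolutely_integrable_on_def)
    fix t assume "t \<in> {a..b}"
    from C[OF this] have "norm (f' t) * norm (h t) * K \<le> norm (f' t) * C * K"
      using K(1) by (intro mult_right_mono mult_left_mono) auto
    then show "norm (B (f' t) (h t)) \<le> (C * K) * norm (f' t)"
      using K(2)[of "f' t" "h t"] by (simp add: mult_ac)
  qed auto
qed

text \<open>
  The difference of the product and the integral of its formal derivative varies by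
  \<open>o(1) \<integral> |f'| + |h'|\<close> over short intervals, because \<open>f\<close> and \<open>h\<close> are continuous.
\<close>

lemma H1w_bilinear:
  fixes B :: "'a::euclidean_space \<Rightarrow> 'b::euclidean_space \<Rightarrow> 'c::euclidean_space"
  assumes B: "bounded_bilinear B" and f: "H1w a b f f'" and h: "H1w a b h h'"
  shows "H1w a b (\<lambda>t. B (f t) (h t)) (\<lambda>t. B (f' t) (h t) + B (f t) (h' t))"
proof -
  interpret B: bounded_bilinear B by (rule B)
  let ?p = "\<lambda>t. B (f' t) (h t) + B (f t) (h' t)"
  obtain K where K: "K > 0" "\<And>x y. norm (B x y) \<le> norm x * norm y * K"
    using B.pos_bounded by blast
  note cf = H1w_continuous[OF f] and ch = H1w_continuous[OF h]
  have a1: "(\<lambda>t. B (f' t) (h t)) absolutely_integrable_on {a..b}"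
    by (rule absolutely_integrable_bilinear_continuous[OF B H1w_absolutely_integrable[OF f] ch])
  have a2: "(\<lambda>t. B (f t) (h' t)) absolutely_integrable_on {a..b}"
    by (rule absolutely_integrable_bilinear_continuous[OF B.flip H1w_absolutely_integrable[OF h] cf])
  have pint: "?p integrable_on {a..b}"
    using a1 a2 by (intro integrable_add) (auto simp: absolutely_integrable_on_def)
  define q where "q t = norm (f' t) + norm (h' t)" for t
  have qint: "q integrable_on {a..b}"
    unfolding q_def using H1w_absolutely_integrable[OF f] H1w_absolutely_integrable[OF h]
    by (intro integrable_add) (auto simp: absolutely_integrable_on_def)
  \<comment> \<open>The defect of the product rule on [s,t]. It is additive over adjacent intervals,
    as is the integral of q, so a bound on short intervals extends to all of them by
    bisection.\<close>
  define E where "E s t = B (f t) (h t) - B (f s) (h s) - integral {s..t} ?p" for s t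
  have est: "norm (E s t) \<le> e * K * integral {s..t} q"
    if st: "a \<le> s" "s \<le> t" "t \<le> b" and e: "e \<ge> 0"
      "\<And>r. r \<in> {s..t} \<Longrightarrow> norm (h t - h r) \<le> e" "\<And>r. r \<in> {s..t} \<Longrightarrow> norm (f s - f r) \<le> e" for s t e
  proof -
    have sub: "{s..t} \<subseteq> {a..b}" using st by auto
    \<comment> \<open>With h frozen at the right end and f at the left end both integrals are exact,
      and together they give the full increment of the product.\<close>
    have i1: "((\<lambda>r. B (f' r) (h t)) has_integral B (f t - f s) (h t)) {s..t}"
      using has_integral_linear[OF H1w_has_integral[OF f st] B.bounded_linear_left] by (simp add: o_def)
    have i2: "((\<lambda>r. B (f s) (h' r)) has_integral B (f s) (h t - h s)) {s..t}"
      using has_integral_linear[OF H1w_has_integral[OF h st] B.bounded_linear_right] by (simp add: o_def)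
    have ip: "(?p has_integral integral {s..t} ?p) {s..t}"
      using integrable_integral[OF integrable_on_subinterval[OF pint sub]] .
    have "((\<lambda>r. B (f' r) (h t) + B (f s) (h' r) - ?p r) has_integral
        (B (f t - f s) (h t) + B (f s) (h t - h s) - integral {s..t} ?p)) {s..t}"
      by (rule has_integral_diff[OF has_integral_add[OF i1 i2] ip])
    moreover have "B (f t - f s) (h t) + B (f s) (h t - h s) - integral {s..t} ?p = E s t"
      unfolding E_def by (simp add: B.diff_left B.diff_right)
    moreover have "B (f' r) (h t) + B (f s) (h' r) - ?p r = B (f' r) (h t - h r) + B (f s - f r) (h' r)" for r
      by (simp add: B.diff_left B.diff_right)
    ultimately have i: "((\<lambda>r. B (f' r) (h t - h r) + B (f s - f r) (h' r)) has_integral E s t) {s..t}" by simp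
    have qi: "((\<lambda>r. e * K * q r) has_integral e * K * integral {s..t} q) {s..t}"
      by (rule has_integral_mult_right[OF integrable_integral[OF integrable_on_subinterval[OF qint sub]]])
    have bd: "norm (B (f' r) (h t - h r) + B (f s - f r) (h' r)) \<le> e * K * q r" if r: "r \<in> {s..t}" for r
    proof -
      have "norm (B (f' r) (h t - h r)) \<le> norm (f' r) * e * K"
        by (rule order_trans[OF K(2)]) (use e(2)[OF r] K(1) in \<open>intro mult_right_mono mult_left_mono; simp\<close>)
      moreover have "norm (B (f s - f r) (h' r)) \<le> e * norm (h' r) * K"
        by (rule order_trans[OF K(2)]) (use e(3)[OF r] K(1) in \<open>intro mult_right_mono mult_left_mono; simp\<close>)
      ultimately have "norm (B (f' r) (h t - h r)) + norm (B (f s - f r) (h' r)) \<le> e * K * q r"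
        unfolding q_def by (simp add: algebra_simps)
      then show ?thesis using norm_triangle_ineq[of "B (f' r) (h t - h r)" "B (f s - f r) (h' r)"] by linarith
    qed
    have "norm (integral {s..t} (\<lambda>r. B (f' r) (h t - h r) + B (f s - f r) (h' r))) \<le> integral {s..t} (\<lambda>r. e * K * q r)"
      by (rule Henstock_Kurzweil_Integration.integral_norm_bound_integral) (use i qi bd in blast)+
    then show ?thesis using integral_unique[OF i] integral_unique[OF qi] by simp
  qed
  have Eadd: "E s u = E s t + E t u" if "a \<le> s" "s \<le> t" "t \<le> u" "u \<le> b" for s t u
  proof -
    have "integral {s..t} ?p + integral {t..u} ?p = integral {s..u} ?p"
      by (rule Henstock_Kurzweil_Integration.integral_combine[OF that(2,3) integrable_on_subinterval[OF pint]]) (use that in auto)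
    then show ?thesis unfolding E_def by (simp add: algebra_simps)
  qed
  have qadd: "integral {s..u} q = integral {s..t} q + integral {t..u} q" if "a \<le> s" "s \<le> t" "t \<le> u" "u \<le> b" for s t u
    using Henstock_Kurzweil_Integration.integral_combine[OF that(2,3) integrable_on_subinterval[OF qint], symmetric] that by auto
  have small: "norm (E a t) \<le> e * K * integral {a..t} q" if e: "e > 0" and t: "t \<in> {a..b}" for e t
  proof -
    have "a \<le> t" using t by simp
    then have "a \<le> a \<and> a \<le> t \<and> t \<le> b \<longrightarrow> norm (E a t) \<le> e * K * integral {a..t} q"
    proof (induction rule: Bolzano[where P="\<lambda>s u. a \<le> s \<and> s \<le> u \<and> u \<le> b \<longrightarrow> norm (E s u) \<le> e * K * integral {s..u} q"])
      case (trans s m u)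
      show ?case
      proof
        assume su: "a \<le> s \<and> s \<le> u \<and> u \<le> b"
        then have "norm (E s m) \<le> e * K * integral {s..m} q" "norm (E m u) \<le> e * K * integral {m..u} q"
          using trans by auto
        then show "norm (E s u) \<le> e * K * integral {s..u} q"
          using norm_triangle_ineq[of "E s m" "E m u"] Eadd[of s m u] qadd[of s m u] su trans by (simp add: algebra_simps)
      qed
    next
      case (local x)
      then have x: "x \<in> {a..b}" using t by auto
      have "\<exists>d>0. \<forall>r\<in>{a..b}. dist r x < d \<longrightarrow> dist (f r) (f x) < e / 2"
        using cf x e unfolding continuous_on_iff by (metis half_gt_zero)
      then obtain d1 where d1: "d1 > 0" "\<And>r. r \<in> {a..b} \<Longrightarrow> dist r x < d1 \<Longrightarrow> dist (f r) (f x) < e / 2" by blast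
      have "\<exists>d>0. \<forall>r\<in>{a..b}. dist r x < d \<longrightarrow> dist (h r) (h x) < e / 2"
        using ch x e unfolding continuous_on_iff by (metis half_gt_zero)
      then obtain d2 where d2: "d2 > 0" "\<And>r. r \<in> {a..b} \<Longrightarrow> dist r x < d2 \<Longrightarrow> dist (h r) (h x) < e / 2" by blast
      show ?case
      proof (intro exI[of _ "min d1 d2"] conjI allI impI)
        show "min d1 d2 > 0" using d1 d2 by simp
        fix s u assume su: "s \<le> x \<and> x \<le> u \<and> u - s < min d1 d2" "a \<le> s \<and> s \<le> u \<and> u \<le> b"
        have near: "dist (f r) (f x) < e / 2" "dist (h r) (h x) < e / 2" if "r \<in> {s..u}" for r
          using d1(2)[of r] d2(2)[of r] su that by (auto simp: dist_real_def)
        show "norm (E s u) \<le> e * K * integral {s..u} q"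
        proof (rule est)
          fix r assume r: "r \<in> {s..u}"
          have "dist (h u) (h r) < e" using near(2)[OF r] near(2)[of u] su dist_triangle_half_l[of "h u" "h x" e "h r"] by (auto simp: dist_commute)
          then show "norm (h u - h r) \<le> e" by (simp add: dist_norm)
          have "dist (f s) (f r) < e" using near(1)[OF r] near(1)[of s] su dist_triangle_half_l[of "f s" "f x" e "f r"] by (auto simp: dist_commute)
          then show "norm (f s - f r) \<le> e" by (simp add: dist_norm)
        qed (use su e in auto)
      qed
    qed
    then show ?thesis using t by simp
  qed
  have E0: "E a t = 0" if t: "t \<in> {a..b}" for t
  proof (rule ccontr)
    assume "E a t \<noteq> 0"
    \<comment> \<open>Chosen so that the bound for the norm of the defect becomes at most half of
      that norm; the added 1 makes Q positive.\<close>
    define Q where "Q = K * \<bar>integral {a..t} q\<bar> + 1"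
    have "Q > 0" using K(1) by (simp add: Q_def add_nonneg_pos)
    let ?e = "norm (E a t) / (2 * Q)"
    have e: "?e > 0" using \<open>E a t \<noteq> 0\<close> \<open>Q > 0\<close> by simp
    have "norm (E a t) \<le> ?e * (K * integral {a..t} q)" using small[OF e t] by (simp add: mult.assoc)
    also have "\<dots> \<le> ?e * Q"
    proof (rule mult_left_mono)
      have "K * integral {a..t} q \<le> K * \<bar>integral {a..t} q\<bar>" using K(1) by (intro mult_left_mono) auto
      then show "K * integral {a..t} q \<le> Q" by (simp add: Q_def)
    qed (use e in simp)
    also have "\<dots> = norm (E a t) / 2" using \<open>Q > 0\<close> by simp
    finally show False using \<open>E a t \<noteq> 0\<close> by simp
  qed
  obtain N where N: "negligible N" "\<forall>t\<in>{a<..<b} - N. (f has_vector_derivative f' t) (at t)"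
    using H1wD(1)[OF f] by blast
  obtain M where M: "negligible M" "\<forall>t\<in>{a<..<b} - M. (h has_vector_derivative h' t) (at t)"
    using H1wD(1)[OF h] by blast
  show ?thesis
    unfolding H1w_def
  proof (intro conjI ballI)
    have "((\<lambda>t. B (f t) (h t)) has_vector_derivative ?p t) (at t)" if "t \<in> {a<..<b} - (N \<union> M)" for t
      using B.has_vector_derivative[of f "f' t" t UNIV h "h' t"] N(2) M(2) that by (simp add: add.commute)
    then show "\<exists>N. negligible N \<and> (\<forall>t\<in>{a<..<b} - N. ((\<lambda>t. B (f t) (h t)) has_vector_derivative ?p t) (at t))"
      using N(1) M(1) by (intro exI[of _ "N \<union> M"]) (auto simp: negligible_Un)
    obtain Cf where Cf: "\<And>t. t \<in> {a..b} \<Longrightarrow> norm (f t) \<le> Cf"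
      using continuous_on_Icc_bounded[OF cf] by blast
    obtain Ch where Ch: "\<And>t. t \<in> {a..b} \<Longrightarrow> norm (h t) \<le> Ch"
      using continuous_on_Icc_bounded[OF ch] by blast
    show "(\<lambda>t. (norm (?p t))\<^sup>2) integrable_on {a..b}"
    proof (rule square_integrable_bound)
      show "?p \<in> borel_measurable (lebesgue_on {a..b})" by (rule integrable_imp_measurable[OF pint])
      show "(\<lambda>t. 2 * (Ch * K)\<^sup>2 * (norm (f' t))\<^sup>2 + 2 * (Cf * K)\<^sup>2 * (norm (h' t))\<^sup>2) integrable_on {a..b}"
        by (intro integrable_add integrable_on_mult_right H1wD(2)[OF f] H1wD(2)[OF h])
      fix t assume t: "t \<in> {a..b}"
      have "norm (B (f' t) (h t)) \<le> norm (f' t) * Ch * K"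
        by (rule order_trans[OF K(2)]) (use Ch[OF t] K(1) in \<open>intro mult_right_mono mult_left_mono; simp\<close>)
      moreover have "norm (B (f t) (h' t)) \<le> Cf * norm (h' t) * K"
        by (rule order_trans[OF K(2)]) (use Cf[OF t] K(1) in \<open>intro mult_right_mono mult_left_mono; simp\<close>)
      ultimately have "norm (?p t) \<le> (Ch * K) * norm (f' t) + (Cf * K) * norm (h' t)"
        using norm_triangle_ineq[of "B (f' t) (h t)" "B (f t) (h' t)"] by (simp add: mult_ac)
      then have "(norm (?p t))\<^sup>2 \<le> ((Ch * K) * norm (f' t) + (Cf * K) * norm (h' t))\<^sup>2"
        by (rule power_mono) simp
      also have "\<dots> \<le> 2 * ((Ch * K) * norm (f' t))\<^sup>2 + 2 * ((Cf * K) * norm (h' t))\<^sup>2" by (rule square_sum_le)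
      finally show "(norm (?p t))\<^sup>2 \<le> 2 * (Ch * K)\<^sup>2 * (norm (f' t))\<^sup>2 + 2 * (Cf * K)\<^sup>2 * (norm (h' t))\<^sup>2"
        by (simp add: power_mult_distrib mult.assoc)
    qed
    fix t assume t: "t \<in> {a..b}"
    have "integral {a..t} ?p = B (f t) (h t) - B (f a) (h a)" using E0[OF t] unfolding E_def by simp
    moreover have "?p integrable_on {a..t}" by (rule integrable_on_subinterval[OF pint]) (use t in auto)
    ultimately show "(?p has_integral (B (f t) (h t) - B (f a) (h a))) {a..t}"
      by (simp add: has_integral_integrable_integral)
  qed
qed

lemma H1w_linear:
  fixes L :: "'a::euclidean_space \<Rightarrow> 'b::euclidean_space"
  assumes L: "bounded_linear L" and f: "H1w a b f f'"
  shows "H1w a b (\<lambda>t. L (f t)) (\<lambda>t. L (f' t))"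
  unfolding H1w_def
proof (intro conjI ballI)
  obtain N where N: "negligible N" "\<forall>t\<in>{a<..<b} - N. (f has_vector_derivative f' t) (at t)"
    using H1wD(1)[OF f] by blast
  then show "\<exists>N. negligible N \<and> (\<forall>t\<in>{a<..<b} - N. ((\<lambda>t. L (f t)) has_vector_derivative L (f' t)) (at t))"
    using bounded_linear.has_vector_derivative[OF L] by blast
  obtain K where K: "\<And>x. norm (L x) \<le> norm x * K" using bounded_linear.bounded[OF L] by blast
  show "(\<lambda>t. (norm (L (f' t)))\<^sup>2) integrable_on {a..b}"
  proof (rule square_integrable_bound)
    show "(\<lambda>t. L (f' t)) \<in> borel_measurable (lebesgue_on {a..b})"
      using integrable_imp_measurable[OF integrable_linear[OF H1w_integrable[OF f] L]] by (simp add: o_def)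
    show "(\<lambda>t. K\<^sup>2 * (norm (f' t))\<^sup>2) integrable_on {a..b}"
      by (intro integrable_on_mult_right H1wD(2)[OF f])
    show "(norm (L (f' t)))\<^sup>2 \<le> K\<^sup>2 * (norm (f' t))\<^sup>2" for t
      using power_mono[OF K[of "f' t"] norm_ge_zero, of 2] by (simp add: power_mult_distrib mult.commute)
  qed
  fix t assume "t \<in> {a..b}"
  then show "((\<lambda>t. L (f' t)) has_integral L (f t) - L (f a)) {a..t}"
    using has_integral_linear[OF H1wD(3)[OF f] L, of t] by (simp add: o_def linear_diff[OF bounded_linear.linear[OF L]])
qed

lemma H1w_add:
  assumes f: "H1w a b f f'" and h: "H1w a b h h'"
  shows "H1w a b (\<lambda>t. f t + h t) (\<lambda>t. f' t + h' t)"
  unfolding H1w_def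
proof (intro conjI ballI)
  obtain N where N: "negligible N" "\<forall>t\<in>{a<..<b} - N. (f has_vector_derivative f' t) (at t)"
    using H1wD(1)[OF f] by blast
  obtain M where M: "negligible M" "\<forall>t\<in>{a<..<b} - M. (h has_vector_derivative h' t) (at t)"
    using H1wD(1)[OF h] by blast
  show "\<exists>N. negligible N \<and> (\<forall>t\<in>{a<..<b} - N. ((\<lambda>t. f t + h t) has_vector_derivative f' t + h' t) (at t))"
    using N M by (intro exI[of _ "N \<union> M"]) (auto simp: negligible_Un intro: has_vector_derivative_add)
  show "(\<lambda>t. (norm (f' t + h' t))\<^sup>2) integrable_on {a..b}"
  proof (rule square_integrable_bound)
    show "(\<lambda>t. f' t + h' t) \<in> borel_measurable (lebesgue_on {a..b})"
      by (rule integrable_imp_measurable[OF integrable_add[OF H1w_integrable[OF f] H1w_integrable[OF h]]])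
    show "(\<lambda>t. 2 * (norm (f' t))\<^sup>2 + 2 * (norm (h' t))\<^sup>2) integrable_on {a..b}"
      by (intro integrable_add integrable_on_mult_right H1wD(2)[OF f] H1wD(2)[OF h])
    show "(norm (f' t + h' t))\<^sup>2 \<le> 2 * (norm (f' t))\<^sup>2 + 2 * (norm (h' t))\<^sup>2" for t
      using power_mono[OF norm_triangle_ineq[of "f' t" "h' t"] norm_ge_zero, of 2]
        square_sum_le[of "norm (f' t)" "norm (h' t)"] by linarith
  qed
  fix t assume "t \<in> {a..b}"
  then show "((\<lambda>t. f' t + h' t) has_integral f t + h t - (f a + h a)) {a..t}"
    using has_integral_add[OF H1wD(3)[OF f] H1wD(3)[OF h], of t] by (simp add: algebra_simps)
qed

lemma H1w_uminus: "H1w a b f f' \<Longrightarrow> H1w a b (\<lambda>t. - f t) (\<lambda>t. - f' t)"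
  using H1w_linear[of uminus] bounded_linear_minus[OF bounded_linear_ident] by auto

lemma H1w_diff: "H1w a b f f' \<Longrightarrow> H1w a b h h' \<Longrightarrow> H1w a b (\<lambda>t. f t - h t) (\<lambda>t. f' t - h' t)"
  using H1w_add[OF _ H1w_uminus, of a b f f' h h'] by simp

lemma H1w_const: "H1w a b (\<lambda>t. c) (\<lambda>t. 0)"
  by (rule H1w_C1) auto

lemma H1w_sum:
  assumes "\<And>i. i \<in> I \<Longrightarrow> H1w a b (f i) (f' i)"
  shows "H1w a b (\<lambda>t. \<Sum>i\<in>I. f i t) (\<lambda>t. \<Sum>i\<in>I. f' i t)"
  using assms by (induction I rule: infinite_finite_induct) (auto simp: H1w_const H1w_add)

section \<open>The kernel of the index form in a parallel frame\<close>

text \<open>The variational problem in the parallel frame, where all fields take values in one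
  vector space with an indefinite form b. H is the holonomy, T converts the euclidean product into
  b, and y0, y1 stand for the Killing field and its covariant derivative.\<close>

locale index_data =
  fixes b :: "'a::euclidean_space \<Rightarrow> 'a \<Rightarrow> real" and R :: "real \<Rightarrow> 'a \<Rightarrow> 'a" and H T :: "'a \<Rightarrow> 'a"
    and y0 y1 :: "real \<Rightarrow> 'a"
  assumes bil: "bilinear b" and sym: "b x y = b y x"
    and T_linear: "linear T" and b_T: "b x (T z) = x \<bullet> z"
    and R_linear: "t \<in> {0..1} \<Longrightarrow> linear (R t)" and R_cont: "continuous_on {0..1} (\<lambda>t. R t x)"
    and R_sym: "t \<in> {0..1} \<Longrightarrow> b (R t x) y = b x (R t y)"
    and H_linear: "linear H" and H_iso: "b (H x) (H y) = b x y"
    and y0: "t \<in> {0..1} \<Longrightarrow> (y0 has_vector_derivative y1 t) (at t within {0..1})"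
    and y1: "t \<in> {0..1} \<Longrightarrow> (y1 has_vector_derivative R t (y0 t)) (at t within {0..1})"
    and y0_H: "y0 0 = H (y0 1)" and y1_H: "y1 0 = H (y1 1)"
    and y0_neg: "t \<in> {0..1} \<Longrightarrow> b (y0 t) (y0 t) < 0"
begin

lemma bb: "bounded_bilinear b"
  using bil by (simp add: bilinear_conv_bounded_bilinear)

sublocale b: bounded_bilinear b by (rule bb)

lemma nondegenerate: "(\<And>y. b x y = 0) \<Longrightarrow> x = 0"
  using b_T[of x x] by simp

lemma H_surj: "surj H"
proof -
  have "inj H" unfolding linear_injective_0[OF H_linear]
  proof (intro allI impI)
    fix x assume "H x = 0"
    then have "b x y = 0" for y using H_iso[of x y] by (simp add: b.zero_left)
    then show "x = 0" by (rule nondegenerate)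
  qed
  then show ?thesis by (rule eucl.linear_inj_imp_surj[OF H_linear])
qed

text \<open>The counterpart of \<open>tangent_N\<close>: the condition x 0 = H (x 1) expresses
  periodicity of the field. The derivative is carried along because it is only defined almost
  everywhere.\<close>

definition adm :: "(real \<Rightarrow> 'a) \<Rightarrow> (real \<Rightarrow> 'a) \<Rightarrow> bool" where
  "adm x x' \<longleftrightarrow> H1w 0 1 x x' \<and> x 0 = H (x 1) \<and>
     (\<exists>k N. negligible N \<and> (\<forall>t\<in>{0..1} - N. b (x' t) (y0 t) - b (x t) (y1 t) = k))"

definition jac :: "(real \<Rightarrow> 'a) \<Rightarrow> (real \<Rightarrow> 'a) \<Rightarrow> bool" where
  "jac x v \<longleftrightarrow> (\<forall>t\<in>{0..1}. (x has_vector_derivative v t) (at t within {0..1}) \<and>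
     (v has_vector_derivative R t (x t)) (at t within {0..1}))"

lemma Rx_cont: "continuous_on {0..1} x \<Longrightarrow> continuous_on {0..1} (\<lambda>t. R t (x t))"
  by (rule linear_family_continuous[OF R_linear R_cont])

lemma jac_cont:
  assumes "jac x v"
  shows "continuous_on {0..1} x" "continuous_on {0..1} v"
  using assms has_vector_derivative_continuous unfolding jac_def continuous_on_eq_continuous_within by blast+

lemma jac_H1w:
  assumes "jac x v"
  shows "H1w 0 1 x v" "H1w 0 1 v (\<lambda>t. R t (x t))"
  using assms jac_cont[OF assms] Rx_cont unfolding jac_def by (auto intro!: H1w_C1)

lemma y_jac: "jac y0 y1"
  unfolding jac_def using y0 y1 by blast

text \<open>The constrained quantity is the symplectic product of x with the Killing Jacobi field,
  and the symplectic product of two Jacobi fields is constant because R is self-adjoint.\<close>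

lemma jac_adm:
  assumes J: "jac x v" and "x 0 = H (x 1)"
  shows "adm x v"
proof -
  have "((\<lambda>t. b (v t) (y0 t) - b (x t) (y1 t)) has_vector_derivative 0) (at t within {0..1})" if t: "t \<in> {0..1}" for t
  proof -
    have "((\<lambda>t. b (v t) (y0 t) - b (x t) (y1 t)) has_vector_derivative
       (b (v t) (y1 t) + b (R t (x t)) (y0 t)) - (b (x t) (R t (y0 t)) + b (v t) (y1 t))) (at t within {0..1})"
      by (intro has_vector_derivative_diff b.has_vector_derivative y0 y1 t) (use J t in \<open>auto simp: jac_def\<close>)
    then show ?thesis by (simp add: R_sym[OF t])
  qed
  then obtain c where "\<And>t. t \<in> {0..1} \<Longrightarrow> b (v t) (y0 t) - b (x t) (y1 t) = c"
    using has_vector_derivative_zero_constant[OF convex_real_interval(5)] by blast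
  then show ?thesis
    unfolding adm_def using jac_H1w(1)[OF J] assms(2) by (intro conjI exI[of _ c] exI[of _ "{}"]) auto
qed

text \<open>The integrand is the derivative of b(v, w), and the boundary terms agree because H is an
  isometry.\<close>

lemma jac_kernel:
  assumes J: "jac x v" and "v 0 = H (v 1)" and w: "H1w 0 1 w w'" "w 0 = H (w 1)"
  shows "((\<lambda>t. b (v t) (w' t) + b (R t (x t)) (w t)) has_integral 0) {0..1}"
proof -
  have "((\<lambda>t. b (R t (x t)) (w t) + b (v t) (w' t)) has_integral b (v 1) (w 1) - b (v 0) (w 0)) {0..1}"
    using H1w_has_integral[OF H1w_bilinear[OF bb jac_H1w(2)[OF J] w(1)], of 0 1] by simp
  then show ?thesis using assms(2) w(2) H_iso by (simp add: add.commute)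
qed

lemma beta_derivative:
  assumes t: "t \<in> {0..1}"
  shows "((\<lambda>t. 1 / b (y0 t) (y0 t)) has_vector_derivative - (2 * b (y0 t) (y1 t)) / (b (y0 t) (y0 t))\<^sup>2) (at t within {0..1})"
proof -
  have "((\<lambda>t. b (y0 t) (y0 t)) has_real_derivative 2 * b (y0 t) (y1 t)) (at t within {0..1})"
    unfolding has_real_derivative_iff_has_vector_derivative
    using b.has_vector_derivative[OF y0[OF t] y0[OF t]] by (simp add: sym[of "y1 t"])
  from DERIV_inverse_fun[OF this] y0_neg[OF t] show ?thesis
    by (simp add: has_real_derivative_iff_has_vector_derivative[symmetric] inverse_eq_divide power2_eq_square divide_simps)
qed

lemma beta_continuous: "continuous_on {0..1} (\<lambda>t. 1 / b (y0 t) (y0 t))"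
  using beta_derivative has_vector_derivative_continuous unfolding continuous_on_eq_continuous_within by blast

lemma y_cont: "continuous_on {0..1} y0" "continuous_on {0..1} y1"
  using jac_cont[OF y_jac] by auto

text \<open>
  Adding a suitable multiple \<open>\<phi> y0\<close> makes a periodic test field satisfy the constraint, and the
  constraint on \<open>x\<close> together with the Jacobi equation for \<open>y0\<close> makes the contribution of
  \<open>\<phi> y0\<close> to the index form an exact derivative.
\<close>

lemma correction_exists:
  assumes z: "H1w 0 1 z z'" and zH: "z 0 = H (z 1)"
  obtains \<phi> \<phi>' where "H1w 0 1 \<phi> \<phi>'" "\<phi> 0 = 0" "\<phi> 1 = 0" "adm (\<lambda>t. z t + \<phi> t *\<^sub>R y0 t) (\<lambda>t. z' t + (\<phi>' t *\<^sub>R y0 t + \<phi> t *\<^sub>R y1 t))"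
proof -
  let ?\<beta> = "\<lambda>t. b (y0 t) (y0 t)"
  let ?r = "\<lambda>t. 1 / ?\<beta> t" and ?r' = "\<lambda>t. - (2 * b (y0 t) (y1 t)) / (?\<beta> t)\<^sup>2"
  have ne: "?\<beta> t \<noteq> 0" if "t \<in> {0..1}" for t using y0_neg[OF that] by simp
  have cr': "continuous_on {0..1} ?r'"
    using ne by (intro continuous_intros b.continuous_on y_cont) auto
  have r: "H1w 0 1 ?r ?r'" by (rule H1w_C1[OF beta_derivative cr'])
  have zy: "H1w 0 1 (\<lambda>t. b (z t) (y0 t)) (\<lambda>t. b (z' t) (y0 t) + b (z t) (y1 t))"
    by (rule H1w_bilinear[OF bb z jac_H1w(1)[OF y_jac]])
  have \<kappa>: "H1w 0 1 (\<lambda>t. ?r t * b (z t) (y0 t)) (\<lambda>t. ?r' t * b (z t) (y0 t) + ?r t * (b (z' t) (y0 t) + b (z t) (y1 t)))"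
    by (rule H1w_bilinear[OF bounded_bilinear_mult r zy])
  \<comment> \<open>The constraint asks for \<phi>' = r (k + b(z, y1) - b(z', y0)) with r = 1 /
    b(y0, y0). The term with z' is the derivative of -r b(z, y0) up to continuous terms; collecting
    these gives the integrand \<open>?m\<close>.\<close>
  let ?m = "\<lambda>t. 2 * ?r t * b (z t) (y1 t) + ?r' t * b (z t) (y0 t)"
  have cz: "continuous_on {0..1} z" by (rule H1w_continuous[OF z])
  have cm: "continuous_on {0..1} ?m"
    by (intro continuous_intros beta_continuous cr' b.continuous_on y_cont cz)
  define \<rho> where "\<rho> t = integral {0..t} ?r" for t
  define \<mu> where "\<mu> t = integral {0..t} ?m" for t
  have \<rho>: "(\<rho> has_vector_derivative ?r t) (at t within {0..1})" if "t \<in> {0..1}" for t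
    unfolding \<rho>_def by (rule integral_has_vector_derivative[OF beta_continuous that])
  have \<mu>: "(\<mu> has_vector_derivative ?m t) (at t within {0..1})" if "t \<in> {0..1}" for t
    unfolding \<mu>_def by (rule integral_has_vector_derivative[OF cm that])
  have z0: "\<rho> 0 = 0" "\<mu> 0 = 0" by (simp_all add: \<rho>_def \<mu>_def)
  \<comment> \<open>This is where \<open>y0\<close> being timelike enters: the integrand r has no
    zero on [0,1].\<close>
  have "\<rho> 1 \<noteq> 0"
  proof
    assume 1: "\<rho> 1 = 0"
    have "\<exists>s\<in>{0<..<1}. \<rho> 1 - \<rho> 0 = ?r s * (1 - 0)"
      by (rule mvt_simple) (use \<rho> in \<open>auto simp: has_vector_derivative_def mult.commute[of _ "?r _"]\<close>)
    then obtain s where "s \<in> {0<..<1}" "?r s = 0" using 1 z0 by auto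
    then show False using ne[of s] by auto
  qed
  \<comment> \<open>Makes \<phi> vanish at time 1: the remaining bracket in \<phi> is zero there,
    because z and y0 satisfy the same condition under the isometry H.\<close>
  define k where "k = - \<mu> 1 / \<rho> 1"
  define \<phi> where "\<phi> t = k * \<rho> t + \<mu> t + (?r 0 * b (z 0) (y0 0) - ?r t * b (z t) (y0 t))" for t
  define \<phi>' where "\<phi>' t = (k * ?r t + ?m t) + (0 - (?r' t * b (z t) (y0 t) + ?r t * (b (z' t) (y0 t) + b (z t) (y1 t))))" for t
  have \<phi>: "H1w 0 1 \<phi> \<phi>'"
    unfolding \<phi>_def[abs_def] \<phi>'_def[abs_def]
  proof (intro H1w_add H1w_diff H1w_const \<kappa>)
    show "H1w 0 1 (\<lambda>t. k * \<rho> t) (\<lambda>t. k * ?r t)"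
      by (rule H1w_linear[OF bounded_linear_mult_right H1w_C1[OF \<rho> beta_continuous]])
    show "H1w 0 1 \<mu> ?m" by (rule H1w_C1[OF \<mu> cm])
  qed
  have \<phi>0: "\<phi> 0 = 0" by (simp add: \<phi>_def z0)
  have "b (z 0) (y0 0) = b (z 1) (y0 1)" "?\<beta> 0 = ?\<beta> 1" using zH y0_H H_iso by simp_all
  then have \<phi>1: "\<phi> 1 = 0" using \<open>\<rho> 1 \<noteq> 0\<close> by (simp add: \<phi>_def k_def)
  have w: "H1w 0 1 (\<lambda>t. z t + \<phi> t *\<^sub>R y0 t) (\<lambda>t. z' t + (\<phi>' t *\<^sub>R y0 t + \<phi> t *\<^sub>R y1 t))"
    by (rule H1w_add[OF z H1w_bilinear[OF bounded_bilinear_scaleR \<phi> jac_H1w(1)[OF y_jac]]])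
  have "b (z' t + (\<phi>' t *\<^sub>R y0 t + \<phi> t *\<^sub>R y1 t)) (y0 t) - b (z t + \<phi> t *\<^sub>R y0 t) (y1 t) = k" if t: "t \<in> {0..1}" for t
  proof -
    have e: "b (z' t + (\<phi>' t *\<^sub>R y0 t + \<phi> t *\<^sub>R y1 t)) (y0 t) - b (z t + \<phi> t *\<^sub>R y0 t) (y1 t)
      = b (z' t) (y0 t) + \<phi>' t * ?\<beta> t - b (z t) (y1 t)"
      by (simp add: b.add_left b.scaleR_left sym[of "y1 t"])
    have e2: "\<phi>' t = k * ?r t + ?r t * b (z t) (y1 t) - ?r t * b (z' t) (y0 t)"
      by (simp add: \<phi>'_def algebra_simps)
    have "b (z' t) (y0 t) + (k * ?r t + ?r t * b (z t) (y1 t) - ?r t * b (z' t) (y0 t)) * ?\<beta> t - b (z t) (y1 t) = k"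
      using ne[OF t] by (simp add: field_simps)
    then have "b (z' t) (y0 t) + \<phi>' t * ?\<beta> t - b (z t) (y1 t) = k" by (simp only: e2)
    then show ?thesis using e by (rule trans[rotated])
  qed
  then have "adm (\<lambda>t. z t + \<phi> t *\<^sub>R y0 t) (\<lambda>t. z' t + (\<phi>' t *\<^sub>R y0 t + \<phi> t *\<^sub>R y1 t))"
    unfolding adm_def using w zH \<phi>0 \<phi>1 by (intro conjI exI[of _ k] exI[of _ "{}"]) auto
  then show thesis using that \<phi> \<phi>0 \<phi>1 by blast
qed

lemma index_integrable:
  assumes x: "H1w 0 1 x x'" and w: "H1w 0 1 w w'"
  shows "(\<lambda>t. b (x' t) (w' t) + b (R t (x t)) (w t)) integrable_on {0..1}"
proof (rule integrable_add)
  show "(\<lambda>t. b (x' t) (w' t)) integrable_on {0..1}"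
    using H1w_prod_integrable[OF bb x w] by (simp add: absolutely_integrable_on_def)
  show "(\<lambda>t. b (R t (x t)) (w t)) integrable_on {0..1}"
    by (intro integrable_continuous_interval b.continuous_on Rx_cont H1w_continuous[OF x] H1w_continuous[OF w])
qed

lemma kernel_all_tests:
  assumes x: "adm x x'" and ker: "\<And>w w'. adm w w' \<Longrightarrow> integral {0..1} (\<lambda>t. b (x' t) (w' t) + b (R t (x t)) (w t)) = 0"
    and z: "H1w 0 1 z z'" and zH: "z 0 = H (z 1)"
  shows "((\<lambda>t. b (x' t) (z' t) + b (R t (x t)) (z t)) has_integral 0) {0..1}"
proof -
  obtain \<phi> \<phi>' where \<phi>: "H1w 0 1 \<phi> \<phi>'" "\<phi> 0 = 0" "\<phi> 1 = 0"
    and w: "adm (\<lambda>t. z t + \<phi> t *\<^sub>R y0 t) (\<lambda>t. z' t + (\<phi>' t *\<^sub>R y0 t + \<phi> t *\<^sub>R y1 t))"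
    by (rule correction_exists[OF z zH])
  obtain C N where xH: "H1w 0 1 x x'" and N: "negligible N"
      and C: "\<And>t. t \<in> {0..1} - N \<Longrightarrow> b (x' t) (y0 t) - b (x t) (y1 t) = C"
    using x unfolding adm_def by blast
  have wH: "H1w 0 1 (\<lambda>t. z t + \<phi> t *\<^sub>R y0 t) (\<lambda>t. z' t + (\<phi>' t *\<^sub>R y0 t + \<phi> t *\<^sub>R y1 t))"
    using w unfolding adm_def by blast
  have 1: "((\<lambda>t. b (x' t) (z' t + (\<phi>' t *\<^sub>R y0 t + \<phi> t *\<^sub>R y1 t)) + b (R t (x t)) (z t + \<phi> t *\<^sub>R y0 t)) has_integral 0) {0..1}"
    using integrable_integral[OF index_integrable[OF xH wH]] ker[OF w] by simp
  \<comment> \<open>By the constraint b(x', y0) = C + b(x, y1) almost everywhere, and y0 solves the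
    Jacobi equation. So \<phi> y0 contributes \<phi>' C plus the derivative of \<phi> b(x, y1), and
    both have integral zero since \<phi> vanishes at the ends.\<close>
  have 2: "((\<lambda>t. \<phi>' t * C) has_integral 0) {0..1}"
    using has_integral_mult_left[OF H1w_has_integral[OF \<phi>(1), of 0 1], of C] \<phi>(2,3) by simp
  have xy: "H1w 0 1 (\<lambda>t. b (x t) (y1 t)) (\<lambda>t. b (x' t) (y1 t) + b (x t) (R t (y0 t)))"
    by (rule H1w_bilinear[OF bb xH jac_H1w(2)[OF y_jac]])
  have 3: "((\<lambda>t. \<phi>' t * b (x t) (y1 t) + \<phi> t * (b (x' t) (y1 t) + b (x t) (R t (y0 t)))) has_integral 0) {0..1}"
    using H1w_has_integral[OF H1w_bilinear[OF bounded_bilinear_mult \<phi>(1) xy], of 0 1] \<phi>(2,3) by simp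
  have "((\<lambda>t. b (x' t) (z' t + (\<phi>' t *\<^sub>R y0 t + \<phi> t *\<^sub>R y1 t)) + b (R t (x t)) (z t + \<phi> t *\<^sub>R y0 t)
      - \<phi>' t * C - (\<phi>' t * b (x t) (y1 t) + \<phi> t * (b (x' t) (y1 t) + b (x t) (R t (y0 t))))) has_integral 0 - 0 - 0) {0..1}"
    by (intro has_integral_diff 1 2 3)
  then have "((\<lambda>t. b (x' t) (z' t + (\<phi>' t *\<^sub>R y0 t + \<phi> t *\<^sub>R y1 t)) + b (R t (x t)) (z t + \<phi> t *\<^sub>R y0 t)
      - \<phi>' t * C - (\<phi>' t * b (x t) (y1 t) + \<phi> t * (b (x' t) (y1 t) + b (x t) (R t (y0 t))))) has_integral 0) {0..1}"
    by simp
  then show ?thesis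
  proof (rule has_integral_spike[OF N, rotated])
    fix t assume t: "t \<in> {0..1} - N"
    then have "b (R t (x t)) (y0 t) = b (x t) (R t (y0 t))" by (intro R_sym) auto
    then show "b (x' t) (z' t) + b (R t (x t)) (z t) = b (x' t) (z' t + (\<phi>' t *\<^sub>R y0 t + \<phi> t *\<^sub>R y1 t)) + b (R t (x t)) (z t + \<phi> t *\<^sub>R y0 t)
      - \<phi>' t * C - (\<phi>' t * b (x t) (y1 t) + \<phi> t * (b (x' t) (y1 t) + b (x t) (R t (y0 t))))"
      unfolding C[OF t, symmetric] by (simp add: b.add_right b.scaleR_right algebra_simps)
  qed
qed

text \<open>Let q be a second primitive of R x and u the difference of x and q, corrected by an
  affine function so as to vanish at both ends. Testing with T u gives that |u'|^2 has integral
  zero, so x is q plus an affine function and inherits its regularity.\<close>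

lemma du_Bois_Reymond:
  assumes x: "H1w 0 1 x x'"
    and test: "\<And>z z'. H1w 0 1 z z' \<Longrightarrow> z 0 = H (z 1) \<Longrightarrow> ((\<lambda>t. b (x' t) (z' t) + b (R t (x t)) (z t)) has_integral 0) {0..1}"
  shows "\<exists>v. jac x v"
proof -
  have cx: "continuous_on {0..1} x" by (rule H1w_continuous[OF x])
  define p where "p t = integral {0..t} (\<lambda>t. R t (x t))" for t
  have p: "(p has_vector_derivative R t (x t)) (at t within {0..1})" if "t \<in> {0..1}" for t
    unfolding p_def by (rule integral_has_vector_derivative[OF Rx_cont[OF cx] that])
  then have cp: "continuous_on {0..1} p"
    using has_vector_derivative_continuous unfolding continuous_on_eq_continuous_within by blast
  have pH: "H1w 0 1 p (\<lambda>t. R t (x t))" by (rule H1w_C1[OF p Rx_cont[OF cx]])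
  define q where "q t = integral {0..t} p" for t
  have q: "(q has_vector_derivative p t) (at t within {0..1})" if "t \<in> {0..1}" for t
    unfolding q_def by (rule integral_has_vector_derivative[OF cp that])
  define c where "c = x 1 - q 1 - x 0"
  have q0: "q 0 = 0" by (simp add: q_def)
  define u where "u t = x t - q t - (x 0 + t *\<^sub>R c)" for t
  define u' where "u' t = x' t - p t - (0 + c)" for t
  have u: "H1w 0 1 u u'"
    unfolding u_def[abs_def] u'_def[abs_def]
  proof (intro H1w_diff H1w_add H1w_const x)
    show "H1w 0 1 q p" by (rule H1w_C1[OF q cp])
    show "H1w 0 1 (\<lambda>t. t *\<^sub>R c) (\<lambda>t. c)"
      by (rule H1w_C1) (auto intro!: derivative_eq_intros)
  qed
  have u0: "u 0 = 0" "u 1 = 0" by (simp_all add: u_def q0 c_def)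
  have T0: "T 0 = 0" by (rule linear_0[OF T_linear])
  \<comment> \<open>The form b is indefinite; inserting T turns it into the euclidean product, which
    makes the resulting square positive.\<close>
  have "((\<lambda>t. b (x' t) (T (u' t)) + b (R t (x t)) (T (u t))) has_integral 0) {0..1}"
    by (rule test[OF H1w_linear[OF linear_conv_bounded_linear[THEN iffD1, OF T_linear] u]])
       (simp add: u0 T0 linear_0[OF H_linear])
  then have 1: "((\<lambda>t. x' t \<bullet> u' t + R t (x t) \<bullet> u t) has_integral 0) {0..1}" by (simp add: b_T)
  have 2: "((\<lambda>t. R t (x t) \<bullet> u t + p t \<bullet> u' t) has_integral 0) {0..1}"
    using H1w_has_integral[OF H1w_bilinear[OF bounded_bilinear_inner pH u], of 0 1] u0 by simp
  have 3: "((\<lambda>t. c \<bullet> u' t) has_integral 0) {0..1}"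
    using H1w_has_integral[OF H1w_linear[OF bounded_linear_inner_right[of c] u], of 0 1] u0 by simp
  have "((\<lambda>t. x' t \<bullet> u' t + R t (x t) \<bullet> u t - (R t (x t) \<bullet> u t + p t \<bullet> u' t) - c \<bullet> u' t) has_integral 0 - 0 - 0) {0..1}"
    by (intro has_integral_diff 1 2 3)
  then have sq: "((\<lambda>t. (norm (u' t))\<^sup>2) has_integral 0) {0..1}"
    by (simp add: u'_def dot_square_norm[symmetric] inner_diff_left inner_add_left algebra_simps)
  have u_zero: "u t = 0" if t: "t \<in> {0..1}" for t
  proof -
    \<comment> \<open>The inequality |u'| <= e/2 + |u'|^2 / (2e) takes the place of Cauchy-Schwarz
      for integrals: the square integrates to zero and only e/2 remains.\<close>
    have "norm (u t) \<le> e" if e: "e > 0" for e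
    proof -
      have i1: "(u' has_integral u t) {0..t}" using H1wD(3)[OF u t] u0 by simp
      have i2: "((\<lambda>s. e / 2 + (norm (u' s))\<^sup>2 / (2 * e)) has_integral e / 2) {0..1}"
        using has_integral_add[OF has_integral_const_real[of "e / 2" 0 1] has_integral_divide[OF sq, of "2 * e"]] by simp
      have i3: "(\<lambda>s. e / 2 + (norm (u' s))\<^sup>2 / (2 * e)) integrable_on {0..t}"
        by (rule integrable_on_subinterval[of _ "{0..1}"]) (use i2 t in auto)
      have "norm (integral {0..t} u') \<le> integral {0..t} (\<lambda>s. e / 2 + (norm (u' s))\<^sup>2 / (2 * e))"
      proof (rule Henstock_Kurzweil_Integration.integral_norm_bound_integral)
        fix s
        have "0 \<le> (norm (u' s) - e)\<^sup>2" by simp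
        then show "norm (u' s) \<le> e / 2 + (norm (u' s))\<^sup>2 / (2 * e)"
          using e by (simp add: power2_eq_square field_simps)
      qed (use i1 i3 in auto)
      also have "\<dots> \<le> integral {0..1} (\<lambda>s. e / 2 + (norm (u' s))\<^sup>2 / (2 * e))"
        by (rule integral_subset_le) (use i2 i3 t e in auto)
      also have "\<dots> = e / 2" by (rule integral_unique[OF i2])
      finally show ?thesis using integral_unique[OF i1] e by simp
    qed
    then have "norm (u t) \<le> 0" by (rule field_le_epsilon[of _ 0, simplified])
    then show ?thesis by simp
  qed
  have eq: "x 0 + t *\<^sub>R c + q t = x t" if "t \<in> {0..1}" for t
    using u_zero[OF that] by (simp add: u_def algebra_simps)
  have "jac x (\<lambda>t. c + p t)"
    unfolding jac_def
  proof (intro ballI conjI)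
    fix t :: real assume t: "t \<in> {0..1}"
    have "((\<lambda>t. x 0 + t *\<^sub>R c + q t) has_vector_derivative c + p t) (at t within {0..1})"
      by (auto intro!: derivative_eq_intros q[OF t])
    then show "(x has_vector_derivative c + p t) (at t within {0..1})"
      by (rule has_vector_derivative_transform[OF t, rotated]) (simp add: eq)
    show "((\<lambda>t. c + p t) has_vector_derivative R t (x t)) (at t within {0..1})"
      using has_vector_derivative_add[OF has_vector_derivative_const[of c] p[OF t]] by simp
  qed
  then show ?thesis by blast
qed

lemma H1w_derivative_unique:
  assumes "H1w 0 1 x x'" "jac x v"
  obtains N where "negligible N" "\<And>t. t \<in> {0..1} - N \<Longrightarrow> x' t = v t"
proof -
  obtain N where N: "negligible N" "\<forall>t\<in>{0<..<1} - N. (x has_vector_derivative x' t) (at t)"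
    using H1wD(1)[OF assms(1)] by blast
  have "x' t = v t" if t: "t \<in> {0..1} - (N \<union> {0, 1})" for t
  proof (rule vector_derivative_unique_at)
    show "(x has_vector_derivative x' t) (at t)" using N(2) t by auto
    have "(x has_vector_derivative v t) (at t within {0..1})" using assms(2) t unfolding jac_def by auto
    then show "(x has_vector_derivative v t) (at t)" using at_within_Icc_at[of 0 t 1] t by auto
  qed
  then show thesis using that[of "N \<union> {0, 1}"] N(1) by (auto simp: negligible_Un)
qed

theorem index_kernel:
  assumes x: "adm x x'" and ker: "\<And>w w'. adm w w' \<Longrightarrow> integral {0..1} (\<lambda>t. b (x' t) (w' t) + b (R t (x t)) (w t)) = 0"
  shows "\<exists>v. jac x v \<and> v 0 = H (v 1)"
proof -
  have xH: "H1w 0 1 x x'" using x unfolding adm_def by blast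
  note test = kernel_all_tests[OF x ker]
  obtain v where v: "jac x v" using du_Bois_Reymond[OF xH test] by blast
  obtain N where N: "negligible N" "\<And>t. t \<in> {0..1} - N \<Longrightarrow> x' t = v t"
    using H1w_derivative_unique[OF xH v] by blast
  have "b (v 0 - H (v 1)) (H a) = 0" for a
  proof -
    \<comment> \<open>A test field with prescribed value a at time 1 and H a at time 0. The
      remaining boundary term is the natural boundary condition, which closes up the
      derivative.\<close>
    let ?z = "\<lambda>t. H a + t *\<^sub>R (a - H a)" and ?z' = "\<lambda>t::real. a - H a"
    have z: "H1w 0 1 ?z ?z'" by (rule H1w_C1) (auto intro!: derivative_eq_intros)
    have "((\<lambda>t. b (x' t) (?z' t) + b (R t (x t)) (?z t)) has_integral 0) {0..1}"
      by (rule test[OF _ z]) simp_all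
    then have i1: "((\<lambda>t. b (R t (x t)) (?z t) + b (v t) (?z' t)) has_integral 0) {0..1}"
      by (rule has_integral_spike[OF N(1), rotated]) (simp add: N(2))
    have i2: "((\<lambda>t. b (R t (x t)) (?z t) + b (v t) (?z' t)) has_integral b (v 1) (?z 1) - b (v 0) (?z 0)) {0..1}"
      using H1w_has_integral[OF H1w_bilinear[OF bb jac_H1w(2)[OF v] z], of 0 1] by simp
    have "b (v 1) (?z 1) - b (v 0) (?z 0) = 0" by (rule has_integral_unique[OF i2 i1])
    then show ?thesis using H_iso[of "v 1" a] by (simp add: b.diff_left)
  qed
  then have "b (v 0 - H (v 1)) y = 0" for y using surjD[OF H_surj, of y] by auto
  then have "v 0 - H (v 1) = 0" by (rule nondegenerate)
  then show ?thesis using v by auto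
qed

end

section \<open>Jacobi fields along closed geodesics\<close>

context index_data
begin

section \<open>The flow of the Jacobi equation over one period\<close>

lemma jac_unique:
  assumes "jac x v" "jac x2 v2" "x 0 = x2 0" "v 0 = v2 0" and t: "t \<in> {0..1}"
  shows "x t = x2 t" "v t = v2 t"
proof -
  let ?A = "\<lambda>t z. (snd z, R t (fst z))" and ?z = "\<lambda>t. (x t - x2 t, v t - v2 t)"
  have "?z t = 0"
  proof (rule linear_ode_unique[of 0 1 ?A ?z 0])
    show "linear (?A t)" if "t \<in> {0..1}" for t
      using R_linear[OF that] by (auto intro!: linearI simp: linear_add linear_scale)
    show "continuous_on {0..1} (\<lambda>t. ?A t z)" for z by (intro continuous_intros R_cont)
    fix t :: real assume t: "t \<in> {0..1}"
    have "((\<lambda>t. x t - x2 t) has_vector_derivative (v t - v2 t)) (at t within {0..1})"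
      "((\<lambda>t. v t - v2 t) has_vector_derivative (R t (x t) - R t (x2 t))) (at t within {0..1})"
      using assms(1,2) t unfolding jac_def by (auto intro!: has_vector_derivative_diff)
    then show "(?z has_vector_derivative ?A t (?z t)) (at t within {0..1})"
      using has_vector_derivative_Pair linear_diff[OF R_linear[OF t]] by fastforce
  qed (use assms in \<open>auto simp: zero_prod_def\<close>)
  then show "x t = x2 t" "v t = v2 t" by (simp_all add: zero_prod_def)
qed

lemma jac_exists: "\<exists>x v. jac x v \<and> x 0 = a \<and> v 0 = c"
proof -
  let ?A = "\<lambda>t z. (snd z, R t (fst z))"
  have lin: "linear (?A t)" if "t \<in> {0..1}" for t
    using R_linear[OF that] by (auto intro!: linearI simp: linear_add linear_scale)
  have cont: "continuous_on {0..1} (\<lambda>t. ?A t z)" for z by (intro continuous_intros R_cont)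
  obtain z where z: "z 0 = (a, c)" "\<And>t. t \<in> {0..1} \<Longrightarrow> (z has_vector_derivative ?A t (z t)) (at t within {0..1})"
    using linear_ode_exists[of 0 1 ?A "(a, c)", OF _ lin cont] by auto
  have "jac (\<lambda>t. fst (z t)) (\<lambda>t. snd (z t))"
    unfolding jac_def
    using bounded_linear.has_vector_derivative[OF bounded_linear_fst z(2)]
      bounded_linear.has_vector_derivative[OF bounded_linear_snd z(2)] by auto
  then show ?thesis using z(1) by (intro exI[of _ "\<lambda>t. fst (z t)"] exI[of _ "\<lambda>t. snd (z t)"]) auto
qed

definition sol :: "'a \<times> 'a \<Rightarrow> (real \<Rightarrow> 'a) \<times> (real \<Rightarrow> 'a)" where
  "sol z = (SOME p. jac (fst p) (snd p) \<and> fst p 0 = fst z \<and> snd p 0 = snd z)"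

lemma sol: "jac (fst (sol z)) (snd (sol z))" "fst (sol z) 0 = fst z" "snd (sol z) 0 = snd z"
proof -
  have "\<exists>p. jac (fst p) (snd p) \<and> fst p 0 = fst z \<and> snd p 0 = snd z"
    using jac_exists[of "fst z" "snd z"] by auto
  from someI_ex[OF this] show "jac (fst (sol z)) (snd (sol z))" "fst (sol z) 0 = fst z" "snd (sol z) 0 = snd z"
    unfolding sol_def by auto
qed

lemma sol_unique: "jac x v \<Longrightarrow> t \<in> {0..1} \<Longrightarrow> fst (sol (x 0, v 0)) t = x t \<and> snd (sol (x 0, v 0)) t = v t"
  using jac_unique[OF sol(1)[of "(x 0, v 0)"], of x v t] sol(2,3)[of "(x 0, v 0)"] by simp

lemma sol_linear:
  assumes t: "t \<in> {0..1}"
  shows "linear (\<lambda>z. fst (sol z) t)" "linear (\<lambda>z. snd (sol z) t)"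
proof -
  have add: "jac (\<lambda>t. fst (sol z) t + fst (sol w) t) (\<lambda>t. snd (sol z) t + snd (sol w) t)" for z w
    using sol(1)[of z] sol(1)[of w] unfolding jac_def
    by (auto intro!: has_vector_derivative_add simp: linear_add[OF R_linear])
  have scale: "jac (\<lambda>t. r *\<^sub>R fst (sol z) t) (\<lambda>t. r *\<^sub>R snd (sol z) t)" for z r
    using sol(1)[of z] unfolding jac_def
    by (auto intro!: bounded_linear.has_vector_derivative[OF bounded_linear_scaleR_right] simp: linear_scale[OF R_linear])
  show "linear (\<lambda>z. fst (sol z) t)" "linear (\<lambda>z. snd (sol z) t)"
    using sol_unique[OF add t] sol_unique[OF scale t] sol(2,3)
    by (auto intro!: linearI simp: plus_prod_def scaleR_prod_def)
qed

text \<open>Solving over one period gives the data in the frame at time 1; applying the holonomy H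
  to both components returns to the tangent space at \<gamma> 0. This is the Poincare map before an
  index is lowered.\<close>

definition flow :: "'a \<times> 'a \<Rightarrow> 'a \<times> 'a" where
  "flow z = (H (fst (sol z) 1), H (snd (sol z) 1))"

lemma flow_linear: "linear flow"
proof -
  have l: "linear (\<lambda>z. H (fst (sol z) 1))" "linear (\<lambda>z. H (snd (sol z) 1))"
    using linear_compose[OF sol_linear(1)[of 1] H_linear] linear_compose[OF sol_linear(2)[of 1] H_linear]
    by (simp_all add: o_def)
  show ?thesis
    by (rule linearI)
       (simp_all only: flow_def linear_add[OF l(1)] linear_add[OF l(2)] linear_scale[OF l(1)] linear_scale[OF l(2)] add_Pair scaleR_Pair)
qed

lemma flow_jac: "jac x v \<Longrightarrow> flow (x 0, v 0) = (H (x 1), H (v 1))"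
  unfolding flow_def using sol_unique[of x v 1] by simp

lemma adm_lincomb:
  assumes "adm x x'" "adm w w'"
  shows "adm (\<lambda>t. x t + r *\<^sub>R w t) (\<lambda>t. x' t + r *\<^sub>R w' t)"
proof -
  obtain k N l M where x: "H1w 0 1 x x'" "x 0 = H (x 1)" "negligible N" "\<forall>t\<in>{0..1} - N. b (x' t) (y0 t) - b (x t) (y1 t) = k"
    and w: "H1w 0 1 w w'" "w 0 = H (w 1)" "negligible M" "\<forall>t\<in>{0..1} - M. b (w' t) (y0 t) - b (w t) (y1 t) = l"
    using assms unfolding adm_def by blast
  have "H1w 0 1 (\<lambda>t. x t + r *\<^sub>R w t) (\<lambda>t. x' t + r *\<^sub>R w' t)"
    by (intro H1w_add x H1w_linear[OF bounded_linear_scaleR_right] w)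
  moreover have "x 0 + r *\<^sub>R w 0 = H (x 1 + r *\<^sub>R w 1)"
    using x(2) w(2) by (simp add: linear_add[OF H_linear] linear_scale[OF H_linear])
  moreover have "b (x' t + r *\<^sub>R w' t) (y0 t) - b (x t + r *\<^sub>R w t) (y1 t) = k + r * l" if t: "t \<in> {0..1} - (N \<union> M)" for t
  proof -
    have "b (x' t) (y0 t) - b (x t) (y1 t) = k" "b (w' t) (y0 t) - b (w t) (y1 t) = l" using x(4) w(4) t by auto
    then show ?thesis by (auto simp: b.add_left b.scaleR_left algebra_simps)
  qed
  ultimately show ?thesis
    unfolding adm_def using x(3) w(3)
    by (intro conjI exI[of _ "k + r * l"] exI[of _ "N \<union> M"]) (auto simp: negligible_Un)
qed

end

section \<open>H^1 fields along a geodesic in the parallel frame\<close>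

lemma H1w_vector_derivative:
  assumes "H1w a b f f'"
  shows "H1w a b f (\<lambda>t. vector_derivative f (at t))"
proof -
  obtain N where N: "negligible N" "\<forall>t\<in>{a<..<b} - N. (f has_vector_derivative f' t) (at t)"
    using H1wD(1)[OF assms] by blast
  have "f' t = vector_derivative f (at t)" if "t \<in> {a..b} - (N \<union> {a, b})" for t
    by (rule vector_derivative_at[symmetric]) (use N(2) that in auto)
  then show ?thesis
    by (intro H1w_spike[OF assms, of "N \<union> {a, b}"]) (use N(1) in \<open>auto simp: negligible_Un\<close>)
qed

text \<open>Covers the degenerate intervals that occur in arguments by bisection.\<close>

lemma H1w_trivial: "b \<le> a \<Longrightarrow> H1w a b f f'"
  unfolding H1w_def by (cases "a = b") (auto intro!: exI[of _ "{}"] has_integral_integrable[OF has_integral_refl(2)])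

context lorentz
begin

lemma g_dual: "\<exists>T. linear T \<and> (\<forall>x z. g p x (T z) = x \<bullet> z)"
proof -
  obtain y where y: "\<And>z x. g p x (y z) = x \<bullet> z" using g_represents by metis
  have "linear y"
  proof (rule linearI)
    fix a b c
    have "g p w (y (a + b)) = g p w (y a + y b)" "g p w (y (c *\<^sub>R a)) = g p w (c *\<^sub>R y a)" for w
      by (simp_all add: y g_simps inner_add_right)
    then show "y (a + b) = y a + y b" "y (c *\<^sub>R a) = c *\<^sub>R y a"
      using g_eqI[of p] g_sym[of p] by metis+
  qed
  then show ?thesis using y by blast
qed

end

context lorentz_geodesic
begin

lemma frame_chart_C1:
  assumes c: "c \<in> A" and S: "{a..b} \<subseteq> {0..1}" "\<gamma> ` {a..b} \<subseteq> fst c"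
  shows "H1w a b (\<lambda>t. comps A c (\<gamma> t) (frame t y))
    (\<lambda>t. comps A c (\<gamma> t) 0 - Gam (gram A g c) (snd c (\<gamma> t)) (comps A c (\<gamma> t) (vel A \<gamma> t)) (comps A c (\<gamma> t) (frame t y)))"
proof (rule H1w_C1)
  have cv: "covd \<gamma> {a..b} (\<lambda>s. frame s y) t 0" if "t \<in> {a..b}" for t
    using covd_subset[OF frame(3) S(1)] S(1) that by auto
  have cf: "continuous_on {a..b} (\<lambda>t. comps A c (\<gamma> t) (frame t y))"
    by (rule covd_continuous[where w="\<lambda>_. 0", OF cv c S(2)])
  show "continuous_on {a..b} (\<lambda>t. comps A c (\<gamma> t) 0 - Gam (gram A g c) (snd c (\<gamma> t)) (comps A c (\<gamma> t) (vel A \<gamma> t)) (comps A c (\<gamma> t) (frame t y)))"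
  proof (rule continuous_on_diff[OF _ Gam_along_continuous[OF c S cf]])
    show "continuous_on {a..b} (\<lambda>t. comps A c (\<gamma> t) 0)"
      by (rule continuous_on_eq[OF continuous_on_const[of _ 0]])
         (use S(2) linear_0[OF comps_linear[OF c]] in \<open>auto simp: image_subset_iff\<close>)
  qed
  fix t assume t: "t \<in> {a..b}"
  then have "\<gamma> t \<in> fst c" using S(2) by auto
  then show "((\<lambda>t. comps A c (\<gamma> t) (frame t y)) has_vector_derivative comps A c (\<gamma> t) 0 - Gam (gram A g c) (snd c (\<gamma> t))
     (comps A c (\<gamma> t) (vel A \<gamma> t)) (comps A c (\<gamma> t) (frame t y))) (at t within {a..b})"
    by (rule covdD[OF cv[OF t] c])
qed

lemma gram_chart_C1:
  assumes c: "c \<in> A" and S: "{a..b} \<subseteq> {0..1}" "\<gamma> ` {a..b} \<subseteq> fst c"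
  shows "\<exists>G'. H1w a b (\<lambda>t. gram A g c (snd c (\<gamma> t))) G'"
proof (rule exI, rule H1w_C1)
  interpret M: local_metric "snd c ` fst c" "gram A g c" by (rule local_metric[OF c])
  have x: "snd c (\<gamma> t) \<in> snd c ` fst c" "\<gamma> t \<in> fst c" if "t \<in> {a..b}" for t using S(2) that by blast+
  show "((\<lambda>t. gram A g c (snd c (\<gamma> t))) has_vector_derivative
     dd (gram A g c) (comps A c (\<gamma> t) (vel A \<gamma> t)) (snd c (\<gamma> t))) (at t within {a..b})" if t: "t \<in> {a..b}" for t
    by (rule dd_compose_curve[OF M.diff_G(1)[OF x(1)[OF t]] vel_chart_subset[OF S(1) t c x(2)[OF t]]])
  have "continuous_on {a..b} (\<lambda>t. dd (gram A g c) e (snd c (\<gamma> t)))" for e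
    by (rule continuous_on_compose2[OF smooth_on_continuous[OF smooth_on_dd[OF M.smooth_G]] chart_continuous[OF c S]])
       (use x in auto)
  then show "continuous_on {a..b} (\<lambda>t. dd (gram A g c) (comps A c (\<gamma> t) (vel A \<gamma> t)) (snd c (\<gamma> t)))"
    using linear_family_continuous[where A="\<lambda>t e. dd (gram A g c) e (snd c (\<gamma> t))", OF dd_linear[OF M.diff_G(1)[OF x(1)]] _ vel_continuous[OF c S]]
    by blast
qed

text \<open>A euclidean component of the unframed field is the g-product of V with a parallel
  vector, in a chart a product of an H^1 function with C^1 functions. The pieces in charts are glued
  by bisection.\<close>

lemma H1_field_unframe:
  assumes V: "H1_field A \<gamma> V"
  shows "\<exists>x'. H1w 0 1 (\<lambda>t. unframe t (V t)) x'"
proof -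
  let ?x = "\<lambda>t. unframe t (V t)"
  \<comment> \<open>The two-sided derivative does not depend on the interval, so that neighbouring
    pieces can be joined with the same derivative function.\<close>
  let ?x' = "\<lambda>t. vector_derivative ?x (at t)"
  obtain T where T: "linear T" "\<And>x z. g (\<gamma> 0) x (T z) = x \<bullet> z" using g_dual by blast
  have loc: "H1w a b ?x ?x'" if c: "c \<in> A" and ab: "0 \<le> a" "a < b" "b \<le> 1" and im: "\<gamma> ` {a..b} \<subseteq> fst c" for a b c
  proof -
    have S: "{a..b} \<subseteq> {0..1}" using ab by auto
    have "H1_on a b (\<lambda>t. comps A c (\<gamma> t) (V t))"
      using V c ab im unfolding H1_field_def by blast
    from H1_on_imp_H1w[OF this] obtain v' where v': "H1w a b (\<lambda>t. comps A c (\<gamma> t) (V t)) v'" by blast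
    obtain G' where G': "H1w a b (\<lambda>t. gram A g c (snd c (\<gamma> t))) G'" using gram_chart_C1[OF c S im] by blast
    have "\<exists>h'. H1w a b (\<lambda>t. ?x t \<bullet> e) h'" for e
    proof -
      have "\<exists>h'. H1w a b (\<lambda>t. comps A c (\<gamma> t) (V t) \<bullet> (gram A g c (snd c (\<gamma> t)) *v comps A c (\<gamma> t) (frame t (T e)))) h'"
        using H1w_bilinear[OF bounded_bilinear_inner v' H1w_bilinear[OF bounded_bilinear_matrix_vector_mult G' frame_chart_C1[OF c S im]]] by blast
      then obtain h' where "H1w a b (\<lambda>t. comps A c (\<gamma> t) (V t) \<bullet> (gram A g c (snd c (\<gamma> t)) *v comps A c (\<gamma> t) (frame t (T e)))) h'" by blast
      then have "H1w a b (\<lambda>t. ?x t \<bullet> e) h'"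
      proof (rule H1w_cong)
        fix t assume t: "t \<in> {a..b}"
        then have "?x t \<bullet> e = g (\<gamma> t) (V t) (frame t (T e))"
          using unframe_isometry[of t "V t" "T e"] S T(2) by auto
        then show "comps A c (\<gamma> t) (V t) \<bullet> (gram A g c (snd c (\<gamma> t)) *v comps A c (\<gamma> t) (frame t (T e))) = ?x t \<bullet> e"
          using g_gram[OF c, of "\<gamma> t"] im t by (auto simp: gm_def image_subset_iff)
      qed
      then show ?thesis by blast
    qed
    then obtain h where h: "\<And>e. H1w a b (\<lambda>t. ?x t \<bullet> e) (h e)" by metis
    have "H1w a b (\<lambda>t. \<Sum>e\<in>Basis. (?x t \<bullet> e) *\<^sub>R e) (\<lambda>t. \<Sum>e\<in>Basis. h e t *\<^sub>R e)"
      by (intro H1w_sum H1w_linear[OF bounded_linear_scaleR_left] h)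
    then have "H1w a b ?x (\<lambda>t. \<Sum>e\<in>Basis. h e t *\<^sub>R e)" by (simp only: euclidean_representation)
    then show ?thesis by (rule H1w_vector_derivative)
  qed
  have "0 \<le> (0::real) \<and> 1 \<le> (1::real) \<longrightarrow> H1w 0 1 ?x ?x'"
  proof (rule Bolzano[where P="\<lambda>a b. 0 \<le> a \<and> b \<le> 1 \<longrightarrow> H1w a b ?x ?x'"])
    fix a b c :: real
    assume "0 \<le> a \<and> b \<le> 1 \<longrightarrow> H1w a b ?x ?x'" "0 \<le> b \<and> c \<le> 1 \<longrightarrow> H1w b c ?x ?x'" "a \<le> b" "b \<le> c"
    then show "0 \<le> a \<and> c \<le> 1 \<longrightarrow> H1w a c ?x ?x'" using H1w_join[of a b ?x ?x' c] by auto
  next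
    fix t0 :: real assume t0: "0 \<le> t0" "t0 \<le> 1"
    let ?c = "chart_at A (\<gamma> t0)"
    have "eventually (\<lambda>s. \<gamma> s \<in> fst ?c) (at t0 within {0..1})"
      using eventually_chart[OF subset_refl _ chart(1)[OF chart_at(1)] chart_at(2)] t0 by auto
    then obtain d where d: "d > 0" "\<And>s. s \<in> {0..1} \<Longrightarrow> s \<noteq> t0 \<Longrightarrow> dist s t0 < d \<Longrightarrow> \<gamma> s \<in> fst ?c"
      unfolding eventually_at by blast
    have d2: "\<gamma> s \<in> fst ?c" if "s \<in> {0..1}" "dist s t0 < d" for s
      using d(2)[of s] that chart_at(2) by (cases "s = t0") auto
    show "\<exists>d>0. \<forall>a b. a \<le> t0 \<and> t0 \<le> b \<and> b - a < d \<longrightarrow> 0 \<le> a \<and> b \<le> 1 \<longrightarrow> H1w a b ?x ?x'"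
    proof (intro exI[of _ d] conjI allI impI d(1))
      fix a b assume ab: "a \<le> t0 \<and> t0 \<le> b \<and> b - a < d" "0 \<le> a \<and> b \<le> 1"
      show "H1w a b ?x ?x'"
      proof (cases "a < b")
        case True
        then show ?thesis
          by (rule loc[OF chart_at(1)[of "\<gamma> t0"], rotated]) (use ab d2 in \<open>auto simp: dist_real_def\<close>)
      qed (simp add: H1w_trivial)
    qed
  qed auto
  then show ?thesis by auto
qed

text \<open>The value zero outside [0,1] agrees with \<open>H1_field\<close>, so that equality of
  fields is equality of functions.\<close>

definition fld :: "(real \<Rightarrow> real^'b) \<Rightarrow> real \<Rightarrow> real^'b" where
  "fld x t = (if t \<in> {0..1} then frame t (x t) else 0)"

lemma fld_unframe: "(\<And>t. t \<notin> {0..1} \<Longrightarrow> V t = 0) \<Longrightarrow> fld (\<lambda>t. unframe t (V t)) = V"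
  by (auto simp: fld_def unframe)

lemma unframe_fld: "t \<in> {0..1} \<Longrightarrow> unframe t (fld x t) = x t"
  by (simp add: fld_def unframe)

lemma covd_fld:
  assumes "t \<in> {0..1}" "(x has_vector_derivative x') (at t within {0..1})"
  shows "covd \<gamma> {0..1} (fld x) t (frame t x')"
  by (rule covd_cong[OF covd_frame[OF subset_refl assms]]) (use assms in \<open>auto simp: fld_def\<close>)

lemma cov_deriv_fld:
  assumes "t \<in> {0..1}" "(x has_vector_derivative x') (at t within {0..1})"
  shows "cov_deriv A g \<gamma> (fld x) t = frame t x'"
  by (rule covd_cov_deriv[OF assms(1) covd_fld[OF assms]])

lemma fld_H1_field:
  assumes x: "H1w 0 1 x x'" and "x 0 = frame 1 (x 1)"
  shows "H1_field A \<gamma> (fld x)"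
  unfolding H1_field_def
proof (intro conjI ballI allI impI)
  show "fld x t = 0" if "t \<notin> {0..1}" for t using that by (simp only: fld_def if_False)
  show "fld x 0 = fld x 1" using assms(2) by (simp add: fld_def frame(2))
  fix c a b assume c: "c \<in> A" and ab: "0 \<le> a \<and> a < b \<and> b \<le> 1 \<and> \<gamma> ` {a..b} \<subseteq> fst c"
  have S: "{a..b} \<subseteq> {0..1}" "\<gamma> ` {a..b} \<subseteq> fst c" using ab by auto
  have xs: "H1w a b x x'" by (rule H1w_subset[OF x]) (use ab in auto)
  have "\<exists>h. H1w a b (\<lambda>t. (x t \<bullet> e) *\<^sub>R comps A c (\<gamma> t) (frame t e)) h" for e
    using H1w_bilinear[OF bounded_bilinear_scaleR H1w_linear[OF bounded_linear_inner_left xs] frame_chart_C1[OF c S]] by blast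
  then obtain h where "\<And>e. H1w a b (\<lambda>t. (x t \<bullet> e) *\<^sub>R comps A c (\<gamma> t) (frame t e)) (h e)" by metis
  then have "H1w a b (\<lambda>t. \<Sum>e\<in>Basis. (x t \<bullet> e) *\<^sub>R comps A c (\<gamma> t) (frame t e)) (\<lambda>t. \<Sum>e\<in>Basis. h e t)"
    by (rule H1w_sum)
  then have "H1w a b (\<lambda>t. comps A c (\<gamma> t) (fld x t)) (\<lambda>t. \<Sum>e\<in>Basis. h e t)"
  proof (rule H1w_cong)
    fix t assume t: "t \<in> {a..b}"
    then have ct: "\<gamma> t \<in> fst c" and t1: "t \<in> {0..1}" using S by auto
    have "comps A c (\<gamma> t) (frame t (x t)) = (\<Sum>e\<in>Basis. (x t \<bullet> e) *\<^sub>R comps A c (\<gamma> t) (frame t e))"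
      using linear_family_expand[OF linear_compose[OF frame(1) comps_linear[OF c ct]], where x="x t"] by (simp add: o_def)
    then show "(\<Sum>e\<in>Basis. (x t \<bullet> e) *\<^sub>R comps A c (\<gamma> t) (frame t e)) = comps A c (\<gamma> t) (fld x t)"
      using t1 by (simp add: fld_def)
  qed
  then show "H1_on a b (\<lambda>t. comps A c (\<gamma> t) (fld x t))"
    by (rule H1w_imp_H1_on) (use ab in simp)
qed

end

section \<open>Closed geodesics: kernel of the index form, Poincare map and nullity\<close>

locale closed_killing = lorentz_killing_geodesic A g \<gamma> Y
  for A :: "('m::{t2_space, second_countable_topology}, 'n::finite) chart set" and g and \<gamma> and Y +
  assumes closed: "closed_geodesic A g \<gamma>" and timelike: "timelike_field g Y"
begin

lemma endpoints: "\<gamma> 1 = \<gamma> 0" "vel A \<gamma> 1 = vel A \<gamma> 0"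
  using closed unfolding closed_geodesic_def by auto

text \<open>Both sides come from one-sided derivatives at opposite ends of [0,1]. They agree because
  the covariant derivative of \<open>Y\<close> along \<gamma> depends only on position and
  velocity.\<close>

lemma DY_endpoints: "DY 1 = DY 0"
proof -
  have "comps A (chart_at A (\<gamma> 0)) (\<gamma> 0) (DY 1) = comps A (chart_at A (\<gamma> 0)) (\<gamma> 0) (DY 0)"
    using DY_nab[of 0, OF _ chart_at] DY_nab[of 1, OF _ chart_at] by (simp add: endpoints)
  then show ?thesis using comps_chart_at by simp
qed

definition dual where "dual = (SOME T. linear T \<and> (\<forall>x z. g (\<gamma> 0) x (T z) = x \<bullet> z))"

lemma dual: "linear dual" "g (\<gamma> 0) x (dual z) = x \<bullet> z"
  using someI_ex[OF g_dual[of "\<gamma> 0"]] unfolding dual_def by auto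

text \<open>Since \<gamma> closes up, \<open>frame 1\<close> is an endomorphism of the tangent space
  at \<gamma> 0, the holonomy. Self-adjointness of \<open>Rf\<close> comes from the pair symmetry of
  the curvature.\<close>

sublocale I: index_data "g (\<gamma> 0)" Rf "frame 1" dual "\<lambda>t. unframe t (Y (\<gamma> t))" "\<lambda>t. unframe t (DY t)"
proof (rule index_data.intro)
  show "bilinear (g (\<gamma> 0))" "g (\<gamma> 0) x y = g (\<gamma> 0) y x" for x y by (rule g_bilinear, rule g_sym)
  show "linear dual" "g (\<gamma> 0) x (dual z) = x \<bullet> z" for x z by (rule dual)+
  show "continuous_on {0..1} (\<lambda>t. Rf t x)" for x by (rule Rf_continuous)
  show "linear (frame 1)" by (rule frame(1))
  show "g (\<gamma> 0) (frame 1 x) (frame 1 y) = g (\<gamma> 0) x y" for x y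
    using frame_isometry[of 1 x y] by (simp add: endpoints)
  have f0: "unframe 0 v = v" for v using unframe(1)[of 0 v] by (simp add: frame(2))
  show "unframe 0 (Y (\<gamma> 0)) = frame 1 (unframe 1 (Y (\<gamma> 1)))" "unframe 0 (DY 0) = frame 1 (unframe 1 (DY 1))"
    by (simp_all add: unframe f0 endpoints DY_endpoints)
  fix t :: real assume t: "t \<in> {0..1}"
  show "linear (Rf t)" "g (\<gamma> 0) (Rf t x) y = g (\<gamma> 0) x (Rf t y)" for x y
    by (rule Rf_linear[OF t], rule Rf_sym[OF t])
  show "((\<lambda>t. unframe t (Y (\<gamma> t))) has_vector_derivative unframe t (DY t)) (at t within {0..1})"
    by (rule covd_unframe[OF subset_refl t covd_Y[OF t]])
  show "((\<lambda>t. unframe t (DY t)) has_vector_derivative Rf t (unframe t (Y (\<gamma> t)))) (at t within {0..1})"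
    using covd_unframe[OF subset_refl t covd_DY[OF t]] by (simp add: Rf_def unframe(1)[OF t])
  show "g (\<gamma> 0) (unframe t (Y (\<gamma> t))) (unframe t (Y (\<gamma> t))) < 0"
    unfolding frame_isometry[OF t, symmetric] unframe(1)[OF t]
    using timelike by (simp add: timelike_field_def)
qed

lemma cov_deriv_H1w:
  assumes x: "H1w 0 1 x x'"
  shows "\<exists>N. negligible N \<and> (\<forall>t\<in>{0..1} - N. cov_deriv A g \<gamma> (fld x) t = frame t (x' t))"
proof -
  obtain N where N: "negligible N" "\<forall>t\<in>{0<..<1} - N. (x has_vector_derivative x' t) (at t)"
    using H1wD(1)[OF x] by blast
  have "cov_deriv A g \<gamma> (fld x) t = frame t (x' t)" if t: "t \<in> {0..1} - (N \<union> {0, 1})" for t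
  proof -
    have "(x has_vector_derivative x' t) (at t)" using N(2) t by auto
    then show ?thesis using t by (intro cov_deriv_fld) (auto intro: has_vector_derivative_at_within)
  qed
  then show ?thesis using N(1) by (intro exI[of _ "N \<union> {0, 1}"]) (auto simp: negligible_Un)
qed

lemma g_frame_unframe: "t \<in> {0..1} \<Longrightarrow> g (\<gamma> t) (frame t v) w = g (\<gamma> 0) v (unframe t w)"
  using frame_isometry[of t v "unframe t w"] by (simp add: unframe)

lemma tangent_condition:
  assumes x: "H1w 0 1 x x'"
  shows "ae_const (\<lambda>t. g (\<gamma> t) (cov_deriv A g \<gamma> (fld x) t) (Y (\<gamma> t)) - g (\<gamma> t) (fld x t) (DY t)) \<longleftrightarrow>
    (\<exists>k N. negligible N \<and> (\<forall>t\<in>{0..1} - N. g (\<gamma> 0) (x' t) (unframe t (Y (\<gamma> t))) - g (\<gamma> 0) (x t) (unframe t (DY t)) = k))"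
    (is "ae_const ?l \<longleftrightarrow> (\<exists>k N. negligible N \<and> (\<forall>t\<in>{0..1} - N. ?r t = k))")
proof -
  obtain M where M: "negligible M" "\<And>t. t \<in> {0..1} - M \<Longrightarrow> cov_deriv A g \<gamma> (fld x) t = frame t (x' t)"
    using cov_deriv_H1w[OF x] by blast
  have eq: "?l t = ?r t" if "t \<in> {0..1} - M" for t
    using M(2)[OF that] that g_frame_unframe[of t] by (simp add: fld_def)
  have "ae_const ?l \<longleftrightarrow> (\<exists>k N. negligible N \<and> (\<forall>t\<in>{0..1} - N. ?l t = k))"
    unfolding ae_const_def using AE_lebesgue_on_iff[of "{0..1::real}"] by simp
  also have "\<dots> \<longleftrightarrow> (\<exists>k N. negligible N \<and> (\<forall>t\<in>{0..1} - N. ?r t = k))"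
  proof safe
    fix k N assume N: "negligible N" "\<forall>t\<in>{0..1} - N. ?l t = k"
    have "?r t = k" if t: "t \<in> {0..1} - (N \<union> M)" for t
    proof -
      have "?l t = ?r t" by (rule eq) (use t in auto)
      moreover have "?l t = k" using N(2) t by blast
      ultimately show ?thesis by (rule trans[OF sym])
    qed
    then show "\<exists>k N. negligible N \<and> (\<forall>t\<in>{0..1} - N. ?r t = k)"
      using M(1) N(1) by (intro exI[of _ k] exI[of _ "N \<union> M"]) (simp add: negligible_Un)
  next
    fix k N assume N: "negligible N" "\<forall>t\<in>{0..1} - N. ?r t = k"
    have "?l t = k" if t: "t \<in> {0..1} - (N \<union> M)" for t
    proof -
      have "?l t = ?r t" by (rule eq) (use t in auto)
      moreover have "?r t = k" using N(2) t by blast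
      ultimately show ?thesis by (rule trans)
    qed
    then show "\<exists>k N. negligible N \<and> (\<forall>t\<in>{0..1} - N. ?l t = k)"
      using M(1) N(1) by (intro exI[of _ k] exI[of _ "N \<union> M"]) (simp add: negligible_Un)
  qed
  finally show ?thesis .
qed

text \<open>The frame is the identity at time 0 and the holonomy at time 1, which turns V 0 = V 1
  into the boundary condition of \<open>adm\<close>.\<close>

lemma tangent_N_iff: "V \<in> tangent_N A g Y \<gamma> \<longleftrightarrow> (\<exists>x x'. I.adm x x' \<and> V = fld x)"
proof
  assume V: "V \<in> tangent_N A g Y \<gamma>"
  let ?x = "\<lambda>t. unframe t (V t)"
  have H1: "H1_field A \<gamma> V" using V unfolding tangent_N_def by blast
  then have ext: "\<And>t. t \<notin> {0..1} \<Longrightarrow> V t = 0" and per: "V 0 = V 1" unfolding H1_field_def by blast+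
  have fx: "fld ?x = V" by (rule fld_unframe[OF ext])
  obtain x' where x': "H1w 0 1 ?x x'" using H1_field_unframe[OF H1] by blast
  have "unframe 0 (V 0) = V 0" using unframe(1)[of 0 "V 0"] by (simp add: frame(2))
  then have "?x 0 = frame 1 (?x 1)" using unframe(1)[of 1 "V 1"] per by simp
  moreover have "ae_const (\<lambda>t. g (\<gamma> t) (cov_deriv A g \<gamma> (fld ?x) t) (Y (\<gamma> t)) - g (\<gamma> t) (fld ?x t) (DY t))"
    using V unfolding tangent_N_def fx DY_def by blast
  ultimately have "I.adm ?x x'" unfolding I.adm_def using x' tangent_condition[OF x'] by blast
  then show "\<exists>x x'. I.adm x x' \<and> V = fld x" using fx by metis
next
  assume "\<exists>x x'. I.adm x x' \<and> V = fld x"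
  then obtain x x' where x: "I.adm x x'" "V = fld x" by blast
  then have x': "H1w 0 1 x x'" "x 0 = frame 1 (x 1)" unfolding I.adm_def by auto
  have "ae_const (\<lambda>t. g (\<gamma> t) (cov_deriv A g \<gamma> (fld x) t) (Y (\<gamma> t)) - g (\<gamma> t) (fld x t) (DY t))"
    unfolding tangent_condition[OF x'(1)] using x(1) unfolding I.adm_def by blast
  then show "V \<in> tangent_N A g Y \<gamma>"
    unfolding tangent_N_def x(2) using fld_H1_field[OF x'] by (simp add: DY_def)
qed

lemma index_form_fld:
  assumes x: "H1w 0 1 x x'" and w: "H1w 0 1 w w'"
  shows "index_form A g \<gamma> (fld x) (fld w) = integral {0..1} (\<lambda>t. g (\<gamma> 0) (x' t) (w' t) + g (\<gamma> 0) (Rf t (x t)) (w t))"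
proof -
  obtain M where M: "negligible M" "\<And>t. t \<in> {0..1} - M \<Longrightarrow> cov_deriv A g \<gamma> (fld x) t = frame t (x' t)"
    using cov_deriv_H1w[OF x] by blast
  obtain N where N: "negligible N" "\<And>t. t \<in> {0..1} - N \<Longrightarrow> cov_deriv A g \<gamma> (fld w) t = frame t (w' t)"
    using cov_deriv_H1w[OF w] by blast
  show ?thesis
    unfolding index_form_def
  proof (rule integral_spike[of "M \<union> N"])
    show "negligible (M \<union> N)" using M N by (simp add: negligible_Un)
    fix t assume t: "t \<in> {0..1} - (M \<union> N)"
    then have t1: "t \<in> {0..1}" by simp
    show "g (\<gamma> 0) (x' t) (w' t) + g (\<gamma> 0) (Rf t (x t)) (w t) =
       g (\<gamma> t) (cov_deriv A g \<gamma> (fld x) t) (cov_deriv A g \<gamma> (fld w) t) +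
       g (\<gamma> t) (curvature A g (\<gamma> t) (vel A \<gamma> t) (fld x t) (vel A \<gamma> t)) (fld w t)"
      using M(2)[of t] N(2)[of t] t t1 frame_isometry[OF t1] by (simp add: fld_def frame_Rf[OF t1, symmetric])
  qed
qed

definition kern where
  "kern = {V \<in> tangent_N A g Y \<gamma>. \<forall>W\<in>tangent_N A g Y \<gamma>. index_form A g \<gamma> V W = 0}"

definition Jf :: "(real^'n) \<times> (real^'n) \<Rightarrow> real \<Rightarrow> real^'n" where "Jf z = fld (fst (I.sol z))"

lemma Jf_jac: "I.jac x v \<Longrightarrow> fld x = Jf (x 0, v 0)"
  unfolding Jf_def fld_def by (intro ext) (use I.sol_unique[of x v] in auto)

text \<open>Kernel fields solve the Jacobi equation and close up together with their derivative by
  \<open>index_kernel\<close>, so their initial data are fixed by the flow. The converse is the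
  integration by parts in \<open>jac_kernel\<close>.\<close>

lemma kern_eq: "kern = Jf ` {z. I.flow z = z}"
proof (intro equalityI subsetI)
  fix V assume V: "V \<in> kern"
  then obtain x x' where x: "I.adm x x'" "V = fld x" unfolding kern_def tangent_N_iff by blast
  have xH: "H1w 0 1 x x'" using x(1) unfolding I.adm_def by blast
  have "integral {0..1} (\<lambda>t. g (\<gamma> 0) (x' t) (w' t) + g (\<gamma> 0) (Rf t (x t)) (w t)) = 0" if w: "I.adm w w'" for w w'
  proof -
    have "H1w 0 1 w w'" using w unfolding I.adm_def by blast
    moreover have "fld w \<in> tangent_N A g Y \<gamma>" using w tangent_N_iff by blast
    ultimately show ?thesis using V index_form_fld[OF xH, of w w'] unfolding kern_def x(2) by simp
  qed
  from I.index_kernel[OF x(1) this] obtain v where v: "I.jac x v" "v 0 = frame 1 (v 1)" by blast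
  have "x 0 = frame 1 (x 1)" using x(1) unfolding I.adm_def by blast
  then have "I.flow (x 0, v 0) = (x 0, v 0)" using I.flow_jac[OF v(1)] v(2) by simp
  then show "V \<in> Jf ` {z. I.flow z = z}" using Jf_jac[OF v(1)] x(2) by blast
next
  fix V assume "V \<in> Jf ` {z. I.flow z = z}"
  then obtain z where z: "I.flow z = z" "V = Jf z" by blast
  let ?x = "fst (I.sol z)" and ?v = "snd (I.sol z)"
  have p: "?x 0 = frame 1 (?x 1)" "?v 0 = frame 1 (?v 1)"
    using z(1) I.sol(2,3)[of z] unfolding I.flow_def by (metis fst_conv, metis snd_conv)
  have a: "I.adm ?x ?v" by (rule I.jac_adm[OF I.sol(1) p(1)])
  show "V \<in> kern"
    unfolding kern_def
  proof (intro CollectI conjI ballI)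
    show "V \<in> tangent_N A g Y \<gamma>" unfolding tangent_N_iff z(2) Jf_def using a by blast
    fix W assume "W \<in> tangent_N A g Y \<gamma>"
    then obtain w w' where w: "I.adm w w'" "W = fld w" unfolding tangent_N_iff by blast
    then have wH: "H1w 0 1 w w'" "w 0 = frame 1 (w 1)" unfolding I.adm_def by auto
    show "index_form A g \<gamma> V W = 0"
      unfolding z(2) Jf_def w(2) index_form_fld[OF I.jac_H1w(1)[OF I.sol(1)] wH(1)]
      by (rule integral_unique[OF I.jac_kernel[OF I.sol(1) p(2) wH]])
  qed
qed

lemma Jf_add: "Jf (z + w) t = Jf z t + Jf w t" and Jf_scale: "Jf (r *\<^sub>R z) t = r *\<^sub>R Jf z t"
proof -
  show "Jf (z + w) t = Jf z t + Jf w t"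
    using linear_add[OF I.sol_linear(1)[of t]] linear_add[OF frame(1)] by (simp add: Jf_def fld_def)
  show "Jf (r *\<^sub>R z) t = r *\<^sub>R Jf z t"
    using linear_scale[OF I.sol_linear(1)[of t]] linear_scale[OF frame(1)] by (simp add: Jf_def fld_def)
qed

text \<open>The field alone determines both components of the initial data, the second one through
  its derivative at time 0.\<close>

lemma Jf_inj:
  assumes eq: "Jf z = Jf w"
  shows "z = w"
proof -
  have e: "fst (I.sol z) t = fst (I.sol w) t" if "t \<in> {0..1}" for t
    using fun_cong[OF eq, of t] unframe_fld[OF that, of "fst (I.sol z)"] unframe_fld[OF that, of "fst (I.sol w)"]
    unfolding Jf_def by simp
  have d: "(fst (I.sol z) has_vector_derivative snd z) (at 0 within {0..1})" for z
    using I.sol(1)[of z] I.sol(3)[of z] unfolding I.jac_def by force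
  have "(fst (I.sol z) has_vector_derivative snd w) (at 0 within {0..1})"
    by (rule has_vector_derivative_transform[OF _ _ d[of w]]) (use e in auto)
  then have "snd z = snd w"
    using vector_derivative_unique_within_closed_interval[of 0 1 0 "fst (I.sol z)"] d[of z] by simp
  moreover have "fst z = fst w" using e[of 0] I.sol(2) by simp
  ultimately show ?thesis by (simp add: prod_eq_iff)
qed

lemma jacobi_field_jac:
  assumes J: "jacobi_field A g \<gamma> J"
  shows "I.jac (\<lambda>t. unframe t (J t)) (\<lambda>t. unframe t (cov_deriv A g \<gamma> J t))"
  unfolding I.jac_def
proof (intro ballI conjI)
  fix t :: real assume t: "t \<in> {0..1}"
  have "covd \<gamma> {0..1} J t (cov_deriv A g \<gamma> J t)"
    using J t differentiable_along_covd unfolding jacobi_field_def by blast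
  from covd_unframe[OF subset_refl t this]
  show "((\<lambda>t. unframe t (J t)) has_vector_derivative unframe t (cov_deriv A g \<gamma> J t)) (at t within {0..1})" .
  have "covd \<gamma> {0..1} (cov_deriv A g \<gamma> J) t (curvature A g (\<gamma> t) (vel A \<gamma> t) (J t) (vel A \<gamma> t))"
    using J t differentiable_along_covd[of "cov_deriv A g \<gamma> J" t] unfolding jacobi_field_def by simp
  from covd_unframe[OF subset_refl t this]
  show "((\<lambda>t. unframe t (cov_deriv A g \<gamma> J t)) has_vector_derivative Rf t (unframe t (J t))) (at t within {0..1})"
    by (simp add: Rf_def unframe(1)[OF t])
qed

lemma jac_jacobi_field:
  assumes J: "I.jac x v"
  shows "jacobi_field A g \<gamma> (fld x)" "t \<in> {0..1} \<Longrightarrow> cov_deriv A g \<gamma> (fld x) t = frame t (v t)"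
proof -
  have x: "(x has_vector_derivative v t) (at t within {0..1})" "(v has_vector_derivative Rf t (x t)) (at t within {0..1})"
    if "t \<in> {0..1}" for t using J that unfolding I.jac_def by auto
  have 1: "cov_deriv A g \<gamma> (fld x) t = frame t (v t)" if "t \<in> {0..1}" for t
    by (rule cov_deriv_fld[OF that x(1)[OF that]])
  have 2: "covd \<gamma> {0..1} (cov_deriv A g \<gamma> (fld x)) t (frame t (Rf t (x t)))" if t: "t \<in> {0..1}" for t
    by (rule covd_cong[OF covd_fld[OF t x(2)[OF t]] t]) (simp add: 1 fld_def)
  show "jacobi_field A g \<gamma> (fld x)"
    unfolding jacobi_field_def
  proof (intro conjI ballI)
    show "differentiable_along A \<gamma> (fld x)" using differentiable_alongI[OF covd_fld[OF _ x(1)]] .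
    show "differentiable_along A \<gamma> (cov_deriv A g \<gamma> (fld x))" using differentiable_alongI[OF 2] .
    fix t :: real assume t: "t \<in> {0..1}"
    show "cov_deriv A g \<gamma> (cov_deriv A g \<gamma> (fld x)) t = curvature A g (\<gamma> t) (vel A \<gamma> t) (fld x t) (vel A \<gamma> t)"
      unfolding covd_cov_deriv[OF t 2[OF t]] using t by (simp add: frame_Rf fld_def)
  qed
  show "t \<in> {0..1} \<Longrightarrow> cov_deriv A g \<gamma> (fld x) t = frame t (v t)" by (rule 1)
qed

lemma unframe_0: "unframe 0 v = v"
  using unframe(1)[of 0 v] by (simp add: frame(2))

lemma jacobi_field_flow:
  assumes "jacobi_field A g \<gamma> J"
  shows "I.flow (J 0, cov_deriv A g \<gamma> J 0) = (J 1, cov_deriv A g \<gamma> J 1)"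
  using I.flow_jac[OF jacobi_field_jac[OF assms]] by (simp add: unframe_0 unframe(1))

lemma jacobi_field_exists: "\<exists>J. jacobi_field A g \<gamma> J \<and> J 0 = a \<and> cov_deriv A g \<gamma> J 0 = c"
proof -
  obtain x v where x: "I.jac x v" "x 0 = a" "v 0 = c" using I.jac_exists by blast
  then show ?thesis using jac_jacobi_field[OF x(1)]
    by (intro exI[of _ "fld x"]) (auto simp: fld_def frame(2))
qed

lemma flat_apply: "flat g p w v = g p w v"
proof -
  have "bounded_linear (\<lambda>v. g p w v)"
    using g_bilinear[of p] unfolding bilinear_def linear_conv_bounded_linear by blast
  then show ?thesis unfolding flat_def by (rule bounded_linear_Blinfun_apply[THEN fun_cong])
qed

lemma flat_inj: "flat g p v = flat g p w \<Longrightarrow> v = w"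
  by (rule g_eqI[of p]) (metis flat_apply)

text \<open>The description in \<open>poincare_map\<close> is unique because lowering an index is
  injective and a Jacobi field is determined by its initial data.\<close>

lemma poincare_map_flow:
  "poincare_map A g \<gamma> (a, flat g (\<gamma> 0) c) = (fst (I.flow (a, c)), flat g (\<gamma> 0) (snd (I.flow (a, c))))"
  unfolding poincare_map_def
proof (rule the_equality)
  obtain J where J: "jacobi_field A g \<gamma> J" "J 0 = a" "cov_deriv A g \<gamma> J 0 = c" using jacobi_field_exists by blast
  show "\<exists>J. jacobi_field A g \<gamma> J \<and> (a, flat g (\<gamma> 0) c) = (J 0, flat g (\<gamma> 0) (cov_deriv A g \<gamma> J 0)) \<and>
     (fst (I.flow (a, c)), flat g (\<gamma> 0) (snd (I.flow (a, c)))) = (J 1, flat g (\<gamma> 1) (cov_deriv A g \<gamma> J 1))"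
    using J jacobi_field_flow[OF J(1)] by (intro exI[of _ J]) (simp add: endpoints)
  fix y
  assume "\<exists>J. jacobi_field A g \<gamma> J \<and> (a, flat g (\<gamma> 0) c) = (J 0, flat g (\<gamma> 0) (cov_deriv A g \<gamma> J 0)) \<and>
     y = (J 1, flat g (\<gamma> 1) (cov_deriv A g \<gamma> J 1))"
  then obtain J where J: "jacobi_field A g \<gamma> J" "a = J 0" "flat g (\<gamma> 0) c = flat g (\<gamma> 0) (cov_deriv A g \<gamma> J 0)"
    "y = (J 1, flat g (\<gamma> 1) (cov_deriv A g \<gamma> J 1))" by blast
  then show "y = (fst (I.flow (a, c)), flat g (\<gamma> 0) (snd (I.flow (a, c))))"
    using jacobi_field_flow[OF J(1)] flat_inj[OF J(3)] by (simp add: endpoints)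
qed

lemma vector_space_fun: "vector_space (\<lambda>a (V::real \<Rightarrow> real^'n) t. a *\<^sub>R V t)"
  by unfold_locales (auto simp: fun_eq_iff scaleR_add_left scaleR_add_right)

text \<open>\<open>Jf\<close> maps the fixed initial data linearly and injectively onto the kernel,
  whose dimension is thereby computed in a finite-dimensional space.\<close>

lemma nullity_flow: "nullity A g Y \<gamma> = dim {z. I.flow z = z}"
proof -
  interpret F: vector_space "\<lambda>a (V::real \<Rightarrow> real^'n) t. a *\<^sub>R V t" by (rule vector_space_fun)
  interpret P: finite_dimensional_vector_space_pair_1 "(*\<^sub>R) :: real \<Rightarrow> (real^'n) \<times> (real^'n) \<Rightarrow> _" Basis
    "\<lambda>a (V::real \<Rightarrow> real^'n) t. a *\<^sub>R V t" ..
  have lin: "Vector_Spaces.linear (*\<^sub>R) (\<lambda>a (V::real \<Rightarrow> real^'n) t. a *\<^sub>R V t) Jf"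
    by unfold_locales (auto simp: fun_eq_iff Jf_add Jf_scale)
  have "nullity A g Y \<gamma> = F.dim kern" unfolding nullity_def kern_def ..
  also have "\<dots> = dim {z. I.flow z = z}"
    unfolding kern_eq dim_raw_def
    by (rule P.dim_image_eq[OF lin]) (auto intro!: inj_onI Jf_inj)
  finally show ?thesis .
qed

lemma H1_loop_\<gamma>: "H1_loop A \<gamma>"
  unfolding H1_loop_def
proof (intro conjI ballI allI impI)
  show "continuous_on {0..1} \<gamma>" "\<gamma> 0 = \<gamma> 1" by (rule cont_\<gamma>, simp add: endpoints)
  fix c a b assume c: "c \<in> A" and ab: "0 \<le> a \<and> a < b \<and> b \<le> 1 \<and> \<gamma> ` {a..b} \<subseteq> fst c"
  have S: "{a..b} \<subseteq> {0..1}" "\<gamma> ` {a..b} \<subseteq> fst c" using ab by auto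
  have "H1w a b (\<lambda>t. snd c (\<gamma> t)) (\<lambda>t. comps A c (\<gamma> t) (vel A \<gamma> t))"
    by (rule H1w_C1[OF vel_chart_subset[OF S(1) _ c] vel_continuous[OF c S]]) (use S in auto)
  then show "H1_on a b (\<lambda>t. snd c (\<gamma> t))" by (rule H1w_imp_H1_on) (use ab in simp)
qed

text \<open>In the frame the velocity is a constant vector fixed by the holonomy, so the
  differential of the energy integrates to boundary terms that cancel.\<close>

lemma critical: "critical_point A g Y \<gamma>"
  unfolding critical_point_def loops_N_def
proof (intro conjI CollectI ballI H1_loop_\<gamma>)
  have "((\<lambda>t. g (\<gamma> t) (vel A \<gamma> t) (Y (\<gamma> t))) has_vector_derivative 0) (at t within {0..1})" if t: "t \<in> {0..1}" for t
    using covd_metric[OF subset_refl t covd_vel[OF t] covd_Y[OF t]] g_vel_DY[OF t] by (simp add: g_simps)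
  then obtain k where "\<And>t. t \<in> {0..1} \<Longrightarrow> g (\<gamma> t) (vel A \<gamma> t) (Y (\<gamma> t)) = k"
    using has_vector_derivative_zero_constant[OF convex_real_interval(5)] by blast
  then show "ae_const (\<lambda>t. g (\<gamma> t) (vel A \<gamma> t) (Y (\<gamma> t)))"
    unfolding ae_const_def using AE_lebesgue_on_iff[of "{0..1::real}"]
    by (intro exI[of _ k]) (auto intro!: exI[of _ "{}"])
  fix V assume "V \<in> tangent_N A g Y \<gamma>"
  then obtain x x' where x: "I.adm x x'" "V = fld x" unfolding tangent_N_iff by blast
  then have xH: "H1w 0 1 x x'" "x 0 = frame 1 (x 1)" unfolding I.adm_def by auto
  obtain M where M: "negligible M" "\<And>t. t \<in> {0..1} - M \<Longrightarrow> cov_deriv A g \<gamma> (fld x) t = frame t (x' t)"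
    using cov_deriv_H1w[OF xH(1)] by blast
  have "((\<lambda>t. g (\<gamma> 0) (vel A \<gamma> 0) (x' t)) has_integral g (\<gamma> 0) (vel A \<gamma> 0) (x 1) - g (\<gamma> 0) (vel A \<gamma> 0) (x 0)) {0..1}"
    using H1w_has_integral[OF H1w_linear[OF I.b.bounded_linear_right[of "vel A \<gamma> 0"] xH(1)], of 0 1] by simp
  moreover have "g (\<gamma> 0) (vel A \<gamma> 0) (x 0) = g (\<gamma> 0) (vel A \<gamma> 0) (x 1)"
    using I.H_iso[of "vel A \<gamma> 0" "x 1"] vel_frame[of 1] xH(2) by (simp add: endpoints)
  ultimately have "((\<lambda>t. g (\<gamma> 0) (vel A \<gamma> 0) (x' t)) has_integral 0) {0..1}" by simp
  then have "((\<lambda>t. g (\<gamma> t) (vel A \<gamma> t) (cov_deriv A g \<gamma> V t)) has_integral 0) {0..1}"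
  proof (rule has_integral_spike[OF M(1), rotated])
    fix t assume t: "t \<in> {0..1} - M"
    then show "g (\<gamma> t) (vel A \<gamma> t) (cov_deriv A g \<gamma> V t) = g (\<gamma> 0) (vel A \<gamma> 0) (x' t)"
      using M(2)[OF t] vel_frame[of t] frame_isometry[of t "vel A \<gamma> 0" "x' t"] by (simp add: x(2))
  qed
  then show "energy_differential A g \<gamma> V = 0" unfolding energy_differential_def by (rule integral_unique)
qed

text \<open>Initial data of the two Jacobi fields that are always periodic, the velocity, which is
  parallel, and, in \<open>zY\<close>, the Killing field.\<close>

definition zvel where "zvel = (vel A \<gamma> 0, 0 :: real^'n)"
definition zY where "zY = (Y (\<gamma> 0), DY 0)"

lemma Jf_zvel: "Jf zvel = (\<lambda>t. if t \<in> {0..1} then vel A \<gamma> t else 0)"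
proof -
  have "I.jac (\<lambda>t. vel A \<gamma> 0) (\<lambda>t. 0)"
    unfolding I.jac_def
  proof (intro ballI conjI)
    fix t :: real assume t: "t \<in> {0..1}"
    have "Rf t (vel A \<gamma> 0) = 0"
      unfolding Rf_def vel_frame[OF t, symmetric] curvature_self by (rule linear_0[OF unframe_linear[OF t]])
    then show "((\<lambda>t. 0) has_vector_derivative Rf t (vel A \<gamma> 0)) (at t within {0..1})" by simp
  qed simp
  from Jf_jac[OF this] have "Jf zvel = fld (\<lambda>t. vel A \<gamma> 0)" by (simp add: zvel_def)
  then show ?thesis by (auto simp: fld_def vel_frame[symmetric] fun_eq_iff)
qed

lemma Jf_zY: "Jf zY = (\<lambda>t. if t \<in> {0..1} then Y (\<gamma> t) else 0)"
proof -
  have "Jf zY = fld (\<lambda>t. unframe t (Y (\<gamma> t)))" using Jf_jac[OF I.y_jac] by (simp add: zY_def unframe_0)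
  then show ?thesis by (auto simp: fld_def unframe fun_eq_iff)
qed

lemma fixed_zvel_zY: "I.flow zvel = zvel" "I.flow zY = zY"
proof -
  have "I.jac (\<lambda>t. vel A \<gamma> 0) (\<lambda>t. 0)"
    unfolding I.jac_def
  proof (intro ballI conjI)
    fix t :: real assume t: "t \<in> {0..1}"
    have "Rf t (vel A \<gamma> 0) = 0"
      unfolding Rf_def vel_frame[OF t, symmetric] curvature_self by (rule linear_0[OF unframe_linear[OF t]])
    then show "((\<lambda>t. 0) has_vector_derivative Rf t (vel A \<gamma> 0)) (at t within {0..1})" by simp
  qed simp
  from I.flow_jac[OF this] show "I.flow zvel = zvel"
    unfolding zvel_def using vel_frame[of 1] by (simp add: endpoints linear_0[OF frame(1)])
  show "I.flow zY = zY"
    using I.flow_jac[OF I.y_jac] unfolding zY_def by (simp add: unframe_0 unframe(1) endpoints DY_endpoints)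
qed

text \<open>On initial data, passing to the quotient by the flow of \<open>Y\<close> means adding
  multiples of \<open>zY\<close>. The Hessian kernel is thus the orbit tangent exactly when every
  fixed vector is a multiple of \<open>zvel\<close> modulo \<open>zY\<close>. The formulation by the
  span carries over to iterates.\<close>

lemma nondegenerate_iff:
  "nondegenerate_critical_orbit A g Y \<gamma> \<longleftrightarrow> (\<forall>z. I.flow z = z \<longrightarrow> (\<exists>p q. z = p *\<^sub>R zvel + q *\<^sub>R zY))"
proof -
  have coset: "coset_Y Y \<gamma> (Jf z) = range (\<lambda>a. Jf (z + a *\<^sub>R zY))" for z
    unfolding coset_Y_def using fun_cong[OF Jf_zY] by (auto simp: fun_eq_iff Jf_add Jf_scale intro!: image_cong)
  have orbit: "orbit_tangent A Y \<gamma> = range (\<lambda>b. coset_Y Y \<gamma> (Jf (b *\<^sub>R zvel)))"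
  proof -
    have "(\<lambda>t. b *\<^sub>R (if t \<in> {0..1} then vel A \<gamma> t else 0)) = Jf (b *\<^sub>R zvel)" for b
      using fun_cong[OF Jf_zvel] by (auto simp: fun_eq_iff Jf_scale)
    then show ?thesis unfolding orbit_tangent_def by simp
  qed
  note fl = linear_add[OF I.flow_linear] linear_scale[OF I.flow_linear]
  have kernJ: "Jf z \<in> kern \<longleftrightarrow> I.flow z = z" for z
    unfolding kern_eq using Jf_inj by blast
  have kern_sub: "kern \<subseteq> tangent_N A g Y \<gamma>" unfolding kern_def by blast
  have hess: "hessian_kernel A g Y \<gamma> = coset_Y Y \<gamma> ` kern"
  proof (intro equalityI subsetI)
    fix X assume "X \<in> hessian_kernel A g Y \<gamma>"
    then obtain V where V: "V \<in> tangent_N A g Y \<gamma>" "X = coset_Y Y \<gamma> V"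
      and k: "\<forall>Z\<in>tangent_quot A g Y \<gamma>. \<forall>V\<in>X. \<forall>W\<in>Z. index_form A g \<gamma> V W = 0"
      unfolding hessian_kernel_def tangent_quot_def by blast
    have self: "W \<in> coset_Y Y \<gamma> W" for W
      unfolding coset_Y_def by (rule range_eqI[of _ _ 0]) simp
    have "index_form A g \<gamma> V W = 0" if "W \<in> tangent_N A g Y \<gamma>" for W
      using k self[of V] self[of W] that unfolding V(2) tangent_quot_def by blast
    then show "X \<in> coset_Y Y \<gamma> ` kern" using V unfolding kern_def by blast
  next
    fix X assume "X \<in> coset_Y Y \<gamma> ` kern"
    then obtain z where z: "I.flow z = z" "X = coset_Y Y \<gamma> (Jf z)" unfolding kern_eq by blast
    show "X \<in> hessian_kernel A g Y \<gamma>"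
      unfolding hessian_kernel_def
    proof (intro CollectI conjI ballI)
      show "X \<in> tangent_quot A g Y \<gamma>"
        unfolding tangent_quot_def z(2) using kernJ[of z] z(1) kern_sub by blast
      fix Z V W assume Z: "Z \<in> tangent_quot A g Y \<gamma>" "V \<in> X" "W \<in> Z"
      obtain a where "V = Jf (z + a *\<^sub>R zY)" using Z(2) unfolding z(2) coset by blast
      then have Vk: "V \<in> kern" using kernJ[of "z + a *\<^sub>R zY"] z(1) fixed_zvel_zY by (simp add: fl)
      obtain w w' where w: "I.adm w w'" "Z = coset_Y Y \<gamma> (fld w)"
        using Z(1) unfolding tangent_quot_def tangent_N_iff by (metis (no_types, lifting) imageE tangent_N_iff)
      obtain r where r: "W = (\<lambda>t. fld w t + r *\<^sub>R (if t \<in> {0..1} then Y (\<gamma> t) else 0))"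
        using Z(3) unfolding w(2) coset_Y_def by blast
      \<comment> \<open>An arbitrary representative of a coset is still tangent, since
        \<open>Y\<close> along \<gamma> is itself admissible.\<close>
      let ?y = "\<lambda>t. unframe t (Y (\<gamma> t))" and ?y' = "\<lambda>t. unframe t (DY t)"
      have "I.adm ?y ?y'" by (rule I.jac_adm[OF I.y_jac I.y0_H])
      then have "I.adm (\<lambda>t. w t + r *\<^sub>R ?y t) (\<lambda>t. w' t + r *\<^sub>R ?y' t)"
        using w(1) by (rule I.adm_lincomb[rotated])
      moreover have "W = fld (\<lambda>t. w t + r *\<^sub>R ?y t)"
        unfolding r fld_def by (auto simp: fun_eq_iff linear_add[OF frame(1)] linear_scale[OF frame(1)] unframe)
      ultimately have "W \<in> tangent_N A g Y \<gamma>" unfolding tangent_N_iff by blast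
      then show "index_form A g \<gamma> V W = 0" using Vk unfolding kern_def by blast
    qed
  qed
  have "hessian_kernel A g Y \<gamma> = orbit_tangent A Y \<gamma> \<longleftrightarrow> (\<forall>z. I.flow z = z \<longrightarrow> (\<exists>p q. z = p *\<^sub>R zvel + q *\<^sub>R zY))"
  proof
    assume eq: "hessian_kernel A g Y \<gamma> = orbit_tangent A Y \<gamma>"
    show "\<forall>z. I.flow z = z \<longrightarrow> (\<exists>p q. z = p *\<^sub>R zvel + q *\<^sub>R zY)"
    proof (intro allI impI)
      fix z assume "I.flow z = z"
      then have "coset_Y Y \<gamma> (Jf z) \<in> orbit_tangent A Y \<gamma>" using kernJ[of z] eq hess by blast
      then obtain p where "coset_Y Y \<gamma> (Jf z) = coset_Y Y \<gamma> (Jf (p *\<^sub>R zvel))" unfolding orbit by blast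
      moreover have "Jf z \<in> coset_Y Y \<gamma> (Jf z)" unfolding coset by (rule range_eqI[of _ _ 0]) simp
      ultimately obtain q where "Jf z = Jf (p *\<^sub>R zvel + q *\<^sub>R zY)" unfolding coset[of "p *\<^sub>R zvel"] by blast
      then show "\<exists>p q. z = p *\<^sub>R zvel + q *\<^sub>R zY" using Jf_inj by blast
    qed
  next
    assume sp: "\<forall>z. I.flow z = z \<longrightarrow> (\<exists>p q. z = p *\<^sub>R zvel + q *\<^sub>R zY)"
    show "hessian_kernel A g Y \<gamma> = orbit_tangent A Y \<gamma>"
      unfolding hess orbit kern_eq
    proof (intro equalityI subsetI)
      fix X assume "X \<in> coset_Y Y \<gamma> ` Jf ` {z. I.flow z = z}"
      then obtain z where z: "I.flow z = z" "X = coset_Y Y \<gamma> (Jf z)" by blast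
      then obtain p q where pq: "z = p *\<^sub>R zvel + q *\<^sub>R zY" using sp by blast
      have "range (\<lambda>a. Jf (z + a *\<^sub>R zY)) = range (\<lambda>a. Jf (p *\<^sub>R zvel + a *\<^sub>R zY))"
      proof (intro equalityI subsetI; elim rangeE)
        show "V \<in> range (\<lambda>a. Jf (p *\<^sub>R zvel + a *\<^sub>R zY))" if "V = Jf (z + a *\<^sub>R zY)" for V a
          unfolding that pq by (rule range_eqI[of _ _ "q + a"]) (simp add: scaleR_add_left add.assoc)
        show "V \<in> range (\<lambda>a. Jf (z + a *\<^sub>R zY))" if "V = Jf (p *\<^sub>R zvel + a *\<^sub>R zY)" for V a
          unfolding that pq by (rule range_eqI[of _ _ "a - q"]) (simp add: scaleR_diff_left)
      qed
      then have "X = coset_Y Y \<gamma> (Jf (p *\<^sub>R zvel))" unfolding z(2) coset .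
      then show "X \<in> range (\<lambda>b. coset_Y Y \<gamma> (Jf (b *\<^sub>R zvel)))" by blast
    next
      fix X assume "X \<in> range (\<lambda>b. coset_Y Y \<gamma> (Jf (b *\<^sub>R zvel)))"
      then obtain p where "X = coset_Y Y \<gamma> (Jf (p *\<^sub>R zvel))" by blast
      moreover have "I.flow (p *\<^sub>R zvel) = p *\<^sub>R zvel" by (simp add: fl fixed_zvel_zY)
      ultimately show "X \<in> coset_Y Y \<gamma> ` Jf ` {z. I.flow z = z}" by blast
    qed
  qed
  then show ?thesis unfolding nondegenerate_critical_orbit_def using critical by blast
qed

end

section \<open>Iterates\<close>

lemma frac_eq_shift: "of_int k \<le> s \<Longrightarrow> s < of_int k + 1 \<Longrightarrow> frac s = s - of_int k"
  by (simp add: frac_unique_iff)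

text \<open>The closed unit interval is allowed: at its right end \<open>frac\<close> jumps to 0,
  and h 0 = h 1 compensates.\<close>

lemma periodic_shift:
  assumes "h 0 = h (1::real)" "s \<in> {of_int k..of_int k + 1}"
  shows "h (frac s) = h (s - of_int k)"
proof (cases "s = of_int k + 1")
  case True
  have "frac (of_int k + 1 :: real) = 0" by (metis frac_of_int of_int_1 of_int_add)
  then show ?thesis using True assms(1) by simp
next
  case False
  then show ?thesis using assms(2) frac_eq_shift[of k s] by auto
qed

lemma has_vector_derivative_affine:
  fixes f :: "real \<Rightarrow> 'a::real_normed_vector"
  assumes "(f has_vector_derivative D) (at (c * t + d) within T)" "\<And>s. s \<in> S \<Longrightarrow> c * s + d \<in> T"
  shows "((\<lambda>s. f (c * s + d)) has_vector_derivative c *\<^sub>R D) (at t within S)"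
proof -
  have l: "((\<lambda>s. c * s + d) has_vector_derivative c) (at t within S)"
    by (auto intro!: derivative_eq_intros simp: has_real_derivative_iff_has_vector_derivative[symmetric])
  have "(f has_vector_derivative D) (at (c * t + d) within (\<lambda>s. c * s + d) ` S)"
    by (rule has_vector_derivative_within_subset[OF assms(1)]) (use assms(2) in auto)
  from vector_diff_chain_within[OF l this] show ?thesis by (simp add: o_def)
qed

lemma periodic_continuous:
  fixes h :: "real \<Rightarrow> 'a::topological_space"
  assumes h: "continuous_on {0..1} h" and 01: "h 0 = h 1"
  shows "continuous_on UNIV (\<lambda>s. h (frac s))"
proof -
  have piece: "continuous_on {of_int k..of_int k + 1} (\<lambda>s. h (frac s))" for k :: int
  proof -
    have "continuous_on {of_int k..of_int k + 1} (\<lambda>s. h (s - of_int k))"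
      by (rule continuous_on_compose2[OF h]) (auto intro!: continuous_intros)
    then show ?thesis by (rule continuous_on_eq) (use periodic_shift[of h, OF 01] in auto)
  qed
  have "isCont (\<lambda>s. h (frac s)) s" for s :: real
  proof -
    define k where "k = \<lfloor>s\<rfloor>"
    have "continuous_on ({of_int (k - 1)..of_int (k - 1) + 1} \<union> {of_int k..of_int k + 1}) (\<lambda>s. h (frac s))"
      by (intro continuous_on_closed_Un piece) auto
    moreover have "{of_int (k - 1)<..<of_int k + 1} \<subseteq> {of_int (k - 1)..of_int (k - 1) + 1} \<union> {of_int k..of_int k + (1::real)}"
      by auto
    ultimately have "continuous_on {of_int (k - 1)<..<of_int k + (1::real)} (\<lambda>s. h (frac s))"
      by (rule continuous_on_subset)
    moreover have "s \<in> {of_int (k - 1)<..<of_int k + 1}"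
      unfolding k_def using floor_correct[of s] by (simp add: algebra_simps) linarith
    ultimately show ?thesis by (simp add: continuous_on_eq_continuous_at)
  qed
  then show ?thesis by (simp add: continuous_on_eq_continuous_at)
qed

text \<open>At an integer the right derivative is the one at 0 and the left derivative the one at 1,
  so both have to be D.\<close>

lemma periodic_has_vector_derivative:
  fixes h :: "real \<Rightarrow> 'a::real_normed_vector"
  assumes D: "(h has_vector_derivative D) (at (frac s) within {0..1})"
    and 0: "frac s = 0 \<Longrightarrow> (h has_vector_derivative D) (at 1 within {0..1})" and 01: "h 0 = h 1"
  shows "((\<lambda>s. h (frac s)) has_vector_derivative D) (at s)"
proof -
  define k where "k = \<lfloor>s\<rfloor>"
  have ks: "of_int k \<le> s" "s < of_int k + 1" and fs: "frac s = s - of_int k"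
    unfolding k_def frac_def using floor_correct[of s] by auto
  have right: "((\<lambda>s. h (frac s)) has_vector_derivative D) (at s within {of_int k..of_int k + 1})"
  proof (rule has_vector_derivative_transform)
    show "s \<in> {of_int k..of_int k + 1}" using ks by auto
    show "h (frac x) = h (1 * x + (- of_int k))" if "x \<in> {of_int k..of_int k + 1}" for x
      using periodic_shift[of h, OF 01 that] by (simp only: mult_1 add_uminus_conv_diff)
    have "(h has_vector_derivative D) (at (1 * s + (- of_int k)) within {0..1})" using D fs by simp
    from has_vector_derivative_affine[OF this, of "{of_int k..of_int k + 1}"]
    show "((\<lambda>x. h (1 * x + (- of_int k))) has_vector_derivative D) (at s within {of_int k..of_int k + 1})" by simp
  qed
  show ?thesis
  proof (cases "frac s = 0")
    case True
    then have s: "s = of_int k" using fs by simp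
    have left: "((\<lambda>s. h (frac s)) has_vector_derivative D) (at s within {of_int (k - 1)..of_int (k - 1) + 1})"
    proof (rule has_vector_derivative_transform)
      show "s \<in> {of_int (k - 1)..of_int (k - 1) + 1}" using s by auto
      show "h (frac x) = h (1 * x + (- of_int (k - 1)))" if "x \<in> {of_int (k - 1)..of_int (k - 1) + 1}" for x
        using periodic_shift[of h, OF 01 that] by (simp only: mult_1 add_uminus_conv_diff)
      have "(h has_vector_derivative D) (at (1 * s + (- of_int (k - 1))) within {0..1})" using 0[OF True] s by simp
      from has_vector_derivative_affine[OF this, of "{of_int (k - 1)..of_int (k - 1) + 1}"]
      show "((\<lambda>x. h (1 * x + (- of_int (k - 1)))) has_vector_derivative D) (at s within {of_int (k - 1)..of_int (k - 1) + 1})" by simp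
    qed
    have "((\<lambda>s. h (frac s)) has_vector_derivative D) (at s within {of_int k - 1..of_int k + 1})"
      by (rule has_vector_derivative_Icc_join[of _ "of_int k"]) (use left right s in auto)
    moreover have "at s within {of_int k - 1..of_int k + 1} = at s" using s by (intro at_within_Icc_at) auto
    ultimately show ?thesis by simp
  next
    case False
    then have "of_int k < s" using ks fs by auto
    then have "at s within {of_int k..of_int k + 1} = at s" using ks by (intro at_within_Icc_at) auto
    then show ?thesis using right by simp
  qed
qed

context lorentz
begin

lemma differentiable_curve_velD:
  assumes "differentiable_curve A \<gamma>"
  shows "lorentz_curve A g \<gamma>"
  by unfold_locales (rule assms)

end

context closed_killing
begin

section \<open>The iterate as a closed geodesic\<close>

lemma chart_periodic:
  assumes c: "c \<in> A" "\<gamma> (frac s) \<in> fst c"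
  shows "((\<lambda>s. snd c (\<gamma> (frac s))) has_vector_derivative comps A c (\<gamma> (frac s)) (vel A \<gamma> (frac s))) (at s)"
proof (rule periodic_has_vector_derivative[of "\<lambda>t. snd c (\<gamma> t)"])
  have "frac s \<in> {0..1}" using frac_ge_0[of s] frac_lt_1[of s] by auto
  then show "((\<lambda>t. snd c (\<gamma> t)) has_vector_derivative comps A c (\<gamma> (frac s)) (vel A \<gamma> (frac s))) (at (frac s) within {0..1})"
    by (rule vel_chart[OF _ c])
  show "((\<lambda>t. snd c (\<gamma> t)) has_vector_derivative comps A c (\<gamma> (frac s)) (vel A \<gamma> (frac s))) (at 1 within {0..1})"
    if "frac s = 0"
    using vel_chart[of 1 c] c unfolding that by (simp add: endpoints)
qed (simp add: endpoints)

lemma chart_vel_periodic: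
  assumes c: "c \<in> A" "\<gamma> (frac s) \<in> fst c"
  shows "((\<lambda>s. comps A c (\<gamma> (frac s)) (vel A \<gamma> (frac s))) has_vector_derivative
     - Gam (gram A g c) (snd c (\<gamma> (frac s))) (comps A c (\<gamma> (frac s)) (vel A \<gamma> (frac s))) (comps A c (\<gamma> (frac s)) (vel A \<gamma> (frac s)))) (at s)"
proof (rule periodic_has_vector_derivative[of "\<lambda>t. comps A c (\<gamma> t) (vel A \<gamma> t)"])
  have d: "((\<lambda>t. comps A c (\<gamma> t) (vel A \<gamma> t)) has_vector_derivative
     - Gam (gram A g c) (snd c (\<gamma> t)) (comps A c (\<gamma> t) (vel A \<gamma> t)) (comps A c (\<gamma> t) (vel A \<gamma> t))) (at t within {0..1})"
    if "t \<in> {0..1}" "\<gamma> t \<in> fst c" for t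
    using covdD[OF covd_vel[OF that(1)] c(1) that(2)] linear_0[OF comps_linear[OF c(1) that(2)]] by simp
  have "frac s \<in> {0..1}" using frac_ge_0[of s] frac_lt_1[of s] by auto
  then show "((\<lambda>t. comps A c (\<gamma> t) (vel A \<gamma> t)) has_vector_derivative
     - Gam (gram A g c) (snd c (\<gamma> (frac s))) (comps A c (\<gamma> (frac s)) (vel A \<gamma> (frac s))) (comps A c (\<gamma> (frac s)) (vel A \<gamma> (frac s))))
     (at (frac s) within {0..1})" by (rule d[OF _ c(2)])
  show "((\<lambda>t. comps A c (\<gamma> t) (vel A \<gamma> t)) has_vector_derivative
     - Gam (gram A g c) (snd c (\<gamma> (frac s))) (comps A c (\<gamma> (frac s)) (vel A \<gamma> (frac s))) (comps A c (\<gamma> (frac s)) (vel A \<gamma> (frac s))))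
     (at 1 within {0..1})" if "frac s = 0"
    using d[of 1] c unfolding that by (simp add: endpoints)
qed (simp add: endpoints)

lemma iterate_eq: "iterate N \<gamma> t = \<gamma> (frac (real N * t))"
  by (simp add: iterate_def periodic_ext_def)

lemma iterate_chart:
  assumes c: "c \<in> A" "iterate N \<gamma> t \<in> fst c"
  shows "((\<lambda>s. snd c (iterate N \<gamma> s)) has_vector_derivative
     real N *\<^sub>R comps A c (iterate N \<gamma> t) (vel A \<gamma> (frac (real N * t)))) (at t within S)"
  using has_vector_derivative_affine[of "\<lambda>s. snd c (\<gamma> (frac s))" _ "real N" t 0 UNIV S] chart_periodic[OF c(1), of "real N * t"] c(2)
  unfolding iterate_eq by simp

lemma iterate_curve: "lorentz_curve A g (iterate N \<gamma>)"
proof (rule differentiable_curve_velD)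
  show "differentiable_curve A (iterate N \<gamma>)"
    unfolding differentiable_curve_def
  proof (intro conjI ballI impI)
    have "continuous_on {0..1} (\<lambda>t. \<gamma> (frac (real N * t)))"
      by (rule continuous_on_compose2[OF periodic_continuous[OF cont_\<gamma>]]) (auto simp: endpoints intro!: continuous_intros)
    then show "continuous_on {0..1} (iterate N \<gamma>)" by (simp add: iterate_eq[abs_def])
    show "(\<lambda>s. snd c (iterate N \<gamma> s)) differentiable at t within {0..1}"
      if "c \<in> A" "iterate N \<gamma> t \<in> fst c" for c t
      using iterate_chart[OF that] by (rule differentiableI_vector)
  qed
qed

lemma iterate_vel:
  assumes t: "t \<in> {0..1}"
  shows "vel A (iterate N \<gamma>) t = real N *\<^sub>R vel A \<gamma> (frac (real N * t))"
proof -
  interpret C: lorentz_curve A g "iterate N \<gamma>" by (rule iterate_curve)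
  let ?p = "iterate N \<gamma> t"
  have "comps A (chart_at A ?p) ?p (vel A (iterate N \<gamma>) t) = real N *\<^sub>R comps A (chart_at A ?p) ?p (vel A \<gamma> (frac (real N * t)))"
    by (rule C.vel_eqI[OF t chart_at iterate_chart[OF chart_at]])
  then show ?thesis by (simp add: comps_chart_at)
qed

text \<open>The velocity is multiplied by N, and both the second derivative and the Christoffel term
  by N^2. As a result everything shown for \<gamma> is available for its iterates.\<close>

lemma iterate_closed_killing: "closed_killing A g (iterate N \<gamma>) Y"
proof -
  interpret C: lorentz_curve A g "iterate N \<gamma>" by (rule iterate_curve)
  let ?\<delta> = "iterate N \<gamma>"
  have cov: "covd ?\<delta> {0..1} (vel A ?\<delta>) t 0" if t: "t \<in> {0..1}" for t
  proof (rule C.covdI[OF subset_refl t chart_at])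
    let ?c = "chart_at A (?\<delta> t)" and ?r = "frac (real N * t)"
    interpret M: local_metric "snd ?c ` fst ?c" "gram A g ?c" by (rule local_metric[OF chart_at(1)])
    have x: "snd ?c (?\<delta> t) \<in> snd ?c ` fst ?c" using chart_at by auto
    let ?u = "comps A ?c (?\<delta> t) (vel A \<gamma> ?r)"
    have c: "\<gamma> ?r \<in> fst ?c" using chart_at(2)[of "?\<delta> t"] by (simp only: iterate_eq)
    have "((\<lambda>s. comps A ?c (\<gamma> (frac (real N * s + 0))) (vel A \<gamma> (frac (real N * s + 0)))) has_vector_derivative
      real N *\<^sub>R (- Gam (gram A g ?c) (snd ?c (?\<delta> t)) ?u ?u)) (at t within {0..1})"
      by (rule has_vector_derivative_affine[where f="\<lambda>s. comps A ?c (\<gamma> (frac s)) (vel A \<gamma> (frac s))" and T=UNIV])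
         (use chart_vel_periodic[OF chart_at(1) c] in \<open>simp_all add: iterate_eq\<close>)
    from bounded_linear.has_vector_derivative[OF bounded_linear_scaleR_right this, of "real N"]
    have "((\<lambda>s. real N *\<^sub>R comps A ?c (?\<delta> s) (vel A \<gamma> (frac (real N * s)))) has_vector_derivative
      real N *\<^sub>R real N *\<^sub>R (- Gam (gram A g ?c) (snd ?c (?\<delta> t)) ?u ?u)) (at t within {0..1})"
      unfolding iterate_eq by simp
    moreover have "eventually (\<lambda>s. real N *\<^sub>R comps A ?c (?\<delta> s) (vel A \<gamma> (frac (real N * s))) = comps A ?c (?\<delta> s) (vel A ?\<delta> s)) (at t within {0..1})"
      using C.eventually_chart[OF subset_refl t chart(1)[OF chart_at(1)] chart_at(2)] eventually_at_topological[of "\<lambda>s. s \<in> {0..1}" t "{0..1}"]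
    proof (elim eventually_elim2)
      show "\<forall>\<^sub>F s in at t within {0..1}. s \<in> {0..1}" by (auto simp: eventually_at_topological)
      fix s assume "?\<delta> s \<in> fst ?c" "s \<in> {0..1}"
      then show "real N *\<^sub>R comps A ?c (?\<delta> s) (vel A \<gamma> (frac (real N * s))) = comps A ?c (?\<delta> s) (vel A ?\<delta> s)"
        by (simp add: iterate_vel linear_scale[OF comps_linear[OF chart_at(1)]])
    qed
    ultimately have "((\<lambda>s. comps A ?c (?\<delta> s) (vel A ?\<delta> s)) has_vector_derivative
      real N *\<^sub>R real N *\<^sub>R (- Gam (gram A g ?c) (snd ?c (?\<delta> t)) ?u ?u)) (at t within {0..1})"
      by (rule has_vector_derivative_eventually) (simp add: iterate_vel[OF t] linear_scale[OF comps_linear[OF chart_at]])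
    then show "((\<lambda>s. comps A ?c (?\<delta> s) (vel A ?\<delta> s)) has_vector_derivative comps A ?c (?\<delta> t) 0 -
      Gam (gram A g ?c) (snd ?c (?\<delta> t)) (comps A ?c (?\<delta> t) (vel A ?\<delta> t)) (comps A ?c (?\<delta> t) (vel A ?\<delta> t))) (at t within {0..1})"
      by (simp add: iterate_vel[OF t] linear_0[OF comps_linear[OF chart_at]] linear_scale[OF comps_linear[OF chart_at]] M.Gam_simps[OF x])
  qed
  have geo: "geodesic A g ?\<delta>"
    unfolding geodesic_def using C.diff_curve C.differentiable_alongI[OF cov] C.covd_cov_deriv[OF _ cov] by blast
  have f: "frac (real N * 1) = frac (real N * 0)" by (metis frac_of_int mult_1_right mult_zero_right of_int_of_nat_eq of_int_0)
  have cl: "?\<delta> 0 = ?\<delta> 1" "vel A ?\<delta> 0 = vel A ?\<delta> 1"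
    using iterate_vel[of 0 N] iterate_vel[of 1 N] unfolding iterate_eq f by simp_all
  show ?thesis
  proof unfold_locales
    show "geodesic A g ?\<delta>" by (rule geo)
    show "killing_field A g Y" by (rule kill)
    show "closed_geodesic A g ?\<delta>" unfolding closed_geodesic_def using geo cl by blast
    show "timelike_field g Y" by (rule timelike)
  qed
qed

section \<open>The single turns of an iterate and the power of the flow\<close>

lemma piece_in: "k < N \<Longrightarrow> t \<in> {0..1} \<Longrightarrow> 1 / real N * t + real k / real N \<in> {0..1}"
proof -
  assume k: "k < N" and t: "t \<in> {0..1}"
  have "real k + 1 \<le> real N" using k by linarith
  then have "t + real k \<le> real N" using k t by auto
  then show ?thesis using k t by (auto simp: field_simps)
qed

text \<open>The affine map t/N + k/N parametrizes turn number k, counted from 0. At the right end of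
  the turn the periodicity of \<gamma> and of its velocity is used.\<close>

lemma iterate_piece:
  assumes "k < N" "t \<in> {0..1}"
  shows "iterate N \<gamma> (1 / real N * t + real k / real N) = \<gamma> t"
    "vel A (iterate N \<gamma>) (1 / real N * t + real k / real N) = real N *\<^sub>R vel A \<gamma> t"
proof -
  have e: "real N * (1 / real N * t + real k / real N) = t + real k" using assms(1) by (simp add: field_simps)
  have f: "h (frac (t + real k)) = h t" if "h 0 = h 1" for h :: "real \<Rightarrow> 'z"
    using periodic_shift[of h "t + real k" "int k"] that assms(2) by simp
  show "iterate N \<gamma> (1 / real N * t + real k / real N) = \<gamma> t"
    unfolding iterate_eq e by (rule f) (simp add: endpoints)
  show "vel A (iterate N \<gamma>) (1 / real N * t + real k / real N) = real N *\<^sub>R vel A \<gamma> t"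
    unfolding iterate_vel[OF piece_in[OF assms]] e using f[of "vel A \<gamma>"] by (simp add: endpoints)
qed

lemma covd_piece:
  assumes k: "k < N" and t: "t \<in> {0..1}"
    and J: "covd (iterate N \<gamma>) {0..1} J (1 / real N * t + real k / real N) w"
  shows "covd \<gamma> {0..1} (\<lambda>s. J (1 / real N * s + real k / real N)) t ((1 / real N) *\<^sub>R w)"
proof (rule covdI[OF subset_refl t chart_at])
  let ?c = "chart_at A (\<gamma> t)" and ?a = "\<lambda>s. 1 / real N * s + real k / real N"
  interpret M: local_metric "snd ?c ` fst ?c" "gram A g ?c" by (rule local_metric[OF chart_at(1)])
  interpret C: lorentz_curve A g "iterate N \<gamma>" by (rule iterate_curve)
  have x: "snd ?c (\<gamma> t) \<in> snd ?c ` fst ?c" using chart_at by auto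
  note p = iterate_piece[OF k]
  have N: "real N \<noteq> 0" using k by simp
  have "((\<lambda>s. comps A ?c (iterate N \<gamma> s) (J s)) has_vector_derivative
     (comps A ?c (\<gamma> t) w - Gam (gram A g ?c) (snd ?c (\<gamma> t)) (comps A ?c (\<gamma> t) (real N *\<^sub>R vel A \<gamma> t)) (comps A ?c (\<gamma> t) (J (?a t)))))
     (at (?a t) within {0..1})"
    using C.covdD[OF J chart_at(1)[of "\<gamma> t"]] chart_at(2)[of "\<gamma> t"] by (simp only: p[OF t])
  from has_vector_derivative_affine[OF this piece_in[OF k]]
  have "((\<lambda>s. comps A ?c (iterate N \<gamma> (?a s)) (J (?a s))) has_vector_derivative
     (1 / real N) *\<^sub>R (comps A ?c (\<gamma> t) w - Gam (gram A g ?c) (snd ?c (\<gamma> t)) (comps A ?c (\<gamma> t) (real N *\<^sub>R vel A \<gamma> t)) (comps A ?c (\<gamma> t) (J (?a t)))))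
     (at t within {0..1})" .
  then have "((\<lambda>s. comps A ?c (\<gamma> s) (J (?a s))) has_vector_derivative
     (1 / real N) *\<^sub>R (comps A ?c (\<gamma> t) w - Gam (gram A g ?c) (snd ?c (\<gamma> t)) (comps A ?c (\<gamma> t) (real N *\<^sub>R vel A \<gamma> t)) (comps A ?c (\<gamma> t) (J (?a t)))))
     (at t within {0..1})"
    by (rule has_vector_derivative_transform[OF t, rotated]) (simp only: p)
  moreover have "(1 / real N) *\<^sub>R (comps A ?c (\<gamma> t) w - Gam (gram A g ?c) (snd ?c (\<gamma> t)) (comps A ?c (\<gamma> t) (real N *\<^sub>R vel A \<gamma> t)) (comps A ?c (\<gamma> t) (J (?a t))))
    = comps A ?c (\<gamma> t) ((1 / real N) *\<^sub>R w) - Gam (gram A g ?c) (snd ?c (\<gamma> t)) (comps A ?c (\<gamma> t) (vel A \<gamma> t)) (comps A ?c (\<gamma> t) (J (?a t)))"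
    using N by (simp add: linear_scale[OF comps_linear[OF chart_at]] M.Gam_simps[OF x] scaleR_diff_right)
  ultimately show "((\<lambda>s. comps A ?c (\<gamma> s) (J (?a s))) has_vector_derivative
     comps A ?c (\<gamma> t) ((1 / real N) *\<^sub>R w) - Gam (gram A g ?c) (snd ?c (\<gamma> t)) (comps A ?c (\<gamma> t) (vel A \<gamma> t)) (comps A ?c (\<gamma> t) (J (?a t)))) (at t within {0..1})"
    by simp
qed

text \<open>Two derivatives in the slower parameter give the factor 1/N^2, and the curvature term,
  quadratic in the velocity, supplies N^2.\<close>

lemma jacobi_piece:
  assumes k: "k < N" and J: "jacobi_field A g (iterate N \<gamma>) J"
  shows "jacobi_field A g \<gamma> (\<lambda>s. J (1 / real N * s + real k / real N))"
    "t \<in> {0..1} \<Longrightarrow> cov_deriv A g \<gamma> (\<lambda>s. J (1 / real N * s + real k / real N)) t =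
      (1 / real N) *\<^sub>R cov_deriv A g (iterate N \<gamma>) J (1 / real N * t + real k / real N)"
proof -
  interpret C: closed_killing A g "iterate N \<gamma>" Y by (rule iterate_closed_killing)
  let ?\<delta> = "iterate N \<gamma>" and ?a = "\<lambda>s. 1 / real N * s + real k / real N"
  let ?D = "cov_deriv A g ?\<delta> J"
  note p = iterate_piece[OF k]
  have N: "real N \<noteq> 0" using k by simp
  have 1: "covd \<gamma> {0..1} (\<lambda>s. J (?a s)) t ((1 / real N) *\<^sub>R ?D (?a t))" if t: "t \<in> {0..1}" for t
    by (rule covd_piece[OF k t C.differentiable_along_covd[OF _ piece_in[OF k t]]])
       (use J in \<open>simp add: jacobi_field_def\<close>)
  have d1: "cov_deriv A g \<gamma> (\<lambda>s. J (?a s)) t = (1 / real N) *\<^sub>R ?D (?a t)" if t: "t \<in> {0..1}" for t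
    by (rule covd_cov_deriv[OF t 1[OF t]])
  have 2: "covd \<gamma> {0..1} (cov_deriv A g \<gamma> (\<lambda>s. J (?a s))) t (curvature A g (\<gamma> t) (vel A \<gamma> t) (J (?a t)) (vel A \<gamma> t))"
    if t: "t \<in> {0..1}" for t
  proof -
    have dD: "differentiable_along A ?\<delta> ?D" and e: "cov_deriv A g ?\<delta> ?D (?a t) =
        curvature A g (?\<delta> (?a t)) (vel A ?\<delta> (?a t)) (J (?a t)) (vel A ?\<delta> (?a t))"
      using J piece_in[OF k t] unfolding jacobi_field_def by blast+
    have "covd ?\<delta> {0..1} ?D (?a t) (curvature A g (\<gamma> t) (real N *\<^sub>R vel A \<gamma> t) (J (?a t)) (real N *\<^sub>R vel A \<gamma> t))"
      using C.differentiable_along_covd[OF dD piece_in[OF k t]] unfolding e p[OF t] .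
    from covd_piece[OF k t this]
    have "covd \<gamma> {0..1} (\<lambda>s. ?D (?a s)) t ((1 / real N) *\<^sub>R curvature A g (\<gamma> t) (real N *\<^sub>R vel A \<gamma> t) (J (?a t)) (real N *\<^sub>R vel A \<gamma> t))" .
    from covd_scaleR[OF subset_refl t this has_vector_derivative_const[of "1 / real N"]]
    have "covd \<gamma> {0..1} (\<lambda>s. (1 / real N) *\<^sub>R ?D (?a s)) t (0 *\<^sub>R ?D (?a t) +
       (1 / real N) *\<^sub>R (1 / real N) *\<^sub>R curvature A g (\<gamma> t) (real N *\<^sub>R vel A \<gamma> t) (J (?a t)) (real N *\<^sub>R vel A \<gamma> t))" .
    moreover have "(0 *\<^sub>R ?D (?a t) +
       (1 / real N) *\<^sub>R (1 / real N) *\<^sub>R curvature A g (\<gamma> t) (real N *\<^sub>R vel A \<gamma> t) (J (?a t)) (real N *\<^sub>R vel A \<gamma> t))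
       = curvature A g (\<gamma> t) (vel A \<gamma> t) (J (?a t)) (vel A \<gamma> t)"
      using N by (simp add: linear_scale[OF curvature_linear(1)] linear_scale[OF curvature_linear(3)])
    ultimately have "covd \<gamma> {0..1} (\<lambda>s. (1 / real N) *\<^sub>R ?D (?a s)) t (curvature A g (\<gamma> t) (vel A \<gamma> t) (J (?a t)) (vel A \<gamma> t))"
      by simp
    then show ?thesis by (rule covd_cong[OF _ t]) (simp only: d1)
  qed
  show "jacobi_field A g \<gamma> (\<lambda>s. J (?a s))"
    unfolding jacobi_field_def
    using differentiable_alongI[OF 1] differentiable_alongI[OF 2] covd_cov_deriv[OF _ 2] by blast
  show "t \<in> {0..1} \<Longrightarrow> cov_deriv A g \<gamma> (\<lambda>s. J (?a s)) t = (1 / real N) *\<^sub>R ?D (?a t)" by (rule d1)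
qed

text \<open>F is the flow of the iterate, kept abstract so that the result can be used without its
  frame. It is conjugate to the N-th power of the flow of \<gamma> by scaling the second component
  with N.\<close>

lemma iterate_flow:
  assumes N: "N \<ge> 1"
  shows "\<exists>F. nullity A g Y (iterate N \<gamma>) = dim {z. F z = z} \<and>
    (nondegenerate_critical_orbit A g Y (iterate N \<gamma>) \<longleftrightarrow> (\<forall>z. F z = z \<longrightarrow>
       (\<exists>p q. z = p *\<^sub>R (real N *\<^sub>R vel A \<gamma> 0, 0) + q *\<^sub>R (Y (\<gamma> 0), real N *\<^sub>R DY 0)))) \<and>
    (\<forall>a c. F (a, real N *\<^sub>R c) = (fst ((I.flow ^^ N) (a, c)), real N *\<^sub>R snd ((I.flow ^^ N) (a, c))))"
proof -
  interpret C: closed_killing A g "iterate N \<gamma>" Y by (rule iterate_closed_killing)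
  have N0: "real N \<noteq> 0" using N by simp
  have flow: "C.I.flow (a, real N *\<^sub>R c) = (fst ((I.flow ^^ N) (a, c)), real N *\<^sub>R snd ((I.flow ^^ N) (a, c)))" for a c
  proof -
    obtain J where J: "jacobi_field A g (iterate N \<gamma>) J" "J 0 = a" "cov_deriv A g (iterate N \<gamma>) J 0 = real N *\<^sub>R c"
      using C.jacobi_field_exists by blast
    let ?D = "cov_deriv A g (iterate N \<gamma>) J"
    \<comment> \<open>The state of J after k turns, with the derivative referred to the parameter of
      \<gamma>.\<close>
    define z where "z k = (J (real k / real N), (1 / real N) *\<^sub>R ?D (real k / real N))" for k
    have step: "I.flow (z k) = z (Suc k)" if k: "k < N" for k
    proof -
      have "1 / real N * 1 + real k / real N = real (Suc k) / real N"
        by (simp add: add_divide_distrib)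
      then show ?thesis
        using jacobi_field_flow[OF jacobi_piece(1)[OF k J(1)]] jacobi_piece(2)[OF k J(1), of 0] jacobi_piece(2)[OF k J(1), of 1]
        by (simp add: z_def)
    qed
    have "k \<le> N \<Longrightarrow> (I.flow ^^ k) (z 0) = z k" for k
      by (induction k) (auto simp: step)
    then have "(I.flow ^^ N) (z 0) = z N" by simp
    moreover have "z 0 = (a, c)" "z N = (J 1, (1 / real N) *\<^sub>R ?D 1)" using N0 by (simp_all add: z_def J)
    moreover have "C.I.flow (a, real N *\<^sub>R c) = (J 1, ?D 1)" using C.jacobi_field_flow[OF J(1)] J by simp
    ultimately show ?thesis using N0 by simp
  qed
  \<comment> \<open>The covariant derivative of \<open>Y\<close> is linear in the direction, and the
    velocity of the iterate is N times that of \<gamma>.\<close>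
  have DY: "C.DY 0 = real N *\<^sub>R DY 0"
  proof -
    let ?c = "chart_at A (\<gamma> 0)"
    interpret K: local_killing "snd ?c ` fst ?c" "gram A g ?c" "field_comps A Y ?c" by (rule local_killing[OF kill chart_at(1)])
    have x: "snd ?c (\<gamma> 0) \<in> snd ?c ` fst ?c" using chart_at by auto
    have i0: "iterate N \<gamma> 0 = \<gamma> 0" by (simp add: iterate_eq)
    have "comps A ?c (\<gamma> 0) (C.DY 0) = K.nab (snd ?c (\<gamma> 0)) (comps A ?c (\<gamma> 0) (real N *\<^sub>R vel A \<gamma> 0))"
      using C.DY_nab[of 0 ?c] chart_at[of "\<gamma> 0"] by (simp add: i0 iterate_vel)
    also have "\<dots> = real N *\<^sub>R comps A ?c (\<gamma> 0) (DY 0)"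
      using DY_nab[of 0 ?c] chart_at[of "\<gamma> 0"]
      by (simp add: linear_scale[OF comps_linear[OF chart_at]] linear_scale[OF K.nab_linear[OF x]])
    finally show ?thesis by (simp add: comps_chart_at)
  qed
  have "iterate N \<gamma> 0 = \<gamma> 0" "vel A (iterate N \<gamma>) 0 = real N *\<^sub>R vel A \<gamma> 0" by (simp_all add: iterate_eq iterate_vel)
  then have "C.zvel = (real N *\<^sub>R vel A \<gamma> 0, 0)" "C.zY = (Y (\<gamma> 0), real N *\<^sub>R DY 0)"
    unfolding C.zvel_def C.zY_def DY by simp_all
  then show ?thesis
    using C.nullity_flow C.nondegenerate_iff flow by (intro exI[of _ C.I.flow]) simp
qed

text \<open>The scaling \<open>?S\<close> maps the fixed points of the power bijectively to those of
  F and preserves dimension.\<close>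

lemma nullity_iterate:
  assumes N: "N \<ge> 1"
  shows "nullity A g Y (iterate N \<gamma>) = dim {z. (I.flow ^^ N) z = z}"
proof -
  let ?S = "\<lambda>z::(real^'n) \<times> (real^'n). (fst z, real N *\<^sub>R snd z)"
  obtain F where F: "nullity A g Y (iterate N \<gamma>) = dim {z. F z = z}"
    and F2: "\<forall>a c. F (a, real N *\<^sub>R c) = ?S ((I.flow ^^ N) (a, c))"
    using iterate_flow[OF N] by blast
  have N0: "real N \<noteq> 0" using N by simp
  have lin: "linear ?S" by (rule linearI) (auto simp: scaleR_add_right)
  have inj: "?S z = ?S w \<longleftrightarrow> z = w" for z w using N0 by (auto simp: prod_eq_iff)
  have "{z. F z = z} = ?S ` {z. (I.flow ^^ N) z = z}"
  proof (intro equalityI subsetI)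
    fix z assume "z \<in> {z. F z = z}"
    then have Fz: "F z = z" by simp
    let ?w = "(fst z, (1 / real N) *\<^sub>R snd z)"
    have w: "?S ?w = z" using N0 by (simp add: prod_eq_iff)
    have "?S ((I.flow ^^ N) ?w) = ?S ?w" using F2[rule_format, of "fst z" "(1 / real N) *\<^sub>R snd z"] N0 Fz w by simp
    then have "(I.flow ^^ N) ?w = ?w" unfolding inj .
    then show "z \<in> ?S ` {z. (I.flow ^^ N) z = z}" using w by (intro image_eqI[of _ _ ?w]) auto
  next
    fix z assume "z \<in> ?S ` {z. (I.flow ^^ N) z = z}"
    then obtain w where "(I.flow ^^ N) w = w" "z = ?S w" by blast
    then show "z \<in> {z. F z = z}" using F2[rule_format, of "fst w" "snd w"] by simp
  qed
  moreover have "dim (?S ` {z. (I.flow ^^ N) z = z}) = dim {z. (I.flow ^^ N) z = z}"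
    by (rule eucl.dim_image_eq[OF lin]) (use inj in \<open>auto simp: inj_on_def\<close>)
  ultimately show ?thesis using F by simp
qed

lemma nondegenerate_iterate:
  assumes N: "N \<ge> 1"
  shows "nondegenerate_critical_orbit A g Y (iterate N \<gamma>) \<longleftrightarrow>
    (\<forall>z. (I.flow ^^ N) z = z \<longrightarrow> (\<exists>p q. z = p *\<^sub>R zvel + q *\<^sub>R zY))"
proof -
  let ?S = "\<lambda>z::(real^'n) \<times> (real^'n). (fst z, real N *\<^sub>R snd z)"
  obtain F where F: "nondegenerate_critical_orbit A g Y (iterate N \<gamma>) \<longleftrightarrow> (\<forall>z. F z = z \<longrightarrow>
       (\<exists>p q. z = p *\<^sub>R (real N *\<^sub>R vel A \<gamma> 0, 0) + q *\<^sub>R (Y (\<gamma> 0), real N *\<^sub>R DY 0)))"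
    and F2: "\<forall>a c. F (a, real N *\<^sub>R c) = ?S ((I.flow ^^ N) (a, c))"
    using iterate_flow[OF N] by blast
  have N0: "real N \<noteq> 0" using N by simp
  have inj: "?S z = ?S w \<longleftrightarrow> z = w" for z w using N0 by (auto simp: prod_eq_iff)
  have fixp: "F (?S z) = ?S z \<longleftrightarrow> (I.flow ^^ N) z = z" for z
    using F2[rule_format, of "fst z" "snd z"] inj[of "(I.flow ^^ N) z" z] by simp
  have surj: "\<exists>w. z = ?S w" for z
    by (rule exI[of _ "(fst z, (1 / real N) *\<^sub>R snd z)"]) (use N0 in \<open>simp add: prod_eq_iff\<close>)
  have span: "(\<exists>p q. ?S z = p *\<^sub>R (real N *\<^sub>R vel A \<gamma> 0, 0) + q *\<^sub>R (Y (\<gamma> 0), real N *\<^sub>R DY 0)) \<longleftrightarrow>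
     (\<exists>p q. z = p *\<^sub>R zvel + q *\<^sub>R zY)" for z
  proof
    assume "\<exists>p q. ?S z = p *\<^sub>R (real N *\<^sub>R vel A \<gamma> 0, 0) + q *\<^sub>R (Y (\<gamma> 0), real N *\<^sub>R DY 0)"
    then obtain p q where "?S z = p *\<^sub>R (real N *\<^sub>R vel A \<gamma> 0, 0) + q *\<^sub>R (Y (\<gamma> 0), real N *\<^sub>R DY 0)" by blast
    then have "?S z = ?S ((p * real N) *\<^sub>R zvel + q *\<^sub>R zY)"
      by (simp add: zvel_def zY_def mult.commute)
    then show "\<exists>p q. z = p *\<^sub>R zvel + q *\<^sub>R zY" unfolding inj by blast
  next
    assume "\<exists>p q. z = p *\<^sub>R zvel + q *\<^sub>R zY"
    then obtain p q where "z = p *\<^sub>R zvel + q *\<^sub>R zY" by blast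
    then have "?S z = (p / real N) *\<^sub>R (real N *\<^sub>R vel A \<gamma> 0, 0) + q *\<^sub>R (Y (\<gamma> 0), real N *\<^sub>R DY 0)"
      using N0 by (simp add: zvel_def zY_def mult.commute)
    then show "\<exists>p q. ?S z = p *\<^sub>R (real N *\<^sub>R vel A \<gamma> 0, 0) + q *\<^sub>R (Y (\<gamma> 0), real N *\<^sub>R DY 0)" by blast
  qed
  show ?thesis unfolding F
  proof (intro iffI allI impI)
    fix z assume l: "\<forall>z. F z = z \<longrightarrow> (\<exists>p q. z = p *\<^sub>R (real N *\<^sub>R vel A \<gamma> 0, 0) + q *\<^sub>R (Y (\<gamma> 0), real N *\<^sub>R DY 0))"
      and z: "(I.flow ^^ N) z = z"
    from l[rule_format, of "?S z"] show "\<exists>p q. z = p *\<^sub>R zvel + q *\<^sub>R zY" using fixp[of z] z span[of z] by blast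
  next
    fix z assume r: "\<forall>z. (I.flow ^^ N) z = z \<longrightarrow> (\<exists>p q. z = p *\<^sub>R zvel + q *\<^sub>R zY)" and z: "F z = z"
    obtain w where w: "z = ?S w" using surj by blast
    have "(I.flow ^^ N) w = w" using fixp[of w] z w by simp
    from r[rule_format, OF this] show "\<exists>p q. z = p *\<^sub>R (real N *\<^sub>R vel A \<gamma> 0, 0) + q *\<^sub>R (Y (\<gamma> 0), real N *\<^sub>R DY 0)"
      unfolding w span .
  qed
qed

end

section \<open>Eigenvalues that are roots of unity\<close>

text \<open>Multiplication by a primitive root w permutes the roots and multiplies the sum by the
  inverse of w^k, which is not 1 for 0 < k < N.\<close>

lemma sum_roots_of_unity_power:
  assumes "0 < k" "k < N"
  shows "(\<Sum>z | z ^ N = (1::complex). inverse z ^ k) = 0"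
proof -
  define w where "w = cis (2 * pi * real 1 / real N)"
  have "w ^ N = cis (real N * (2 * pi * real 1 / real N))" unfolding w_def by (rule Complex.DeMoivre)
  then have wN: "w ^ N = 1" using assms by simp
  have "w ^ k \<noteq> 1"
  proof
    assume "w ^ k = 1"
    then have eq: "cis (2 * pi * real k / real N) = cis (2 * pi * real 0 / real N)"
      by (simp add: w_def Complex.DeMoivre mult_ac)
    have "bij_betw (\<lambda>k. cis (2 * pi * real k / real N)) {..<N} {z. z ^ N = 1}"
      by (rule Complex.bij_betw_roots_unity) (use assms in simp)
    then have "inj_on (\<lambda>k. cis (2 * pi * real k / real N)) {..<N}"
      by (rule bij_betw_imp_inj_on)
    from inj_onD[OF this eq] assms have "k = 0" by simp
    then show False using assms by simp
  qed
  have w0: "w \<noteq> 0" by (simp add: w_def)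
  let ?Z = "{z::complex. z ^ N = 1}"
  have "(\<Sum>z\<in>?Z. inverse z ^ k) = (\<Sum>z\<in>?Z. inverse (w * z) ^ k)"
    by (rule sum.reindex_bij_witness[of _ "\<lambda>z. w * z" "\<lambda>z. z / w"])
       (use wN w0 in \<open>auto simp: power_mult_distrib power_divide\<close>)
  also have "\<dots> = inverse w ^ k * (\<Sum>z\<in>?Z. inverse z ^ k)"
    by (simp add: sum_distrib_left power_mult_distrib)
  finally have "(1 - inverse w ^ k) * (\<Sum>z\<in>?Z. inverse z ^ k) = 0" by (simp add: algebra_simps)
  moreover have "inverse w ^ k \<noteq> 1" using \<open>w ^ k \<noteq> 1\<close> by (simp add: power_inverse)
  ultimately show ?thesis by simp
qed

lemma linear_funpow: "linear P \<Longrightarrow> linear (P ^^ k)" for P :: "'a::real_vector \<Rightarrow> 'a"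
proof (induction k)
  case 0
  show ?case by (rule linearI) simp_all
next
  case (Suc k)
  then show ?case using linear_compose[of "P ^^ k" P] by (simp add: o_def)
qed

lemma eigenvector_funpow:
  assumes P: "linear P" and uv: "P u = Re z *\<^sub>R u - Im z *\<^sub>R v" "P v = Im z *\<^sub>R u + Re z *\<^sub>R v"
  shows "(P ^^ k) u = Re (z ^ k) *\<^sub>R u - Im (z ^ k) *\<^sub>R v \<and> (P ^^ k) v = Im (z ^ k) *\<^sub>R u + Re (z ^ k) *\<^sub>R v"
proof (induction k)
  case (Suc k)
  show ?case
    unfolding funpow.simps o_apply conjunct1[OF Suc] conjunct2[OF Suc] linear_add[OF P] linear_diff[OF P]
      linear_scale[OF P] uv power_Suc times_complex.sel
    by (simp add: algebra_simps)
qed simp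

text \<open>
  Projecting \<open>v\<close> to the eigenspaces of the \<open>N\<close>-th roots of unity by averaging over the cyclic
  group generated by \<open>P\<close>.
\<close>

lemma root_of_unity_eigenvalue:
  fixes P :: "'a::real_vector \<Rightarrow> 'a"
  assumes P: "linear P" and N: "N \<ge> 1" and v: "(P ^^ N) v = v" and m: "(P ^^ m) v \<noteq> v"
  shows "\<exists>z\<in>spectrum P. z ^ N = 1 \<and> z ^ m \<noteq> 1"
proof (rule ccontr)
  assume no: "\<not> ?thesis"
  let ?Z = "{z::complex. z ^ N = 1}"
  have fin: "finite ?Z" using N by (intro finite_roots_unity) simp
  \<comment> \<open>U z + i V z is the sum of z^(-k) P^k v over k < N, that is, N times the
    projection of v to the eigenspace of z.\<close>
  define U where "U z = (\<Sum>k<N. Re (inverse z ^ k) *\<^sub>R (P ^^ k) v)" for z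
  define V where "V z = (\<Sum>k<N. Im (inverse z ^ k) *\<^sub>R (P ^^ k) v)" for z
  have shift: "(\<Sum>k<N. f (Suc k)) = (\<Sum>k<N. f k)" if "f N = f 0" for f :: "nat \<Rightarrow> 'a"
    using sum.lessThan_Suc_shift[of f N] sum.lessThan_Suc[of f N] that by (simp add: add.commute)
  have eig: "P (U z) = Re z *\<^sub>R U z - Im z *\<^sub>R V z" "P (V z) = Im z *\<^sub>R U z + Re z *\<^sub>R V z" if z: "z \<in> ?Z" for z
  proof -
    have z0: "z \<noteq> 0" using z N by (auto simp: power_0_left)
    have zN: "inverse z ^ N = 1" using z by (simp add: power_inverse)
    have step: "inverse z ^ k = z * inverse z ^ Suc k" for k using z0 by simp
    have sU: "U z = (\<Sum>k<N. Re (inverse z ^ Suc k) *\<^sub>R (P ^^ Suc k) v)"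
      unfolding U_def by (rule shift[symmetric]) (use zN v in simp)
    have sV: "V z = (\<Sum>k<N. Im (inverse z ^ Suc k) *\<^sub>R (P ^^ Suc k) v)"
      unfolding V_def by (rule shift[symmetric]) (use zN v in simp)
    have "P (U z) = (\<Sum>k<N. Re (inverse z ^ k) *\<^sub>R (P ^^ Suc k) v)"
      unfolding U_def by (simp add: linear_sum[OF P] linear_scale[OF P])
    also have "\<dots> = (\<Sum>k<N. Re z *\<^sub>R (Re (inverse z ^ Suc k) *\<^sub>R (P ^^ Suc k) v) - Im z *\<^sub>R (Im (inverse z ^ Suc k) *\<^sub>R (P ^^ Suc k) v))"
      by (subst step) (simp only: times_complex.sel scaleR_diff_left scaleR_scaleR)
    also have "\<dots> = Re z *\<^sub>R U z - Im z *\<^sub>R V z"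
      unfolding sU sV by (simp only: sum_subtractf scaleR_sum_right)
    finally show "P (U z) = Re z *\<^sub>R U z - Im z *\<^sub>R V z" .
    have "P (V z) = (\<Sum>k<N. Im (inverse z ^ k) *\<^sub>R (P ^^ Suc k) v)"
      unfolding V_def by (simp add: linear_sum[OF P] linear_scale[OF P])
    also have "\<dots> = (\<Sum>k<N. Re z *\<^sub>R (Im (inverse z ^ Suc k) *\<^sub>R (P ^^ Suc k) v) + Im z *\<^sub>R (Re (inverse z ^ Suc k) *\<^sub>R (P ^^ Suc k) v))"
      by (subst step) (simp only: times_complex.sel scaleR_add_left scaleR_scaleR)
    also have "\<dots> = Im z *\<^sub>R U z + Re z *\<^sub>R V z"
      unfolding sU sV by (simp only: sum.distrib scaleR_sum_right add.commute)
    finally show "P (V z) = Im z *\<^sub>R U z + Re z *\<^sub>R V z" .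
  qed
  \<comment> \<open>Under the assumption made for contradiction, a root z with z^m different from 1
    is no eigenvalue, so its projection vanishes; the other projections are fixed by P^m.\<close>
  have fixU: "(P ^^ m) (U z) = U z" if z: "z \<in> ?Z" for z
  proof (cases "z ^ m = 1")
    case True
    then show ?thesis using eigenvector_funpow[OF P eig[OF z], of m] by simp
  next
    case False
    then have "z \<notin> spectrum P" using no z by blast
    then have "U z = 0" using eig[OF z] unfolding spectrum_def by blast
    then show ?thesis using linear_0[OF linear_funpow[OF P]] by simp
  qed
  \<comment> \<open>The projections add up to the vector: only the term k = 0 survives the sum over
    the roots, with weight N.\<close>
  have "(\<Sum>z\<in>?Z. U z) = (\<Sum>k<N. (\<Sum>z\<in>?Z. Re (inverse z ^ k)) *\<^sub>R (P ^^ k) v)"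
    unfolding U_def by (subst sum.swap) (simp add: scaleR_sum_left)
  also have "\<dots> = (\<Sum>k<N. if k = 0 then real N *\<^sub>R v else 0)"
  proof (rule sum.cong[OF refl])
    fix k assume k: "k \<in> {..<N}"
    have "(\<Sum>z\<in>?Z. Re (inverse z ^ k)) = Re (\<Sum>z\<in>?Z. inverse z ^ k)" by (rule Re_sum[symmetric])
    also have "\<dots> = (if k = 0 then real N else 0)"
      using sum_roots_of_unity_power[of k N] k card_roots_unity_eq[of N] N by (cases "k = 0") (simp_all del: Re_sum)
    finally show "(\<Sum>z\<in>?Z. Re (inverse z ^ k)) *\<^sub>R (P ^^ k) v = (if k = 0 then real N *\<^sub>R v else 0)"
      by simp
  qed
  also have "\<dots> = real N *\<^sub>R v" using N by simp
  finally have sum: "(\<Sum>z\<in>?Z. U z) = real N *\<^sub>R v" .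
  have "(P ^^ m) (real N *\<^sub>R v) = real N *\<^sub>R v"
    unfolding sum[symmetric] using fixU by (simp add: linear_sum[OF linear_funpow[OF P]])
  then have "(P ^^ m) v = v" using N by (simp add: linear_scale[OF linear_funpow[OF P]])
  then show False using m by simp
qed

text \<open>The complexification of a real vector space, with \<open>(u, v)\<close> standing for \<open>u + \<i> v\<close>.\<close>

definition cscale :: "complex \<Rightarrow> 'a::real_vector \<times> 'a \<Rightarrow> 'a \<times> 'a" where
  "cscale z w = (Re z *\<^sub>R fst w - Im z *\<^sub>R snd w, Im z *\<^sub>R fst w + Re z *\<^sub>R snd w)"

lemma vector_space_cscale: "vector_space cscale"
  by unfold_locales (auto simp: cscale_def algebra_simps prod_eq_iff)

lemma spectrum_cscale: "z \<in> spectrum P \<longleftrightarrow> (\<exists>w. w \<noteq> 0 \<and> (P (fst w), P (snd w)) = cscale z w)"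
  unfolding spectrum_def cscale_def zero_prod_def by auto

text \<open>Eigenvectors for distinct eigenvalues are independent over the complex numbers, and the
  complexification has the real dimension of the original space as its complex dimension.\<close>

lemma card_eigenvalues_le:
  fixes P :: "'a::euclidean_space \<Rightarrow> 'a"
  assumes P: "linear P" and Z: "finite Z" "Z \<subseteq> spectrum P"
  shows "card Z \<le> DIM('a)"
proof -
  interpret C: vector_space "cscale :: complex \<Rightarrow> 'a \<times> 'a \<Rightarrow> 'a \<times> 'a" by (rule vector_space_cscale)
  define Q where "Q w = (P (fst w), P (snd w))" for w
  obtain e where e: "\<And>z. z \<in> Z \<Longrightarrow> e z \<noteq> 0 \<and> Q (e z) = cscale z (e z)"
  proof -
    have "\<forall>z\<in>Z. \<exists>w. w \<noteq> 0 \<and> Q w = cscale z w"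
    proof
      fix z assume "z \<in> Z"
      then have "z \<in> spectrum P" using Z(2) by (rule subsetD[rotated])
      then show "\<exists>w. w \<noteq> 0 \<and> Q w = cscale z w" unfolding Q_def by (rule spectrum_cscale[THEN iffD1])
    qed
    from bchoice[OF this] that show thesis by blast
  qed
  have Q_add: "Q (x + y) = Q x + Q y" for x y by (simp add: Q_def linear_add[OF P])
  have Q_scale: "Q (cscale z x) = cscale z (Q x)" for z x
    by (simp add: Q_def cscale_def linear_add[OF P] linear_diff[OF P] linear_scale[OF P])
  have Q0: "Q 0 = 0" by (simp add: Q_def linear_0[OF P] zero_prod_def)
  have Q_sum: "Q (\<Sum>z\<in>S. f z) = (\<Sum>z\<in>S. Q (f z))" for S and f :: "complex \<Rightarrow> 'a \<times> 'a"
    by (induction S rule: infinite_finite_induct) (simp_all add: Q0 Q_add)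
  \<comment> \<open>Applying Q - z0 to the relation eliminates the term of z0 and multiplies the
    coefficient of z by z - z0, which is not zero.\<close>
  have ind: "\<forall>z\<in>S. a z = 0" if "finite S" "S \<subseteq> Z" "(\<Sum>z\<in>S. cscale (a z) (e z)) = 0" for S a
    using that
  proof (induction S arbitrary: a rule: finite_induct)
    case (insert z0 S)
    have s: "cscale (a z0) (e z0) + (\<Sum>z\<in>S. cscale (a z) (e z)) = 0" using insert by simp
    have Qz: "Q (cscale (a z) (e z)) = cscale z (cscale (a z) (e z))" if "z \<in> Z" for z
      using e[OF that] by (simp add: Q_scale C.scale_left_commute)
    have "Q (cscale (a z0) (e z0) + (\<Sum>z\<in>S. cscale (a z) (e z))) = 0" unfolding s by (rule Q0)
    then have "cscale z0 (cscale (a z0) (e z0)) + (\<Sum>z\<in>S. cscale z (cscale (a z) (e z))) = 0"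
      using insert.prems(1) sum.cong[of S S "\<lambda>z. Q (cscale (a z) (e z))" "\<lambda>z. cscale z (cscale (a z) (e z))"] Qz
      by (simp add: Q_add Q_sum subset_iff)
    moreover have "cscale z0 (cscale (a z0) (e z0)) + (\<Sum>z\<in>S. cscale z0 (cscale (a z) (e z))) = 0"
      using arg_cong[OF s, of "cscale z0"] by (simp add: C.scale_right_distrib C.scale_sum_right)
    ultimately have "(\<Sum>z\<in>S. cscale z (cscale (a z) (e z))) = (\<Sum>z\<in>S. cscale z0 (cscale (a z) (e z)))"
      by (simp add: add_eq_0_iff)
    then have "(\<Sum>z\<in>S. cscale z (cscale (a z) (e z))) - (\<Sum>z\<in>S. cscale z0 (cscale (a z) (e z))) = 0" by simp
    then have "(\<Sum>z\<in>S. cscale ((z - z0) * a z) (e z)) = 0"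
      by (simp add: left_diff_distrib C.scale_left_diff_distrib sum_subtractf)
    then have "\<forall>z\<in>S. (z - z0) * a z = 0"
      using insert.IH[of "\<lambda>z. (z - z0) * a z"] insert.prems(1) by simp
    then have S0: "\<forall>z\<in>S. a z = 0" using insert.hyps by auto
    then have "cscale (a z0) (e z0) = 0" using s by simp
    then show ?case using S0 e insert.prems(1) by simp
  qed simp
  have inj: "inj_on e Z"
  proof (rule inj_onI, rule ccontr)
    fix z y assume zy: "z \<in> Z" "y \<in> Z" "e z = e y" "z \<noteq> y"
    have "(\<Sum>x\<in>{z, y}. cscale (if x = z then 1 else - 1) (e x)) = 0" using zy by simp
    with ind[of "{z, y}" "\<lambda>x. if x = z then 1 else - 1"] zy show False by simp
  qed
  have "C.independent (e ` Z)"
  proof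
    assume "C.dependent (e ` Z)"
    then obtain u where u: "\<exists>x\<in>e ` Z. u x \<noteq> 0" "(\<Sum>x\<in>e ` Z. cscale (u x) x) = 0"
      using C.dependent_finite[of "e ` Z"] Z(1) by auto
    have "(\<Sum>z\<in>Z. cscale (u (e z)) (e z)) = 0" using u(2) by (simp add: sum.reindex[OF inj])
    with ind[of Z "\<lambda>z. u (e z)"] Z(1) u(1) show False by auto
  qed
  \<comment> \<open>A real basis spans the complexification: the coefficient of b in u + i v has
    real part u \<bullet> b and imaginary part v \<bullet> b.\<close>
  moreover have "e ` Z \<subseteq> C.span ((\<lambda>b. (b, 0)) ` Basis)"
  proof
    fix w :: "'a \<times> 'a"
    have "(\<Sum>b\<in>Basis. cscale (Complex (fst w \<bullet> b) (snd w \<bullet> b)) (b, 0)) \<in> C.span ((\<lambda>b. (b, 0)) ` Basis)"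
      by (rule C.span_sum, rule C.span_scale, rule C.span_base) simp
    moreover have "(\<Sum>b\<in>Basis. cscale (Complex (fst w \<bullet> b) (snd w \<bullet> b)) (b, 0)) = w"
      by (simp add: cscale_def prod_eq_iff fst_sum snd_sum euclidean_representation)
    ultimately show "w \<in> C.span ((\<lambda>b. (b, 0)) ` Basis)" by (simp only:)
  qed
  ultimately have "card (e ` Z) \<le> card ((\<lambda>b::'a. (b, 0::'a)) ` Basis)"
    using C.independent_span_bound[of "(\<lambda>b. (b, 0)) ` Basis" "e ` Z"] by simp
  also have "\<dots> \<le> DIM('a)" by (rule card_image_le) simp
  finally show ?thesis by (simp add: card_image[OF inj])
qed

lemma spectrum_finite: "linear P \<Longrightarrow> finite (spectrum P)" for P :: "'a::euclidean_space \<Rightarrow> 'a"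
  using finite_if_finite_subsets_card_bdd[of "spectrum P" "DIM('a)"] card_eigenvalues_le[of P] by blast

lemma spectrum_cnj: "z \<in> spectrum P \<Longrightarrow> linear P \<Longrightarrow> cnj z \<in> spectrum P"
proof -
  assume "z \<in> spectrum P" and P: "linear P"
  then obtain u v where "(u, v) \<noteq> (0, 0)" "P u = Re z *\<^sub>R u - Im z *\<^sub>R v" "P v = Im z *\<^sub>R u + Re z *\<^sub>R v"
    unfolding spectrum_def by blast
  then show ?thesis
    unfolding spectrum_def by (intro CollectI exI[of _ u] exI[of _ "- v"]) (simp add: linear_neg[OF P])
qed

section \<open>Orders of the eigenvalues that are roots of unity\<close>

definition unity_order :: "complex \<Rightarrow> nat" where
  "unity_order z = (LEAST d. d > 0 \<and> z ^ d = 1)"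

lemma unity_order:
  assumes "N > 0" "z ^ N = 1"
  shows "unity_order z > 0" "z ^ unity_order z = 1" "\<And>M. z ^ M = 1 \<longleftrightarrow> unity_order z dvd M"
proof -
  have o: "unity_order z > 0 \<and> z ^ unity_order z = 1"
    unfolding unity_order_def by (rule LeastI[of _ N]) (use assms in simp)
  then show "unity_order z > 0" "z ^ unity_order z = 1" by auto
  show "z ^ M = 1 \<longleftrightarrow> unity_order z dvd M" for M
  proof
    assume M: "z ^ M = 1"
    let ?r = "M mod unity_order z"
    have "z ^ M = (z ^ unity_order z) ^ (M div unity_order z) * z ^ ?r"
      by (simp add: power_mult[symmetric] power_add[symmetric])
    then have "z ^ ?r = 1" using M o by simp
    moreover have "?r < unity_order z" using o by simp
    ultimately have "?r = 0"
      using not_less_Least[of ?r "\<lambda>d. d > 0 \<and> z ^ d = 1"] unfolding unity_order_def by auto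
    then show "unity_order z dvd M" by auto
  next
    assume "unity_order z dvd M"
    then show "z ^ M = 1" using o by (auto simp: power_mult)
  qed
qed

text \<open>Order 1 divides every N and cannot distinguish iterates. Leaving it out also gives the
  sharp count below, since 1, like -1, is its own conjugate.\<close>

definition root_orders :: "('a::real_vector \<Rightarrow> 'a) \<Rightarrow> nat set" where
  "root_orders P = unity_order ` {z \<in> spectrum P. \<exists>N>0. z ^ N = 1} - {1}"

text \<open>
  An eigenvalue of order \<open>d > 2\<close> is not real, so that it comes together with its conjugate, which
  has the same order.
\<close>

lemma card_root_orders:
  fixes P :: "'a::euclidean_space \<Rightarrow> 'a"
  assumes P: "linear P" and dim: "DIM('a) = 2 * n"
  shows "finite (root_orders P)" "card (root_orders P) \<le> n"
proof -
  let ?R = "{z \<in> spectrum P. \<exists>N>0. z ^ N = 1}" and ?D = "root_orders P"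
  show fin: "finite ?D" unfolding root_orders_def using spectrum_finite[OF P] by simp
  have "\<forall>d\<in>?D. \<exists>z. z \<in> ?R \<and> unity_order z = d" unfolding root_orders_def by blast
  then obtain e where e: "\<And>d. d \<in> ?D \<Longrightarrow> e d \<in> ?R \<and> unity_order (e d) = d"
    by (drule_tac bchoice) blast
  \<comment> \<open>The order can be read off from the exponents at which a power is 1. This
    separates eigenvalues of different orders and shows that conjugation preserves the
    order.\<close>
  have pow: "e d ^ M = 1 \<longleftrightarrow> d dvd M" if "d \<in> ?D" for d M
  proof -
    obtain N where "N > 0" "e d ^ N = 1" using e[OF \<open>d \<in> ?D\<close>] by blast
    from unity_order(3)[OF this, of M] show ?thesis using e[OF that] by simp
  qed
  have pow': "cnj (e d) ^ M = 1 \<longleftrightarrow> d dvd M" if "d \<in> ?D" for d M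
    using pow[OF that, of M] complex_cnj_cancel_iff[of "e d ^ M" 1] by simp
  let ?F = "\<lambda>d. {e d, cnj (e d)}"
  have disj: "?F d \<inter> ?F d' = {}" if "d \<in> ?D" "d' \<in> ?D" "d \<noteq> d'" for d d'
  proof (rule ccontr)
    assume "?F d \<inter> ?F d' \<noteq> {}"
    then obtain w where w: "w \<in> ?F d" "w \<in> ?F d'" by blast
    have 1: "w ^ M = 1 \<longleftrightarrow> d dvd M" for M using w(1) pow[OF that(1)] pow'[OF that(1)] by auto
    have 2: "w ^ M = 1 \<longleftrightarrow> d' dvd M" for M using w(2) pow[OF that(2)] pow'[OF that(2)] by auto
    have "d dvd d'" "d' dvd d" using 1[of d'] 2[of d'] 1[of d] 2[of d] by simp_all
    then show False using that(3) by (simp add: dvd_antisym)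
  qed
  \<comment> \<open>A real root of unity is 1 or -1, so only d = 2 can contribute a single
    eigenvalue.\<close>
  have two: "(if d = 2 then 1 else 2) \<le> card (?F d)" if d: "d \<in> ?D" for d
  proof (cases "e d = cnj (e d)")
    case True
    then have r: "e d = of_real (Re (e d))" by (simp add: complex_eq_iff)
    obtain N where "N > 0" "e d ^ N = 1" using e[OF d] by blast
    from unity_order(1)[OF this] have "d > 0" using e[OF d] by simp
    have "e d ^ d = 1" using pow[OF d] by simp
    then have "norm (e d) ^ d = 1" by (simp add: norm_power[symmetric])
    then have "norm (e d) = 1" using \<open>d > 0\<close> power_eq_1_iff[of "norm (e d)" d] by simp
    then have "\<bar>Re (e d)\<bar> = 1" using r by (metis norm_of_real)
    then have "Re (e d) = 1 \<or> Re (e d) = - 1" by linarith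
    then have "e d = 1 \<or> e d = - 1" using r by auto
    then have "e d ^ 2 = 1" by auto
    then have "d dvd 2" using pow[OF d] by blast
    moreover have "d \<noteq> 1" using d unfolding root_orders_def by blast
    ultimately have "d = 2" using \<open>d > 0\<close> dvd_imp_le[of d 2] by simp
    then show ?thesis by (simp add: card_insert_if)
  qed auto
  \<comment> \<open>Order 2 loses at most one eigenvalue in total, and 2 |D| - 1 <= 2n still gives
    |D| <= n by parity.\<close>
  have "2 * card ?D - 1 \<le> (\<Sum>d\<in>?D. (if d = 2 then 1 else 2))"
  proof -
    have "2 * card ?D = (\<Sum>d\<in>?D. 2)" by simp
    also have "\<dots> = (\<Sum>d\<in>?D. (if d = 2 then 1 else 2) + (if d = 2 then 1 else 0))"
      by (rule sum.cong[OF refl]) simp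
    also have "\<dots> \<le> (\<Sum>d\<in>?D. (if d = 2 then 1 else 2)) + 1"
      unfolding sum.distrib using fin by simp
    finally show ?thesis by simp
  qed
  also have "\<dots> \<le> (\<Sum>d\<in>?D. card (?F d))" by (rule sum_mono) (rule two)
  also have "\<dots> = card (\<Union>d\<in>?D. ?F d)"
    by (rule card_UN_disjoint[symmetric]) (use fin disj in auto)
  also have "\<dots> \<le> DIM('a)"
    by (rule card_eigenvalues_le[OF P]) (use fin e spectrum_cnj[OF _ P] in auto)
  finally show "card ?D \<le> n" using dim by simp
qed

text \<open>A vector fixed by P^M but not by P^m would produce an eigenvalue whose order divides M
  and not m.\<close>

lemma fixed_points_eq:
  fixes P :: "'a::real_vector \<Rightarrow> 'a"
  assumes P: "linear P" and m: "m > 0" "m dvd M" "M > 0"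
    and ord: "{d \<in> root_orders P. d dvd M} = {d \<in> root_orders P. d dvd m}"
  shows "{z. (P ^^ M) z = z} = {z. (P ^^ m) z = z}"
proof (intro equalityI subsetI CollectI; elim CollectE)
  fix v assume "(P ^^ m) v = v"
  then have "(P ^^ (m * k)) v = v" for k by (induction k) (simp_all add: funpow_add)
  then show "(P ^^ M) v = v" using m(2) by auto
next
  fix v assume v: "(P ^^ M) v = v"
  show "(P ^^ m) v = v"
  proof (rule ccontr)
    assume "(P ^^ m) v \<noteq> v"
    then obtain z where z: "z \<in> spectrum P" "z ^ M = 1" "z ^ m \<noteq> 1"
      using root_of_unity_eigenvalue[OF P _ v, of m] m(3) by auto
    note o = unity_order[OF m(3) z(2)]
    have "unity_order z \<noteq> 1" using o(2) z(3) by auto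
    then have "unity_order z \<in> root_orders P" unfolding root_orders_def using z m(3) by blast
    then show False using ord o(3)[of M] o(3)[of m] z by blast
  qed
qed

lemma Lcm_pos:
  fixes D :: "nat set"
  assumes "finite D" "0 \<notin> D"
  shows "Lcm D > 0"
proof -
  have "Lcm D \<noteq> 0" using Lcm_0_iff[OF assms(1)] assms(2) by simp
  then show ?thesis by simp
qed

text \<open>Only the subsets of D that actually occur as divisor sets are counted, which makes every
  class nonempty; there are at most 2^n subsets in all.\<close>

lemma partition_by_divisors:
  fixes D :: "nat set"
  assumes D: "finite D" "card D \<le> n" "0 \<notin> D"
  shows "\<exists>(s::nat) (m :: nat \<Rightarrow> nat) (q :: nat \<Rightarrow> nat \<Rightarrow> nat). s \<le> 2 ^ n \<and>
    (\<forall>j\<in>{1..s}. m j > 0 \<and> strict_mono_on {1..} (q j) \<and> (\<forall>i\<ge>1. q j i > 0)) \<and>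
    disjoint_family_on (\<lambda>j. {m j * q j i | i. i \<ge> 1}) {1..s} \<and>
    (\<Union>j\<in>{1..s}. {m j * q j i | i. i \<ge> 1}) = UNIV - {0} \<and>
    (\<forall>j\<in>{1..s}. \<forall>i\<ge>1. {d\<in>D. d dvd m j * q j i} = {d\<in>D. d dvd m j})"
proof -
  define cl where "cl N = {d\<in>D. d dvd N}" for N :: nat
  define CC where "CC = cl ` {0<..}"
  have CC: "CC \<subseteq> Pow D" unfolding CC_def cl_def by auto
  then have finCC: "finite CC" using D(1) by (meson finite_Pow_iff finite_subset)
  have "card CC \<le> card (Pow D)" by (rule card_mono) (use CC D(1) in auto)
  also have "\<dots> \<le> 2 ^ n" using D by (simp add: card_Pow)
  finally have s: "card CC \<le> 2 ^ n" .
  obtain h where h: "bij_betw h {1..card CC} CC"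
    using ex_bij_betw_nat_finite_1[OF finCC] by blast
  define m where "m j = Lcm (h j)" for j
  define Q where "Q j = {k. k > 0 \<and> cl (m j * k) = h j}" for j
  \<comment> \<open>\<open>enumerate\<close> starts at 0, while the sequences start at index
    1.\<close>
  define q where "q j i = enumerate (Q j) (i - 1)" for j i
  have hj: "h j \<in> CC" "h j \<subseteq> D" "finite (h j)" if "j \<in> {1..card CC}" for j
  proof -
    show "h j \<in> CC" using bij_betwE[OF h] that by blast
    then show "h j \<subseteq> D" using CC by blast
    then show "finite (h j)" using D(1) by (rule finite_subset)
  qed
  have m0: "m j > 0" if "j \<in> {1..card CC}" for j
    unfolding m_def by (rule Lcm_pos) (use hj[OF that] D(3) in auto)
  have mdvd: "m j dvd N" if "j \<in> {1..card CC}" "cl N = h j" for j N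
    unfolding m_def using that(2) by (intro Lcm_least) (auto simp: cl_def)
  \<comment> \<open>The least common multiple belongs to its own class: it is divisible by the whole
    set and divides every member of the class, so no further divisors in D appear.\<close>
  have clm: "cl (m j) = h j" if j: "j \<in> {1..card CC}" for j
  proof -
    obtain N where N: "cl N = h j" using hj(1)[OF j] unfolding CC_def by auto
    have "h j \<subseteq> cl (m j)" using hj(2)[OF j] unfolding cl_def m_def by auto
    moreover have "cl (m j) \<subseteq> cl N" unfolding cl_def using dvd_trans[OF _ mdvd[OF j N]] by auto
    ultimately show ?thesis unfolding N by (rule subset_antisym[rotated])
  qed
  \<comment> \<open>With L a common multiple of D, the factor 1 + t L changes no divisibility by
    elements of D, so every class is infinite.\<close>
  have inf: "infinite (Q j)" if j: "j \<in> {1..card CC}" for j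
  proof -
    define L where "L = Lcm D"
    have L: "L > 0" unfolding L_def by (rule Lcm_pos[OF D(1,3)])
    have "cl (m j * (1 + t * L)) = h j" for t
    proof -
      have "d dvd m j * (1 + t * L) \<longleftrightarrow> d dvd m j" if "d \<in> D" for d
      proof -
        have "d dvd L" unfolding L_def using that by simp
        then have "d dvd m j * (t * L)" by simp
        then show ?thesis by (simp add: distrib_left dvd_add_left_iff)
      qed
      then show ?thesis using clm[OF j] unfolding cl_def by auto
    qed
    then have "range (\<lambda>t. 1 + t * L) \<subseteq> Q j" unfolding Q_def by auto
    moreover have "infinite (range (\<lambda>t. 1 + t * L))"
      using L by (intro range_inj_infinite) (auto simp: inj_on_def)
    ultimately show ?thesis using infinite_super by blast
  qed
  have qQ: "q j i \<in> Q j" if "j \<in> {1..card CC}" for j i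
    unfolding q_def using enumerate_in_set[OF inf[OF that]] .
  have sets: "{m j * q j i | i. i \<ge> 1} = {N. N > 0 \<and> cl N = h j}" if j: "j \<in> {1..card CC}" for j
  proof (intro equalityI subsetI)
    fix N assume "N \<in> {m j * q j i | i. i \<ge> 1}"
    then show "N \<in> {N. N > 0 \<and> cl N = h j}" using qQ[OF j] m0[OF j] unfolding Q_def by auto
  next
    fix N assume "N \<in> {N. N > 0 \<and> cl N = h j}"
    then have N: "N > 0" "cl N = h j" by auto
    obtain k where k: "N = m j * k" using mdvd[OF j N(2)] by blast
    then have "k \<in> Q j" using N unfolding Q_def by auto
    then have "k \<in> range (enumerate (Q j))" using range_enumerate[OF inf[OF j]] by simp
    then obtain i where "enumerate (Q j) i = k" by blast
    then have "N = m j * q j (Suc i)" by (simp add: q_def k)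
    then show "N \<in> {m j * q j i | i. i \<ge> 1}" by auto
  qed
  have 1: "m j > 0 \<and> strict_mono_on {1..} (q j) \<and> (\<forall>i\<ge>1. q j i > 0)" if j: "j \<in> {1..card CC}" for j
  proof (intro conjI allI impI)
    show "m j > 0" by (rule m0[OF j])
    show "strict_mono_on {1..} (q j)"
    proof (rule strict_mono_onI)
      fix r t :: nat assume "r \<in> {1..}" "t \<in> {1..}" "r < t"
      then show "q j r < q j t" unfolding q_def by (intro enumerate_mono[OF _ inf[OF j]]) auto
    qed
    show "q j i > 0" for i using qQ[OF j, of i] unfolding Q_def by auto
  qed
  have 2: "disjoint_family_on (\<lambda>j. {m j * q j i | i. i \<ge> 1}) {1..card CC}"
    unfolding disjoint_family_on_def
  proof (intro ballI impI)
    fix j k assume j: "j \<in> {1..card CC}" and k: "k \<in> {1..card CC}" and "j \<noteq> k"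
    then have "h j \<noteq> h k" using inj_on_eq_iff[OF bij_betw_imp_inj_on[OF h] j k] by simp
    then show "{m j * q j i | i. i \<ge> 1} \<inter> {m k * q k i | i. i \<ge> 1} = {}"
      unfolding sets[OF j] sets[OF k] by auto
  qed
  have 3: "(\<Union>j\<in>{1..card CC}. {m j * q j i | i. i \<ge> 1}) = UNIV - {0}"
  proof (intro equalityI subsetI)
    fix N :: nat assume "N \<in> UNIV - {0}"
    then have "N > 0" by simp
    then have "cl N \<in> CC" unfolding CC_def by auto
    then have "cl N \<in> h ` {1..card CC}" using h unfolding bij_betw_def by simp
    then obtain j where j: "j \<in> {1..card CC}" "h j = cl N" by auto
    then have "N \<in> {m j * q j i | i. i \<ge> 1}" unfolding sets[OF j(1)] using \<open>N > 0\<close> by simp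
    then show "N \<in> (\<Union>j\<in>{1..card CC}. {m j * q j i | i. i \<ge> 1})" using j(1) by blast
  next
    fix N assume "N \<in> (\<Union>j\<in>{1..card CC}. {m j * q j i | i. i \<ge> 1})"
    then obtain j where j: "j \<in> {1..card CC}" "N \<in> {m j * q j i | i. i \<ge> 1}" by blast
    from j(2) show "N \<in> UNIV - {0}" unfolding sets[OF j(1)] by simp
  qed
  have 4: "{d\<in>D. d dvd m j * q j i} = {d\<in>D. d dvd m j}" if j: "j \<in> {1..card CC}" for j i
    using qQ[OF j, of i] clm[OF j] unfolding Q_def cl_def by simp
  show ?thesis
  proof (rule exI[of _ "card CC"], rule exI[of _ m], rule exI[of _ q], intro conjI ballI)
    show "\<forall>i\<ge>1. {d \<in> D. d dvd m j * q j i} = {d \<in> D. d dvd m j}" if "j \<in> {1..card CC}" for j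
      using 4[OF that] by blast
    show "m j > 0" "strict_mono_on {1..} (q j)" "\<forall>i\<ge>1. q j i > 0" if "j \<in> {1..card CC}" for j
      using 1[OF that] by blast+
  qed (rule s 2 3)+
qed

section \<open>The iteration theorem\<close>

lemma spectrum_conjugate:
  assumes \<iota>: "linear \<iota>" "bij \<iota>" and c: "\<And>x. Q (\<iota> x) = \<iota> (P x)"
  shows "spectrum Q = spectrum P"
proof -
  note inj = bij_is_inj[OF \<iota>(2)]
  have eq: "(u, v) \<noteq> (0, 0) \<and> P u = Re z *\<^sub>R u - Im z *\<^sub>R v \<and> P v = Im z *\<^sub>R u + Re z *\<^sub>R v \<longleftrightarrow>
    (\<iota> u, \<iota> v) \<noteq> (0, 0) \<and> Q (\<iota> u) = Re z *\<^sub>R \<iota> u - Im z *\<^sub>R \<iota> v \<and> Q (\<iota> v) = Im z *\<^sub>R \<iota> u + Re z *\<^sub>R \<iota> v" for u v z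
  proof -
    have "\<iota> x = 0 \<longleftrightarrow> x = 0" for x using inj linear_0[OF \<iota>(1)] by (metis injD)
    moreover have "Re z *\<^sub>R \<iota> u - Im z *\<^sub>R \<iota> v = \<iota> (Re z *\<^sub>R u - Im z *\<^sub>R v)" "Im z *\<^sub>R \<iota> u + Re z *\<^sub>R \<iota> v = \<iota> (Im z *\<^sub>R u + Re z *\<^sub>R v)"
      by (simp_all add: linear_add[OF \<iota>(1)] linear_diff[OF \<iota>(1)] linear_scale[OF \<iota>(1)])
    ultimately show ?thesis unfolding c using inj by (simp add: inj_eq)
  qed
  have surj: "\<exists>u. x = \<iota> u" for x using bij_is_surj[OF \<iota>(2)] by (meson surjD)
  show ?thesis
  proof (intro equalityI subsetI)
    fix z assume "z \<in> spectrum Q"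
    then obtain x y where "(x, y) \<noteq> (0, 0) \<and> Q x = Re z *\<^sub>R x - Im z *\<^sub>R y \<and> Q y = Im z *\<^sub>R x + Re z *\<^sub>R y"
      unfolding spectrum_def by blast
    moreover obtain u v where "x = \<iota> u" "y = \<iota> v" using surj by meson
    ultimately show "z \<in> spectrum P" unfolding spectrum_def using eq[of u v z] by blast
  next
    fix z assume "z \<in> spectrum P"
    then show "z \<in> spectrum Q" unfolding spectrum_def using eq by blast
  qed
qed

context closed_killing
begin

lemma flat_linear: "linear (flat g p)"
  by (rule linearI) (simp_all add: blinfun_eqI flat_apply g_simps blinfun.add_left blinfun.scaleR_left)

text \<open>The euclidean representative of the functional is turned into a representative for
  \<open>g\<close> by \<open>dual\<close>.\<close>

lemma flat_surj: "\<exists>w. flat g (\<gamma> 0) w = \<beta>"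
proof -
  let ?z = "\<Sum>i\<in>Basis. blinfun_apply \<beta> i *\<^sub>R i"
  have "blinfun_apply (flat g (\<gamma> 0) (dual ?z)) v = blinfun_apply \<beta> v" for v
  proof -
    have "blinfun_apply \<beta> v = (\<Sum>i\<in>Basis. (v \<bullet> i) * blinfun_apply \<beta> i)"
      using linear_family_expand[OF bounded_linear.linear[OF blinfun.bounded_linear_right], of \<beta> v] by simp
    moreover have "g (\<gamma> 0) (dual ?z) v = v \<bullet> ?z" using dual(2)[of v ?z] g_sym by simp
    ultimately show ?thesis by (simp add: flat_apply inner_sum_right mult.commute)
  qed
  then show ?thesis by (meson blinfun_eqI)
qed

lemma spectrum_poincare: "spectrum (poincare_map A g \<gamma>) = spectrum I.flow"
proof (rule spectrum_conjugate)
  let ?i = "\<lambda>z :: (real^'n) \<times> (real^'n). (fst z, flat g (\<gamma> 0) (snd z))"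
  show "linear ?i" by (rule linearI) (simp_all add: linear_add[OF flat_linear] linear_scale[OF flat_linear])
  show "bij ?i"
  proof (rule bijI)
    show "inj ?i" using flat_inj by (auto simp: inj_on_def prod_eq_iff)
    show "surj ?i"
      unfolding surj_def
    proof
      fix y :: "(real^'n) \<times> ((real^'n) \<Rightarrow>\<^sub>L real)"
      obtain w where "flat g (\<gamma> 0) w = snd y" using flat_surj by blast
      then show "\<exists>x. y = ?i x" by (intro exI[of _ "(fst y, w)"]) (simp add: prod_eq_iff)
    qed
  qed
  show "poincare_map A g \<gamma> (?i x) = ?i (I.flow x)" for x
    using poincare_map_flow[of "fst x" "snd x"] by simp
qed

text \<open>An eigenvector for an N-th root z is fixed by P^N. If such vectors lie in the span of
  \<open>zvel\<close> and \<open>zY\<close>, they are fixed by P, which forces z = 1. Conversely, a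
  vector fixed by P^N but not by P would yield a root of unity other than 1 in the spectrum.\<close>

lemma nondegenerate_iterate_iff:
  assumes N: "N \<ge> 1"
  shows "nondegenerate_critical_orbit A g Y (iterate N \<gamma>) \<longleftrightarrow>
    nondegenerate_critical_orbit A g Y \<gamma> \<and> \<not> (\<exists>z \<in> spectrum (poincare_map A g \<gamma>) - {1}. z ^ N = 1)"
proof -
  let ?P = "I.flow" and ?sp = "\<lambda>z. \<exists>p q. z = p *\<^sub>R zvel + q *\<^sub>R zY"
  have fix_pow: "(?P ^^ N) z = z" if "?P z = z" for z using that by (induction N) auto
  have fix_sp: "?P z = z" if "?sp z" for z
    using that fixed_zvel_zY by (auto simp: linear_add[OF I.flow_linear] linear_scale[OF I.flow_linear])
  show ?thesis
    unfolding nondegenerate_iterate[OF N] nondegenerate_iff spectrum_poincare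
  proof (intro iffI conjI notI)
    assume l: "\<forall>z. (?P ^^ N) z = z \<longrightarrow> ?sp z"
    show "\<forall>z. ?P z = z \<longrightarrow> ?sp z" using l fix_pow by blast
    assume "\<exists>z\<in>spectrum ?P - {1}. z ^ N = 1"
    then obtain z u v where z: "z \<noteq> 1" "z ^ N = 1" and uv: "(u, v) \<noteq> (0, 0)"
      "?P u = Re z *\<^sub>R u - Im z *\<^sub>R v" "?P v = Im z *\<^sub>R u + Re z *\<^sub>R v"
      unfolding spectrum_def by blast
    have "(?P ^^ N) u = u" "(?P ^^ N) v = v"
      using eigenvector_funpow[OF I.flow_linear uv(2,3), of N] z(2) by simp_all
    then have "?P u = u" "?P v = v" using l fix_sp by blast+
    \<comment> \<open>These equations say (z - 1) w = 0 for w = u + i v in the complexification.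
      Multiplying by the conjugate of z - 1 gives |z - 1|^2 u = 0 and |z - 1|^2 v = 0.\<close>
    then have 1: "(Re z - 1) *\<^sub>R u = Im z *\<^sub>R v" "(Re z - 1) *\<^sub>R v = - (Im z *\<^sub>R u)"
      using uv(2,3) by (simp_all add: scaleR_diff_left algebra_simps)
    have "((Re z - 1)\<^sup>2 + (Im z)\<^sup>2) *\<^sub>R u = (Re z - 1) *\<^sub>R ((Re z - 1) *\<^sub>R u) + Im z *\<^sub>R (Im z *\<^sub>R u)"
      by (simp add: power2_eq_square scaleR_add_left)
    also have "\<dots> = Im z *\<^sub>R ((Re z - 1) *\<^sub>R v) + Im z *\<^sub>R (Im z *\<^sub>R u)" unfolding 1(1) by (simp add: mult.commute)
    also have "\<dots> = 0" unfolding 1(2) by simp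
    finally have u0: "((Re z - 1)\<^sup>2 + (Im z)\<^sup>2) *\<^sub>R u = 0" .
    have "((Re z - 1)\<^sup>2 + (Im z)\<^sup>2) *\<^sub>R v = (Re z - 1) *\<^sub>R ((Re z - 1) *\<^sub>R v) + Im z *\<^sub>R (Im z *\<^sub>R v)"
      by (simp add: power2_eq_square scaleR_add_left)
    also have "\<dots> = - (Im z *\<^sub>R ((Re z - 1) *\<^sub>R u)) + Im z *\<^sub>R (Im z *\<^sub>R v)" unfolding 1(2) by (simp add: mult.commute)
    also have "\<dots> = 0" unfolding 1(1) by simp
    finally have v0: "((Re z - 1)\<^sup>2 + (Im z)\<^sup>2) *\<^sub>R v = 0" .
    have "(Re z - 1)\<^sup>2 + (Im z)\<^sup>2 \<noteq> 0" using z(1) by (simp add: sum_power2_eq_zero_iff complex_eq_iff)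
    then have "u = 0" "v = 0" using u0 v0 scaleR_eq_0_iff by blast+
    then show False using uv(1) by simp
  next
    assume r: "(\<forall>z. ?P z = z \<longrightarrow> ?sp z) \<and> \<not> (\<exists>z\<in>spectrum ?P - {1}. z ^ N = 1)"
    show "\<forall>z. (?P ^^ N) z = z \<longrightarrow> ?sp z"
    proof (intro allI impI)
      fix w assume w: "(?P ^^ N) w = w"
      have "(?P ^^ 1) w = w"
      proof (rule ccontr)
        assume "(?P ^^ 1) w \<noteq> w"
        from root_of_unity_eigenvalue[OF I.flow_linear N w this] r show False by auto
      qed
      then have "?P w = w" by simp
      then show "?sp w" using r by blast
    qed
  qed
qed

lemma nullity_partition:
  "\<exists>(s::nat) (m :: nat \<Rightarrow> nat) (q :: nat \<Rightarrow> nat \<Rightarrow> nat).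
     s \<le> 2 ^ CARD('n) \<and>
     (\<forall>j\<in>{1..s}. m j > 0 \<and> strict_mono_on {1..} (q j) \<and> (\<forall>i\<ge>1. q j i > 0)) \<and>
     disjoint_family_on (\<lambda>j. {m j * q j i | i. i \<ge> 1}) {1..s} \<and>
     (\<Union>j\<in>{1..s}. {m j * q j i | i. i \<ge> 1}) = UNIV - {0} \<and>
     (\<forall>j\<in>{1..s}. \<forall>i\<ge>1. nullity A g Y (iterate (m j * q j i) \<gamma>) = nullity A g Y (iterate (m j) \<gamma>))"
proof -
  let ?D = "root_orders I.flow"
  have "DIM((real^'n) \<times> (real^'n)) = 2 * CARD('n)" by simp
  note D = card_root_orders[OF I.flow_linear this]
  have "0 \<notin> ?D"
  proof
    assume "0 \<in> ?D"
    then obtain z N where "unity_order z = 0" "N > 0" "z ^ N = 1" unfolding root_orders_def by auto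
    then show False using unity_order(1)[of N z] by simp
  qed
  from partition_by_divisors[OF D this]
  obtain s :: nat and m :: "nat \<Rightarrow> nat" and q :: "nat \<Rightarrow> nat \<Rightarrow> nat" where
    p: "s \<le> 2 ^ CARD('n)" "\<forall>j\<in>{1..s}. m j > 0 \<and> strict_mono_on {1..} (q j) \<and> (\<forall>i\<ge>1. q j i > 0)"
      "disjoint_family_on (\<lambda>j. {m j * q j i | i. i \<ge> 1}) {1..s}"
      "(\<Union>j\<in>{1..s}. {m j * q j i | i. i \<ge> 1}) = UNIV - {0}"
    and d: "\<forall>j\<in>{1..s}. \<forall>i\<ge>1. {d\<in>?D. d dvd m j * q j i} = {d\<in>?D. d dvd m j}"
    by (elim exE conjE) (rule that; assumption)
  have "nullity A g Y (iterate (m j * q j i) \<gamma>) = nullity A g Y (iterate (m j) \<gamma>)"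
    if j: "j \<in> {1..s}" and i: "i \<ge> 1" for j i
  proof -
    have pos: "m j > 0" "m j * q j i > 0" using p(2) j i by auto
    have "{z. (I.flow ^^ (m j * q j i)) z = z} = {z. (I.flow ^^ m j) z = z}"
      by (rule fixed_points_eq[OF I.flow_linear pos(1) _ pos(2)]) (use d j i in auto)
    then show ?thesis using nullity_iterate[of "m j * q j i"] nullity_iterate[of "m j"] pos by simp
  qed
  then have n: "\<forall>j\<in>{1..s}. \<forall>i\<ge>1. nullity A g Y (iterate (m j * q j i) \<gamma>) = nullity A g Y (iterate (m j) \<gamma>)"
    by (intro ballI allI impI)
  show ?thesis
    by (rule exI[of _ s], rule exI[of _ m], rule exI[of _ q])
      (rule conjI[OF p(1) conjI[OF p(2) conjI[OF p(3) conjI[OF p(4) n]]]])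
qed

end

theorem lemma6p9:
  fixes A :: "('m::{t2_space, second_countable_topology}, 'n::finite) chart set"
    and g :: "('m, 'n) metric"
    and Y :: "'m \<Rightarrow> real ^ 'n"
    and S :: "'m set"
    and \<gamma> :: "real \<Rightarrow> 'm"
  assumes "lorentzian_manifold A g"
    and "globally_hyperbolic A g"
    and "killing_field A g Y" and "timelike_field g Y" and "complete_field A Y"
    and "cauchy_surface A g S" and "compact S"
    and "closed_geodesic A g \<gamma>"
    and "\<not> (\<exists>p. \<forall>t\<in>{0..1}. \<gamma> t = p)"
  shows "(\<forall>N\<ge>1. nondegenerate_critical_orbit A g Y (iterate N \<gamma>) \<longleftrightarrow>
            nondegenerate_critical_orbit A g Y \<gamma> \<and>
            \<not> (\<exists>z \<in> spectrum (poincare_map A g \<gamma>) - {1}. z ^ N = 1)) \<and>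
         (\<exists>(s::nat) (m :: nat \<Rightarrow> nat) (q :: nat \<Rightarrow> nat \<Rightarrow> nat).
            s \<le> 2 ^ CARD('n) \<and>
            (\<forall>j\<in>{1..s}. m j > 0 \<and> strict_mono_on {1..} (q j) \<and> (\<forall>i\<ge>1. q j i > 0)) \<and>
            disjoint_family_on (\<lambda>j. {m j * q j i | i. i \<ge> 1}) {1..s} \<and>
            (\<Union>j\<in>{1..s}. {m j * q j i | i. i \<ge> 1}) = UNIV - {0} \<and>
            (\<forall>j\<in>{1..s}. \<forall>i\<ge>1. nullity A g Y (iterate (m j * q j i) \<gamma>)
               = nullity A g Y (iterate (m j) \<gamma>)))"
proof -
  interpret closed_killing A g \<gamma> Y
  proof unfold_locales
    show "lorentzian_manifold A g" "killing_field A g Y" "timelike_field g Y" "closed_geodesic A g \<gamma>"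
      by fact+
    then show "geodesic A g \<gamma>" unfolding closed_geodesic_def by blast
    then show "differentiable_curve A \<gamma>" unfolding geodesic_def by blast
  qed
  show ?thesis
  proof (intro conjI allI impI)
    fix N :: nat assume "N \<ge> 1"
    then show "nondegenerate_critical_orbit A g Y (iterate N \<gamma>) \<longleftrightarrow>
        nondegenerate_critical_orbit A g Y \<gamma> \<and> \<not> (\<exists>z \<in> spectrum (poincare_map A g \<gamma>) - {1}. z ^ N = 1)"
      by (rule nondegenerate_iterate_iff)
  qed (rule nullity_partition)
qed

end
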